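(* Let $\Lambda$ be a full rank lattice in $\mathbb{R}^d\times\widehat{\mathbb{R}}^d$, let $M,N$ be positive integers, and let $\mathbf{S}=\{S_1,\dots,S_N\}\subset\mathcal{HS}(\mathbb{R}^d)$ be such that $\{\alpha_\lambda(S_n)\}_{\lambda\in\Lambda;\,n=1,\dots,N}$ is a Riesz sequence in $\mathcal{HS}(\mathbb{R}^d)$. Let $$V_{\mathbf{S}}^2=\Big\{\sum_{n=1}^N\sum_{\lambda\in\Lambda}c_n(\lambda)\,\alpha_\lambda(S_n)\,:\,\{c_n(\lambda)\}_{\lambda\in\Lambda}\in\ell^2(\Lambda),\ n=1,\dots,N\Big\}.$$ Let $A=[a_{m,n}]$ be an $M\times N$ matrix with entries $a_{m,n}\in\ell^2(\Lambda)$, with transfer matrix $\widehat{A}(\xi)=[\mathcal{F}_\sigma^\Lambda(a_{m,n})(\xi)]$, a.e. $\xi\in\widehat{\Lambda}$, and set $$\alpha_A:=\operatorname*{ess\,inf}_{\xi\in\widehat{\Lambda}}\lambda_{\min}[\widehat{A}(\xi)^*\widehat{A}(\xi)],\qquad \beta_A:=\operatorname*{ess\,sup}_{\xi\in\widehat{\Lambda}}\lambda_{\max}[\widehat{A}(\xi)^*\widehat{A}(\xi)].$$ For each $T=\sum_{n=1}^N\sum_{\lambda\in\Lambda}c_n(\lambda)\,\alpha_\lambda(S_n)\in V_{\mathbf{S}}^2$, with coefficients $\mathbf{c}=(c_1,\dots,c_N)^\top\in\ell^2_N(\Lambda)$, define the samples $$\mathbf{s}_T(\lambda)=(s_{T,1}(\lambda),\dots,s_{T,M}(\lambda))^\top:=(A\ast_\Lambda\mathbf{c})(\lambda),\qquad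 \lambda\in\Lambda .$$ (a) If $0<\alpha_A\le\beta_A<+\infty$ (so that $\mathbf{s}_T\in\ell^2_M(\Lambda)$ for every $T\in V_{\mathbf{S}}^2$), then $M\ge N$ and there exist $M$ elements $H_1,\dots,H_M\in V_{\mathbf{S}}^2$ such that $\{\alpha_\lambda(H_m)\}_{\lambda\in\Lambda;\,m=1,\dots,M}$ is a frame for $V_{\mathbf{S}}^2$ and the sampling formula $$T=\sum_{m=1}^M\sum_{\lambda\in\Lambda}s_{T,m}(\lambda)\,\alpha_\lambda(H_m)\quad\text{in Hilbert-Schmidt norm}$$ holds for each $T\in V_{\mathbf{S}}^2$; the convergence of the series is unconditional in Hilbert-Schmidt norm. (b) Conversely, if $\beta_A<+\infty$ and there exist $H_1,\dots,H_M\in V_{\mathbf{S}}^2$ such that $\{\alpha_\lambda(H_m)\}_{\lambda\in\Lambda;\,m=1,\dots,M}$ is a frame for $V_{\mathbf{S}}^2$ and $T=\sum_{m=1}^M\sum_{\lambda\in\Lambda}s_{T,m}(\lambda)\,\alpha_\lambda(H_m)$ in Hilbert-Schmidt norm for each $T\in V_{\mathbf{S}}^2$, then $\alpha_A>0$.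
   Context: $\mathcal{HS}(\mathbb{R}^d)$ is the Hilbert space of Hilbert-Schmidt operators on $L^2(\mathbb{R}^d)$ with inner product $\langle S,T\rangle_{\mathcal{HS}}=\mathrm{tr}(ST^* )$. For $z=(x,\omega)\in\mathbb{R}^d\times\widehat{\mathbb{R}}^d\cong\mathbb{R}^{2d}$, the time-frequency shift is the unitary operator $\pi(z)f(t)=e^{2\pi i\omega\cdot t}f(t-x)$ on $L^2(\mathbb{R}^d)$, and the translation of an operator $S$ by $z$ is $\alpha_z(S)=\pi(z)S\pi(z)^*$. A full rank lattice is $\Lambda=B\mathbb{Z}^{2d}$ with $B\in GL(2d,\mathbb{R})$. A Riesz sequence in a Hilbert space is a sequence which is a Riesz basis for its closed linear span; under the Riesz sequence assumption, $V_{\mathbf{S}}^2$ is the closed linear span of $\{\alpha_\lambda(S_n)\}_{\lambda\in\Lambda;\,n=1,\dots,N}$ and each $T\in V_{\mathbf{S}}^2$ has unique coefficients $\mathbf{c}\in\ell^2_N(\Lambda)$. $\ell^2_N(\Lambda)=\ell^2(\Lambda)\times\dots\times\ell^2(\Lambda)$ ($N$ times). Convolution on $\Lambda$ is $(c\ast_\Lambda d)(\lambda)=\sum_{\lambda'\in\Lambda}c(\lambda')\,d(\lambda-\lambda')$, and $(A\ast_\Lambda\mathbf{c})(\lambda)=\sum_{\lambda'\in\Lambda}A(\lambda-\lambda')\,\mathbf{c}(\lambda')$, i.e. its $m$-th entry is $\sum_{n=1}^N(a_{m,n}\ast_\Lambda c_n)(\lambda)$. The standard symplectic form is $\sigma(z,z')=\omega\cdot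 x'-\omega'\cdot x$ for $z=(x,\omega)$, $z'=(x',\omega')$. The dual group $\widehat{\Lambda}$ is identified with the compact group $(\mathbb{R}^d\times\widehat{\mathbb{R}}^d)/\Lambda^\circ$, where $\Lambda^\circ=\{\lambda^\circ: e^{2\pi i\sigma(\lambda^\circ,\lambda)}=1\ \text{for all }\lambda\in\Lambda\}$, equipped with its normalized Haar measure. The symplectic Fourier series of $c\in\ell^1(\Lambda)$ is $\mathcal{F}_\sigma^\Lambda(c)(\dot z)=\sum_{\lambda\in\Lambda}c(\lambda)e^{2\pi i\sigma(\lambda,z)}$, where $\dot z$ is the class of $z$ modulo $\Lambda^\circ$; it extends to a unitary map $\mathcal{F}_\sigma^\Lambda:\ell^2(\Lambda)\to L^2(\widehat{\Lambda})$. Essential infima and suprema are with respect to Haar measure on $\widehat{\Lambda}$. $\lambda_{\min}$ and $\lambda_{\max}$ denote the smallest and largest eigenvalues of a positive semidefinite matrix, and $\widehat{A}(\xi)^*$ is the conjugate transpose of $\widehat{A}(\xi)$. *)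

theory Defs
  imports "HOL-Probability.Probability"
begin

section \<open>The Hilbert space of square-integrable functions\<close>

definition square_integrable :: "'x measure \<Rightarrow> ('x \<Rightarrow> complex) \<Rightarrow> bool" where
  "square_integrable M f \<longleftrightarrow> f \<in> borel_measurable M \<and> integrable M (\<lambda>x. (cmod (f x))\<^sup>2)"

definition l2_dist :: "'x measure \<Rightarrow> ('x \<Rightarrow> complex) \<Rightarrow> ('x \<Rightarrow> complex) \<Rightarrow> real" where
  "l2_dist M f g = sqrt (\<integral>x. (cmod (f x - g x))\<^sup>2 \<partial>M)"

lemma borel_measurable_cnj [measurable]: "cnj \<in> borel_measurable borel"
  by (intro borel_measurable_continuous_onI continuous_on_cnj continuous_on_id)

lemma square_integrable_mult_cnj:
  assumes "square_integrable M f" "square_integrable M g"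
  shows "integrable M (\<lambda>x. f x * cnj (g x))"
proof (rule Bochner_Integration.integrable_bound)
  have [measurable]: "f \<in> borel_measurable M" "g \<in> borel_measurable M"
    using assms by (auto simp: square_integrable_def)
  show "integrable M (\<lambda>x. (cmod (f x))\<^sup>2 + (cmod (g x))\<^sup>2)"
    using assms by (auto simp: square_integrable_def)
  show "(\<lambda>x. f x * cnj (g x)) \<in> borel_measurable M"
    by measurable
  have "cmod a * cmod b \<le> (cmod a)\<^sup>2 + (cmod b)\<^sup>2" for a b
  proof -
    have "0 \<le> (cmod a - cmod b)\<^sup>2" "0 \<le> cmod a * cmod b"
      by auto
    then show ?thesis
      unfolding power2_diff by linarith
  qed
  then show "AE x in M. norm (f x * cnj (g x)) \<le> norm ((cmod (f x))\<^sup>2 + (cmod (g x))\<^sup>2)"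
    by (auto simp: norm_mult)
qed

lemma square_integrable_zero: "square_integrable M (\<lambda>x. 0)"
  by (simp add: square_integrable_def)

lemma square_integrable_cmult:
  "square_integrable M f \<Longrightarrow> square_integrable M (\<lambda>x. c * f x)"
  by (auto simp: square_integrable_def norm_mult power_mult_distrib)

lemma square_integrable_add:
  assumes "square_integrable M f" "square_integrable M g"
  shows "square_integrable M (\<lambda>x. f x + g x)"
proof -
  have [measurable]: "f \<in> borel_measurable M" "g \<in> borel_measurable M"
    using assms by (auto simp: square_integrable_def)
  have "integrable M (\<lambda>x. (cmod (f x + g x))\<^sup>2)"
  proof (rule Bochner_Integration.integrable_bound)
    show "integrable M (\<lambda>x. 2 * (cmod (f x))\<^sup>2 + 2 * (cmod (g x))\<^sup>2)"
      using assms by (auto simp: square_integrable_def)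
    have "(cmod (a + b))\<^sup>2 \<le> 2 * (cmod a)\<^sup>2 + 2 * (cmod b)\<^sup>2" for a b
    proof -
      have "(cmod (a + b))\<^sup>2 \<le> (cmod a + cmod b)\<^sup>2"
        by (simp add: norm_triangle_ineq power_mono)
      moreover have "0 \<le> (cmod a - cmod b)\<^sup>2"
        by simp
      ultimately show ?thesis
        unfolding power2_diff power2_sum by linarith
    qed
    then show "AE x in M. norm ((cmod (f x + g x))\<^sup>2) \<le> norm (2 * (cmod (f x))\<^sup>2 + 2 * (cmod (g x))\<^sup>2)"
      by auto
  qed measurable
  then show ?thesis
    by (simp add: square_integrable_def)
qed

text \<open>Elements of \<open>'a l2\<close> are classes of square-integrable functions modulo equality almost
  everywhere.\<close>

definition l2_rel :: "('a::euclidean_space \<Rightarrow> complex) \<Rightarrow> ('a \<Rightarrow> complex) \<Rightarrow> bool" where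
  "l2_rel f g \<longleftrightarrow>
    square_integrable lborel f \<and> square_integrable lborel g \<and> (AE x in lborel. f x = g x)"

quotient_type (overloaded) 'a l2 = "'a::euclidean_space \<Rightarrow> complex" / partial: l2_rel
proof (rule part_equivpI)
  show "\<exists>f. l2_rel f f"
    by (rule exI[of _ "\<lambda>x. 0"]) (simp add: l2_rel_def square_integrable_zero)
  show "symp l2_rel"
    by (auto simp: l2_rel_def symp_def elim: eventually_mono)
  show "transp l2_rel"
    unfolding l2_rel_def transp_def by (auto elim: eventually_elim2)
qed

lift_definition cinner :: "'a::euclidean_space l2 \<Rightarrow> 'a l2 \<Rightarrow> complex" is
  "\<lambda>f g. \<integral>x. f x * cnj (g x) \<partial>lborel"
proof -
  fix f f' g g' :: "'a \<Rightarrow> complex"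
  assume *: "l2_rel f f'" "l2_rel g g'"
  then have "AE x in lborel. f x = f' x" "AE x in lborel. g x = g' x"
    by (simp_all add: l2_rel_def)
  then have "AE x in lborel. f x * cnj (g x) = f' x * cnj (g' x)"
    by eventually_elim simp
  with * show "(\<integral>x. f x * cnj (g x) \<partial>lborel) = (\<integral>x. f' x * cnj (g' x) \<partial>lborel)"
    by (intro integral_cong_AE) (auto simp: l2_rel_def dest: borel_measurable_integrable[OF square_integrable_mult_cnj])
qed

lift_definition scaleC :: "complex \<Rightarrow> 'a::euclidean_space l2 \<Rightarrow> 'a l2" (infixr "*\<^sub>C" 75) is
  "\<lambda>c f x. c * f x"
  by (auto simp: l2_rel_def square_integrable_cmult elim: eventually_mono)

instantiation l2 :: (euclidean_space) real_inner
begin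

lift_definition zero_l2 :: "'a l2" is "\<lambda>x. 0"
  by (simp add: l2_rel_def square_integrable_zero)

lift_definition plus_l2 :: "'a l2 \<Rightarrow> 'a l2 \<Rightarrow> 'a l2" is "\<lambda>f g x. f x + g x"
  unfolding l2_rel_def by (auto intro: square_integrable_add elim: eventually_elim2)

definition uminus_l2 :: "'a l2 \<Rightarrow> 'a l2" where "uminus_l2 f = (-1) *\<^sub>C f"

definition minus_l2 :: "'a l2 \<Rightarrow> 'a l2 \<Rightarrow> 'a l2" where "minus_l2 f g = f + (- g)"

definition scaleR_l2 :: "real \<Rightarrow> 'a l2 \<Rightarrow> 'a l2" where "scaleR_l2 r f = complex_of_real r *\<^sub>C f"

definition inner_l2 :: "'a l2 \<Rightarrow> 'a l2 \<Rightarrow> real" where "inner_l2 f g = Re (cinner f g)"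

definition norm_l2 :: "'a l2 \<Rightarrow> real" where "norm_l2 f = sqrt (inner f f)"

definition sgn_l2 :: "'a l2 \<Rightarrow> 'a l2" where "sgn_l2 f = scaleR (inverse (norm f)) f"

definition dist_l2 :: "'a l2 \<Rightarrow> 'a l2 \<Rightarrow> real" where "dist_l2 f g = norm (f - g)"

definition uniformity_l2 :: "('a l2 \<times> 'a l2) filter" where
  "uniformity_l2 = (INF e\<in>{0 <..}. principal {(f, g). dist f g < e})"

definition open_l2 :: "'a l2 set \<Rightarrow> bool" where
  "open_l2 U = (\<forall>x\<in>U. eventually (\<lambda>(x', y). x' = x \<longrightarrow> y \<in> U) uniformity)"

instance
proof
  fix f g h :: "'a l2" and r s :: real
  show "f + g + h = f + (g + h)"
    by transfer (auto simp: l2_rel_def add.assoc intro!: square_integrable_add)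
  show "f + g = g + f"
    by transfer (auto simp: l2_rel_def add.commute intro!: square_integrable_add)
  show "0 + f = f"
    by transfer (auto simp: l2_rel_def)
  show "- f + f = 0"
    unfolding uminus_l2_def by transfer (auto simp: l2_rel_def square_integrable_zero)
  show "f - g = f + - g"
    by (simp add: minus_l2_def)
  show "r *\<^sub>R (f + g) = r *\<^sub>R f + r *\<^sub>R g"
    unfolding scaleR_l2_def
    by transfer (auto simp: l2_rel_def ring_distribs mult.assoc mult.left_commute intro!: square_integrable_add square_integrable_cmult)
  show "(r + s) *\<^sub>R f = r *\<^sub>R f + s *\<^sub>R f"
    unfolding scaleR_l2_def
    by transfer (auto simp: l2_rel_def ring_distribs mult.assoc mult.left_commute intro!: square_integrable_add square_integrable_cmult)
  show "r *\<^sub>R s *\<^sub>R f = (r * s) *\<^sub>R f"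
    unfolding scaleR_l2_def
    by transfer (auto simp: l2_rel_def ring_distribs mult.assoc mult.left_commute intro!: square_integrable_cmult)
  show "1 *\<^sub>R f = f"
    unfolding scaleR_l2_def by transfer (auto simp: l2_rel_def)
  show "inner f g = inner g f"
    unfolding inner_l2_def
  proof transfer
    fix f g :: "'a \<Rightarrow> complex"
    assume "l2_rel f f" "l2_rel g g"
    have "(\<integral>x. g x * cnj (f x) \<partial>lborel) = (\<integral>x. cnj (f x * cnj (g x)) \<partial>lborel)"
      by (simp add: mult.commute)
    also have "\<dots> = cnj (\<integral>x. f x * cnj (g x) \<partial>lborel)"
      by (rule integral_bounded_linear'[OF bounded_linear_cnj bounded_linear_cnj]) simp
    finally show "Re (\<integral>x. f x * cnj (g x) \<partial>lborel) = Re (\<integral>x. g x * cnj (f x) \<partial>lborel)"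
      by simp
  qed
  show "inner (f + g) h = inner f h + inner g h"
    unfolding inner_l2_def
    by transfer (auto simp: l2_rel_def ring_distribs Bochner_Integration.integral_add square_integrable_mult_cnj)
  show "inner (r *\<^sub>R f) g = r * inner f g"
    unfolding inner_l2_def scaleR_l2_def by transfer (simp add: mult.assoc)
  have re: "Re (\<integral>x. k x * cnj (k x) \<partial>lborel) = (\<integral>x. (cmod (k x))\<^sup>2 \<partial>lborel)"
    if "l2_rel k k" for k :: "'a \<Rightarrow> complex"
  proof -
    have "(\<integral>x. k x * cnj (k x) \<partial>lborel) = (\<integral>x. complex_of_real ((cmod (k x))\<^sup>2) \<partial>lborel)"
      by (intro Bochner_Integration.integral_cong) (simp_all add: complex_norm_square[symmetric])
    also have "\<dots> = complex_of_real (\<integral>x. (cmod (k x))\<^sup>2 \<partial>lborel)"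
      by (rule integral_complex_of_real)
    finally show ?thesis
      by simp
  qed
  show "0 \<le> inner f f"
    unfolding inner_l2_def by transfer (simp add: re)
  show "(inner f f = 0) = (f = 0)"
    unfolding inner_l2_def
  proof transfer
    fix f :: "'a \<Rightarrow> complex"
    assume f: "l2_rel f f"
    have "(\<integral>x. (cmod (f x))\<^sup>2 \<partial>lborel) = 0 \<longleftrightarrow> (AE x in lborel. (cmod (f x))\<^sup>2 = 0)"
      using f by (intro integral_nonneg_eq_0_iff_AE) (auto simp: l2_rel_def square_integrable_def)
    with f show "(Re (\<integral>x. f x * cnj (f x) \<partial>lborel) = 0) = l2_rel f (\<lambda>x. 0)"
      by (simp add: re l2_rel_def square_integrable_zero)
  qed
qed (simp_all only: norm_l2_def sgn_l2_def dist_l2_def uniformity_l2_def open_l2_def)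

end

lemma norm_scaleC: "norm (c *\<^sub>C f) = cmod c * norm f"
proof -
  have "cinner (c *\<^sub>C f) (c *\<^sub>C f) = complex_of_real ((cmod c)\<^sup>2) * cinner f f"
  proof transfer
    fix c :: complex and f :: "'a \<Rightarrow> complex"
    have "(\<integral>x. c * f x * cnj (c * f x) \<partial>lborel) = (\<integral>x. c * cnj c * (f x * cnj (f x)) \<partial>lborel)"
      by (simp add: mult_ac)
    also have "\<dots> = (c * cnj c) * (\<integral>x. f x * cnj (f x) \<partial>lborel)"
      by (rule integral_mult_right_zero)
    finally show "(\<integral>x. c * f x * cnj (c * f x) \<partial>lborel) =
        complex_of_real ((cmod c)\<^sup>2) * (\<integral>x. f x * cnj (f x) \<partial>lborel)"
      by (simp add: complex_norm_square[symmetric])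
  qed
  then show ?thesis
    by (simp add: norm_l2_def inner_l2_def real_sqrt_mult)
qed

lemma bounded_linear_scaleC: "bounded_linear ((*\<^sub>C) c)"
proof (rule bounded_linear_intro)
  fix f g :: "'a l2" and r :: real
  show "c *\<^sub>C (f + g) = c *\<^sub>C f + c *\<^sub>C g"
    by transfer (auto simp: l2_rel_def ring_distribs mult.assoc mult.left_commute intro!: square_integrable_add square_integrable_cmult)
  show "c *\<^sub>C r *\<^sub>R f = r *\<^sub>R c *\<^sub>C f"
    unfolding scaleR_l2_def
    by transfer (auto simp: l2_rel_def ring_distribs mult.assoc mult.left_commute intro!: square_integrable_cmult)
  show "norm (c *\<^sub>C f) \<le> norm f * cmod c"
    by (simp add: norm_scaleC)
qed

section \<open>Operators, time-frequency shifts and the Hilbert-Schmidt class\<close>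

type_synonym 'a op = "'a l2 \<Rightarrow>\<^sub>L 'a l2"

definition scaleC_op :: "complex \<Rightarrow> 'a::euclidean_space op \<Rightarrow> 'a op" (infixr "*\<^sub>O" 75) where
  "c *\<^sub>O S = Blinfun (\<lambda>f. c *\<^sub>C S f)"

lemma scaleC_op_apply: "(c *\<^sub>O S) f = c *\<^sub>C S f"
  unfolding scaleC_op_def
  by (subst bounded_linear_Blinfun_apply)
    (auto intro: bounded_linear_compose[OF bounded_linear_scaleC] blinfun.bounded_linear_right)

text \<open>Meant for complex-linear operators; on these the adjoint exists and is unique.\<close>

definition op_adj :: "'a::euclidean_space op \<Rightarrow> 'a op" where
  "op_adj T = (THE T' :: 'a op. \<forall>f g. cinner (T f) g = cinner f (T' g))"

definition is_onb :: "'a::euclidean_space l2 set \<Rightarrow> bool" where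
  "is_onb E \<longleftrightarrow>
    (\<forall>e\<in>E. \<forall>e'\<in>E. cinner e e' = (if e = e' then 1 else 0)) \<and>
    closure {\<Sum>e\<in>F. c e *\<^sub>C e |F c. finite F \<and> F \<subseteq> E} = UNIV"

text \<open>The operators of type \<open>'a op\<close> are bounded and real-linear; membership in \<open>HS\<close> includes
  complex linearity. Neither the Hilbert-Schmidt class nor the traces used below depend on the chosen
  orthonormal basis.\<close>

definition some_onb :: "'a::euclidean_space l2 set" where
  "some_onb = (SOME E. is_onb E)"

definition op_trace :: "'a::euclidean_space op \<Rightarrow> complex" where
  "op_trace X = (\<Sum>\<^sub>\<infinity>e\<in>some_onb. cinner (X e) e)"

definition HS :: "'a::euclidean_space op set" where
  "HS = {S :: 'a op. (\<forall>c f. S (c *\<^sub>C f) = c *\<^sub>C S f) \<and> (\<lambda>e. (norm (S e))\<^sup>2) summable_on some_onb}"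

definition hs_inner :: "'a::euclidean_space op \<Rightarrow> 'a op \<Rightarrow> complex" where
  "hs_inner S T = op_trace (S o\<^sub>L op_adj T)"

definition hs_norm :: "'a::euclidean_space op \<Rightarrow> real" where
  "hs_norm S = sqrt (Re (hs_inner S S))"

type_synonym 'a phase = "'a \<times> 'a"

lemma distr_lborel_minus: "distr lborel borel (\<lambda>t::'a::euclidean_space. t - x) = lborel"
proof -
  have "(\<lambda>t. t - x) = (+) (- x)"
    by auto
  then show ?thesis
    by (simp only: lborel_distr_plus)
qed

lemma
  fixes x :: "'a::euclidean_space" and f :: "'a \<Rightarrow> complex"
  assumes f: "square_integrable lborel f"
  shows square_integrable_tf_shift:
      "square_integrable lborel (\<lambda>t. cis (2 * pi * (w \<bullet> t)) * f (t - x))" (is ?A)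
    and integral_tf_shift:
      "(\<integral>t. (cmod (cis (2 * pi * (w \<bullet> t)) * f (t - x)))\<^sup>2 \<partial>lborel) =
        (\<integral>t. (cmod (f t))\<^sup>2 \<partial>lborel)" (is ?B)
proof -
  have [measurable]: "f \<in> borel_measurable borel"
    using f by (simp add: square_integrable_def)
  have [measurable]: "cis \<in> borel_measurable borel"
    by (intro borel_measurable_continuous_onI continuous_intros)
  have shift: "distr lborel borel (\<lambda>t. t - x) = lborel"
    by (rule distr_lborel_minus)
  have "integrable (distr lborel borel (\<lambda>t. t - x)) (\<lambda>t. (cmod (f t))\<^sup>2)"
    using f unfolding shift by (simp add: square_integrable_def)
  then have "integrable lborel (\<lambda>t. (cmod (f (t - x)))\<^sup>2)"
    by (subst (asm) integrable_distr_eq) auto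
  then show ?A
    by (simp add: square_integrable_def norm_mult)
  have "(\<integral>t. (cmod (f t))\<^sup>2 \<partial>distr lborel borel (\<lambda>t. t - x)) = (\<integral>t. (cmod (f (t - x)))\<^sup>2 \<partial>lborel)"
    by (subst integral_distr) auto
  then show ?B
    by (simp add: norm_mult shift)
qed

lift_definition tf_shift_l2 :: "'a::euclidean_space phase \<Rightarrow> 'a l2 \<Rightarrow> 'a l2" is
  "\<lambda>z f t. cis (2 * pi * (snd z \<bullet> t)) * f (t - fst z)"
proof -
  fix z :: "'a phase" and f g :: "'a \<Rightarrow> complex"
  assume fg: "l2_rel f g"
  have shift: "distr lborel borel (\<lambda>t. t - fst z) = lborel"
    by (rule distr_lborel_minus)
  have [measurable]: "f \<in> borel_measurable borel" "g \<in> borel_measurable borel"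
    using fg by (simp_all add: l2_rel_def square_integrable_def)
  have "AE t in distr lborel borel (\<lambda>t. t - fst z). f t = g t"
    using fg unfolding shift by (simp add: l2_rel_def)
  then have "AE t in lborel. f (t - fst z) = g (t - fst z)"
    by (subst (asm) AE_distr_iff) auto
  then have "AE t in lborel. cis (2 * pi * (snd z \<bullet> t)) * f (t - fst z) =
      cis (2 * pi * (snd z \<bullet> t)) * g (t - fst z)"
    by eventually_elim simp
  with fg show "l2_rel (\<lambda>t. cis (2 * pi * (snd z \<bullet> t)) * f (t - fst z))
      (\<lambda>t. cis (2 * pi * (snd z \<bullet> t)) * g (t - fst z))"
    by (simp add: l2_rel_def square_integrable_tf_shift)
qed

lemma bounded_linear_tf_shift: "bounded_linear (tf_shift_l2 z)"
proof (rule bounded_linear_intro)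
  fix f g :: "'a l2" and r :: real
  show "tf_shift_l2 z (f + g) = tf_shift_l2 z f + tf_shift_l2 z g"
    by transfer
      (auto simp: l2_rel_def ring_distribs intro!: square_integrable_add square_integrable_tf_shift)
  show "tf_shift_l2 z (r *\<^sub>R f) = r *\<^sub>R tf_shift_l2 z f"
    unfolding scaleR_l2_def
    by transfer (auto simp: l2_rel_def mult.left_commute
        intro!: square_integrable_cmult square_integrable_tf_shift)
  have "cinner (tf_shift_l2 z f) (tf_shift_l2 z f) = cinner f f"
  proof transfer
    fix z :: "'a phase" and f :: "'a \<Rightarrow> complex"
    assume "l2_rel f f"
    then have "complex_of_real (\<integral>t. (cmod (cis (2 * pi * (snd z \<bullet> t)) * f (t - fst z)))\<^sup>2 \<partial>lborel) =
        complex_of_real (\<integral>t. (cmod (f t))\<^sup>2 \<partial>lborel)"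
      by (simp only: integral_tf_shift l2_rel_def)
    then show "(\<integral>t. cis (2 * pi * (snd z \<bullet> t)) * f (t - fst z) *
          cnj (cis (2 * pi * (snd z \<bullet> t)) * f (t - fst z)) \<partial>lborel) =
        (\<integral>t. f t * cnj (f t) \<partial>lborel)"
      by (simp only: integral_complex_of_real[symmetric] complex_norm_square)
  qed
  then have "norm (tf_shift_l2 z f) = norm f"
    by (simp add: norm_eq_sqrt_inner inner_l2_def)
  then show "norm (tf_shift_l2 z f) \<le> norm f * 1"
    by simp
qed

definition tf_shift :: "'a::euclidean_space phase \<Rightarrow> 'a op" where
  "tf_shift z = Blinfun (tf_shift_l2 z)"

lemma tf_shift_apply: "tf_shift z f = tf_shift_l2 z f"
  by (simp add: tf_shift_def bounded_linear_Blinfun_apply bounded_linear_tf_shift)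

definition op_translate :: "'a::euclidean_space phase \<Rightarrow> 'a op \<Rightarrow> 'a op" where
  "op_translate z S = tf_shift z o\<^sub>L S o\<^sub>L op_adj (tf_shift z)"


section \<open>Series, Riesz sequences and frames in the Hilbert-Schmidt class\<close>

text \<open>Operators carry the operator norm topology, hence \<open>has_sum\<close> does not express convergence in
  Hilbert-Schmidt norm. As for \<open>has_sum\<close>, the limit is over the net of finite partial sums, i.e. the
  convergence is unconditional.\<close>

definition hs_has_sum :: "('i \<Rightarrow> 'a::euclidean_space op) \<Rightarrow> 'i set \<Rightarrow> 'a op \<Rightarrow> bool" where
  "hs_has_sum G I T \<longleftrightarrow>
    T \<in> HS \<and> (\<forall>i\<in>I. G i \<in> HS) \<and>
    ((\<lambda>F. hs_norm (T - (\<Sum>i\<in>F. G i))) \<longlongrightarrow> 0) (finite_subsets_at_top I)"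

definition hs_closed_span :: "'i set \<Rightarrow> ('i \<Rightarrow> 'a::euclidean_space op) \<Rightarrow> 'a op set" where
  "hs_closed_span I G =
    {T \<in> HS. \<forall>\<epsilon>>0. \<exists>F c. finite F \<and> F \<subseteq> I \<and> hs_norm (T - (\<Sum>i\<in>F. c i *\<^sub>O G i)) < \<epsilon>}"

definition hs_onb :: "'a::euclidean_space op set \<Rightarrow> 'i set \<Rightarrow> ('i \<Rightarrow> 'a op) \<Rightarrow> bool" where
  "hs_onb V I E \<longleftrightarrow>
    (\<forall>i\<in>I. E i \<in> HS) \<and>
    (\<forall>i\<in>I. \<forall>j\<in>I. hs_inner (E i) (E j) = (if i = j then 1 else 0)) \<and>
    hs_closed_span I E = V"

definition hs_bounded_linear_on ::
    "'a::euclidean_space op set \<Rightarrow> ('a op \<Rightarrow> 'a op) \<Rightarrow> bool" where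
  "hs_bounded_linear_on V U \<longleftrightarrow>
    (\<forall>S\<in>V. \<forall>T\<in>V. U (S + T) = U S + U T) \<and>
    (\<forall>c. \<forall>T\<in>V. U (c *\<^sub>O T) = c *\<^sub>O U T) \<and>
    (\<exists>K. \<forall>T\<in>V. hs_norm (U T) \<le> K * hs_norm T)"

text \<open>A Riesz basis of \<open>V\<close> is the image of an orthonormal basis of \<open>V\<close> under a bounded bijective
  linear operator on \<open>V\<close>.\<close>

definition hs_riesz_basis :: "'a::euclidean_space op set \<Rightarrow> 'i set \<Rightarrow> ('i \<Rightarrow> 'a op) \<Rightarrow> bool" where
  "hs_riesz_basis V I G \<longleftrightarrow>
    (\<exists>E U. hs_onb V I E \<and> hs_bounded_linear_on V U \<and> bij_betw U V V \<and> (\<forall>i\<in>I. G i = U (E i)))"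

definition hs_riesz_sequence :: "'i set \<Rightarrow> ('i \<Rightarrow> 'a::euclidean_space op) \<Rightarrow> bool" where
  "hs_riesz_sequence I G \<longleftrightarrow> (\<forall>i\<in>I. G i \<in> HS) \<and> hs_riesz_basis (hs_closed_span I G) I G"

definition hs_frame :: "'a::euclidean_space op set \<Rightarrow> 'i set \<Rightarrow> ('i \<Rightarrow> 'a op) \<Rightarrow> bool" where
  "hs_frame V I G \<longleftrightarrow>
    (\<forall>i\<in>I. G i \<in> V) \<and>
    (\<exists>A>0. \<exists>B>0. \<forall>T\<in>V.
      (\<lambda>i. (cmod (hs_inner T (G i)))\<^sup>2) summable_on I \<and>
      A * (hs_norm T)\<^sup>2 \<le> (\<Sum>\<^sub>\<infinity>i\<in>I. (cmod (hs_inner T (G i)))\<^sup>2) \<and>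
      (\<Sum>\<^sub>\<infinity>i\<in>I. (cmod (hs_inner T (G i)))\<^sup>2) \<le> B * (hs_norm T)\<^sup>2)"


section \<open>Lattices and the dual group\<close>

definition int_points :: "'b::euclidean_space set" where
  "int_points = {z. \<forall>b\<in>Basis. z \<bullet> b \<in> \<int>}"

definition full_rank_lattice :: "'b::euclidean_space set \<Rightarrow> bool" where
  "full_rank_lattice L \<longleftrightarrow> (\<exists>B :: 'b \<Rightarrow> 'b. linear B \<and> bij B \<and> L = B ` int_points)"

definition sympl :: "'a::euclidean_space phase \<Rightarrow> 'a phase \<Rightarrow> real" where
  "sympl z z' = snd z \<bullet> fst z' - snd z' \<bullet> fst z"

definition adjoint_lattice :: "'a::euclidean_space phase set \<Rightarrow> 'a phase set" where
  "adjoint_lattice \<Lambda> = {z. \<forall>l\<in>\<Lambda>. cis (2 * pi * sympl z l) = 1}"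

definition coset :: "'b::euclidean_space set \<Rightarrow> 'b \<Rightarrow> 'b set" where
  "coset L z = (+) z ` L"

definition quotient_borel :: "'b::euclidean_space set \<Rightarrow> 'b set measure" where
  "quotient_borel L =
    sigma (range (coset L)) {E. E \<subseteq> range (coset L) \<and> coset L -` E \<in> sets borel}"

definition unit_cube :: "'b::euclidean_space set" where
  "unit_cube = {t. \<forall>b\<in>Basis. 0 \<le> t \<bullet> b \<and> t \<bullet> b < 1}"

text \<open>For a full rank lattice \<open>L = C \<int>\<^sup>n\<close>, the image of the uniform distribution on \<open>[0,1)\<^sup>n\<close> under
  \<open>t \<mapsto> C t + L\<close> is the normalized Haar measure of the quotient by \<open>L\<close>; it does not depend on \<open>C\<close>
  (see \<open>prob_space_haar\<close> and \<open>haar_translation_invariant\<close> below).\<close>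

definition haar :: "'b::euclidean_space set \<Rightarrow> 'b set measure" where
  "haar L = distr (uniform_measure lborel unit_cube) (quotient_borel L)
    (\<lambda>t. coset L ((SOME C :: 'b \<Rightarrow> 'b. linear C \<and> bij C \<and> L = C ` int_points) t))"

lemma full_rank_lattice_adjoint:
  fixes \<Lambda> :: "'a::euclidean_space phase set"
  assumes "full_rank_lattice \<Lambda>"
  shows "full_rank_lattice (adjoint_lattice \<Lambda>)"
proof -
  obtain B :: "'a phase \<Rightarrow> 'a phase" where B: "linear B" "bij B" "\<Lambda> = B ` int_points"
    using assms by (auto simp: full_rank_lattice_def)
  define J :: "'a phase \<Rightarrow> 'a phase" where "J z = (snd z, - fst z)" for z
  have J: "linear J" "bij J" "sympl z w = J z \<bullet> w" for z w
  proof -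
    show "linear J"
      by (rule linearI) (auto simp: J_def)
    show "bij J"
      by (rule bij_betw_byWitness[where f' = "\<lambda>z. (- snd z, fst z)"]) (auto simp: J_def)
    show "sympl z w = J z \<bullet> w"
      by (cases w) (simp add: J_def sympl_def inner_commute)
  qed
  have adj: "linear (adjoint B)" "\<And>x y. adjoint B x \<bullet> y = x \<bullet> B y"
    using adjoint_linear[OF B(1)] adjoint_works[OF B(1)] by (auto simp: inner_commute)
  have "inj (adjoint B)"
  proof (rule injI)
    fix x y
    assume "adjoint B x = adjoint B y"
    then have "(x - y) \<bullet> B w = 0" for w
      by (metis adj(2) inner_diff_left right_minus_eq)
    moreover obtain w where "x - y = B w"
      using B(2) by (metis bij_pointE)
    ultimately have "(x - y) \<bullet> (x - y) = 0"
      by metis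
    then show "x = y"
      by simp
  qed
  then have bijA: "bij (adjoint B)"
    using adj(1) by (simp add: bij_def linear_injective_imp_surjective)
  define D where "D = adjoint B \<circ> J"
  have D: "linear D" "bij D"
    unfolding D_def using J adj bijA by (auto intro: linear_compose bij_comp)
  obtain C where C: "linear C" "C \<circ> D = id" "D \<circ> C = id"
  proof -
    obtain C where C: "linear C" "C \<circ> D = id"
      using linear_injective_left_inverse[of D] D by (auto simp: bij_def)
    moreover have "D \<circ> C = id"
      using C D(2) by (metis bij_is_surj inv_unique_comp fun.map_id0 comp_assoc surj_iff id_comp comp_id)
    ultimately show thesis
      using that by blast
  qed
  have "bij C"
    using C(2,3) o_bij by blast
  have cis1: "cis (2 * pi * r) = 1 \<longleftrightarrow> r \<in> \<int>" for r :: real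
  proof -
    have "cis (2 * pi * r) = 1 \<longleftrightarrow> (\<exists>n. 2 * pi * r = of_int (2 * n) * pi)"
      by (subst cis_conv_exp, subst exp_eq_1) auto
    also have "\<dots> \<longleftrightarrow> r \<in> \<int>"
      by (auto simp: Ints_def)
    finally show ?thesis .
  qed
  have int_iff: "(\<forall>k\<in>int_points. x \<bullet> k \<in> \<int>) \<longleftrightarrow> x \<in> int_points" for x :: "'a phase"
  proof
    assume "\<forall>k\<in>int_points. x \<bullet> k \<in> \<int>"
    moreover have "b \<in> int_points" if "b \<in> Basis" for b :: "'a phase"
      using that by (auto simp: int_points_def inner_Basis)
    ultimately show "x \<in> int_points"
      unfolding int_points_def by blast
  next
    assume x: "x \<in> int_points"
    show "\<forall>k\<in>int_points. x \<bullet> k \<in> \<int>"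
    proof
      fix k :: "'a phase"
      assume "k \<in> int_points"
      with x show "x \<bullet> k \<in> \<int>"
        unfolding euclidean_inner[of x k] int_points_def by (intro Ints_sum Ints_mult) auto
    qed
  qed
  have "z \<in> adjoint_lattice \<Lambda> \<longleftrightarrow> D z \<in> int_points" for z
  proof -
    have "z \<in> adjoint_lattice \<Lambda> \<longleftrightarrow> (\<forall>k\<in>int_points. J z \<bullet> B k \<in> \<int>)"
      by (simp add: adjoint_lattice_def cis1 B(3) J(3))
    also have "\<dots> \<longleftrightarrow> D z \<in> int_points"
      unfolding int_iff[symmetric] by (simp add: D_def adj(2))
    finally show ?thesis .
  qed
  moreover have "C (D x) = x" "D (C x) = x" for x
    using C(2,3) by (metis comp_apply id_apply)+
  ultimately have "adjoint_lattice \<Lambda> = C ` int_points"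
    by (intro set_eqI) (metis image_iff)
  with C(1) \<open>bij C\<close> show ?thesis
    unfolding full_rank_lattice_def by blast
qed

lemma unit_cube_borel [measurable]: "unit_cube \<in> sets borel"
  unfolding unit_cube_def by measurable

lemma emeasure_unit_cube: "emeasure lborel (unit_cube :: 'b::euclidean_space set) = 1"
proof (rule antisym)
  have "emeasure lborel (unit_cube :: 'b set) \<le> emeasure lborel (cbox 0 One :: 'b set)"
    by (rule emeasure_mono) (auto simp: unit_cube_def mem_box less_imp_le)
  then show "emeasure lborel (unit_cube :: 'b set) \<le> 1"
    by (simp add: emeasure_lborel_cbox_eq)
  have "emeasure lborel (box 0 One :: 'b set) \<le> emeasure lborel (unit_cube :: 'b set)"
    by (rule emeasure_mono) (auto simp: unit_cube_def mem_box less_imp_le)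
  then show "1 \<le> emeasure lborel (unit_cube :: 'b set)"
    by (simp add: emeasure_lborel_box_eq)
qed

lemma countable_int_points: "countable (int_points :: 'b::euclidean_space set)"
proof (rule countable_image_inj_on)
  let ?g = "\<lambda>z::'b. restrict (\<lambda>b. \<lfloor>z \<bullet> b\<rfloor>) Basis"
  have "?g ` int_points \<subseteq> (\<Pi>\<^sub>E b\<in>Basis. UNIV)"
    by auto
  then show "countable (?g ` int_points)"
    by (rule countable_subset) (intro countable_PiE, auto)
  show "inj_on ?g int_points"
  proof (rule inj_onI)
    fix y z :: 'b
    assume yz: "y \<in> int_points" "z \<in> int_points" "?g y = ?g z"
    show "y = z"
    proof (rule euclidean_eqI)
      fix b :: 'b
      assume b: "b \<in> Basis"
      then have "\<lfloor>y \<bullet> b\<rfloor> = \<lfloor>z \<bullet> b\<rfloor>"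
        using fun_cong[OF yz(3), of b] by simp
      with yz(1,2) b show "y \<bullet> b = z \<bullet> b"
        by (auto simp: int_points_def elim!: Ints_cases)
    qed
  qed
qed

lemma emeasure_unit_cube_split:
  fixes X :: "'b::euclidean_space set"
  assumes [measurable]: "X \<in> sets borel" and c: "c = 1 \<or> c = -1"
  shows "emeasure lborel X =
    (\<integral>\<^sup>+k. emeasure lborel (X \<inter> {t. t + u + c *\<^sub>R k \<in> unit_cube}) \<partial>count_space int_points)"
proof -
  have "\<exists>k\<in>int_points. t + u + c *\<^sub>R k \<in> unit_cube" for t
  proof
    let ?k = "\<Sum>b\<in>Basis. (- c * \<lfloor>(t + u) \<bullet> b\<rfloor>) *\<^sub>R b"
    have inner_k: "?k \<bullet> b = - c * \<lfloor>(t + u) \<bullet> b\<rfloor>" if "b \<in> Basis" for b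
      by (rule inner_sum_left_Basis[OF that])
    show "?k \<in> int_points"
      unfolding int_points_def
    proof (intro CollectI ballI)
      fix b :: 'b
      assume "b \<in> Basis"
      then show "?k \<bullet> b \<in> \<int>"
        by (subst inner_k) (use c in auto)
    qed
    have frac: "(t + u + c *\<^sub>R ?k) \<bullet> b = (t + u) \<bullet> b - \<lfloor>(t + u) \<bullet> b\<rfloor>" if "b \<in> Basis" for b
      by (subst inner_add_left, subst inner_scaleR_left, subst inner_k[OF that]) (use c in auto)
    show "t + u + c *\<^sub>R ?k \<in> unit_cube"
      unfolding unit_cube_def
    proof (intro CollectI ballI)
      fix b :: 'b
      assume "b \<in> Basis"
      then have "(t + u + c *\<^sub>R ?k) \<bullet> b = (t + u) \<bullet> b - \<lfloor>(t + u) \<bullet> b\<rfloor>"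
        by (rule frac)
      then show "0 \<le> (t + u + c *\<^sub>R ?k) \<bullet> b \<and> (t + u + c *\<^sub>R ?k) \<bullet> b < 1"
        by linarith
    qed
  qed
  then have "X = (\<Union>k\<in>int_points. X \<inter> {t. t + u + c *\<^sub>R k \<in> unit_cube})"
    by auto
  moreover have "k = l"
    if kl: "k \<in> int_points" "l \<in> int_points" "t + u + c *\<^sub>R k \<in> unit_cube" "t + u + c *\<^sub>R l \<in> unit_cube"
    for k l t
  proof (rule euclidean_eqI)
    fix b :: 'b
    assume b: "b \<in> Basis"
    have "k \<bullet> b \<in> \<int>" "l \<bullet> b \<in> \<int>"
      using kl(1,2) b by (auto simp: int_points_def)
    then obtain m n :: int where mn: "k \<bullet> b = m" "l \<bullet> b = n"
      by (metis Ints_cases)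
    have "0 \<le> (t + u + c *\<^sub>R k) \<bullet> b" "(t + u + c *\<^sub>R k) \<bullet> b < 1"
      "0 \<le> (t + u + c *\<^sub>R l) \<bullet> b" "(t + u + c *\<^sub>R l) \<bullet> b < 1"
      using kl(3,4) b unfolding unit_cube_def by blast+
    then have "\<bar>(t + u + c *\<^sub>R k) \<bullet> b - (t + u + c *\<^sub>R l) \<bullet> b\<bar> < 1"
      by linarith
    with c have "\<bar>real_of_int m - real_of_int n\<bar> < 1"
      by (auto simp: inner_add_left mn)
    then have "m = n"
      by linarith
    then show "k \<bullet> b = l \<bullet> b"
      by (simp add: mn)
  qed
  then have "disjoint_family_on (\<lambda>k. X \<inter> {t. t + u + c *\<^sub>R k \<in> unit_cube}) int_points"
    unfolding disjoint_family_on_def by blast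
  ultimately show ?thesis
    using emeasure_UN_countable[of int_points "\<lambda>k. X \<inter> {t. t + u + c *\<^sub>R k \<in> unit_cube}" lborel]
      countable_int_points by auto
qed

lemma emeasure_unit_cube_translate:
  fixes Q :: "'b::euclidean_space set"
  assumes [measurable]: "Q \<in> sets borel"
    and per: "\<And>x k. k \<in> int_points \<Longrightarrow> x - k \<in> Q \<longleftrightarrow> x \<in> Q"
  shows "emeasure lborel (unit_cube \<inter> {t. t + v \<in> Q}) = emeasure lborel (unit_cube \<inter> Q)"
proof -
  have "emeasure lborel (unit_cube \<inter> {t. t + v \<in> Q}) =
      (\<integral>\<^sup>+k. emeasure lborel (unit_cube \<inter> {t. t + v \<in> Q} \<inter> {t. t + v + (-1) *\<^sub>R k \<in> unit_cube})
        \<partial>count_space int_points)"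
    by (rule emeasure_unit_cube_split) auto
  also have "\<dots> = (\<integral>\<^sup>+k. emeasure lborel (unit_cube \<inter> Q \<inter> {s. s + (- v) + 1 *\<^sub>R k \<in> unit_cube})
      \<partial>count_space int_points)"
  proof (rule nn_integral_cong)
    fix k :: 'b
    assume "k \<in> space (count_space int_points)"
    then have k: "k \<in> int_points"
      by simp
    let ?Y = "unit_cube \<inter> Q \<inter> {s. s + (- v) + 1 *\<^sub>R k \<in> unit_cube}"
    have "emeasure lborel ?Y = emeasure (distr lborel borel (\<lambda>t. t - (k - v))) ?Y"
      by (simp only: distr_lborel_minus)
    also have "\<dots> = emeasure lborel ((\<lambda>t. t - (k - v)) -` ?Y \<inter> space lborel)"
      by (rule emeasure_distr) auto
    also have "(\<lambda>t. t - (k - v)) -` ?Y \<inter> space lborel =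
        unit_cube \<inter> {t. t + v \<in> Q} \<inter> {t. t + v + (-1) *\<^sub>R k \<in> unit_cube}"
      using per[OF k] by (auto simp: algebra_simps)
    finally show "emeasure lborel (unit_cube \<inter> {t. t + v \<in> Q} \<inter> {t. t + v + (-1) *\<^sub>R k \<in> unit_cube}) =
        emeasure lborel ?Y" ..
  qed
  also have "\<dots> = emeasure lborel (unit_cube \<inter> Q)"
    by (rule emeasure_unit_cube_split[symmetric]) auto
  finally show ?thesis .
qed

lemma
  shows space_quotient_borel: "space (quotient_borel L) = range (coset L)"
    and sets_quotient_borel:
      "sets (quotient_borel L) = {E. E \<subseteq> range (coset L) \<and> coset L -` E \<in> sets borel}"
proof -
  let ?M = "{E. E \<subseteq> range (coset L) \<and> coset L -` E \<in> sets borel}"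
  have "coset L -` (range (coset L) - E) = - coset L -` E" for E
    by auto
  then have "range (coset L) - E \<in> ?M" if "E \<in> ?M" for E
    using that by (auto intro: borel_comp)
  moreover have "(\<Union>i. A i) \<in> ?M" if "range A \<subseteq> ?M" for A :: "nat \<Rightarrow> _"
    using that by (auto simp: vimage_UN)
  ultimately have "sigma_algebra (range (coset L)) ?M"
    unfolding sigma_algebra_iff2 by auto
  then show "sets (quotient_borel L) = {E. E \<subseteq> range (coset L) \<and> coset L -` E \<in> sets borel}"
    by (simp add: quotient_borel_def sigma_algebra.sets_measure_of_eq)
  show "space (quotient_borel L) = range (coset L)"
    by (simp add: quotient_borel_def space_measure_of_conv)
qed

lemma coset_translate: "(+) w ` coset L z = coset L (w + z)"
  by (auto simp: coset_def image_image add.assoc)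

lemma coset_eq:
  assumes "full_rank_lattice L" "l \<in> L"
  shows "coset L (z + l) = coset L z"
proof -
  obtain C :: "'a \<Rightarrow> 'a" where C: "linear C" "L = C ` int_points"
    using assms(1) by (auto simp: full_rank_lattice_def)
  have add: "k + m \<in> L" and minus: "- k \<in> L" if km: "k \<in> L" "m \<in> L" for k m
  proof -
    obtain a b where ab: "k = C a" "m = C b" "a \<in> int_points" "b \<in> int_points"
      using km C(2) by auto
    then have "a + b \<in> int_points" "- a \<in> int_points"
      by (auto simp: int_points_def inner_add_left)
    then show "k + m \<in> L" "- k \<in> L"
      using ab C by (auto simp: linear_add[symmetric] linear_neg[symmetric])
  qed
  have "x \<in> (+) l ` L \<longleftrightarrow> x \<in> L" for x
  proof
    assume "x \<in> L"
    then have "- l + x \<in> L"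
      using add minus assms(2) by blast
    then show "x \<in> (+) l ` L"
      by (intro image_eqI[of _ _ "- l + x"]) auto
  qed (use add assms(2) in auto)
  then have "(+) l ` L = L"
    by auto
  then show ?thesis
    unfolding coset_translate[symmetric] by (simp add: coset_def)
qed

lemma
  assumes "full_rank_lattice L"
  shows prob_space_haar: "prob_space (haar L)"
    and sets_haar: "sets (haar L) = sets (quotient_borel L)"
    and haar_translation_invariant: "distr (haar L) (haar L) (image ((+) w)) = haar L"
proof -
  define C :: "'a \<Rightarrow> 'a" where "C = (SOME C. linear C \<and> bij C \<and> L = C ` int_points)"
  have C: "linear C" "bij C" "L = C ` int_points"
    using someI_ex[OF assms[unfolded full_rank_lattice_def]] unfolding C_def by blast+
  let ?U = "uniform_measure lborel (unit_cube :: 'a set)"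
  interpret U: prob_space ?U
    by (rule prob_space_uniform_measure) (simp_all add: emeasure_unit_cube)
  have haar: "haar L = distr ?U (quotient_borel L) (\<lambda>t. coset L (C t))"
    by (simp add: haar_def C_def)
  have [measurable]: "C \<in> borel_measurable borel"
    using C(1) by (intro borel_measurable_continuous_onI linear_continuous_on) (simp add: linear_conv_bounded_linear)
  have [measurable]: "coset L \<in> borel \<rightarrow>\<^sub>M quotient_borel L"
    by (rule measurableI) (auto simp: space_quotient_borel sets_quotient_borel)
  have CL [measurable]: "(\<lambda>t. coset L (C t)) \<in> ?U \<rightarrow>\<^sub>M quotient_borel L"
    by (subst measurable_cong_sets[OF sets_uniform_measure refl]) measurable
  show "prob_space (haar L)"
    unfolding haar by (rule U.prob_space_distr) (rule CL)
  show sets: "sets (haar L) = sets (quotient_borel L)"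
    by (simp add: haar)
  have space: "space (haar L) = range (coset L)"
    by (simp add: haar space_quotient_borel)
  have tr: "image ((+) w) \<in> haar L \<rightarrow>\<^sub>M haar L"
  proof (rule measurableI)
    show "(+) w ` \<xi> \<in> space (haar L)" if "\<xi> \<in> space (haar L)" for \<xi>
      using that unfolding space by (force simp only: coset_translate)
    fix E
    assume E: "E \<in> sets (haar L)"
    then have [measurable]: "E \<in> sets (quotient_borel L)"
      by (simp add: sets)
    have "coset L -` (image ((+) w) -` E \<inter> range (coset L)) = (\<lambda>z. coset L (w + z)) -` E \<inter> space borel"
      by (simp add: set_eq_iff coset_translate rangeI)
    also have "\<dots> \<in> sets borel"
      by measurable
    finally show "image ((+) w) -` E \<inter> space (haar L) \<in> sets (haar L)"
      unfolding sets sets_quotient_borel space by blast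
  qed
  show "distr (haar L) (haar L) (image ((+) w)) = haar L"
  proof (rule measure_eqI)
    fix E
    assume "E \<in> sets (distr (haar L) (haar L) (image ((+) w)))"
    then have E: "E \<in> sets (haar L)" and [measurable]: "E \<in> sets (quotient_borel L)"
      by (simp_all add: sets)
    obtain v where v: "C v = w"
      using surjD[OF bij_is_surj[OF C(2)], of w] by auto
    define Q where "Q = {t. coset L (C t) \<in> E}"
    have "Q = (\<lambda>t. coset L (C t)) -` E \<inter> space borel"
      by (auto simp: Q_def)
    also have "\<dots> \<in> sets borel"
      by measurable
    finally have Q [measurable]: "Q \<in> sets borel" .
    have "x - k \<in> Q \<longleftrightarrow> x \<in> Q" if "k \<in> int_points" for x k
    proof -
      have "coset L (C (x - k) + C k) = coset L (C (x - k))"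
        using that by (intro coset_eq[OF assms]) (simp add: C(3))
      then show ?thesis
        by (simp add: Q_def linear_diff[OF C(1)])
    qed
    then have *: "emeasure lborel (unit_cube \<inter> {t. t + v \<in> Q}) = emeasure lborel (unit_cube \<inter> Q)"
      by (rule emeasure_unit_cube_translate[OF Q])
    have "emeasure (distr (haar L) (haar L) (image ((+) w))) E =
        emeasure (haar L) (image ((+) w) -` E \<inter> space (haar L))"
      by (rule emeasure_distr[OF tr E])
    also have "\<dots> = emeasure ?U ((\<lambda>t. coset L (C t)) -` (image ((+) w) -` E \<inter> space (haar L)) \<inter> space ?U)"
      using measurable_sets[OF tr E] unfolding sets by (subst (1) haar, subst emeasure_distr[OF CL]) auto
    also have "(\<lambda>t. coset L (C t)) -` (image ((+) w) -` E \<inter> space (haar L)) \<inter> space ?U = {t. t + v \<in> Q}"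
      by (auto simp: space coset_translate Q_def linear_add[OF C(1)] v add.commute[of "C _" w])
    also have "emeasure ?U {t. t + v \<in> Q} = emeasure ?U Q"
      using * by (subst (1 2) emeasure_uniform_measure) auto
    also have "\<dots> = emeasure (haar L) E"
      unfolding haar by (subst emeasure_distr[OF CL]) (auto simp: Q_def vimage_def)
    finally show "emeasure (distr (haar L) (haar L) (image ((+) w))) E = emeasure (haar L) E" .
  qed simp
qed


section \<open>Convolution and the symplectic Fourier series\<close>

text \<open>Sequences on \<open>\<Lambda>\<close> are functions on the whole space of which only the values on \<open>\<Lambda>\<close>
  matter.\<close>

definition ell1 :: "'b set \<Rightarrow> ('b \<Rightarrow> complex) set" where
  "ell1 \<Lambda> = {c. (\<lambda>l. cmod (c l)) summable_on \<Lambda>}"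

definition ell2 :: "'b set \<Rightarrow> ('b \<Rightarrow> complex) set" where
  "ell2 \<Lambda> = {c. (\<lambda>l. (cmod (c l))\<^sup>2) summable_on \<Lambda>}"

definition ell2_dist :: "'b set \<Rightarrow> ('b \<Rightarrow> complex) \<Rightarrow> ('b \<Rightarrow> complex) \<Rightarrow> real" where
  "ell2_dist \<Lambda> c d = sqrt (\<Sum>\<^sub>\<infinity>l\<in>\<Lambda>. (cmod (c l - d l))\<^sup>2)"

definition conv :: "'b::ab_group_add set \<Rightarrow> ('b \<Rightarrow> complex) \<Rightarrow> ('b \<Rightarrow> complex) \<Rightarrow> 'b \<Rightarrow> complex" where
  "conv \<Lambda> c d l = (\<Sum>\<^sub>\<infinity>l'\<in>\<Lambda>. c l' * d (l - l'))"

definition mat_conv ::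
    "'b::ab_group_add set \<Rightarrow> ('m \<Rightarrow> 'n::finite \<Rightarrow> 'b \<Rightarrow> complex) \<Rightarrow> ('n \<Rightarrow> 'b \<Rightarrow> complex) \<Rightarrow> 'm \<Rightarrow> 'b \<Rightarrow> complex"
  where "mat_conv \<Lambda> A c m l = (\<Sum>n\<in>UNIV. conv \<Lambda> (A m n) (c n) l)"

abbreviation dual_haar :: "'a::euclidean_space phase set \<Rightarrow> 'a phase set measure" where
  "dual_haar \<Lambda> \<equiv> haar (adjoint_lattice \<Lambda>)"

text \<open>The value at the class \<open>\<xi>\<close> does not depend on the representative \<open>SOME z. z \<in> \<xi>\<close>.\<close>

definition fourier_series_l1 ::
    "'a::euclidean_space phase set \<Rightarrow> ('a phase \<Rightarrow> complex) \<Rightarrow> 'a phase set \<Rightarrow> complex" where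
  "fourier_series_l1 \<Lambda> c \<xi> = (\<Sum>\<^sub>\<infinity>l\<in>\<Lambda>. c l * cis (2 * pi * sympl l (SOME z. z \<in> \<xi>)))"

text \<open>The continuous extension to \<open>\<ell>\<^sup>2\<close>: the limit in \<open>L\<^sup>2\<close> of the Fourier series of \<open>b\<close> as \<open>b\<close>
  tends to \<open>c\<close> in \<open>\<ell>\<^sup>2\<close> within \<open>\<ell>\<^sup>1\<close>. It is determined up to equality almost everywhere.\<close>

definition fourier_series ::
    "'a::euclidean_space phase set \<Rightarrow> ('a phase \<Rightarrow> complex) \<Rightarrow> 'a phase set \<Rightarrow> complex" where
  "fourier_series \<Lambda> c = (SOME f. square_integrable (dual_haar \<Lambda>) f \<and>
    (\<forall>\<epsilon>>0. \<exists>\<delta>>0. \<forall>b\<in>ell1 \<Lambda>. ell2_dist \<Lambda> b c < \<delta> \<longrightarrow>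
      l2_dist (dual_haar \<Lambda>) (fourier_series_l1 \<Lambda> b) f < \<epsilon>))"

definition transfer_matrix ::
    "'a::euclidean_space phase set \<Rightarrow> ('m::finite \<Rightarrow> 'n::finite \<Rightarrow> 'a phase \<Rightarrow> complex) \<Rightarrow>
      'a phase set \<Rightarrow> complex^'n^'m" where
  "transfer_matrix \<Lambda> A \<xi> = (\<chi> m n. fourier_series \<Lambda> (A m n) \<xi>)"

definition conj_transpose :: "complex^'n^'m \<Rightarrow> complex^'m^'n" where
  "conj_transpose X = (\<chi> n m. cnj (X $ m $ n))"

text \<open>Only applied to Hermitian matrices \<open>X\<^sup>* X\<close>, all of whose eigenvalues are real.\<close>

definition real_eigenvalues :: "complex^'n^'n \<Rightarrow> real set" where
  "real_eigenvalues X = {r. \<exists>v. v \<noteq> 0 \<and> X *v v = complex_of_real r *s v}"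

definition lambda_min :: "complex^'n^'n \<Rightarrow> real" where
  "lambda_min X = Min (real_eigenvalues X)"

definition lambda_max :: "complex^'n^'n \<Rightarrow> real" where
  "lambda_max X = Max (real_eigenvalues X)"

definition essinf :: "'x measure \<Rightarrow> ('x \<Rightarrow> ereal) \<Rightarrow> ereal" where
  "essinf M f = - esssup M (\<lambda>x. - f x)"

definition alpha ::
    "'a::euclidean_space phase set \<Rightarrow> ('m::finite \<Rightarrow> 'n::finite \<Rightarrow> 'a phase \<Rightarrow> complex) \<Rightarrow> ereal" where
  "alpha \<Lambda> A = essinf (dual_haar \<Lambda>)
    (\<lambda>\<xi>. ereal (lambda_min (conj_transpose (transfer_matrix \<Lambda> A \<xi>) ** transfer_matrix \<Lambda> A \<xi>)))"

definition beta ::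
    "'a::euclidean_space phase set \<Rightarrow> ('m::finite \<Rightarrow> 'n::finite \<Rightarrow> 'a phase \<Rightarrow> complex) \<Rightarrow> ereal" where
  "beta \<Lambda> A = esssup (dual_haar \<Lambda>)
    (\<lambda>\<xi>. ereal (lambda_max (conj_transpose (transfer_matrix \<Lambda> A \<xi>) ** transfer_matrix \<Lambda> A \<xi>)))"


section \<open>The shift-invariant subspace and the sampling formula\<close>

definition translates :: "('k \<Rightarrow> 'a::euclidean_space op) \<Rightarrow> 'a phase \<times> 'k \<Rightarrow> 'a op" where
  "translates S = (\<lambda>(l, k). op_translate l (S k))"

text \<open>\<open>T = (\<Sum>k. \<Sum>l\<in>\<Lambda>. c\<^sub>k(l) \<alpha>\<^sub>l(S\<^sub>k))\<close>, unconditionally in Hilbert-Schmidt norm.\<close>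

definition expands ::
    "'a::euclidean_space phase set \<Rightarrow> ('k \<Rightarrow> 'a op) \<Rightarrow> ('k \<Rightarrow> 'a phase \<Rightarrow> complex) \<Rightarrow> 'a op \<Rightarrow> bool" where
  "expands \<Lambda> S c T \<longleftrightarrow> hs_has_sum (\<lambda>(l, k). c k l *\<^sub>O translates S (l, k)) (\<Lambda> \<times> UNIV) T"

definition V2 :: "'a::euclidean_space phase set \<Rightarrow> ('n \<Rightarrow> 'a op) \<Rightarrow> 'a op set" where
  "V2 \<Lambda> S = {T. \<exists>c. (\<forall>n. c n \<in> ell2 \<Lambda>) \<and> expands \<Lambda> S c T}"

definition sampling_formula ::
    "'a::euclidean_space phase set \<Rightarrow> ('n::finite \<Rightarrow> 'a op) \<Rightarrow>
      ('m \<Rightarrow> 'n \<Rightarrow> 'a phase \<Rightarrow> complex) \<Rightarrow> ('m \<Rightarrow> 'a op) \<Rightarrow> bool" where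
  "sampling_formula \<Lambda> S A H \<longleftrightarrow>
    (\<forall>T c. (\<forall>n. c n \<in> ell2 \<Lambda>) \<longrightarrow> expands \<Lambda> S c T \<longrightarrow> expands \<Lambda> H (mat_conv \<Lambda> A c) T)"

end

theory Submission
  imports Defs
begin

text \<open>Convolution by \<open>A\<close> is multiplication of the symplectic Fourier series by the transfer matrix, so
  \<open>\<alpha>\<^sub>A\<close> and \<open>\<beta>\<^sub>A\<close> are the optimal constants in
  \<open>\<alpha>\<^sub>A \<parallel>c\<parallel>\<^sup>2 \<le> \<parallel>A * c\<parallel>\<^sup>2 \<le> \<beta>\<^sub>A \<parallel>c\<parallel>\<^sup>2\<close>. As the translates form a Riesz sequence, \<open>\<parallel>c\<parallel>\<close> is comparable
  to \<open>\<parallel>T\<parallel>\<close>; hence for \<open>\<alpha>\<^sub>A > 0\<close> the sample functionals are a frame of functionals on the space. Its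
  dual frame reconstructs \<open>T\<close> and consists of the translates of \<open>M\<close> operators, because sampling
  commutes with translations. Conversely, the upper bound of a frame that reconstructs every \<open>T\<close>
  from its samples bounds \<open>\<parallel>T\<parallel>\<close> by \<open>\<parallel>A * c\<parallel>\<close>, and choosing Fourier series concentrated on a
  subset of the dual group gives a pointwise lower bound for the transfer matrix.\<close>

text \<open>Three features of the setting shape the argument. Operators carry the operator norm and
  need only be real-linear, so the Hilbert-Schmidt class gets its own type \<open>hs\<close>, on
  which abstract Hilbert space theory and \<open>has_sum\<close> apply. A Riesz basis is given only
  through a bounded bijection, so the lower Riesz bound costs an open mapping argument. Finally,
  \<open>fourier_series\<close> is fixed only almost everywhere and \<open>A * c\<close> is not
  known to be square-summable beforehand; hence the multiplication rule is proved for finitely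
  supported \<open>c\<close>, where \<open>mat_conv\<close> is a finite sum of shifts, and the norm
  bounds reach all \<open>c\<close> by limits. The dual frame is found without an explicit inverse
  of the frame operator: Lax-Milgram for the form \<open>B\<close> is a fixed-point argument, and
  uniqueness in it yields the compatibility with translations. In part (b) the passage from norm
  inequalities to pointwise ones needs trigonometric polynomials to be dense in L2 of the dual
  group; vectors are treated one at a time, and a countable dense set of them provides a common null
  set.\<close>

section \<open>Inequalities between weighted squares\<close>

text \<open>The cross term \<open>2 * norm a * norm b\<close> is split by expanding
  \<open>(t * norm a - norm b)\<^sup>2 / t\<close>. The free weight matters: \<open>t = 1\<close>
  suffices for summability of sums, while letting \<open>t\<close> vary recovers the triangle
  inequality or makes a small perturbation negligible.\<close>

lemma power2_norm_add_weighted: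
  fixes a b :: "'v::real_normed_vector"
  assumes "0 < t"
  shows "(norm (a + b))\<^sup>2 \<le> (1 + t) * (norm a)\<^sup>2 + (1 + 1 / t) * (norm b)\<^sup>2"
proof -
  have "(norm (a + b))\<^sup>2 \<le> (norm a + norm b)\<^sup>2"
    by (simp add: norm_triangle_ineq power_mono)
  moreover have "0 \<le> (t * norm a - norm b)\<^sup>2 / t"
    using assms by simp
  moreover have "(t * norm a - norm b)\<^sup>2 / t = t * (norm a)\<^sup>2 - 2 * norm a * norm b + 1 / t * (norm b)\<^sup>2"
    using assms by (simp add: field_simps power2_eq_square)
  ultimately show ?thesis
    by (simp add: power2_sum algebra_simps)
qed

text \<open>The right-hand side is smallest at \<open>t = sqrt G / sqrt F\<close>, where it equals
  the square of \<open>sqrt F + sqrt G\<close>. Adding \<open>e > 0\<close> to both \<open>F\<close>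
  and \<open>G\<close> keeps this weight defined and positive when one of them vanishes; then
  \<open>e\<close> tends to 0.\<close>

lemma sqrt_le_sum_if_weighted:
  fixes F G S :: real
  assumes "0 \<le> F" "0 \<le> G" and S: "\<And>t. 0 < t \<Longrightarrow> S \<le> (1 + t) * F + (1 + 1 / t) * G"
  shows "sqrt S \<le> sqrt F + sqrt G"
proof -
  have *: "S \<le> (sqrt (F + e) + sqrt (G + e))\<^sup>2" if e: "0 < e" for e
  proof -
    have pos: "0 < sqrt (F + e)" "0 < sqrt (G + e)"
      using assms e by simp_all
    define t where "t = sqrt (G + e) / sqrt (F + e)"
    have "0 < t" using pos by (simp add: t_def)
    have "S \<le> (1 + t) * F + (1 + 1 / t) * G"
      by (rule S) fact
    also have "\<dots> \<le> (1 + t) * (F + e) + (1 + 1 / t) * (G + e)"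
      using \<open>0 < t\<close> e by (intro add_mono mult_left_mono) auto
    also have "\<dots> = (1 + t) * (sqrt (F + e))\<^sup>2 + (1 + 1 / t) * (sqrt (G + e))\<^sup>2"
      using assms e by simp
    also have "\<dots> = (sqrt (F + e) + sqrt (G + e))\<^sup>2"
    proof -
      have "(1 + q / p) * p\<^sup>2 + (1 + 1 / (q / p)) * q\<^sup>2 = (p + q)\<^sup>2" if "0 < p" "0 < q" for p q :: real
        using that by (simp add: field_simps power2_eq_square)
      then show ?thesis
        using pos unfolding t_def by blast
    qed
    finally show ?thesis .
  qed
  have "((\<lambda>e. (sqrt (F + e) + sqrt (G + e))\<^sup>2) \<longlongrightarrow> (sqrt (F + 0) + sqrt (G + 0))\<^sup>2) (at_right 0)"
    by (intro tendsto_intros)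
  moreover have "\<forall>\<^sub>F e in at_right 0. S \<le> (sqrt (F + e) + sqrt (G + e))\<^sup>2"
    using * by (auto simp: eventually_at_right_less eventually_at_right_field intro: exI[of _ 1])
  ultimately have "S \<le> (sqrt F + sqrt G)\<^sup>2"
    by (simp add: tendsto_lowerbound)
  then show ?thesis
    using assms by (intro real_le_lsqrt) auto
qed

section \<open>Square-integrable functions on a general measure space\<close>

lemma square_integrable_measurable:
  "square_integrable M f \<Longrightarrow> f \<in> borel_measurable M"
  and square_integrable_integrable:
  "square_integrable M f \<Longrightarrow> integrable M (\<lambda>x. (cmod (f x))\<^sup>2)"
  by (simp_all add: square_integrable_def)

lemma square_integrable_diff:
  assumes "square_integrable M f" "square_integrable M g"
  shows "square_integrable M (\<lambda>x. f x - g x)"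
  using square_integrable_add[OF assms(1) square_integrable_cmult[OF assms(2), of "-1"]] by simp

lemma square_integrable_sum:
  "(\<And>i. i \<in> I \<Longrightarrow> square_integrable M (f i)) \<Longrightarrow> square_integrable M (\<lambda>x. \<Sum>i\<in>I. f i x)"
  by (induction I rule: infinite_finite_induct)
    (auto simp: square_integrable_zero intro: square_integrable_add)

lemma l2_dist_nonneg: "0 \<le> l2_dist M f g"
  by (simp add: l2_dist_def)

lemma l2_dist_power2: "(l2_dist M f g)\<^sup>2 = (\<integral>x. (cmod (f x - g x))\<^sup>2 \<partial>M)"
  by (simp add: l2_dist_def)

lemma l2_dist_commute: "l2_dist M f g = l2_dist M g f"
  by (simp add: l2_dist_def norm_minus_commute)

text \<open>For a general measure \<open>l2_dist\<close> is not the distance of a type of classes,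
  so Minkowski's inequality is obtained by integrating the pointwise weighted inequality for every
  \<open>t\<close> and optimising afterwards.\<close>

lemma l2_dist_triangle:
  assumes "square_integrable M f" "square_integrable M g" "square_integrable M h"
  shows "l2_dist M f h \<le> l2_dist M f g + l2_dist M g h"
  unfolding l2_dist_def
proof (rule sqrt_le_sum_if_weighted)
  fix t :: real assume "0 < t"
  have i: "integrable M (\<lambda>x. (cmod (f x - g x))\<^sup>2)" "integrable M (\<lambda>x. (cmod (g x - h x))\<^sup>2)"
      "integrable M (\<lambda>x. (cmod (f x - h x))\<^sup>2)"
    using assms by (auto intro!: square_integrable_integrable square_integrable_diff)
  have "(\<integral>x. (cmod (f x - h x))\<^sup>2 \<partial>M) \<le> (\<integral>x. (1 + t) * (cmod (f x - g x))\<^sup>2 + (1 + 1 / t) * (cmod (g x - h x))\<^sup>2 \<partial>M)"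
    using power2_norm_add_weighted[OF \<open>0 < t\<close>, of "f x - g x" "g x - h x" for x]
    by (intro integral_mono i Bochner_Integration.integrable_add integrable_mult_right) simp
  then show "(\<integral>x. (cmod (f x - h x))\<^sup>2 \<partial>M) \<le> (1 + t) * (\<integral>x. (cmod (f x - g x))\<^sup>2 \<partial>M) + (1 + 1 / t) * (\<integral>x. (cmod (g x - h x))\<^sup>2 \<partial>M)"
    using i by simp
qed simp_all

text \<open>Along a fast subsequence the weighted sum of the squared increments is integrable, so the
  subsequence converges almost everywhere; Fatou's lemma identifies the limit.\<close>

lemma Riesz_Fischer:
  fixes f :: "nat \<Rightarrow> 'x \<Rightarrow> complex"
  assumes sq: "\<And>n. square_integrable M (f n)"
    and cauchy: "\<And>e. 0 < e \<Longrightarrow> \<exists>N. \<forall>m\<ge>N. \<forall>n\<ge>N. (\<integral>x. (cmod (f m x - f n x))\<^sup>2 \<partial>M) < e"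
  obtains g where "square_integrable M g" "(\<lambda>n. \<integral>x. (cmod (f n x - g x))\<^sup>2 \<partial>M) \<longlonglongrightarrow> 0"
proof -
  have [measurable]: "f n \<in> borel_measurable M" for n
    using sq by (simp add: square_integrable_def)
  have intd: "integrable M (\<lambda>x. (cmod (f m x - f n x))\<^sup>2)" for m n
    by (intro square_integrable_integrable square_integrable_diff sq)
  \<comment> \<open>The rate 1/4 leaves room for the weights \<open>2^k\<close> used below: the
    weighted increments still have integrals at most \<open>(1/2)^k\<close>.\<close>
  have "\<forall>k. \<exists>N. \<forall>m\<ge>N. \<forall>n\<ge>N. (\<integral>x. (cmod (f m x - f n x))\<^sup>2 \<partial>M) < (1/4)^k"
    by (intro allI cauchy) simp
  then obtain N where N: "\<And>k m n. N k \<le> m \<Longrightarrow> N k \<le> n \<Longrightarrow> (\<integral>x. (cmod (f m x - f n x))\<^sup>2 \<partial>M) < (1/4)^k"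
    by metis
  \<comment> \<open>Adding up all thresholds so far makes \<open>R\<close> monotone and at least
    both \<open>N k\<close> and \<open>k\<close>.\<close>
  define R where "R k = k + (\<Sum>i\<le>k. N i)" for k
  have RN: "N k \<le> R k" for k
    unfolding R_def by (rule trans_le_add2) (rule member_le_sum, auto)
  have R_mono: "R k \<le> R (Suc k)" and R_ge: "k \<le> R k" for k
    by (auto simp: R_def)
  define d where "d k x = f (R (Suc k)) x - f (R k) x" for k x
  have [measurable]: "d k \<in> borel_measurable M" for k
    unfolding d_def by measurable
  have d: "(\<integral>\<^sup>+x. ennreal ((cmod (d k x))\<^sup>2) \<partial>M) \<le> ennreal ((1/4)^k)" for k
  proof -
    have "(\<integral>x. (cmod (d k x))\<^sup>2 \<partial>M) < (1/4)^k"
      unfolding d_def by (rule N) (use RN R_mono order_trans in blast)+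
    then show ?thesis
      using intd unfolding d_def by (subst nn_integral_eq_integral) (auto intro: ennreal_leI)
  qed
  have "(\<integral>\<^sup>+x. (\<Sum>k. ennreal (2^k * (cmod (d k x))\<^sup>2)) \<partial>M) = (\<Sum>k. \<integral>\<^sup>+x. ennreal (2^k * (cmod (d k x))\<^sup>2) \<partial>M)"
    by (rule nn_integral_suminf) measurable
  also have "\<dots> \<le> (\<Sum>k. ennreal ((1/2)^k))"
  proof (rule suminf_le)
    fix k
    have "(\<integral>\<^sup>+x. ennreal (2^k * (cmod (d k x))\<^sup>2) \<partial>M) = ennreal (2^k) * (\<integral>\<^sup>+x. ennreal ((cmod (d k x))\<^sup>2) \<partial>M)"
      by (subst nn_integral_cmult[symmetric]) (auto simp: ennreal_mult)
    also have "\<dots> \<le> ennreal (2^k) * ennreal ((1/4)^k)"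
      by (rule mult_left_mono[OF d]) simp
    also have "\<dots> = ennreal ((1/2)^k)"
      by (simp add: ennreal_mult[symmetric] power_mult_distrib[symmetric])
    finally show "(\<integral>\<^sup>+x. ennreal (2^k * (cmod (d k x))\<^sup>2) \<partial>M) \<le> ennreal ((1/2)^k)" .
  qed auto
  also have "\<dots> = ennreal (\<Sum>k. (1/2)^k)"
    by (rule suminf_ennreal2) (auto intro: summable_geometric)
  finally have "(\<integral>\<^sup>+x. (\<Sum>k. ennreal (2^k * (cmod (d k x))\<^sup>2)) \<partial>M) \<noteq> \<infinity>"
    by (auto simp: top_unique)
  then have "AE x in M. (\<Sum>k. ennreal (2^k * (cmod (d k x))\<^sup>2)) \<noteq> \<infinity>"
    by (rule nn_integral_PInf_AE[rotated]) measurable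
  then have conv: "AE x in M. (\<lambda>k. f (R k) x) \<longlonglongrightarrow> lim (\<lambda>k. f (R k) x)"
  proof eventually_elim
    fix x assume "(\<Sum>k. ennreal (2^k * (cmod (d k x))\<^sup>2)) \<noteq> \<infinity>"
    then have "summable (\<lambda>k. 2^k * (cmod (d k x))\<^sup>2)"
      by (intro summable_suminf_not_top) (auto simp: infinity_ennreal_def)
    then have sm: "summable (\<lambda>k. 2^k * (cmod (d k x))\<^sup>2 + (1/2)^k)"
      by (intro summable_add summable_geometric) auto
    \<comment> \<open>An instance of \<open>y \<le> y\<^sup>2 + 1\<close> for
      \<open>y = 2^k * cmod (d k x)\<close>, divided by \<open>2^k\<close>: a summable weighted
      square controls the increment itself up to a geometric series.\<close>
    have "cmod (d k x) \<le> 2^k * (cmod (d k x))\<^sup>2 + (1/2)^k" for k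
    proof -
      have "0 \<le> (2^k * cmod (d k x) - 1/2)\<^sup>2" by simp
      then have "2^k * cmod (d k x) \<le> (2^k * cmod (d k x))\<^sup>2 + 1"
        unfolding power2_diff by (simp add: power2_eq_square)
      then have "2^k * cmod (d k x) \<le> 2^k * (2^k * (cmod (d k x))\<^sup>2 + (1/2)^k)"
        by (simp add: distrib_left power_mult_distrib[symmetric] power2_eq_square mult_ac power_one_over)
      then show ?thesis by simp
    qed
    then have "summable (\<lambda>k. d k x)"
      using sm by (intro summable_comparison_test[OF _ sm]) auto
    then have "convergent (\<lambda>n. \<Sum>k<n. d k x)"
      by (simp add: summable_iff_convergent)
    moreover have "(\<Sum>k<n. d k x) = f (R n) x - f (R 0) x" for n
      unfolding d_def by (rule sum_lessThan_telescope)
    ultimately have "convergent (\<lambda>n. f (R n) x - f (R 0) x)"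
      by simp
    then have "convergent (\<lambda>n. f (R n) x)"
      by (simp add: convergent_diff_const_right_iff)
    then show "(\<lambda>k. f (R k) x) \<longlonglongrightarrow> lim (\<lambda>k. f (R k) x)"
      by (simp add: convergent_LIMSEQ_iff)
  qed
  \<comment> \<open>\<open>lim\<close> has an arbitrary value where the subsequence diverges, which
    by \<open>conv\<close> happens only on a null set; using it everywhere keeps \<open>g\<close>
    measurable.\<close>
  define g where "g x = lim (\<lambda>k. f (R k) x)" for x
  have [measurable]: "g \<in> borel_measurable M"
    unfolding g_def by measurable
  have fatou: "(\<integral>\<^sup>+x. ennreal ((cmod (f n x - g x))\<^sup>2) \<partial>M) \<le> ennreal e"
    if n: "\<forall>m\<ge>K. \<forall>n\<ge>K. (\<integral>x. (cmod (f m x - f n x))\<^sup>2 \<partial>M) < e" "K \<le> n" for n e K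
  proof -
    have "(\<integral>\<^sup>+x. ennreal ((cmod (f n x - g x))\<^sup>2) \<partial>M) =
        (\<integral>\<^sup>+x. liminf (\<lambda>k. ennreal ((cmod (f n x - f (R k) x))\<^sup>2)) \<partial>M)"
    proof (rule nn_integral_cong_AE)
      show "AE x in M. ennreal ((cmod (f n x - g x))\<^sup>2) = liminf (\<lambda>k. ennreal ((cmod (f n x - f (R k) x))\<^sup>2))"
        using conv
      proof eventually_elim
        fix x assume "(\<lambda>k. f (R k) x) \<longlonglongrightarrow> lim (\<lambda>k. f (R k) x)"
        then have "(\<lambda>k. ennreal ((cmod (f n x - f (R k) x))\<^sup>2)) \<longlonglongrightarrow> ennreal ((cmod (f n x - g x))\<^sup>2)"
          unfolding g_def[symmetric] by (intro tendsto_ennrealI tendsto_intros)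
        then show "ennreal ((cmod (f n x - g x))\<^sup>2) = liminf (\<lambda>k. ennreal ((cmod (f n x - f (R k) x))\<^sup>2))"
          by (intro lim_imp_Liminf[symmetric]) auto
      qed
    qed
    also have "\<dots> \<le> liminf (\<lambda>k. \<integral>\<^sup>+x. ennreal ((cmod (f n x - f (R k) x))\<^sup>2) \<partial>M)"
      by (rule nn_integral_liminf) measurable
    also have "\<dots> \<le> ennreal e"
    proof (rule Liminf_le)
      show "\<forall>\<^sub>F k in sequentially. (\<integral>\<^sup>+x. ennreal ((cmod (f n x - f (R k) x))\<^sup>2) \<partial>M) \<le> ennreal e"
        using eventually_ge_at_top[of K]
      proof eventually_elim
        fix k assume "K \<le> k"
        then have "(\<integral>x. (cmod (f n x - f (R k) x))\<^sup>2 \<partial>M) < e"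
          using n R_ge[of k] order_trans by blast
        then show "(\<integral>\<^sup>+x. ennreal ((cmod (f n x - f (R k) x))\<^sup>2) \<partial>M) \<le> ennreal e"
          using intd by (subst nn_integral_eq_integral) (auto intro: ennreal_leI)
      qed
    qed simp
    finally show ?thesis .
  qed
  have int: "integrable M (\<lambda>x. (cmod (f n x - g x))\<^sup>2)" "(\<integral>x. (cmod (f n x - g x))\<^sup>2 \<partial>M) \<le> e"
    if n: "0 < e" "\<forall>m\<ge>K. \<forall>n\<ge>K. (\<integral>x. (cmod (f m x - f n x))\<^sup>2 \<partial>M) < e" "K \<le> n" for n e K
  proof -
    note F = fatou[OF n(2,3)]
    show i: "integrable M (\<lambda>x. (cmod (f n x - g x))\<^sup>2)"
      using F by (intro integrableI_bounded) (auto simp: less_top[symmetric] top_unique)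
    have "ennreal (\<integral>x. (cmod (f n x - g x))\<^sup>2 \<partial>M) \<le> ennreal e"
      using F i by (subst nn_integral_eq_integral[symmetric]) auto
    then show "(\<integral>x. (cmod (f n x - g x))\<^sup>2 \<partial>M) \<le> e"
      using n(1) by (simp add: ennreal_le_iff)
  qed
  obtain K where K: "\<forall>m\<ge>K. \<forall>n\<ge>K. (\<integral>x. (cmod (f m x - f n x))\<^sup>2 \<partial>M) < 1"
    using cauchy[of 1] by auto
  have "square_integrable M (\<lambda>x. f K x - g x)"
    using int(1)[OF _ K order_refl] by (simp add: square_integrable_def)
  from square_integrable_diff[OF sq[of K] this] have "square_integrable M g"
    by simp
  moreover have "(\<lambda>n. \<integral>x. (cmod (f n x - g x))\<^sup>2 \<partial>M) \<longlonglongrightarrow> 0"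
  proof (rule LIMSEQ_I)
    fix e :: real assume "0 < e"
    then obtain K where K: "\<forall>m\<ge>K. \<forall>n\<ge>K. (\<integral>x. (cmod (f m x - f n x))\<^sup>2 \<partial>M) < e/2"
      using cauchy[of "e/2"] by auto
    show "\<exists>no. \<forall>n\<ge>no. norm ((\<integral>x. (cmod (f n x - g x))\<^sup>2 \<partial>M) - 0) < e"
    proof (intro exI allI impI)
      fix n assume "K \<le> n"
      from int(2)[OF _ K this] show "norm ((\<integral>x. (cmod (f n x - g x))\<^sup>2 \<partial>M) - 0) < e"
        using \<open>0 < e\<close> by simp
    qed
  qed
  ultimately show thesis
    by (rule that)
qed

text \<open>\<open>Riesz_Fischer\<close> for \<open>lborel\<close>, applied to the representatives
  \<open>rep_l2 (X n)\<close>. Completeness is what the abstract Hilbert space locale needs for the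
  convergence of series and for representing functionals.\<close>

instance l2 :: (euclidean_space) complete_space
proof
  fix X :: "nat \<Rightarrow> 'a l2"
  assume X: "Cauchy X"
  have rel: "l2_rel (rep_l2 h) (rep_l2 h)" for h :: "'a l2"
    by (rule Quotient_rep_reflp[OF Quotient_l2])
  have abs: "abs_l2 (rep_l2 h) = h" for h :: "'a l2"
    by (rule Quotient_abs_rep[OF Quotient_l2])
  have sq: "square_integrable lborel (rep_l2 h)" for h :: "'a l2"
    using rel[of h] by (simp add: l2_rel_def)
  have nrm: "(norm (abs_l2 u))\<^sup>2 = (\<integral>x. (cmod (u x))\<^sup>2 \<partial>lborel)" if "square_integrable lborel u" for u :: "'a \<Rightarrow> complex"
  proof -
    have "l2_rel u u" using that by (simp add: l2_rel_def)
    then have "cinner (abs_l2 u) (abs_l2 u) = (\<integral>x. u x * cnj (u x) \<partial>lborel)"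
      by (simp add: cinner.abs_eq)
    also have "\<dots> = (\<integral>x. complex_of_real ((cmod (u x))\<^sup>2) \<partial>lborel)"
      by (intro Bochner_Integration.integral_cong) (simp_all add: complex_norm_square[symmetric])
    also have "\<dots> = complex_of_real (\<integral>x. (cmod (u x))\<^sup>2 \<partial>lborel)"
      by (rule integral_complex_of_real)
    finally show ?thesis
      by (simp add: power2_norm_eq_inner inner_l2_def)
  qed
  have minus: "abs_l2 u - abs_l2 v = abs_l2 (\<lambda>x. u x - v x)"
    if "square_integrable lborel u" "square_integrable lborel v" for u v :: "'a \<Rightarrow> complex"
  proof -
    have "abs_l2 u - abs_l2 v = abs_l2 (\<lambda>x. u x + - 1 * v x)"
      unfolding minus_l2_def uminus_l2_def
      using that square_integrable_cmult[OF that(2), of "-1"]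
      by (simp add: plus_l2.abs_eq scaleC.abs_eq l2_rel_def)
    then show ?thesis by simp
  qed
  have dist: "(norm (h - k))\<^sup>2 = (\<integral>x. (cmod (rep_l2 h x - rep_l2 k x))\<^sup>2 \<partial>lborel)" for h k :: "'a l2"
    using nrm[OF square_integrable_diff[OF sq[of h] sq[of k]]] minus[OF sq[of h] sq[of k]] abs by simp
  obtain g where g: "square_integrable lborel g"
      "(\<lambda>n. \<integral>x. (cmod (rep_l2 (X n) x - g x))\<^sup>2 \<partial>lborel) \<longlonglongrightarrow> 0"
  proof (rule Riesz_Fischer[of lborel "\<lambda>n. rep_l2 (X n)"])
    show "square_integrable lborel (rep_l2 (X n))" for n by (rule sq)
    fix e :: real assume "0 < e"
    then obtain N where "\<forall>m\<ge>N. \<forall>n\<ge>N. norm (X m - X n) < sqrt e"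
      using X by (metis CauchyD real_sqrt_gt_zero)
    then have "\<forall>m\<ge>N. \<forall>n\<ge>N. (norm (X m - X n))\<^sup>2 < e"
      using \<open>0 < e\<close> by (metis norm_ge_zero less_eq_real_def real_less_rsqrt real_sqrt_pow2 power2_eq_square pos2 power_strict_mono)
    then show "\<exists>N. \<forall>m\<ge>N. \<forall>n\<ge>N. (\<integral>x. (cmod (rep_l2 (X m) x - rep_l2 (X n) x))\<^sup>2 \<partial>lborel) < e"
      by (auto simp: dist)
  qed
  have "(norm (X n - abs_l2 g))\<^sup>2 = (\<integral>x. (cmod (rep_l2 (X n) x - g x))\<^sup>2 \<partial>lborel)" for n
    using nrm[OF square_integrable_diff[OF sq[of "X n"] g(1)]] minus[OF sq[of "X n"] g(1)] abs by simp
  with g(2) have "(\<lambda>n. (norm (X n - abs_l2 g))\<^sup>2) \<longlonglongrightarrow> 0"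
    by simp
  then have "(\<lambda>n. sqrt ((norm (X n - abs_l2 g))\<^sup>2)) \<longlonglongrightarrow> sqrt 0"
    by (rule tendsto_real_sqrt)
  then have "X \<longlonglongrightarrow> abs_l2 g"
    by (simp add: LIM_zero_iff tendsto_norm_zero_iff)
  then show "convergent X"
    by (auto simp: convergent_def)
qed

instance l2 :: (euclidean_space) banach ..

section \<open>Unconditional summability and square-summable families\<close>

lemma nonneg_summable_bound:
  fixes f :: "'i \<Rightarrow> real"
  assumes "\<And>i. i \<in> I \<Longrightarrow> 0 \<le> f i" and "\<And>F. finite F \<Longrightarrow> F \<subseteq> I \<Longrightarrow> sum f F \<le> b"
  shows "f summable_on I" and "infsum f I \<le> b"
proof -
  show s: "f summable_on I"
    using assms by (intro nonneg_bdd_above_summable_on bdd_aboveI2[where M = b]) auto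
  show "infsum f I \<le> b"
    using s assms(2) by (rule infsum_le_finite_sums)
qed

lemma summable_tail:
  fixes f :: "'i \<Rightarrow> real"
  assumes "f summable_on I" "\<And>i. i \<in> I \<Longrightarrow> 0 \<le> f i" "0 < e"
  obtains X where "finite X" "X \<subseteq> I" "infsum f (I - X) < e"
proof -
  have "\<exists>X. finite X \<and> X \<subseteq> I \<and> dist (sum f X) (infsum f I) \<le> e/2"
    using assms(1,3) by (intro infsum_finite_approximation) auto
  then obtain X where X: "finite X" "X \<subseteq> I" "dist (sum f X) (infsum f I) \<le> e / 2"
    by blast
  have "infsum f (I - X) = infsum f I - sum f X"
    using X assms(1) by (subst infsum_Diff) auto
  also have "\<dots> < e"
    using X(3) assms(3) unfolding dist_real_def by linarith
  finally show thesis
    using X that by blast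
qed

text \<open>Two finite sets containing \<open>X\<close> differ by sums over sets disjoint from
  \<open>X\<close>, so small sums off \<open>X\<close> make the net of partial sums a Cauchy filter,
  which converges in a Banach space.\<close>

lemma summable_on_Cauchy:
  fixes f :: "'i \<Rightarrow> 'v::banach"
  assumes "\<And>e. 0 < e \<Longrightarrow> \<exists>X. finite X \<and> X \<subseteq> I \<and> (\<forall>Y. finite Y \<longrightarrow> Y \<subseteq> I - X \<longrightarrow> norm (sum f Y) < e)"
  shows "f summable_on I"
proof -
  have "\<exists>P. eventually P (finite_subsets_at_top I) \<and> (\<forall>F F'. P F \<and> P F' \<longrightarrow> dist (sum f F) (sum f F') < e)"
    if "0 < e" for e
  proof -
    obtain X where X: "finite X" "X \<subseteq> I" "\<And>Y. finite Y \<Longrightarrow> Y \<subseteq> I - X \<Longrightarrow> norm (sum f Y) < e/2"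
      using assms[of "e/2"] \<open>0 < e\<close> by auto
    show ?thesis
    proof (intro exI conjI allI impI)
      show "\<forall>\<^sub>F F in finite_subsets_at_top I. finite F \<and> X \<subseteq> F \<and> F \<subseteq> I"
        unfolding eventually_finite_subsets_at_top using X by blast
      fix F F' assume F: "(finite F \<and> X \<subseteq> F \<and> F \<subseteq> I) \<and> finite F' \<and> X \<subseteq> F' \<and> F' \<subseteq> I"
      have "sum f F - sum f F' = sum f (F - X) - sum f (F' - X)"
        using F X(1) by (simp add: sum_diff)
      also have "norm \<dots> < e/2 + e/2"
        using F by (intro order_le_less_trans[OF norm_triangle_ineq4] add_strict_mono X(3)) auto
      finally show "dist (sum f F) (sum f F') < e"
        by (simp add: dist_norm)
    qed
  qed
  then have "cauchy_filter (filtermap (sum f) (finite_subsets_at_top I))"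
    by (simp add: cauchy_filter_metric_filtermap)
  then obtain L where "(sum f \<longlongrightarrow> L) (finite_subsets_at_top I)"
    using complete_uniform[where S = "UNIV::'v set"] complete_UNIV by (force simp add: filterlim_def)
  then show ?thesis
    using summable_on_def has_sum_def by blast
qed

lemma ell2_iff: "c \<in> ell2 I \<longleftrightarrow> (\<lambda>i. (cmod (c i))\<^sup>2) summable_on I"
  by (simp add: ell2_def)

lemma ell2_cmult: "c \<in> ell2 I \<Longrightarrow> (\<lambda>i. k * c i) \<in> ell2 I"
  unfolding ell2_iff norm_mult power_mult_distrib by (rule summable_on_cmult_right)

lemma ell2_add:
  assumes "c \<in> ell2 I" "d \<in> ell2 I"
  shows "(\<lambda>i. c i + d i) \<in> ell2 I"
proof -
  have "(\<lambda>i. 2 * (cmod (c i))\<^sup>2 + 2 * (cmod (d i))\<^sup>2) summable_on I"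
    using assms unfolding ell2_iff by (intro summable_on_add summable_on_cmult_right)
  then show ?thesis
    unfolding ell2_iff
    by (rule summable_on_comparison_test) (use power2_norm_add_weighted[of 1] in auto)
qed

lemma ell2_diff: "c \<in> ell2 I \<Longrightarrow> d \<in> ell2 I \<Longrightarrow> (\<lambda>i. c i - d i) \<in> ell2 I"
  using ell2_add[of c I "\<lambda>i. - 1 * d i"] ell2_cmult[of d I "-1"] by simp

lemma ell2_zero: "(\<lambda>i. 0) \<in> ell2 I"
  by (simp add: ell2_iff)

lemma ell2_sum: "(\<And>k. k \<in> K \<Longrightarrow> c k \<in> ell2 I) \<Longrightarrow> (\<lambda>i. \<Sum>k\<in>K. c k i) \<in> ell2 I"
  by (induction K rule: infinite_finite_induct) (auto intro: ell2_add simp: ell2_zero)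

lemma ell2_finite_support:
  assumes "finite X" "\<And>i. i \<in> I - X \<Longrightarrow> c i = 0"
  shows "c \<in> ell2 I"
proof -
  have "(\<lambda>i. (cmod (c i))\<^sup>2) summable_on (X \<inter> I)"
    using assms(1) by simp
  then show ?thesis
    unfolding ell2_iff by (rule summable_on_cong_neutral[THEN iffD1, rotated -1]) (use assms in auto)
qed

text \<open>Stated without conjugation: convolution uses it directly, sesquilinear forms after
  \<open>ell2_cnj\<close>. The infinite sums enter only as bounds in the finite Cauchy-Schwarz
  inequality, which yields summability at the same time.\<close>

lemma Cauchy_Schwarz_ell2:
  assumes "c \<in> ell2 I" "d \<in> ell2 I"
  shows "(\<lambda>i. norm (c i * d i)) summable_on I"
    and "cmod (\<Sum>\<^sub>\<infinity>i\<in>I. c i * d i) \<le> sqrt (\<Sum>\<^sub>\<infinity>i\<in>I. (cmod (c i))\<^sup>2) * sqrt (\<Sum>\<^sub>\<infinity>i\<in>I. (cmod (d i))\<^sup>2)"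
proof -
  let ?b = "sqrt (\<Sum>\<^sub>\<infinity>i\<in>I. (cmod (c i))\<^sup>2) * sqrt (\<Sum>\<^sub>\<infinity>i\<in>I. (cmod (d i))\<^sup>2)"
  have fin: "(\<Sum>i\<in>F. norm (c i * d i)) \<le> ?b" if "finite F" "F \<subseteq> I" for F
  proof -
    have "(\<Sum>i\<in>F. norm (c i * d i)) \<le> L2_set (\<lambda>i. cmod (c i)) F * L2_set (\<lambda>i. cmod (d i)) F"
      using L2_set_mult_ineq[of "\<lambda>i. cmod (c i)" "\<lambda>i. cmod (d i)" F] by (simp add: norm_mult)
    also have "\<dots> \<le> ?b"
      unfolding L2_set_def using assms that unfolding ell2_iff
      by (intro mult_mono real_sqrt_le_mono finite_sum_le_infsum) (auto intro: sum_nonneg infsum_nonneg)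
    finally show ?thesis .
  qed
  show s: "(\<lambda>i. norm (c i * d i)) summable_on I"
    by (rule nonneg_summable_bound(1)[OF _ fin]) auto
  have "cmod (\<Sum>\<^sub>\<infinity>i\<in>I. c i * d i) \<le> (\<Sum>\<^sub>\<infinity>i\<in>I. norm (c i * d i))"
    by (rule norm_infsum_bound[OF s])
  also have "\<dots> \<le> ?b"
    by (rule nonneg_summable_bound(2)[OF _ fin]) auto
  finally show "cmod (\<Sum>\<^sub>\<infinity>i\<in>I. c i * d i) \<le> ?b" .
qed

lemma ell2_cnj: "c \<in> ell2 I \<Longrightarrow> (\<lambda>i. cnj (c i)) \<in> ell2 I"
  by (simp add: ell2_iff)

section \<open>Complex Hilbert spaces\<close>

text \<open>Both \<open>'a l2\<close> and the Hilbert-Schmidt class are instances, with different scalar multiplications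
  and inner products.\<close>

locale complex_hilbert =
  fixes sc :: "complex \<Rightarrow> 'v::{real_inner,banach} \<Rightarrow> 'v" (infixr "\<odot>" 75)
    and ip :: "'v \<Rightarrow> 'v \<Rightarrow> complex"
  assumes sc_of_real: "complex_of_real r \<odot> x = r *\<^sub>R x"
    and sc_add_right: "c \<odot> (x + y) = c \<odot> x + c \<odot> y"
    and sc_add_left: "(c + d) \<odot> x = c \<odot> x + d \<odot> x"
    and sc_assoc: "c \<odot> d \<odot> x = (c * d) \<odot> x"
    and ip_add_left: "ip (x + y) z = ip x z + ip y z"
    and ip_sc_left: "ip (c \<odot> x) y = c * ip x y"
    and ip_commute: "ip y x = cnj (ip x y)"
    and Re_ip: "Re (ip x y) = inner x y"
begin

lemma sc_one [simp]: "1 \<odot> x = x" and sc_zero [simp]: "0 \<odot> x = 0"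
  using sc_of_real[of 1 x] sc_of_real[of 0 x] by simp_all

lemma sc_zero_right [simp]: "c \<odot> 0 = 0"
  using sc_add_right[of c 0 0] by simp

lemma sc_minus1: "(- 1) \<odot> x = - x"
  using sc_of_real[of "-1" x] by simp

lemma sc_minus_right: "c \<odot> (- x) = - (c \<odot> x)"
  by (metis sc_minus1 sc_assoc mult.commute)

lemma sc_diff_right: "c \<odot> (x - y) = c \<odot> x - c \<odot> y"
  using sc_add_right[of c x "- y"] by (simp add: sc_minus_right)

lemma sc_sum_right: "c \<odot> (\<Sum>i\<in>F. g i) = (\<Sum>i\<in>F. c \<odot> g i)"
  by (induction F rule: infinite_finite_induct) (auto simp: sc_add_right)

lemma ip_add_right: "ip x (y + z) = ip x y + ip x z"
  by (metis ip_commute ip_add_left complex_cnj_add)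

lemma ip_sc_right: "ip x (c \<odot> y) = cnj c * ip x y"
  by (metis ip_commute ip_sc_left complex_cnj_mult)

lemma ip_zero_left [simp]: "ip 0 x = 0" and ip_zero_right [simp]: "ip x 0 = 0"
  using ip_add_left[of 0 0 x] ip_add_right[of x 0 0] by simp_all

lemma ip_diff_left: "ip (x - y) z = ip x z - ip y z"
  using ip_add_left[of "x - y" y z] by simp

lemma ip_diff_right: "ip x (y - z) = ip x y - ip x z"
  using ip_add_right[of x "y - z" z] by simp

lemma ip_sum_left: "ip (\<Sum>i\<in>F. g i) y = (\<Sum>i\<in>F. ip (g i) y)"
  by (induction F rule: infinite_finite_induct) (auto simp: ip_add_left)

lemma ip_sum_right: "ip y (\<Sum>i\<in>F. g i) = (\<Sum>i\<in>F. ip y (g i))"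
  by (induction F rule: infinite_finite_induct) (auto simp: ip_add_right)

lemma ip_self: "ip x x = complex_of_real ((norm x)\<^sup>2)"
proof (rule complex_eqI)
  show "Re (ip x x) = Re (complex_of_real ((norm x)\<^sup>2))"
    by (simp add: Re_ip power2_norm_eq_inner)
  show "Im (ip x x) = Im (complex_of_real ((norm x)\<^sup>2))"
    using ip_commute[of x x] by (simp add: complex_eq_iff)
qed

lemma norm_sc: "norm (c \<odot> x) = cmod c * norm x"
proof -
  have "complex_of_real ((norm (c \<odot> x))\<^sup>2) = complex_of_real ((cmod c)\<^sup>2 * (norm x)\<^sup>2)"
    unfolding ip_self[symmetric] ip_sc_left ip_sc_right
    by (simp add: ip_self complex_norm_square mult.assoc del: of_real_power)
  then have "(norm (c \<odot> x))\<^sup>2 = (cmod c * norm x)\<^sup>2"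
    unfolding of_real_eq_iff by (simp add: power_mult_distrib)
  then show ?thesis
    by simp
qed

lemma ip_Cauchy_Schwarz: "cmod (ip x y) \<le> norm x * norm y"
proof (cases "ip x y = 0")
  case False
  define c where "c = cnj (ip x y) / complex_of_real (cmod (ip x y))"
  have "cnj (ip x y) * ip x y = complex_of_real (cmod (ip x y)) * complex_of_real (cmod (ip x y))"
    by (metis complex_norm_square mult.commute power2_eq_square of_real_mult)
  then have "c * ip x y = complex_of_real (cmod (ip x y))"
    using False by (simp add: c_def)
  then have "cmod (ip x y) = Re (ip (c \<odot> x) y)"
    by (simp add: ip_sc_left)
  also have "\<dots> \<le> norm (c \<odot> x) * norm y"
    unfolding Re_ip by (rule norm_cauchy_schwarz)
  also have "norm (c \<odot> x) = norm x"
    using False by (simp add: norm_sc c_def norm_divide)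
  finally show ?thesis .
qed simp

lemma bounded_linear_ip_left: "bounded_linear (\<lambda>x. ip x y)"
proof (rule bounded_linear_intro[where K = "norm y"])
  show "ip (r *\<^sub>R x) y = r *\<^sub>R ip x y" for r x
    using ip_sc_left[of "complex_of_real r" x y] by (simp add: sc_of_real scaleR_conv_of_real)
qed (simp_all add: ip_add_left ip_Cauchy_Schwarz)

lemma bounded_linear_ip_right: "bounded_linear (\<lambda>y. ip x y)"
proof (rule bounded_linear_intro[where K = "norm x"])
  show "ip x (r *\<^sub>R y) = r *\<^sub>R ip x y" for r y
    using ip_sc_right[of x "complex_of_real r" y] by (simp add: sc_of_real scaleR_conv_of_real)
qed (simp_all add: ip_add_right ip_Cauchy_Schwarz mult.commute[of _ "norm x"])

lemma bounded_linear_sc: "bounded_linear (\<lambda>x. c \<odot> x)"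
proof (rule bounded_linear_intro[where K = "cmod c"])
  show "c \<odot> r *\<^sub>R x = r *\<^sub>R c \<odot> x" for r x
    using sc_assoc[of c "complex_of_real r" x] sc_assoc[of "complex_of_real r" c x]
    by (simp add: sc_of_real mult.commute)
qed (simp_all add: sc_add_right norm_sc mult.commute)

lemmas has_sum_ip_left = has_sum_bounded_linear[OF bounded_linear_ip_left]
lemmas has_sum_ip_right = has_sum_bounded_linear[OF bounded_linear_ip_right]
lemmas has_sum_sc = has_sum_bounded_linear[OF bounded_linear_sc]

definition csubspace :: "'v set \<Rightarrow> bool" where
  "csubspace V \<longleftrightarrow> 0 \<in> V \<and> (\<forall>x\<in>V. \<forall>y\<in>V. x + y \<in> V) \<and> (\<forall>c. \<forall>x\<in>V. c \<odot> x \<in> V) \<and> closed V"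

lemma csubspace_closed: "csubspace V \<Longrightarrow> closed V"
  and csubspace_zero: "csubspace V \<Longrightarrow> 0 \<in> V"
  and csubspace_add: "csubspace V \<Longrightarrow> x \<in> V \<Longrightarrow> y \<in> V \<Longrightarrow> x + y \<in> V"
  and csubspace_sc: "csubspace V \<Longrightarrow> x \<in> V \<Longrightarrow> c \<odot> x \<in> V"
  by (simp_all add: csubspace_def)

lemma csubspace_scaleR: "csubspace V \<Longrightarrow> x \<in> V \<Longrightarrow> r *\<^sub>R x \<in> V"
  using csubspace_sc[of V x "complex_of_real r"] by (simp add: sc_of_real)

lemma csubspace_diff: "csubspace V \<Longrightarrow> x \<in> V \<Longrightarrow> y \<in> V \<Longrightarrow> x - y \<in> V"
  using csubspace_add[of V x "- y"] csubspace_sc[of V y "-1"] by (simp add: sc_minus1)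

lemma csubspace_sum: "csubspace V \<Longrightarrow> (\<And>i. i \<in> F \<Longrightarrow> g i \<in> V) \<Longrightarrow> (\<Sum>i\<in>F. g i) \<in> V"
  by (induction F rule: infinite_finite_induct) (auto simp: csubspace_zero csubspace_add)

lemma csubspace_has_sum:
  assumes "csubspace V" "\<And>i. i \<in> I \<Longrightarrow> g i \<in> V" "(g has_sum x) I"
  shows "x \<in> V"
proof (rule Lim_in_closed_set[OF csubspace_closed[OF assms(1)]])
  show "(sum g \<longlongrightarrow> x) (finite_subsets_at_top I)"
    using assms(3) by (simp add: has_sum_def)
  show "\<forall>\<^sub>F F in finite_subsets_at_top I. sum g F \<in> V"
    by (rule eventually_finite_subsets_at_top_weakI) (use assms in \<open>auto intro!: csubspace_sum\<close>)
qed simp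

text \<open>For maps that are additive and bounded only on a closed subspace, such as sampling
  functionals or the operator \<open>U\<close> of a Riesz basis, and thus are no
  \<open>bounded_linear\<close> maps on the whole type. Additivity settles finite sums and the bound
  transports the limit.\<close>

lemma has_sum_additive_on:
  fixes g :: "'v \<Rightarrow> 'w::real_normed_vector"
  assumes V: "csubspace V" and add: "\<And>x y. x \<in> V \<Longrightarrow> y \<in> V \<Longrightarrow> g (x + y) = g x + g y"
    and K: "\<And>x. x \<in> V \<Longrightarrow> norm (g x) \<le> K * norm x"
    and h: "\<And>i. i \<in> I \<Longrightarrow> h i \<in> V" "(h has_sum x) I"
  shows "((\<lambda>i. g (h i)) has_sum g x) I"
proof -
  have x: "x \<in> V"
    by (rule csubspace_has_sum[OF V h])
  have g0: "g 0 = 0"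
    using add[of 0 0] csubspace_zero[OF V] by simp
  have diff: "g (y - z) = g y - g z" if "y \<in> V" "z \<in> V" for y z
    using add[of "y - z" z] that csubspace_diff[OF V that] by simp
  have sum: "g (sum h F) = (\<Sum>i\<in>F. g (h i))" if "finite F" "F \<subseteq> I" for F
    using that
  proof (induction F)
    case (insert i F)
    then show ?case
      using h(1) add[of "h i" "sum h F"] csubspace_sum[OF V, of F h] by (auto simp: subset_iff)
  qed (simp add: g0)
  have "((\<lambda>F. norm (sum h F - x)) \<longlongrightarrow> 0) (finite_subsets_at_top I)"
    using h(2) unfolding has_sum_def by (simp add: LIM_zero tendsto_norm_zero)
  then have "((\<lambda>F. K * norm (sum h F - x)) \<longlongrightarrow> 0) (finite_subsets_at_top I)"
    by (rule tendsto_mult_right_zero)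
  moreover have "\<forall>\<^sub>F F in finite_subsets_at_top I. norm ((\<Sum>i\<in>F. g (h i)) - g x) \<le> K * norm (sum h F - x)"
  proof (rule eventually_finite_subsets_at_top_weakI)
    fix F assume F: "finite F" "F \<subseteq> I"
    then have "sum h F \<in> V"
      using h(1) by (intro csubspace_sum[OF V]) auto
    then show "norm ((\<Sum>i\<in>F. g (h i)) - g x) \<le> K * norm (sum h F - x)"
      using K[of "sum h F - x"] diff[of "sum h F" x] x sum[OF F] csubspace_diff[OF V] by simp
  qed
  ultimately have "((\<lambda>F. (\<Sum>i\<in>F. g (h i)) - g x) \<longlongrightarrow> 0) (finite_subsets_at_top I)"
    by (rule Lim_null_comparison[rotated])
  then show ?thesis
    unfolding has_sum_def by (simp add: LIM_zero_iff)
qed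

text \<open>The finite bound, applied to sets disjoint from a finite \<open>X\<close> that carries
  most of the mass of \<open>c\<close>, is the Cauchy criterion. It serves orthonormal families,
  dual frames and the given frame of part (b) alike.\<close>

lemma bessel_has_sum:
  assumes B: "\<And>F c. finite F \<Longrightarrow> F \<subseteq> I \<Longrightarrow>
      (norm (\<Sum>i\<in>F. c i \<odot> G i))\<^sup>2 \<le> B * (\<Sum>i\<in>F. (cmod (c i))\<^sup>2)"
    and "0 \<le> B" and c: "c \<in> ell2 I"
  shows "(\<lambda>i. c i \<odot> G i) summable_on I"
    and "((\<lambda>i. c i \<odot> G i) has_sum x) I \<Longrightarrow> (norm x)\<^sup>2 \<le> B * (\<Sum>\<^sub>\<infinity>i\<in>I. (cmod (c i))\<^sup>2)"
proof -
  have s: "(\<lambda>i. (cmod (c i))\<^sup>2) summable_on I"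
    using c by (simp add: ell2_iff)
  show "(\<lambda>i. c i \<odot> G i) summable_on I"
  proof (rule summable_on_Cauchy)
    fix e :: real assume "0 < e"
    \<comment> \<open>\<open>B\<close> may be 0, hence the denominator \<open>B + 1\<close>.\<close>
    then have "0 < e\<^sup>2 / (B + 1)"
      using \<open>0 \<le> B\<close> by simp
    then obtain X where X: "finite X" "X \<subseteq> I" "(\<Sum>\<^sub>\<infinity>i\<in>I - X. (cmod (c i))\<^sup>2) < e\<^sup>2 / (B + 1)"
      using summable_tail[OF s] by (metis zero_le_power2)
    have "norm (\<Sum>i\<in>Y. c i \<odot> G i) < e" if Y: "finite Y" "Y \<subseteq> I - X" for Y
    proof -
      have "(\<Sum>i\<in>Y. (cmod (c i))\<^sup>2) \<le> (\<Sum>\<^sub>\<infinity>i\<in>I - X. (cmod (c i))\<^sup>2)"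
        using Y summable_on_subset_banach[OF s, of "I - X"] by (intro finite_sum_le_infsum) auto
      then have "(\<Sum>i\<in>Y. (cmod (c i))\<^sup>2) < e\<^sup>2 / (B + 1)"
        using X(3) by linarith
      then have "(B + 1) * (\<Sum>i\<in>Y. (cmod (c i))\<^sup>2) < e\<^sup>2"
        using \<open>0 \<le> B\<close> by (simp add: field_simps)
      moreover have "(norm (\<Sum>i\<in>Y. c i \<odot> G i))\<^sup>2 \<le> B * (\<Sum>i\<in>Y. (cmod (c i))\<^sup>2)"
        using Y by (intro B) auto
      moreover have "B * (\<Sum>i\<in>Y. (cmod (c i))\<^sup>2) \<le> (B + 1) * (\<Sum>i\<in>Y. (cmod (c i))\<^sup>2)"
        by (intro mult_right_mono sum_nonneg) auto
      ultimately have "(norm (\<Sum>i\<in>Y. c i \<odot> G i))\<^sup>2 < e\<^sup>2"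
        by linarith
      then show ?thesis
        using \<open>0 < e\<close> by (simp add: power2_less_imp_less)
    qed
    then show "\<exists>X. finite X \<and> X \<subseteq> I \<and> (\<forall>Y. finite Y \<longrightarrow> Y \<subseteq> I - X \<longrightarrow> norm (\<Sum>i\<in>Y. c i \<odot> G i) < e)"
      using X by blast
  qed
  assume x: "((\<lambda>i. c i \<odot> G i) has_sum x) I"
  show "(norm x)\<^sup>2 \<le> B * (\<Sum>\<^sub>\<infinity>i\<in>I. (cmod (c i))\<^sup>2)"
  proof (rule tendsto_upperbound)
    show "((\<lambda>F. (norm (\<Sum>i\<in>F. c i \<odot> G i))\<^sup>2) \<longlongrightarrow> (norm x)\<^sup>2) (finite_subsets_at_top I)"
      using x unfolding has_sum_def by (intro tendsto_intros)
    show "\<forall>\<^sub>F F in finite_subsets_at_top I. (norm (\<Sum>i\<in>F. c i \<odot> G i))\<^sup>2 \<le> B * (\<Sum>\<^sub>\<infinity>i\<in>I. (cmod (c i))\<^sup>2)"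
    proof (rule eventually_finite_subsets_at_top_weakI)
      fix F assume F: "finite F" "F \<subseteq> I"
      have "(\<Sum>i\<in>F. (cmod (c i))\<^sup>2) \<le> (\<Sum>\<^sub>\<infinity>i\<in>I. (cmod (c i))\<^sup>2)"
        using F s by (intro finite_sum_le_infsum) auto
      then show "(norm (\<Sum>i\<in>F. c i \<odot> G i))\<^sup>2 \<le> B * (\<Sum>\<^sub>\<infinity>i\<in>I. (cmod (c i))\<^sup>2)"
        using B[OF F, of c] \<open>0 \<le> B\<close> by (meson mult_left_mono order_trans)
    qed
  qed simp
qed

text \<open>Analysis and synthesis are adjoint and so have the same norm. Concretely, the sum
  \<open>s\<close> equals \<open>ip x y\<close> for the synthesis \<open>y\<close> of its own
  coefficients, whence \<open>s\<^sup>2 \<le> (norm x)\<^sup>2 * B * s\<close>, and one factor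
  \<open>s\<close> cancels.\<close>

lemma sum_ip_le_if_synthesis:
  assumes "finite F" "0 \<le> B"
    and B: "\<And>c. (norm (\<Sum>i\<in>F. c i \<odot> G i))\<^sup>2 \<le> B * (\<Sum>i\<in>F. (cmod (c i))\<^sup>2)"
  shows "(\<Sum>i\<in>F. (cmod (ip x (G i)))\<^sup>2) \<le> B * (norm x)\<^sup>2"
proof -
  define s where "s = (\<Sum>i\<in>F. (cmod (ip x (G i)))\<^sup>2)"
  define y where "y = (\<Sum>i\<in>F. ip x (G i) \<odot> G i)"
  have "0 \<le> s" by (simp add: s_def sum_nonneg)
  have "ip x y = complex_of_real s"
    unfolding y_def s_def ip_sum_right ip_sc_right
    by (simp add: complex_norm_square[symmetric] mult.commute of_real_sum del: of_real_power)
  then have "s \<le> norm x * norm y"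
    using ip_Cauchy_Schwarz[of x y] \<open>0 \<le> s\<close> by simp
  then have "s\<^sup>2 \<le> (norm x)\<^sup>2 * (norm y)\<^sup>2"
    using \<open>0 \<le> s\<close> by (metis power_mono power_mult_distrib)
  also have "\<dots> \<le> (norm x)\<^sup>2 * (B * s)"
    unfolding y_def s_def by (intro mult_left_mono B) simp
  finally have "s * s \<le> (B * (norm x)\<^sup>2) * s"
    by (simp add: power2_eq_square mult_ac)
  then show ?thesis
    using \<open>0 \<le> s\<close> assms(2) unfolding s_def[symmetric]
    by (cases "s = 0") auto
qed

text \<open>The other half of the duality: pairing the synthesis \<open>y\<close> with itself and
  applying Cauchy-Schwarz leaves a factor \<open>norm y\<close> to cancel. The bound on analysis is
  demanded only on \<open>V\<close>, which is all that a frame of a subspace provides.\<close>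

lemma synthesis_le_if_sum_ip:
  assumes "finite F" "0 \<le> B" and V: "csubspace V" "\<And>i. i \<in> F \<Longrightarrow> G i \<in> V"
    and B: "\<And>x. x \<in> V \<Longrightarrow> (\<Sum>i\<in>F. (cmod (ip x (G i)))\<^sup>2) \<le> B * (norm x)\<^sup>2"
  shows "(norm (\<Sum>i\<in>F. c i \<odot> G i))\<^sup>2 \<le> B * (\<Sum>i\<in>F. (cmod (c i))\<^sup>2)"
proof -
  define y where "y = (\<Sum>i\<in>F. c i \<odot> G i)"
  define s where "s = (\<Sum>i\<in>F. (cmod (c i))\<^sup>2)"
  have "0 \<le> s" by (simp add: s_def sum_nonneg)
  have "y \<in> V"
    unfolding y_def using V by (intro csubspace_sum csubspace_sc) auto
  have "(norm y)\<^sup>2 = cmod (ip y y)"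
    by (simp add: ip_self norm_power)
  also have "\<dots> = cmod (\<Sum>i\<in>F. cnj (c i) * ip y (G i))"
    by (subst (2) y_def) (simp add: ip_sum_right ip_sc_right)
  also have "\<dots> \<le> (\<Sum>i\<in>F. \<bar>cmod (c i)\<bar> * \<bar>cmod (ip y (G i))\<bar>)"
    by (rule order_trans[OF norm_sum]) (simp add: norm_mult)
  also have "\<dots> \<le> L2_set (\<lambda>i. cmod (c i)) F * L2_set (\<lambda>i. cmod (ip y (G i))) F"
    by (rule L2_set_mult_ineq)
  also have "\<dots> \<le> sqrt s * sqrt (B * (norm y)\<^sup>2)"
    unfolding L2_set_def s_def using B[OF \<open>y \<in> V\<close>] by (intro mult_left_mono real_sqrt_le_mono) (auto intro: sum_nonneg)
  also have "\<dots> = sqrt (B * s) * norm y"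
    by (simp add: real_sqrt_mult)
  finally have "norm y \<le> sqrt (B * s)"
    by (cases "norm y = 0") (use \<open>0 \<le> s\<close> \<open>0 \<le> B\<close> in \<open>auto simp: power2_eq_square\<close>)
  then have "(norm y)\<^sup>2 \<le> (sqrt (B * s))\<^sup>2"
    by (intro power_mono) auto
  then show ?thesis
    using \<open>0 \<le> s\<close> \<open>0 \<le> B\<close> by (simp add: y_def s_def)
qed

subsection \<open>Orthonormal families\<close>

definition orthonormal :: "'i set \<Rightarrow> ('i \<Rightarrow> 'v) \<Rightarrow> bool" where
  "orthonormal I E \<longleftrightarrow> (\<forall>i\<in>I. \<forall>j\<in>I. ip (E i) (E j) = (if i = j then 1 else 0))"

definition closed_span :: "'i set \<Rightarrow> ('i \<Rightarrow> 'v) \<Rightarrow> 'v set" where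
  "closed_span I G =
    {x. \<forall>e>0. \<exists>F c. finite F \<and> F \<subseteq> I \<and> norm (x - (\<Sum>i\<in>F. c i \<odot> G i)) < e}"

lemma csubspace_closed_span: "csubspace (closed_span I G)"
  unfolding csubspace_def
proof (intro conjI ballI allI)
  show "0 \<in> closed_span I G"
    unfolding closed_span_def by (auto intro!: exI[of _ "{}"])
  show "x + y \<in> closed_span I G" if xy: "x \<in> closed_span I G" "y \<in> closed_span I G" for x y
    unfolding closed_span_def
  proof (intro CollectI allI impI)
    fix e :: real assume "0 < e"
    then obtain F c F' c' where F: "finite F" "F \<subseteq> I" "norm (x - (\<Sum>i\<in>F. c i \<odot> G i)) < e/2"
        "finite F'" "F' \<subseteq> I" "norm (y - (\<Sum>i\<in>F'. c' i \<odot> G i)) < e/2"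
      using xy half_gt_zero[of e] unfolding closed_span_def by blast
    \<comment> \<open>Both coefficient families are extended by 0 to the union of their
      supports.\<close>
    define d where "d i = (if i \<in> F then c i else 0) + (if i \<in> F' then c' i else 0)" for i
    have ext: "(\<Sum>i\<in>F \<union> F'. (if i \<in> H then a i else 0) \<odot> G i) = (\<Sum>i\<in>H. a i \<odot> G i)"
      if "H \<subseteq> F \<union> F'" for H a
      using that F(1,4) by (intro sum.mono_neutral_cong_right) auto
    have "(\<Sum>i\<in>F \<union> F'. d i \<odot> G i) = (\<Sum>i\<in>F. c i \<odot> G i) + (\<Sum>i\<in>F'. c' i \<odot> G i)"
      unfolding d_def sc_add_left sum.distrib by (simp add: ext)
    then have "norm (x + y - (\<Sum>i\<in>F \<union> F'. d i \<odot> G i)) < e/2 + e/2"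
      using norm_add_less[OF F(3,6)] by (simp add: algebra_simps)
    then show "\<exists>F c. finite F \<and> F \<subseteq> I \<and> norm (x + y - (\<Sum>i\<in>F. c i \<odot> G i)) < e"
      using F by (intro exI[of _ "F \<union> F'"] exI[of _ d]) auto
  qed
  show "k \<odot> x \<in> closed_span I G" if x: "x \<in> closed_span I G" for k x
    unfolding closed_span_def
  proof (intro CollectI allI impI)
    fix e :: real assume "0 < e"
    moreover have "0 < cmod k + 1" by (simp add: add_nonneg_pos)
    ultimately have "0 < e / (cmod k + 1)"
      by simp
    then obtain F c where F: "finite F" "F \<subseteq> I" "norm (x - (\<Sum>i\<in>F. c i \<odot> G i)) < e / (cmod k + 1)"
      using x unfolding closed_span_def by blast
    have "norm (k \<odot> x - (\<Sum>i\<in>F. (k * c i) \<odot> G i)) = cmod k * norm (x - (\<Sum>i\<in>F. c i \<odot> G i))"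
      by (simp add: sc_assoc[symmetric] sc_sum_right[symmetric] sc_diff_right[symmetric] norm_sc)
    also have "\<dots> \<le> (cmod k + 1) * norm (x - (\<Sum>i\<in>F. c i \<odot> G i))"
      by (intro mult_right_mono) auto
    also have "\<dots> < e"
      using F(3) \<open>0 < cmod k + 1\<close> by (simp add: field_simps)
    finally show "\<exists>F c. finite F \<and> F \<subseteq> I \<and> norm (k \<odot> x - (\<Sum>i\<in>F. c i \<odot> G i)) < e"
      using F by (intro exI[of _ F] exI[of _ "\<lambda>i. k * c i"]) auto
  qed
  show "closed (closed_span I G)"
  proof (subst closed_limpt, intro allI impI)
    fix x assume "x islimpt closed_span I G"
    show "x \<in> closed_span I G"
      unfolding closed_span_def
    proof (intro CollectI allI impI)
      fix e :: real assume "0 < e"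
      then obtain y where y: "y \<in> closed_span I G" "dist y x < e/2"
        using \<open>x islimpt closed_span I G\<close> unfolding islimpt_approachable by (meson half_gt_zero)
      then obtain F c where F: "finite F" "F \<subseteq> I" "norm (y - (\<Sum>i\<in>F. c i \<odot> G i)) < e/2"
        using \<open>0 < e\<close> half_gt_zero[of e] unfolding closed_span_def by blast
      have "norm (x - (\<Sum>i\<in>F. c i \<odot> G i)) < e"
        by (rule norm_diff_triangle_less[of x y "e/2" _ "e/2", simplified])
          (use F y in \<open>auto simp: dist_norm norm_minus_commute\<close>)
      then show "\<exists>F c. finite F \<and> F \<subseteq> I \<and> norm (x - (\<Sum>i\<in>F. c i \<odot> G i)) < e"
        using F by blast
    qed
  qed
qed

lemma closed_span_base: "i \<in> I \<Longrightarrow> G i \<in> closed_span I G"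
  unfolding closed_span_def by (auto intro!: exI[of _ "{i}"] exI[of _ "\<lambda>_. 1"])

lemma closed_span_ext:
  assumes V: "csubspace V" and "\<And>i. i \<in> I \<Longrightarrow> G i \<in> V"
  shows "closed_span I G \<subseteq> V"
proof
  fix x assume x: "x \<in> closed_span I G"
  have "x \<in> closure V"
    unfolding closure_approachable
  proof (intro allI impI)
    fix e :: real assume "0 < e"
    then obtain F c where F: "finite F" "F \<subseteq> I" "norm (x - (\<Sum>i\<in>F. c i \<odot> G i)) < e"
      using x unfolding closed_span_def by blast
    then show "\<exists>y\<in>V. dist y x < e"
      using assms by (intro bexI[of _ "\<Sum>i\<in>F. c i \<odot> G i"] csubspace_sum[OF V] csubspace_sc[OF V])
        (auto simp: dist_norm norm_minus_commute)
  qed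
  then show "x \<in> V"
    using csubspace_closed[OF V] by simp
qed

lemma orthonormal_norm_sum:
  assumes "orthonormal I E" "finite F" "F \<subseteq> I"
  shows "(norm (\<Sum>i\<in>F. c i \<odot> E i))\<^sup>2 = (\<Sum>i\<in>F. (cmod (c i))\<^sup>2)"
proof -
  have "complex_of_real ((norm (\<Sum>i\<in>F. c i \<odot> E i))\<^sup>2) = (\<Sum>i\<in>F. \<Sum>j\<in>F. c i * cnj (c j) * ip (E i) (E j))"
    unfolding ip_self[symmetric] ip_sum_left by (simp add: ip_sum_right ip_sc_left ip_sc_right mult_ac sum_distrib_left)
  also have "\<dots> = (\<Sum>i\<in>F. \<Sum>j\<in>F. if i = j then c i * cnj (c j) else 0)"
    using assms unfolding orthonormal_def by (intro sum.cong refl) (auto simp: subset_iff)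
  also have "\<dots> = complex_of_real (\<Sum>i\<in>F. (cmod (c i))\<^sup>2)"
    using assms(2) by (simp add: complex_norm_square[unfolded of_real_power])
  finally show ?thesis
    by (simp only: of_real_eq_iff)
qed

lemma orthonormal_bessel:
  assumes "orthonormal I E"
  shows "(\<lambda>i. ip x (E i)) \<in> ell2 I" "(\<Sum>\<^sub>\<infinity>i\<in>I. (cmod (ip x (E i)))\<^sup>2) \<le> (norm x)\<^sup>2"
proof -
  have "(\<Sum>i\<in>F. (cmod (ip x (E i)))\<^sup>2) \<le> (norm x)\<^sup>2" if "finite F" "F \<subseteq> I" for F
    using sum_ip_le_if_synthesis[OF that(1), of 1 E x] orthonormal_norm_sum[OF assms that] by simp
  from nonneg_summable_bound[OF _ this]
  show "(\<lambda>i. ip x (E i)) \<in> ell2 I" "(\<Sum>\<^sub>\<infinity>i\<in>I. (cmod (ip x (E i)))\<^sup>2) \<le> (norm x)\<^sup>2"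
    by (auto simp: ell2_iff)
qed

lemma orthonormal_summable:
  assumes "orthonormal I E" "c \<in> ell2 I"
  shows "(\<lambda>i. c i \<odot> E i) summable_on I"
  by (rule bessel_has_sum(1)[where B = 1]) (use assms orthonormal_norm_sum[OF assms(1)] in auto)

lemma orthonormal_coefficient:
  assumes "orthonormal I E" "((\<lambda>i. c i \<odot> E i) has_sum x) I" "j \<in> I"
  shows "ip x (E j) = c j"
proof -
  have "((\<lambda>i. ip (c i \<odot> E i) (E j)) has_sum ip x (E j)) I"
    by (rule has_sum_ip_left[OF assms(2)])
  moreover have "((\<lambda>i. ip (c i \<odot> E i) (E j)) has_sum c j) I"
    by (rule has_sum_finite_neutralI[of "{j}"])
      (use assms in \<open>auto simp: orthonormal_def ip_sc_left\<close>)
  ultimately show ?thesis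
    by (rule has_sum_unique)
qed

text \<open>Bessel's inequality makes the series converge to some \<open>y\<close>, and
  \<open>x - y\<close> is orthogonal to the family. The vectors orthogonal to \<open>x - y\<close>
  form a closed subspace, which contains the closed span and with it \<open>x - y\<close>; so
  \<open>x - y\<close> is orthogonal to itself.\<close>

lemma orthonormal_expansion:
  assumes E: "orthonormal I E" and x: "x \<in> closed_span I E"
  shows "((\<lambda>i. ip x (E i) \<odot> E i) has_sum x) I"
proof -
  obtain y where y: "((\<lambda>i. ip x (E i) \<odot> E i) has_sum y) I"
    using orthonormal_summable[OF E orthonormal_bessel(1)[OF E]] unfolding summable_on_def by blast
  have orth: "ip (x - y) (E j) = 0" if "j \<in> I" for j
    using orthonormal_coefficient[OF E y that] by (simp add: ip_diff_left)
  have V: "csubspace {z. ip (x - y) z = 0}"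
    unfolding csubspace_def
    using continuous_closed_vimage[of "{0}" "\<lambda>z. ip (x - y) z"]
      bounded_linear.isCont[OF bounded_linear_ip_right]
    by (auto simp: ip_add_right ip_sc_right vimage_def linear_continuous_at[OF bounded_linear_ip_right])
  have "x - y \<in> closed_span I E"
    using csubspace_closed_span x csubspace_has_sum[OF csubspace_closed_span _ y]
    by (blast intro: csubspace_diff csubspace_sc closed_span_base)
  then have "ip (x - y) (x - y) = 0"
    using closed_span_ext[OF V, of I E] orth by blast
  then show ?thesis
    using y by (simp add: ip_self)
qed

lemma orthonormal_parseval:
  assumes E: "orthonormal I E" and x: "x \<in> closed_span I E"
  shows "((\<lambda>i. ip x (E i) * cnj (ip y (E i))) has_sum ip x y) I"
    and "((\<lambda>i. (cmod (ip x (E i)))\<^sup>2) has_sum (norm x)\<^sup>2) I"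
proof -
  show *: "((\<lambda>i. ip x (E i) * cnj (ip y (E i))) has_sum ip x y) I" for y
    using has_sum_ip_left[OF orthonormal_expansion[OF E x], of y]
    by (simp add: ip_sc_left ip_commute[of "E _" y])
  show "((\<lambda>i. (cmod (ip x (E i)))\<^sup>2) has_sum (norm x)\<^sup>2) I"
    using has_sum_Re[OF *[of x]] by (simp add: ip_self complex_norm_square[symmetric])
qed

text \<open>A representing vector must have the coefficients \<open>cnj (g (E i))\<close>. They are
  square-summable because \<open>g\<close>, evaluated at a partial sum \<open>w\<close> formed with
  them, returns the squared norm of \<open>w\<close>, while the bound on \<open>g\<close> allows at
  most \<open>K * norm w\<close>.\<close>

lemma Riesz_representation:
  assumes E: "orthonormal I E" and V: "V = closed_span I E"
    and add: "\<And>x y. x \<in> V \<Longrightarrow> y \<in> V \<Longrightarrow> g (x + y) = g x + g y"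
    and scale: "\<And>x c. x \<in> V \<Longrightarrow> g (c \<odot> x) = c * g x"
    and K: "\<And>x. x \<in> V \<Longrightarrow> cmod (g x) \<le> K * norm x"
  shows "\<exists>y\<in>V. \<forall>x\<in>V. ip x y = g x"
proof -
  have csubspace_V: "csubspace V" by (simp add: V csubspace_closed_span)
  have EV: "E i \<in> V" if "i \<in> I" for i by (simp add: V closed_span_base that)
  define c where "c i = cnj (g (E i))" for i
  have "(\<Sum>i\<in>F. (cmod (c i))\<^sup>2) \<le> K\<^sup>2" if F: "finite F" "F \<subseteq> I" for F
  proof -
    define s where "s = (\<Sum>i\<in>F. (cmod (c i))\<^sup>2)"
    define w where "w = (\<Sum>i\<in>F. c i \<odot> E i)"
    have "0 \<le> s" by (simp add: s_def sum_nonneg)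
    have w: "w \<in> V" unfolding w_def using F EV by (intro csubspace_sum csubspace_sc csubspace_V) auto
    have "((\<lambda>i. g (c i \<odot> E i)) has_sum g w) F"
      by (rule has_sum_additive_on[OF csubspace_V add K]) (use F EV csubspace_V in \<open>auto simp: w_def intro!: csubspace_sc has_sum_finiteI\<close>)
    then have "g w = (\<Sum>i\<in>F. g (c i \<odot> E i))"
      using F(1) has_sum_finite has_sum_unique by blast
    also have "\<dots> = complex_of_real s"
      using F EV by (auto simp: s_def scale c_def complex_norm_square[unfolded of_real_power] mult.commute subset_iff intro!: sum.cong)
    finally have "s \<le> K * norm w"
      using K[OF w] \<open>0 \<le> s\<close> by simp
    moreover have "(norm w)\<^sup>2 = s"
      unfolding w_def s_def by (rule orthonormal_norm_sum[OF E F])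
    ultimately have "norm w * norm w \<le> K * norm w"
      by (simp add: power2_eq_square)
    then have "norm w \<le> \<bar>K\<bar>"
      by (cases "norm w = 0") auto
    then have "(norm w)\<^sup>2 \<le> K\<^sup>2"
      by (metis norm_ge_zero power2_abs power_mono)
    then show ?thesis
      using \<open>(norm w)\<^sup>2 = s\<close> by (simp add: s_def)
  qed
  then have "c \<in> ell2 I"
    unfolding ell2_iff by (intro nonneg_summable_bound(1)) auto
  then obtain y where y: "((\<lambda>i. c i \<odot> E i) has_sum y) I"
    using orthonormal_summable[OF E] unfolding summable_on_def by blast
  show ?thesis
  proof (intro bexI ballI)
    show "y \<in> V"
      by (rule csubspace_has_sum[OF csubspace_V _ y]) (auto intro: csubspace_sc csubspace_V EV)
    fix x assume x: "x \<in> V"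
    have "((\<lambda>i. g (ip x (E i) \<odot> E i)) has_sum g x) I"
      by (rule has_sum_additive_on[OF csubspace_V add K])
        (use x V orthonormal_expansion[OF E] csubspace_sc[OF csubspace_V EV] in auto)
    also have "?this \<longleftrightarrow> ((\<lambda>i. cnj (c i) * ip x (E i)) has_sum g x) I"
      by (rule has_sum_cong) (simp add: scale EV c_def)
    finally have "((\<lambda>i. cnj (c i) * ip x (E i)) has_sum g x) I" .
    moreover have "((\<lambda>i. cnj (c i) * ip x (E i)) has_sum ip x y) I"
      using has_sum_ip_right[OF y, of x] by (simp add: ip_sc_right)
    ultimately show "ip x y = g x"
      by (rule has_sum_unique[symmetric])
  qed
qed

text \<open>Zorn's lemma gives a maximal orthonormal set. A vector outside its closed span would
  leave a nonzero residual after subtracting its Fourier series, and the normalised residual could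
  be adjoined.\<close>

lemma exists_orthonormal_basis:
  "\<exists>E::'v set. orthonormal E (\<lambda>e. e) \<and> closed_span E (\<lambda>e. e) = UNIV"
proof -
  define A where "A = {E::'v set. orthonormal E (\<lambda>e. e)}"
  have "\<Union>C \<in> A" if C: "subset.chain A C" for C
  proof -
    have "ip i j = (if i = j then 1 else 0)" if ij: "i \<in> X" "X \<in> C" "j \<in> Y" "Y \<in> C" for i j X Y
    proof -
      have "X \<subseteq> Y \<or> Y \<subseteq> X" "X \<in> A" "Y \<in> A"
        using C ij unfolding subset_chain_def by auto
      then show ?thesis
        using ij unfolding A_def orthonormal_def by blast
    qed
    then show ?thesis
      unfolding A_def orthonormal_def by blast
  qed
  then obtain E where E: "E \<in> A" "\<And>X. X \<in> A \<Longrightarrow> E \<subseteq> X \<Longrightarrow> X = E"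
    using subset_Zorn'[of A] by blast
  then have on: "orthonormal E (\<lambda>e. e)"
    by (simp add: A_def)
  have "x \<in> closed_span E (\<lambda>e. e)" for x
  proof (rule ccontr)
    assume nx: "x \<notin> closed_span E (\<lambda>e. e)"
    obtain y where y: "((\<lambda>i. ip x i \<odot> i) has_sum y) E"
      using orthonormal_summable[OF on orthonormal_bessel(1)[OF on]] unfolding summable_on_def by blast
    have "y \<in> closed_span E (\<lambda>e. e)"
      by (rule csubspace_has_sum[OF csubspace_closed_span _ y])
        (auto intro: csubspace_sc[OF csubspace_closed_span] closed_span_base[of _ E "\<lambda>e. e"])
    then have ne: "x - y \<noteq> 0"
      using nx by auto
    define u where "u = complex_of_real (1 / norm (x - y)) \<odot> (x - y)"
    have orth: "ip u j = 0" if "j \<in> E" for j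
      using orthonormal_coefficient[OF on y that] by (simp add: u_def ip_sc_left ip_diff_left)
    have orth': "ip j u = 0" if "j \<in> E" for j
      using ip_commute[of j u] orth[OF that] by simp
    have "norm u = 1"
      using ne by (simp add: u_def norm_sc norm_divide)
    then have uu: "ip u u = 1"
      by (simp add: ip_self)
    have "insert u E \<in> A"
      using on orth orth' uu unfolding A_def orthonormal_def by auto
    then have "u \<in> E"
      using E(2)[of "insert u E"] by blast
    then show False
      using orth uu by auto
  qed
  then show ?thesis
    using on by auto
qed

end

context complex_hilbert
begin

subsection \<open>Bounded bijections and Riesz bases\<close>

text \<open>The open mapping theorem for one bounded bijection: by Baire's theorem the closure of the image
  of some ball has interior points, hence every \<open>y\<close> is approximated up to \<open>\<parallel>y\<parallel> / 2\<close> by images of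
  vectors of norm at most \<open>M \<parallel>y\<parallel>\<close>, and iteration gives a preimage.\<close>

lemma bounded_inverse:
  assumes V: "csubspace V" and add: "\<And>x y. x \<in> V \<Longrightarrow> y \<in> V \<Longrightarrow> U (x + y) = U x + U y"
    and scale: "\<And>x c. x \<in> V \<Longrightarrow> U (c \<odot> x) = c \<odot> U x"
    and K: "\<And>x. x \<in> V \<Longrightarrow> norm (U x) \<le> K * norm x"
    and bij: "bij_betw U V V"
  shows "\<exists>k>0. \<forall>x\<in>V. norm x \<le> k * norm (U x)"
proof -
  note closV = csubspace_closed[OF V]
  have UV: "U x \<in> V" if "x \<in> V" for x
    using bij that by (auto simp: bij_betw_def)
  have diff: "U (x - y) = U x - U y" if "x \<in> V" "y \<in> V" for x y
    using add[of "x - y" y] that csubspace_diff[OF V that] by simp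
  have scaleR: "U (r *\<^sub>R x) = r *\<^sub>R U x" if "x \<in> V" for r x
    using scale[OF that, of "complex_of_real r"] by (simp add: sc_of_real)
  have zero: "U 0 = 0"
    using scaleR[OF csubspace_zero[OF V], of 0] by simp
  \<comment> \<open>Closures are taken because Baire's theorem is about closed sets; the price is
    that points are only approximated by images, which the iteration below repairs.\<close>
  define C where "C n = closure (U ` {x \<in> V. norm x \<le> real n})" for n :: nat
  have csubspace_V: "C n \<subseteq> V" for n
    unfolding C_def using UV by (intro closure_minimal closV) auto
  have "V \<subseteq> \<Union>(range C)"
  proof
    fix y assume "y \<in> V"
    then obtain x where x: "x \<in> V" "y = U x"
      using bij by (auto simp: bij_betw_def)
    obtain n :: nat where "norm x \<le> real n"
      using real_arch_simple by blast
    then show "y \<in> \<Union>(range C)"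
      using x closure_subset unfolding C_def by fastforce
  qed
  with csubspace_V have VC: "\<Union>(range C) = V"
    by blast
  have "\<exists>n. top_of_set V interior_of C n \<noteq> {}"
  proof (rule ccontr)
    assume "\<not> ?thesis"
    moreover have "completely_metrizable_space (top_of_set V)"
      using closV by (intro completely_metrizable_space_closedin[OF completely_metrizable_space_euclidean]) simp
    moreover have "closedin (top_of_set V) (C n)" for n
      using csubspace_V by (intro closed_subset) (auto simp: C_def)
    ultimately have "top_of_set V interior_of \<Union>(range C) = {}"
      by (intro Baire_category_alt) auto
    moreover have "top_of_set V interior_of V = V"
      by (metis interior_of_topspace topspace_euclidean_subtopology)
    ultimately show False
      using VC csubspace_zero[OF V] by simp
  qed
  then obtain n y0 where "y0 \<in> top_of_set V interior_of C n"
    by blast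
  then obtain T where T: "openin (top_of_set V) T" "y0 \<in> T" "T \<subseteq> C n"
    by (auto simp: interior_of_def)
  then obtain e where e: "0 < e" "\<And>y. y \<in> V \<Longrightarrow> dist y y0 < e \<Longrightarrow> y \<in> C n"
    unfolding openin_euclidean_subtopology_iff by blast
  have y0: "y0 \<in> C n" "y0 \<in> V"
    using T csubspace_V by blast+
  \<comment> \<open>Approximating both \<open>y0 + y\<close> and \<open>y0\<close> and subtracting
    moves the interior point to the origin, at the price of the doubled radius
    \<open>2 * real n\<close>.\<close>
  have near: "\<exists>x\<in>V. norm x \<le> 2 * real n \<and> norm (U x - y) < d" if y: "y \<in> V" "norm y < e" "0 < d" for y d
  proof -
    have "y0 + y \<in> C n"
      using e(2)[of "y0 + y"] y csubspace_add[OF V y0(2)] by (simp add: dist_norm)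
    then obtain x1 x2 where x: "x1 \<in> V" "norm x1 \<le> n" "dist (U x1) (y0 + y) < d/2"
        "x2 \<in> V" "norm x2 \<le> n" "dist (U x2) y0 < d/2"
      using y0(1) half_gt_zero[OF y(3)] unfolding C_def closure_approachable by blast
    have "norm (x1 - x2) \<le> 2 * real n"
      using norm_triangle_ineq4[of x1 x2] x by linarith
    moreover have "norm ((U x1 - (y0 + y)) - (U x2 - y0)) < d/2 + d/2"
      using norm_triangle_ineq4[of "U x1 - (y0 + y)" "U x2 - y0"] x unfolding dist_norm by linarith
    then have "norm (U (x1 - x2) - y) < d"
      unfolding diff[OF x(1,4)] by (simp add: algebra_simps)
    ultimately show ?thesis
      using csubspace_diff[OF V x(1,4)] by (intro bexI[of _ "x1 - x2"] conjI)
  qed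
  \<comment> \<open>Scaling \<open>y\<close> by \<open>t = e / (2 * norm y)\<close> puts it inside
    the ball of \<open>near\<close>; undoing the scaling turns the bound \<open>2 * real n\<close>
    into \<open>(4 * real n / e) * norm y\<close> and the error \<open>e / 4\<close> into
    \<open>norm y / 2\<close>.\<close>
  define M where "M = 4 * real n / e"
  have M0: "0 \<le> M"
    using e(1) by (simp add: M_def)
  have half: "\<exists>x\<in>V. norm x \<le> M * norm y \<and> norm (U x - y) \<le> norm y / 2" if y: "y \<in> V" for y
  proof (cases "y = 0")
    case True
    then show ?thesis
      using csubspace_zero[OF V] zero by force
  next
    case False
    define t where "t = e / (2 * norm y)"
    have "0 < t" using False e(1) by (simp add: t_def)
    have "norm (t *\<^sub>R y) < e"
      using False e(1) by (simp add: t_def)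
    then obtain x where x: "x \<in> V" "norm x \<le> 2 * real n" "norm (U x - t *\<^sub>R y) < e/4"
      using near[of "t *\<^sub>R y" "e/4"] csubspace_scaleR[OF V y] e(1) by auto
    have "norm ((1/t) *\<^sub>R x) \<le> M * norm y"
      using x(2) \<open>0 < t\<close> e(1) False unfolding t_def M_def by (simp add: field_simps)
    moreover have "U ((1/t) *\<^sub>R x) - y = (1/t) *\<^sub>R (U x - t *\<^sub>R y)"
      using \<open>0 < t\<close> scaleR[OF x(1)] by (simp add: scaleR_diff_right)
    then have "norm (U ((1/t) *\<^sub>R x) - y) \<le> (1/t) * (e/4)"
      using x(3) \<open>0 < t\<close> mult_left_mono[of "norm (U x - t *\<^sub>R y)" "e/4" "1/t"] by simp
    moreover have "(1/t) * (e/4) = norm y / 2"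
      using e(1) False unfolding t_def by simp
    ultimately show ?thesis
      using csubspace_scaleR[OF V x(1), of "1/t"] by (metis (no_types))
  qed
  then obtain \<phi> where \<phi>: "\<And>y. y \<in> V \<Longrightarrow> \<phi> y \<in> V \<and> norm (\<phi> y) \<le> M * norm y \<and> norm (U (\<phi> y) - y) \<le> norm y / 2"
    by metis
  \<comment> \<open>\<open>2 * M\<close> is the sum of the geometric series; the added 1 keeps the
    constant positive when \<open>M = 0\<close>.\<close>
  have "norm x \<le> (2 * M + 1) * norm (U x)" if x: "x \<in> V" for x
  proof -
    define y where "y = U x"
    \<comment> \<open>The bounds on the residuals \<open>r k\<close> halve at each step, so the
      corrections \<open>\<phi> (r k)\<close> form an absolutely convergent series whose sum is
      mapped to \<open>y\<close>.\<close>
    define r where "r = rec_nat y (\<lambda>_ z. z - U (\<phi> z))"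
    have r0: "r 0 = y" and rS: "r (Suc k) = r k - U (\<phi> (r k))" for k
      by (simp_all add: r_def)
    have rV: "r k \<in> V" for k
      by (induction k) (auto simp: r0 rS y_def x UV \<phi> intro!: csubspace_diff[OF V])
    have rn: "norm (r k) \<le> norm y * (1/2)^k" for k
    proof (induction k)
      case (Suc k)
      have "norm (r (Suc k)) \<le> norm (r k) / 2"
        using \<phi>[OF rV[of k]] by (simp add: rS norm_minus_commute)
      then show ?case
        using Suc by simp
    qed (simp add: r0)
    define X where "X k = \<phi> (r k)" for k
    have XV: "X k \<in> V" for k
      using \<phi> rV by (simp add: X_def)
    have Xn: "norm (X k) \<le> M * norm y * (1/2)^k" for k
    proof -
      have "norm (X k) \<le> M * norm (r k)"
        using \<phi> rV by (simp add: X_def)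
      also have "\<dots> \<le> M * (norm y * (1/2)^k)"
        by (rule mult_left_mono[OF rn M0])
      finally show ?thesis by simp
    qed
    have g: "summable (\<lambda>k. M * norm y * (1/2)^k)"
      by (intro summable_mult summable_geometric) simp
    have sX: "summable (\<lambda>k. norm (X k))"
      by (rule summable_comparison_test[OF _ g]) (use Xn in auto)
    then have sumX: "(\<lambda>N. \<Sum>k<N. X k) \<longlonglongrightarrow> (\<Sum>k. X k)"
      by (simp add: summable_LIMSEQ summable_norm_cancel)
    have partV: "(\<Sum>k<N. X k) \<in> V" for N
      using XV by (intro csubspace_sum[OF V]) auto
    have sV: "(\<Sum>k. X k) \<in> V"
      using closed_sequentially[OF closV _ sumX] partV by blast
    have part: "U (\<Sum>k<N. X k) = y - r N" for N
    proof (induction N)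
      case (Suc N)
      then show ?case
        using add[OF partV[of N] XV[of N]] by (simp add: rS X_def)
    qed (simp add: zero r0)
    have "(\<lambda>N. U (\<Sum>k<N. X k)) \<longlonglongrightarrow> y - 0"
      unfolding part
    proof (intro tendsto_diff tendsto_const Lim_null_comparison[of r "\<lambda>k. norm y * (1/2)^k"])
      show "(\<lambda>k. norm y * (1/2)^k) \<longlonglongrightarrow> 0"
        by (intro tendsto_mult_right_zero LIMSEQ_power_zero) simp
    qed (use rn in auto)
    moreover have "(\<lambda>N. U (\<Sum>k<N. X k)) \<longlonglongrightarrow> U (\<Sum>k. X k)"
    proof (rule LIM_zero_cancel, rule Lim_null_comparison)
      show "\<forall>\<^sub>F N in sequentially. norm (U (\<Sum>k<N. X k) - U (\<Sum>k. X k)) \<le> K * norm ((\<Sum>k<N. X k) - (\<Sum>k. X k))"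
        using K[OF csubspace_diff[OF V partV sV]] diff[OF partV sV] by simp
      show "(\<lambda>N. K * norm ((\<Sum>k<N. X k) - (\<Sum>k. X k))) \<longlonglongrightarrow> 0"
        using sumX by (intro tendsto_mult_right_zero tendsto_norm_zero LIM_zero)
    qed
    ultimately have "U (\<Sum>k. X k) = U x"
      using LIMSEQ_unique y_def by fastforce
    \<comment> \<open>Injectivity identifies the preimage constructed with a norm bound with the
      given \<open>x\<close>.\<close>
    then have "(\<Sum>k. X k) = x"
      using bij sV x by (auto simp: bij_betw_def inj_on_def)
    then have "norm x \<le> (\<Sum>k. norm (X k))"
      using summable_norm[OF sX] by simp
    also have "\<dots> \<le> (\<Sum>k. M * norm y * (1/2)^k)"
      by (rule suminf_le[OF Xn sX g])
    also have "\<dots> = 2 * M * norm y"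
      by (subst suminf_mult) (auto simp: suminf_geometric summable_geometric)
    also have "\<dots> \<le> (2 * M + 1) * norm y"
      by (simp add: distrib_right)
    finally show ?thesis
      by (simp add: y_def)
  qed
  moreover have "0 < 2 * M + 1"
    using M0 by simp
  ultimately show ?thesis
    by blast
qed

text \<open>Applying \<open>U\<close> termwise, the \<open>E\<close>-coefficients of
  \<open>x\<close> serve as \<open>G\<close>-coefficients of \<open>U x\<close>, and Parseval makes
  their squared norm that of \<open>x\<close>. The bounds are those of \<open>U\<close> and of its
  inverse; \<open>K\<^sup>2 + 1\<close> instead of \<open>K\<^sup>2\<close> guarantees
  positivity.\<close>

lemma Riesz_basis_bounds:
  assumes E: "orthonormal I E" and V: "V = closed_span I E"
    and add: "\<And>x y. x \<in> V \<Longrightarrow> y \<in> V \<Longrightarrow> U (x + y) = U x + U y"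
    and scale: "\<And>x c. x \<in> V \<Longrightarrow> U (c \<odot> x) = c \<odot> U x"
    and K: "\<And>x. x \<in> V \<Longrightarrow> norm (U x) \<le> K * norm x"
    and bij: "bij_betw U V V"
    and G: "\<And>i. i \<in> I \<Longrightarrow> G i = U (E i)"
  obtains a b where "0 < a" "0 < b"
    "\<And>c. c \<in> ell2 I \<Longrightarrow> \<exists>x\<in>V. ((\<lambda>i. c i \<odot> G i) has_sum x) I"
    "\<And>c x. c \<in> ell2 I \<Longrightarrow> ((\<lambda>i. c i \<odot> G i) has_sum x) I \<Longrightarrow>
      a * (\<Sum>\<^sub>\<infinity>i\<in>I. (cmod (c i))\<^sup>2) \<le> (norm x)\<^sup>2 \<and> (norm x)\<^sup>2 \<le> b * (\<Sum>\<^sub>\<infinity>i\<in>I. (cmod (c i))\<^sup>2)"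
    "\<And>x. x \<in> V \<Longrightarrow> \<exists>c\<in>ell2 I. ((\<lambda>i. c i \<odot> G i) has_sum x) I"
proof -
  have csubspace_V: "csubspace V" and EV: "\<And>i. i \<in> I \<Longrightarrow> E i \<in> V"
    by (simp_all add: V csubspace_closed_span closed_span_base)
  have UV: "U x \<in> V" if "x \<in> V" for x
    using bij that by (auto simp: bij_betw_def)
  obtain k where k: "0 < k" "\<And>x. x \<in> V \<Longrightarrow> norm x \<le> k * norm (U x)"
    using bounded_inverse[OF csubspace_V add scale K bij] by blast
  have push: "((\<lambda>i. c i \<odot> G i) has_sum U x) I" if "x \<in> V" "((\<lambda>i. c i \<odot> E i) has_sum x) I" for c x
  proof -
    have "((\<lambda>i. U (c i \<odot> E i)) has_sum U x) I"
      by (rule has_sum_additive_on[OF csubspace_V add K]) (use that csubspace_sc[OF csubspace_V EV] in auto)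
    also have "?this \<longleftrightarrow> ?thesis"
      by (rule has_sum_cong) (simp add: scale EV G)
    finally show ?thesis .
  qed
  have onb: "\<exists>x\<in>V. ((\<lambda>i. c i \<odot> E i) has_sum x) I \<and> (norm x)\<^sup>2 = (\<Sum>\<^sub>\<infinity>i\<in>I. (cmod (c i))\<^sup>2)" if c: "c \<in> ell2 I" for c
  proof -
    obtain x where x: "((\<lambda>i. c i \<odot> E i) has_sum x) I"
      using orthonormal_summable[OF E c] unfolding summable_on_def by blast
    have xV: "x \<in> V"
      by (rule csubspace_has_sum[OF csubspace_V _ x]) (rule csubspace_sc[OF csubspace_V EV])
    have "(\<Sum>\<^sub>\<infinity>i\<in>I. (cmod (ip x (E i)))\<^sup>2) = (norm x)\<^sup>2"
      using orthonormal_parseval(2)[OF E] xV V by (auto intro: infsumI)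
    moreover have "(\<Sum>\<^sub>\<infinity>i\<in>I. (cmod (ip x (E i)))\<^sup>2) = (\<Sum>\<^sub>\<infinity>i\<in>I. (cmod (c i))\<^sup>2)"
      by (rule infsum_cong) (simp add: orthonormal_coefficient[OF E x])
    ultimately show ?thesis
      using x xV by auto
  qed
  show thesis
  proof (rule that[of "1 / k\<^sup>2" "K\<^sup>2 + 1"])
    show "0 < 1 / k\<^sup>2" "0 < K\<^sup>2 + 1"
      using k(1) by (simp_all add: add_nonneg_pos)
    show "\<exists>x\<in>V. ((\<lambda>i. c i \<odot> G i) has_sum x) I" if "c \<in> ell2 I" for c
      using onb[OF that] push UV by blast
    show "1 / k\<^sup>2 * (\<Sum>\<^sub>\<infinity>i\<in>I. (cmod (c i))\<^sup>2) \<le> (norm y)\<^sup>2 \<and>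
        (norm y)\<^sup>2 \<le> (K\<^sup>2 + 1) * (\<Sum>\<^sub>\<infinity>i\<in>I. (cmod (c i))\<^sup>2)"
      if c: "c \<in> ell2 I" "((\<lambda>i. c i \<odot> G i) has_sum y) I" for c y
    proof -
      obtain x where x: "x \<in> V" "((\<lambda>i. c i \<odot> E i) has_sum x) I" "(norm x)\<^sup>2 = (\<Sum>\<^sub>\<infinity>i\<in>I. (cmod (c i))\<^sup>2)"
        using onb[OF c(1)] by blast
      have y: "y = U x"
        using has_sum_unique c(2) push[OF x(1,2)] by blast
      have "(norm x)\<^sup>2 \<le> k\<^sup>2 * (norm y)\<^sup>2"
        unfolding y power_mult_distrib[symmetric] using k(2)[OF x(1)] by (intro power_mono) auto
      then have "1 / k\<^sup>2 * (norm x)\<^sup>2 \<le> (norm y)\<^sup>2"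
        using k(1) by (simp add: field_simps)
      moreover have "(norm y)\<^sup>2 \<le> K\<^sup>2 * (norm x)\<^sup>2"
        unfolding y power_mult_distrib[symmetric] using K[OF x(1)] by (intro power_mono) auto
      then have "(norm y)\<^sup>2 \<le> (K\<^sup>2 + 1) * (norm x)\<^sup>2"
        by (simp add: distrib_right add_increasing2)
      ultimately show ?thesis
        by (simp add: x(3))
    qed
    show "\<exists>c\<in>ell2 I. ((\<lambda>i. c i \<odot> G i) has_sum y) I" if "y \<in> V" for y
    proof -
      have "y \<in> U ` V"
        using bij that by (simp add: bij_betw_imp_surj_on)
      then obtain x where x: "x \<in> V" "y = U x"
        by (rule imageE)
      have "((\<lambda>i. ip x (E i) \<odot> G i) has_sum U x) I"
        by (rule push[OF x(1) orthonormal_expansion[OF E x(1)[unfolded V]]])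
      then show ?thesis
        using orthonormal_bessel(1)[OF E, of x] x(2) by (intro bexI[of _ "\<lambda>i. ip x (E i)"]) simp_all
    qed
  qed
qed

end

subsection \<open>Dual frames\<close>

text \<open>The functionals \<open>f j\<close> define an equivalent inner product \<open>B x y = (\<Sum>j. f j x * cnj (f j y))\<close>
  on \<open>V\<close>; the dual frame represents the functionals with respect to \<open>B\<close>.\<close>

locale frame_functionals = complex_hilbert sc ip
  for sc :: "complex \<Rightarrow> 'v::{real_inner,banach} \<Rightarrow> 'v" (infixr "\<odot>" 75) and ip :: "'v \<Rightarrow> 'v \<Rightarrow> complex" +
  fixes I :: "'i set" and E :: "'i \<Rightarrow> 'v" and V :: "'v set"
    and J :: "'j set" and f :: "'j \<Rightarrow> 'v \<Rightarrow> complex" and a b :: real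
  assumes E: "orthonormal I E" and V: "V = closed_span I E"
    and f_add: "\<And>j x y. j \<in> J \<Longrightarrow> x \<in> V \<Longrightarrow> y \<in> V \<Longrightarrow> f j (x + y) = f j x + f j y"
    and f_scale: "\<And>j x c. j \<in> J \<Longrightarrow> x \<in> V \<Longrightarrow> f j (c \<odot> x) = c * f j x"
    and f_ell2: "\<And>x. x \<in> V \<Longrightarrow> (\<lambda>j. f j x) \<in> ell2 J"
    and lower: "\<And>x. x \<in> V \<Longrightarrow> a * (norm x)\<^sup>2 \<le> (\<Sum>\<^sub>\<infinity>j\<in>J. (cmod (f j x))\<^sup>2)"
    and upper: "\<And>x. x \<in> V \<Longrightarrow> (\<Sum>\<^sub>\<infinity>j\<in>J. (cmod (f j x))\<^sup>2) \<le> b * (norm x)\<^sup>2"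
    and a: "0 < a" and b: "0 < b"
begin

definition B :: "'v \<Rightarrow> 'v \<Rightarrow> complex" where
  "B x y = (\<Sum>\<^sub>\<infinity>j\<in>J. f j x * cnj (f j y))"

lemma csubspace_V: "csubspace V"
  by (simp add: V csubspace_closed_span)

lemma B_has_sum:
  assumes "x \<in> V" "y \<in> V"
  shows "((\<lambda>j. f j x * cnj (f j y)) has_sum B x y) J"
  unfolding B_def
  using Cauchy_Schwarz_ell2(1)[OF f_ell2[OF assms(1)] ell2_cnj[OF f_ell2[OF assms(2)]]]
  by (rule has_sum_infsum[OF abs_summable_summable])

lemma B_self:
  assumes "x \<in> V"
  shows "B x x = complex_of_real (\<Sum>\<^sub>\<infinity>j\<in>J. (cmod (f j x))\<^sup>2)"
proof -
  have "((\<lambda>j. (cmod (f j x))\<^sup>2) has_sum (\<Sum>\<^sub>\<infinity>j\<in>J. (cmod (f j x))\<^sup>2)) J"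
    using f_ell2[OF assms] by (simp add: ell2_iff)
  then have "((\<lambda>j. complex_of_real ((cmod (f j x))\<^sup>2)) has_sum complex_of_real (\<Sum>\<^sub>\<infinity>j\<in>J. (cmod (f j x))\<^sup>2)) J"
    by (rule has_sum_of_real)
  then show ?thesis
    by (intro has_sum_unique[OF B_has_sum[OF assms assms]]) (simp only: complex_norm_square)
qed

lemma B_add_left: "x \<in> V \<Longrightarrow> y \<in> V \<Longrightarrow> z \<in> V \<Longrightarrow> B (x + y) z = B x z + B y z"
proof -
  assume *: "x \<in> V" "y \<in> V" "z \<in> V"
  have "((\<lambda>j. f j (x + y) * cnj (f j z)) has_sum B x z + B y z) J \<longleftrightarrow>
      ((\<lambda>j. f j x * cnj (f j z) + f j y * cnj (f j z)) has_sum B x z + B y z) J"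
    using * by (intro has_sum_cong) (simp add: f_add distrib_right)
  moreover have "((\<lambda>j. f j x * cnj (f j z) + f j y * cnj (f j z)) has_sum B x z + B y z) J"
    using * by (intro has_sum_add B_has_sum)
  moreover have "((\<lambda>j. f j (x + y) * cnj (f j z)) has_sum B (x + y) z) J"
    using * by (intro B_has_sum csubspace_add[OF csubspace_V])
  ultimately show ?thesis
    using has_sum_unique by blast
qed

lemma B_sc_left: "x \<in> V \<Longrightarrow> z \<in> V \<Longrightarrow> B (c \<odot> x) z = c * B x z"
proof -
  assume *: "x \<in> V" "z \<in> V"
  have "((\<lambda>j. f j (c \<odot> x) * cnj (f j z)) has_sum c * B x z) J \<longleftrightarrow>
      ((\<lambda>j. c * (f j x * cnj (f j z))) has_sum c * B x z) J"
    using * by (intro has_sum_cong) (simp add: f_scale mult.assoc)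
  moreover have "((\<lambda>j. c * (f j x * cnj (f j z))) has_sum c * B x z) J"
    using * by (intro has_sum_cmult_right B_has_sum)
  moreover have "((\<lambda>j. f j (c \<odot> x) * cnj (f j z)) has_sum B (c \<odot> x) z) J"
    using * by (intro B_has_sum csubspace_sc[OF csubspace_V])
  ultimately show ?thesis
    using has_sum_unique by blast
qed

lemma B_commute: "x \<in> V \<Longrightarrow> y \<in> V \<Longrightarrow> B y x = cnj (B x y)"
  unfolding B_def infsum_cnj[symmetric] by (rule infsum_cong) (simp add: mult.commute)

lemma B_diff_right:
  assumes "x \<in> V" "y \<in> V" "z \<in> V"
  shows "B x (y - z) = B x y - B x z"
proof -
  have yz: "y - z \<in> V"
    by (rule csubspace_diff[OF csubspace_V assms(2,3)])
  have "B y x = B (y - z) x + B z x"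
    using B_add_left[OF yz assms(3,1)] by simp
  from arg_cong[OF this, of cnj] show ?thesis
    using B_commute[OF assms(2,1)] B_commute[OF yz assms(1)] B_commute[OF assms(3,1)] by simp
qed

lemma B_Cauchy_Schwarz:
  assumes "x \<in> V" "y \<in> V"
  shows "cmod (B x y) \<le> sqrt (\<Sum>\<^sub>\<infinity>j\<in>J. (cmod (f j x))\<^sup>2) * sqrt (\<Sum>\<^sub>\<infinity>j\<in>J. (cmod (f j y))\<^sup>2)"
  unfolding B_def
  using Cauchy_Schwarz_ell2(2)[OF f_ell2[OF assms(1)] ell2_cnj[OF f_ell2[OF assms(2)]]] by simp

lemma B_bound:
  assumes "x \<in> V" "y \<in> V"
  shows "cmod (B x y) \<le> b * norm x * norm y"
proof -
  have s: "sqrt (\<Sum>\<^sub>\<infinity>j\<in>J. (cmod (f j x))\<^sup>2) \<le> sqrt b * norm x" if "x \<in> V" for x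
    using upper[OF that] by (metis real_sqrt_abs real_sqrt_le_iff real_sqrt_mult abs_norm_cancel)
  have "cmod (B x y) \<le> (sqrt b * norm x) * (sqrt b * norm y)"
    by (rule order_trans[OF B_Cauchy_Schwarz[OF assms]])
      (intro mult_mono s assms, use b in \<open>auto intro: infsum_nonneg\<close>)
  also have "\<dots> = b * norm x * norm y"
    using b by (simp add: mult_ac)
  finally show ?thesis .
qed

lemma Re_B_self: "x \<in> V \<Longrightarrow> a * (norm x)\<^sup>2 \<le> Re (B x x)"
  using lower by (simp add: B_self)

lemma B_unique:
  assumes "h \<in> V" "k \<in> V" "\<And>x. x \<in> V \<Longrightarrow> B x h = B x k"
  shows "h = k"
proof -
  have w: "h - k \<in> V"
    by (rule csubspace_diff[OF csubspace_V assms(1,2)])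
  have "B (h - k) (h - k) = 0"
    using assms w by (simp add: B_diff_right)
  then have "a * (norm (h - k))\<^sup>2 \<le> 0"
    using Re_B_self[OF w] by simp
  then show ?thesis
    using a by (simp add: mult_le_0_iff)
qed

text \<open>With \<open>\<Theta>\<close> representing \<open>B\<close> through \<open>ip\<close>, the map \<open>h \<mapsto> h - t (\<Theta> h - F)\<close> is a contraction for
  \<open>t = a / b\<^sup>2\<close>.\<close>

lemma Lax_Milgram:
  assumes F: "F \<in> V"
  shows "\<exists>h\<in>V. \<forall>x\<in>V. B x h = ip x F"
proof -
  have "\<exists>y\<in>V. \<forall>x\<in>V. ip x y = B x h" if h: "h \<in> V" for h
  proof (rule Riesz_representation[OF E V, where g = "\<lambda>x. B x h" and K = "b * norm h"])
    show "cmod (B x h) \<le> b * norm h * norm x" if "x \<in> V" for x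
      using B_bound[OF that h] by (simp only: mult_ac)
  qed (use h in \<open>auto simp: B_add_left B_sc_left\<close>)
  then obtain \<Theta> where \<Theta>: "\<And>h. h \<in> V \<Longrightarrow> \<Theta> h \<in> V" "\<And>h x. h \<in> V \<Longrightarrow> x \<in> V \<Longrightarrow> ip x (\<Theta> h) = B x h"
    by metis
  define t where "t = a / b\<^sup>2"
  \<comment> \<open>With \<open>w = h - k\<close>, the squared distance of the images is at most
    \<open>1 - 2 * t * a + t\<^sup>2 * b\<^sup>2\<close> times the squared norm of \<open>w\<close>,
    a factor that is smallest at the chosen \<open>t\<close>. The maximum with 0 is there because
    \<open>a \<le> b\<close> can fail when \<open>V\<close> is trivial.\<close>
  define c where "c = sqrt (max 0 (1 - a\<^sup>2 / b\<^sup>2))"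
  define T where "T h = h - t *\<^sub>R (\<Theta> h - F)" for h
  have TV: "T h \<in> V" if "h \<in> V" for h
    unfolding T_def by (intro csubspace_diff[OF csubspace_V] csubspace_scaleR[OF csubspace_V] \<Theta> F that)
  have "\<exists>!x. x \<in> V \<and> T x = x"
  proof (rule Banach_fix[OF complete_eq_closed[THEN iffD2, OF csubspace_closed[OF csubspace_V]]])
    show "V \<noteq> {}" using F by auto
    show "0 \<le> c" by (simp add: c_def)
    have "max 0 (1 - a\<^sup>2 / b\<^sup>2) < 1"
      using a b by simp
    then show "c < 1"
      unfolding c_def by simp
    show "T ` V \<subseteq> V" using TV by auto
    show "dist (T h) (T k) \<le> c * dist h k" if hk: "h \<in> V" "k \<in> V" for h k
    proof -
      define w where "w = h - k"
      define v where "v = \<Theta> h - \<Theta> k"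
      have w: "w \<in> V" and v: "v \<in> V"
        unfolding w_def v_def using hk \<Theta> by (auto intro: csubspace_diff[OF csubspace_V])
      have ipv: "ip x v = B x w" if "x \<in> V" for x
        unfolding v_def w_def using \<Theta> hk that by (simp add: ip_diff_right B_diff_right)
      have "(norm v)\<^sup>2 = cmod (B v w)"
        by (simp add: ipv[OF v, symmetric] ip_self norm_power)
      also have "\<dots> \<le> b * norm v * norm w"
        by (rule B_bound[OF v w])
      finally have "norm v \<le> b * norm w"
        using b by (cases "norm v = 0") (auto simp: power2_eq_square mult_ac)
      then have nv: "(norm v)\<^sup>2 \<le> b\<^sup>2 * (norm w)\<^sup>2"
        unfolding power_mult_distrib[symmetric] by (intro power_mono) auto
      have iwv: "a * (norm w)\<^sup>2 \<le> inner w v"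
        using Re_B_self[OF w] ipv[OF w] by (simp add: Re_ip[symmetric])
      have "(norm (w - t *\<^sub>R v))\<^sup>2 = (norm w)\<^sup>2 - 2 * t * inner w v + t\<^sup>2 * (norm v)\<^sup>2"
        unfolding power2_norm_eq_inner by (simp add: inner_diff inner_commute power2_eq_square algebra_simps)
      also have "\<dots> \<le> (norm w)\<^sup>2 - 2 * t * (a * (norm w)\<^sup>2) + t\<^sup>2 * (b\<^sup>2 * (norm w)\<^sup>2)"
        using a b by (intro add_mono diff_mono mult_left_mono iwv nv) (auto simp: t_def)
      also have "\<dots> = (1 - a\<^sup>2 / b\<^sup>2) * (norm w)\<^sup>2"
        using b by (simp add: t_def field_simps power2_eq_square)
      also have "\<dots> \<le> max 0 (1 - a\<^sup>2 / b\<^sup>2) * (norm w)\<^sup>2"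
        by (intro mult_right_mono) auto
      also have "\<dots> = (c * norm w)\<^sup>2"
        by (simp add: c_def power_mult_distrib)
      finally have "norm (w - t *\<^sub>R v) \<le> c * norm w"
        by (rule power2_le_imp_le) (simp add: c_def)
      moreover have "T h - T k = w - t *\<^sub>R v"
        by (simp add: T_def w_def v_def algebra_simps)
      ultimately show ?thesis
        by (simp add: dist_norm w_def)
    qed
  qed
  then obtain h where h: "h \<in> V" "T h = h"
    by blast
  then have "\<Theta> h = F"
    using a b by (simp add: T_def t_def)
  then show ?thesis
    using \<Theta>(2) h(1) by auto
qed

text \<open>A single term of the sum is bounded by the whole, so \<open>f j\<close> is continuous
  and is represented by some \<open>F\<close> through \<open>ip\<close>; Lax-Milgram converts this
  into a representation through \<open>B\<close>.\<close>

lemma exists_dual: "j \<in> J \<Longrightarrow> \<exists>h\<in>V. \<forall>x\<in>V. B x h = f j x"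
proof -
  assume j: "j \<in> J"
  have "cmod (f j x) \<le> sqrt b * norm x" if x: "x \<in> V" for x
  proof -
    have "(\<Sum>i\<in>{j}. (cmod (f i x))\<^sup>2) \<le> (\<Sum>\<^sub>\<infinity>i\<in>J. (cmod (f i x))\<^sup>2)"
      using f_ell2[OF x] j by (intro finite_sum_le_infsum) (auto simp: ell2_iff)
    also have "\<dots> \<le> b * (norm x)\<^sup>2"
      by (rule upper[OF x])
    also have "\<dots> = (sqrt b * norm x)\<^sup>2"
      using b by (simp add: power_mult_distrib)
    finally have "(cmod (f j x))\<^sup>2 \<le> (sqrt b * norm x)\<^sup>2"
      by simp
    then show ?thesis
      by (rule power2_le_imp_le) (use b in simp)
  qed
  then have "\<exists>y\<in>V. \<forall>x\<in>V. ip x y = f j x"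
    by (intro Riesz_representation[OF E V] f_add[OF j] f_scale[OF j])
  then obtain F where F: "F \<in> V" "\<And>x. x \<in> V \<Longrightarrow> ip x F = f j x"
    by auto
  then show ?thesis
    using Lax_Milgram[OF F(1)] by auto
qed

text \<open>The canonical dual frame: if \<open>F j\<close> represents \<open>f j\<close> through
  \<open>ip\<close>, and \<Theta> is the frame operator of these vectors, so that
  \<open>B x h = ip x (\<Theta> h)\<close>, then \<open>dual j\<close> is the preimage of
  \<open>F j\<close> under \<Theta>.\<close>

definition dual :: "'j \<Rightarrow> 'v" where
  "dual j = (SOME h. h \<in> V \<and> (\<forall>x\<in>V. B x h = f j x))"

lemma dual: "j \<in> J \<Longrightarrow> dual j \<in> V" "j \<in> J \<Longrightarrow> x \<in> V \<Longrightarrow> B x (dual j) = f j x"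
proof -
  assume "j \<in> J"
  then have "\<exists>h. h \<in> V \<and> (\<forall>x\<in>V. B x h = f j x)"
    using exists_dual by blast
  then have "dual j \<in> V \<and> (\<forall>x\<in>V. B x (dual j) = f j x)"
    unfolding dual_def by (rule someI_ex)
  then show "dual j \<in> V" "x \<in> V \<Longrightarrow> B x (dual j) = f j x"
    by auto
qed

text \<open>Here \<open>y\<close> is the preimage of \<open>x\<close> under the frame operator.
  Analysing \<open>x\<close> by the dual frame amounts to applying the functionals to
  \<open>y\<close>, so estimates for the dual frame become estimates for the \<open>f j\<close> at
  \<open>y\<close>.\<close>

lemma ip_dual:
  assumes "x \<in> V"
  obtains y where "y \<in> V" "\<And>z. z \<in> V \<Longrightarrow> B z y = ip z x" "\<And>j. j \<in> J \<Longrightarrow> ip x (dual j) = f j y"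
proof -
  obtain y where y: "y \<in> V" "\<And>z. z \<in> V \<Longrightarrow> B z y = ip z x"
    using Lax_Milgram[OF assms] by auto
  have "ip x (dual j) = f j y" if "j \<in> J" for j
    using y dual[OF that] ip_commute[of x "dual j"] B_commute[of "dual j" y] by simp
  then show thesis
    using that y by blast
qed

text \<open>For the \<open>y\<close> of \<open>ip_dual\<close> the sum in question is
  \<open>B y y = ip y x\<close>. Cauchy-Schwarz and the lower bound at \<open>y\<close> give the
  upper estimate; Cauchy-Schwarz for \<open>B x y\<close>, which is the squared norm of
  \<open>x\<close>, and the upper bound at \<open>x\<close> give the lower one. This is why the
  constants are inverted and exchanged.\<close>

lemma dual_frame:
  assumes x: "x \<in> V"
  shows "(\<lambda>j. ip x (dual j)) \<in> ell2 J"
    and "1 / b * (norm x)\<^sup>2 \<le> (\<Sum>\<^sub>\<infinity>j\<in>J. (cmod (ip x (dual j)))\<^sup>2)"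
    and "(\<Sum>\<^sub>\<infinity>j\<in>J. (cmod (ip x (dual j)))\<^sup>2) \<le> 1 / a * (norm x)\<^sup>2"
proof -
  obtain y where y: "y \<in> V" "\<And>z. z \<in> V \<Longrightarrow> B z y = ip z x" "\<And>j. j \<in> J \<Longrightarrow> ip x (dual j) = f j y"
    by (rule ip_dual[OF x]) blast
  define s where "s = (\<Sum>\<^sub>\<infinity>j\<in>J. (cmod (f j y))\<^sup>2)"
  have s: "(\<Sum>\<^sub>\<infinity>j\<in>J. (cmod (ip x (dual j)))\<^sup>2) = s"
    unfolding s_def by (rule infsum_cong) (simp add: y(3))
  have "0 \<le> s" by (simp add: s_def infsum_nonneg)
  show "(\<lambda>j. ip x (dual j)) \<in> ell2 J"
    using f_ell2[OF y(1)] unfolding ell2_iff by (rule summable_on_cong[THEN iffD1, rotated]) (simp add: y(3))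
  have "complex_of_real s = ip y x"
    using B_self[OF y(1)] y(1,2) by (simp add: s_def)
  then have syx: "s \<le> norm y * norm x"
    using ip_Cauchy_Schwarz[of y x] \<open>0 \<le> s\<close> by (metis norm_of_real abs_of_nonneg)
  have "a * (norm y)\<^sup>2 \<le> norm y * norm x"
    using lower[OF y(1)] syx unfolding s_def by linarith
  then have "a * norm y \<le> norm x"
    by (cases "norm y = 0") (auto simp: power2_eq_square mult_ac)
  then have "a * norm y * norm x \<le> norm x * norm x"
    by (rule mult_right_mono) simp
  moreover have "a * s \<le> a * (norm y * norm x)"
    using a by (intro mult_left_mono syx) simp
  ultimately have "a * s \<le> norm x * norm x"
    by (simp add: mult.assoc)
  then show "(\<Sum>\<^sub>\<infinity>j\<in>J. (cmod (ip x (dual j)))\<^sup>2) \<le> 1 / a * (norm x)\<^sup>2"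
    using a unfolding s by (simp add: field_simps power2_eq_square)
  have "(norm x)\<^sup>2 = cmod (B x y)"
    using y(2)[OF x] by (simp add: ip_self norm_power)
  also have "\<dots> \<le> sqrt (\<Sum>\<^sub>\<infinity>j\<in>J. (cmod (f j x))\<^sup>2) * sqrt s"
    unfolding s_def by (rule B_Cauchy_Schwarz[OF x y(1)])
  also have "\<dots> \<le> sqrt (b * (norm x)\<^sup>2) * sqrt s"
    using upper[OF x] \<open>0 \<le> s\<close> by (intro mult_right_mono) auto
  also have "\<dots> = norm x * sqrt (b * s)"
    by (simp add: real_sqrt_mult)
  finally have "norm x \<le> sqrt (b * s)"
    by (cases "norm x = 0") (use \<open>0 \<le> s\<close> b in \<open>auto simp: power2_eq_square\<close>)
  then have "(norm x)\<^sup>2 \<le> (sqrt (b * s))\<^sup>2"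
    by (intro power_mono) auto
  then show "1 / b * (norm x)\<^sup>2 \<le> (\<Sum>\<^sub>\<infinity>j\<in>J. (cmod (ip x (dual j)))\<^sup>2)"
    using b \<open>0 \<le> s\<close> unfolding s by (simp add: field_simps)
qed

text \<open>The upper bound of the dual frame makes the series converge to some \<open>w\<close> in
  \<open>V\<close>. Against any \<open>z\<close> in \<open>V\<close>, with \<open>y\<close> taken
  from \<open>ip_dual\<close> for \<open>z\<close>, termwise evaluation gives
  \<open>ip w z = B x y = ip x z\<close>.\<close>

lemma reconstruction:
  assumes x: "x \<in> V"
  shows "((\<lambda>j. f j x \<odot> dual j) has_sum x) J"
proof -
  have "(norm (\<Sum>j\<in>F. c j \<odot> dual j))\<^sup>2 \<le> 1 / a * (\<Sum>j\<in>F. (cmod (c j))\<^sup>2)" if F: "finite F" "F \<subseteq> J" for F c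
  proof (rule synthesis_le_if_sum_ip[OF F(1) _ csubspace_V])
    show "(\<Sum>j\<in>F. (cmod (ip y (dual j)))\<^sup>2) \<le> 1 / a * (norm y)\<^sup>2" if y: "y \<in> V" for y
      using dual_frame(1)[OF y] F unfolding ell2_iff
      by (intro order_trans[OF finite_sum_le_infsum dual_frame(3)[OF y]]) auto
  qed (use a F dual in auto)
  from bessel_has_sum(1)[OF this _ f_ell2[OF x]] a
  obtain w where w: "((\<lambda>j. f j x \<odot> dual j) has_sum w) J"
    unfolding summable_on_def by fastforce
  have wV: "w \<in> V"
    by (rule csubspace_has_sum[OF csubspace_V _ w]) (intro csubspace_sc[OF csubspace_V] dual)
  have "ip (w - x) z = 0" if z: "z \<in> V" for z
  proof -
    obtain y where y: "y \<in> V" "\<And>u. u \<in> V \<Longrightarrow> B u y = ip u z" "\<And>j. j \<in> J \<Longrightarrow> ip z (dual j) = f j y"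
      by (rule ip_dual[OF z]) blast
    have "((\<lambda>j. f j x * ip (dual j) z) has_sum ip w z) J"
      using has_sum_ip_left[OF w, of z] by (simp add: ip_sc_left)
    also have "?this \<longleftrightarrow> ((\<lambda>j. f j x * cnj (f j y)) has_sum ip w z) J"
      by (rule has_sum_cong) (simp add: y(3)[symmetric] ip_commute[of z "dual _"])
    finally have "ip w z = B x y"
      using B_has_sum[OF x y(1)] has_sum_unique by blast
    then show ?thesis
      using y(2)[OF x] by (simp add: ip_diff_left)
  qed
  from this[of "w - x"] have "w = x"
    using csubspace_diff[OF csubspace_V wV x] by (simp add: ip_self)
  then show ?thesis
    using w by simp
qed

text \<open>If \<tau> permutes the functionals, it preserves \<open>B\<close> and therefore carries
  the vector representing one functional to the vector representing its image;
  \<open>\<tau>'\<close> supplies preimages for testing against all of \<open>V\<close>.\<close>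

lemma dual_equivariant:
  assumes \<tau>: "\<And>x. x \<in> V \<Longrightarrow> \<tau> x \<in> V" and \<tau>': "\<And>x. x \<in> V \<Longrightarrow> \<tau>' x \<in> V \<and> \<tau> (\<tau>' x) = x"
    and p: "bij_betw p J J"
    and f: "\<And>j x. j \<in> J \<Longrightarrow> x \<in> V \<Longrightarrow> f (p j) (\<tau> x) = f j x"
    and j: "j \<in> J"
  shows "\<tau> (dual j) = dual (p j)"
proof (rule B_unique)
  have pj: "p j \<in> J"
    using p j by (auto simp: bij_betw_def)
  show "\<tau> (dual j) \<in> V" "dual (p j) \<in> V"
    using \<tau> dual(1) j pj by auto
  have inv: "B (\<tau> x) (\<tau> y) = B x y" if "x \<in> V" "y \<in> V" for x y
  proof -
    have "B (\<tau> x) (\<tau> y) = (\<Sum>\<^sub>\<infinity>j\<in>J. f (p j) (\<tau> x) * cnj (f (p j) (\<tau> y)))"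
      unfolding B_def by (rule infsum_reindex_bij_betw[OF p, symmetric])
    also have "\<dots> = B x y"
      unfolding B_def by (rule infsum_cong) (simp add: f that)
    finally show ?thesis .
  qed
  show "B x (\<tau> (dual j)) = B x (dual (p j))" if x: "x \<in> V" for x
  proof -
    have "B x (\<tau> (dual j)) = B (\<tau>' x) (dual j)"
      using inv[of "\<tau>' x" "dual j"] \<tau>'[OF x] dual(1)[OF j] by simp
    also have "\<dots> = f j (\<tau>' x)"
      using dual(2)[OF j] \<tau>'[OF x] by blast
    also have "\<dots> = f (p j) x"
      using f[OF j, of "\<tau>' x"] \<tau>'[OF x] by simp
    also have "\<dots> = B x (dual (p j))"
      using dual(2)[OF pj x] by simp
    finally show ?thesis .
  qed
qed

end

section \<open>The Hilbert-Schmidt class\<close>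

interpretation l2: complex_hilbert "scaleC :: complex \<Rightarrow> 'a::euclidean_space l2 \<Rightarrow> 'a l2" cinner
proof
  fix f g h :: "'a l2" and c d :: complex and r :: real
  show "complex_of_real r *\<^sub>C f = r *\<^sub>R f"
    by (simp add: scaleR_l2_def)
  show "c *\<^sub>C (f + g) = c *\<^sub>C f + c *\<^sub>C g"
    by (rule linear_add[OF bounded_linear.linear[OF bounded_linear_scaleC]])
  show "(c + d) *\<^sub>C f = c *\<^sub>C f + d *\<^sub>C f"
    by transfer (auto simp: l2_rel_def ring_distribs intro!: square_integrable_add square_integrable_cmult)
  show "c *\<^sub>C d *\<^sub>C f = (c * d) *\<^sub>C f"
    by transfer (auto simp: l2_rel_def mult.assoc intro!: square_integrable_cmult)
  show "cinner (f + g) h = cinner f h + cinner g h"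
    by transfer (auto simp: l2_rel_def ring_distribs Bochner_Integration.integral_add square_integrable_mult_cnj)
  show "cinner (c *\<^sub>C f) g = c * cinner f g"
    by transfer (simp add: mult.assoc)
  show "cinner g f = cnj (cinner f g)"
  proof transfer
    fix f g :: "'a \<Rightarrow> complex"
    assume "l2_rel g g" "l2_rel f f"
    have "(\<integral>x. g x * cnj (f x) \<partial>lborel) = (\<integral>x. cnj (f x * cnj (g x)) \<partial>lborel)"
      by (simp add: mult.commute)
    also have "\<dots> = cnj (\<integral>x. f x * cnj (g x) \<partial>lborel)"
      by (rule integral_bounded_linear'[OF bounded_linear_cnj bounded_linear_cnj]) simp
    finally show "(\<integral>x. g x * cnj (f x) \<partial>lborel) = cnj (\<integral>x. f x * cnj (g x) \<partial>lborel)" .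
  qed
  show "Re (cinner f g) = inner f g"
    by (simp add: inner_l2_def)
qed

lemma is_onb_iff: "is_onb E \<longleftrightarrow> l2.orthonormal E (\<lambda>e. e) \<and> l2.closed_span E (\<lambda>e. e) = UNIV"
proof -
  have "closure {\<Sum>e\<in>F. c e *\<^sub>C e |F c. finite F \<and> F \<subseteq> E} = l2.closed_span E (\<lambda>e. e)"
    unfolding l2.closed_span_def closure_approachable set_eq_iff mem_Collect_eq
    by (intro allI iff_allI imp_cong refl) (force simp: dist_norm norm_minus_commute)
  then show ?thesis
    by (simp add: is_onb_def l2.orthonormal_def)
qed

lemma is_onb_some_onb: "is_onb some_onb"
  unfolding some_onb_def
  by (rule someI_ex) (use l2.exists_orthonormal_basis in \<open>auto simp: is_onb_iff\<close>)

lemma orthonormal_some_onb: "l2.orthonormal some_onb (\<lambda>e. e)"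
  and closed_span_some_onb: "l2.closed_span some_onb (\<lambda>e. e) = UNIV"
  using is_onb_some_onb unfolding is_onb_iff by blast+

lemma parseval_some_onb:
  "((\<lambda>e. cinner x e * cnj (cinner y e)) has_sum cinner x y) some_onb"
  "((\<lambda>e. (cmod (cinner x e))\<^sup>2) has_sum (norm x)\<^sup>2) some_onb"
  using l2.orthonormal_parseval[OF orthonormal_some_onb, of x] by (auto simp: closed_span_some_onb)

lemma cinner_ext: "(\<And>f. cinner f x = cinner f y) \<Longrightarrow> x = y"
proof -
  assume "\<And>f. cinner f x = cinner f y"
  then have "cinner (x - y) (x - y) = 0"
    by (simp add: l2.ip_diff_right)
  then show "x = y"
    by (simp add: l2.ip_self)
qed

definition clinear :: "'a::euclidean_space op \<Rightarrow> bool" where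
  "clinear T \<longleftrightarrow> (\<forall>c f. T (c *\<^sub>C f) = c *\<^sub>C T f)"

lemma op_adjI:
  fixes T T' :: "'a::euclidean_space op"
  assumes "\<And>f g. cinner (T f) g = cinner f (T' g)"
  shows "op_adj T = T'"
  unfolding op_adj_def
proof (rule the_equality)
  show "\<forall>f g. cinner (T f) g = cinner f (T' g)"
    using assms by simp
  fix T'' :: "'a op" assume "\<forall>f g. cinner (T f) g = cinner f (T'' g)"
  then show "T'' = T'"
    using assms by (intro blinfun_eqI cinner_ext) metis
qed

text \<open>\<open>op_adj\<close> is a definite description. Existence comes from representing
  \<open>\<lambda>f. cinner (T f) g\<close> for each \<open>g\<close>, which requires complex
  linearity of \<open>T\<close>; the representing map is bounded by testing it on its own
  value.\<close>

lemma cinner_op_adj: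
  fixes T :: "'a::euclidean_space op"
  assumes T: "clinear T"
  shows "cinner (T f) g = cinner f (op_adj T g)"
proof -
  have "\<exists>y\<in>UNIV. \<forall>f\<in>UNIV. cinner f y = cinner (T f) g" for g
  proof (rule l2.Riesz_representation[OF orthonormal_some_onb closed_span_some_onb[symmetric], where K = "norm T * norm g"])
    show "cmod (cinner (T x) g) \<le> norm T * norm g * norm x" for x
    proof -
      have "cmod (cinner (T x) g) \<le> norm (T x) * norm g"
        by (rule l2.ip_Cauchy_Schwarz)
      also have "\<dots> \<le> norm T * norm x * norm g"
        by (intro mult_right_mono norm_blinfun) simp
      finally show ?thesis by (simp only: mult_ac)
    qed
  qed (use T in \<open>simp_all add: clinear_def blinfun.add_right l2.ip_add_left l2.ip_sc_left\<close>)
  then obtain A where A: "\<And>f g. cinner f (A g) = cinner (T f) g"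
    by (metis UNIV_I)
  have "bounded_linear A"
  proof (rule bounded_linear_intro[where K = "norm T"])
    show "A (g + h) = A g + A h" for g h
      by (rule cinner_ext) (simp add: A l2.ip_add_right)
    show "A (r *\<^sub>R g) = r *\<^sub>R A g" for r g
      by (rule cinner_ext) (simp add: A l2.ip_sc_right l2.sc_of_real[symmetric])
    show "norm (A g) \<le> norm g * norm T" for g
    proof -
      have "(norm (A g))\<^sup>2 = cmod (cinner (T (A g)) g)"
        by (simp add: A[symmetric] l2.ip_self norm_power)
      also have "\<dots> \<le> norm (T (A g)) * norm g"
        by (rule l2.ip_Cauchy_Schwarz)
      also have "\<dots> \<le> norm T * norm (A g) * norm g"
        by (intro mult_right_mono norm_blinfun) simp
      finally show ?thesis
        by (cases "norm (A g) = 0") (auto simp: power2_eq_square mult_ac)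
    qed
  qed
  then have "cinner (T f) g = cinner f (Blinfun A g)" for f g
    by (simp add: bounded_linear_Blinfun_apply A)
  then show ?thesis
    using op_adjI by metis
qed

lemma cinner_op_adj': "clinear T \<Longrightarrow> cinner g (T f) = cinner (op_adj T g) f"
  using cinner_op_adj[of T f g] l2.ip_commute[of g "T f"] l2.ip_commute[of "op_adj T g" f] by simp

lemma clinear_op_adj: "clinear T \<Longrightarrow> clinear (op_adj T)"
  unfolding clinear_def[of "op_adj T"]
  by (intro allI cinner_ext) (simp add: cinner_op_adj[symmetric] l2.ip_sc_right)

lemma op_adj_op_adj: "clinear T \<Longrightarrow> op_adj (op_adj T) = T"
  by (rule op_adjI) (simp add: cinner_op_adj')

lemma clinear_compose: "clinear S \<Longrightarrow> clinear T \<Longrightarrow> clinear (S o\<^sub>L T)"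
  by (simp add: clinear_def)

lemma op_adj_compose: "clinear S \<Longrightarrow> clinear T \<Longrightarrow> op_adj (S o\<^sub>L T) = op_adj T o\<^sub>L op_adj S"
  by (rule op_adjI) (simp add: cinner_op_adj)

lemma HS_iff: "S \<in> HS \<longleftrightarrow> clinear S \<and> (\<lambda>e. (norm (S e))\<^sup>2) summable_on some_onb"
  by (simp add: HS_def clinear_def)

lemma HS_clinear: "S \<in> HS \<Longrightarrow> clinear S"
  by (simp add: HS_iff)

text \<open>Parseval in the second index turns the Hilbert-Schmidt sum into a double sum over matrix
  entries, where both indices play the same part.\<close>

lemma matrix_coefficients_has_sum:
  assumes S: "S \<in> HS"
  shows "((\<lambda>(e, e'). (cmod (cinner (S e) e'))\<^sup>2) has_sum (\<Sum>\<^sub>\<infinity>e\<in>some_onb. (norm (S e))\<^sup>2)) (some_onb \<times> some_onb)"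
proof -
  have "(\<lambda>(e, e'). (cmod (cinner (S e) e'))\<^sup>2) summable_on (some_onb \<times> some_onb)"
    by (rule summable_on_SigmaI[where g = "\<lambda>e. (norm (S e))\<^sup>2"])
      (use S parseval_some_onb(2) in \<open>auto simp: HS_iff\<close>)
  then obtain s where s: "((\<lambda>(e, e'). (cmod (cinner (S e) e'))\<^sup>2) has_sum s) (some_onb \<times> some_onb)"
    by (auto simp: summable_on_def)
  have "((\<lambda>e. (norm (S e))\<^sup>2) has_sum s) some_onb"
    by (rule has_sum_SigmaD[OF s]) (simp add: parseval_some_onb(2))
  with s show ?thesis
    by (metis infsumI)
qed

text \<open>The matrix of the adjoint is the conjugate transpose, and the double sum of
  \<open>matrix_coefficients_has_sum\<close> may be evaluated in either order.\<close>

lemma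
  assumes S: "S \<in> HS"
  shows op_adj_HS: "op_adj S \<in> HS"
    and infsum_norm_op_adj: "(\<Sum>\<^sub>\<infinity>e\<in>some_onb. (norm (op_adj S e))\<^sup>2) = (\<Sum>\<^sub>\<infinity>e\<in>some_onb. (norm (S e))\<^sup>2)"
proof -
  have swap: "((\<lambda>(e', e). (cmod (cinner (S e) e'))\<^sup>2) has_sum (\<Sum>\<^sub>\<infinity>e\<in>some_onb. (norm (S e))\<^sup>2)) (some_onb \<times> some_onb)"
    using has_sum_swap[THEN iffD1, OF matrix_coefficients_has_sum[OF S]] by simp
  have "cmod (cinner (op_adj S e') e) = cmod (cinner (S e) e')" for e e'
    using cinner_op_adj'[OF HS_clinear[OF S], of e' e] l2.ip_commute[of e' "S e"]
    by (metis complex_mod_cnj)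
  then have "((\<lambda>e. (\<lambda>(e', e). (cmod (cinner (S e) e'))\<^sup>2) (e', e)) has_sum (norm (op_adj S e'))\<^sup>2) some_onb" for e'
    using parseval_some_onb(2)[of "op_adj S e'"] by simp
  then have "((\<lambda>e'. (norm (op_adj S e'))\<^sup>2) has_sum (\<Sum>\<^sub>\<infinity>e\<in>some_onb. (norm (S e))\<^sup>2)) some_onb"
    by (rule has_sum_SigmaD[OF swap])
  then show "op_adj S \<in> HS" "(\<Sum>\<^sub>\<infinity>e\<in>some_onb. (norm (op_adj S e))\<^sup>2) = (\<Sum>\<^sub>\<infinity>e\<in>some_onb. (norm (S e))\<^sup>2)"
    using clinear_op_adj[OF HS_clinear[OF S]] by (auto simp: HS_iff summable_on_def infsumI)
qed

lemma cmod_mult_le_sum_power2: "cmod (a * cnj b) \<le> (cmod a)\<^sup>2 + (cmod b)\<^sup>2"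
proof -
  have "0 \<le> (cmod a - cmod b)\<^sup>2" "0 \<le> cmod a * cmod b"
    by auto
  then show ?thesis
    unfolding power2_diff norm_mult complex_mod_cnj by linarith
qed

lemma HS_cinner_summable:
  assumes S: "S \<in> HS" and T: "T \<in> HS"
  shows "(\<lambda>e. cinner (S e) (T e)) summable_on some_onb"
proof (rule abs_summable_summable, rule summable_on_comparison_test)
  show "(\<lambda>e. (norm (S e))\<^sup>2 + (norm (T e))\<^sup>2) summable_on some_onb"
    using S T by (intro summable_on_add) (auto simp: HS_iff)
  show "norm (cinner (S e) (T e)) \<le> (norm (S e))\<^sup>2 + (norm (T e))\<^sup>2" for e
    using l2.ip_Cauchy_Schwarz[of "S e" "T e"]
      cmod_mult_le_sum_power2[of "complex_of_real (norm (S e))" "complex_of_real (norm (T e))"]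
    by (simp add: norm_mult)
qed simp

text \<open>The trace of \<open>S T\<^sup>*\<close> is the sum of \<open>\<langle>T\<^sup>* e, S\<^sup>* e\<rangle>\<close>; expanding in matrix coefficients
  and interchanging the two sums gives the sum of \<open>\<langle>S e, T e\<rangle>\<close>.\<close>

lemma hs_inner_eq:
  assumes S: "S \<in> HS" and T: "T \<in> HS"
  shows "hs_inner S T = (\<Sum>\<^sub>\<infinity>e\<in>some_onb. cinner (S e) (T e))"
proof -
  note cS = HS_clinear[OF S] and cT = HS_clinear[OF T]
  let ?F = "\<lambda>e e'. cinner (S e) e' * cnj (cinner (T e) e')"
  have "(\<lambda>(e, e'). ?F e e') summable_on (some_onb \<times> some_onb)"
  proof (rule abs_summable_summable, rule summable_on_comparison_test)
    show "(\<lambda>p. (\<lambda>(e, e'). (cmod (cinner (S e) e'))\<^sup>2) p + (\<lambda>(e, e'). (cmod (cinner (T e) e'))\<^sup>2) p) summable_on (some_onb \<times> some_onb)"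
      using matrix_coefficients_has_sum[OF S] matrix_coefficients_has_sum[OF T]
      by (intro summable_on_add) (auto simp: summable_on_def)
  qed (auto simp del: complex_cnj_mult norm_mult intro: cmod_mult_le_sum_power2)
  then have "(\<Sum>\<^sub>\<infinity>e\<in>some_onb. \<Sum>\<^sub>\<infinity>e'\<in>some_onb. ?F e e') = (\<Sum>\<^sub>\<infinity>e'\<in>some_onb. \<Sum>\<^sub>\<infinity>e\<in>some_onb. ?F e e')"
    by (rule infsum_swap_banach)
  moreover have "(\<Sum>\<^sub>\<infinity>e'\<in>some_onb. ?F e e') = cinner (S e) (T e)" for e
    by (rule infsumI[OF parseval_some_onb(1)])
  moreover have "(\<Sum>\<^sub>\<infinity>e\<in>some_onb. ?F e e') = cinner (S (op_adj T e')) e'" for e'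
  proof -
    have 1: "cinner (S e) e' = cnj (cinner (op_adj S e') e)" for e
      using cinner_op_adj[OF cS, of e e'] l2.ip_commute[of e "op_adj S e'"] by simp
    have 2: "cnj (cinner (T e) e') = cinner (op_adj T e') e" for e
      using cinner_op_adj[OF cT, of e e'] l2.ip_commute[of "op_adj T e'" e] by simp
    have "(\<lambda>e. ?F e e') = (\<lambda>e. cinner (op_adj T e') e * cnj (cinner (op_adj S e') e))"
      unfolding 1 2 by (simp add: mult.commute)
    then have "(\<Sum>\<^sub>\<infinity>e\<in>some_onb. ?F e e') = cinner (op_adj T e') (op_adj S e')"
      using infsumI[OF parseval_some_onb(1)] by simp
    then show ?thesis
      by (simp add: cinner_op_adj[OF cS])
  qed
  ultimately show ?thesis
    by (simp add: hs_inner_def op_trace_def)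
qed

lemma HS_zero: "0 \<in> HS"
  by (simp add: HS_def)

lemma HS_add:
  assumes S: "S \<in> HS" and T: "T \<in> HS"
  shows "S + T \<in> HS"
proof -
  have "(\<lambda>e. 2 * (norm (S e))\<^sup>2 + 2 * (norm (T e))\<^sup>2) summable_on some_onb"
    using S T by (intro summable_on_add summable_on_cmult_right) (auto simp: HS_iff)
  then have "(\<lambda>e. (norm ((S + T) e))\<^sup>2) summable_on some_onb"
    by (rule summable_on_comparison_test)
      (use power2_norm_add_weighted[of 1] in \<open>auto simp: blinfun.add_left\<close>)
  then show ?thesis
    using S T by (auto simp: HS_def blinfun.add_left l2.sc_add_right)
qed

lemma HS_scaleC: "S \<in> HS \<Longrightarrow> c *\<^sub>O S \<in> HS"
  by (auto simp: HS_def scaleC_op_apply l2.norm_sc power_mult_distrib l2.sc_assoc mult.commute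
      intro!: summable_on_cmult_right)

lemma scaleR_op: "r *\<^sub>R S = complex_of_real r *\<^sub>O S"
  by (rule blinfun_eqI) (simp add: scaleC_op_apply l2.sc_of_real blinfun.scaleR_left)

lemma HS_scaleR: "S \<in> HS \<Longrightarrow> r *\<^sub>R S \<in> HS"
  unfolding scaleR_op by (rule HS_scaleC)

lemma HS_uminus: "S \<in> HS \<Longrightarrow> - S \<in> HS"
  using HS_scaleR[of S "-1"] by simp

lemma HS_minus: "S \<in> HS \<Longrightarrow> T \<in> HS \<Longrightarrow> S - T \<in> HS"
  using HS_add[OF _ HS_uminus] by force

text \<open>Definiteness of the Hilbert-Schmidt norm: the norm sees only basis vectors, and
  continuity together with complex linearity propagates vanishing to their expansions.\<close>

lemma HS_eq_zero:
  fixes S :: "'a::euclidean_space op"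
  assumes S: "S \<in> HS" and z: "\<And>e. e \<in> some_onb \<Longrightarrow> S e = 0"
  shows "S = 0"
proof (rule blinfun_eqI)
  fix x :: "'a l2"
  have "((\<lambda>e. cinner x e *\<^sub>C e) has_sum x) some_onb"
    using l2.orthonormal_expansion[OF orthonormal_some_onb] closed_span_some_onb by auto
  then have "((\<lambda>e. S (cinner x e *\<^sub>C e)) has_sum S x) some_onb"
    by (rule has_sum_bounded_linear[OF blinfun.bounded_linear_right])
  also have "?this \<longleftrightarrow> ((\<lambda>e::'a l2. 0) has_sum S x) some_onb"
    by (rule has_sum_cong) (use S z in \<open>simp add: HS_def\<close>)
  finally have "S x = 0"
    by (rule has_sum_unique) simp
  then show "blinfun_apply S x = blinfun_apply 0 x"
    by simp
qed

lemma infsum_cinner_self: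
  assumes "S \<in> HS"
  shows "hs_inner S S = complex_of_real (\<Sum>\<^sub>\<infinity>e\<in>some_onb. (norm (S e))\<^sup>2)"
proof -
  have "((\<lambda>e. (norm (S e))\<^sup>2) has_sum (\<Sum>\<^sub>\<infinity>e\<in>some_onb. (norm (S e))\<^sup>2)) some_onb"
    using assms by (simp add: HS_iff)
  then have "((\<lambda>e. complex_of_real ((norm (S e))\<^sup>2)) has_sum complex_of_real (\<Sum>\<^sub>\<infinity>e\<in>some_onb. (norm (S e))\<^sup>2)) some_onb"
    by (rule has_sum_of_real)
  then show ?thesis
    unfolding hs_inner_eq[OF assms assms] l2.ip_self by (rule infsumI)
qed

lemma hs_inner_add_left:
  assumes "S \<in> HS" "T \<in> HS" "R \<in> HS"
  shows "hs_inner (S + T) R = hs_inner S R + hs_inner T R"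
  using assms by (simp add: hs_inner_eq HS_add blinfun.add_left l2.ip_add_left infsum_add HS_cinner_summable)

lemma hs_inner_scaleC_left:
  assumes "S \<in> HS" "R \<in> HS"
  shows "hs_inner (c *\<^sub>O S) R = c * hs_inner S R"
  using assms by (simp add: hs_inner_eq HS_scaleC scaleC_op_apply l2.ip_sc_left infsum_cmult_right')

lemma hs_inner_commute:
  assumes "S \<in> HS" "R \<in> HS"
  shows "hs_inner R S = cnj (hs_inner S R)"
  unfolding hs_inner_eq[OF assms] hs_inner_eq[OF assms(2,1)] infsum_cnj[symmetric]
  by (rule infsum_cong) (rule l2.ip_commute)

text \<open>A type of its own, because on \<open>'a op\<close> the topology is that of the operator
  norm; here limits and \<open>has_sum\<close> mean convergence in Hilbert-Schmidt norm.\<close>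

typedef (overloaded) 'a hs = "HS :: 'a::euclidean_space op set"
  morphisms hs_op Abs_hs
  by (rule exI[of _ 0]) (rule HS_zero)

setup_lifting type_definition_hs

lemma hs_op_HS: "hs_op S \<in> HS"
  by (rule hs_op)

lift_definition hs_scaleC :: "complex \<Rightarrow> 'a::euclidean_space hs \<Rightarrow> 'a hs" is scaleC_op
  by (rule HS_scaleC)

lift_definition hs_cinner :: "'a::euclidean_space hs \<Rightarrow> 'a hs \<Rightarrow> complex" is hs_inner .

instantiation hs :: (euclidean_space) real_inner
begin

lift_definition zero_hs :: "'a hs" is 0 by (rule HS_zero)

lift_definition plus_hs :: "'a hs \<Rightarrow> 'a hs \<Rightarrow> 'a hs" is "(+)" by (rule HS_add)

lift_definition minus_hs :: "'a hs \<Rightarrow> 'a hs \<Rightarrow> 'a hs" is "(-)" by (rule HS_minus)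

lift_definition uminus_hs :: "'a hs \<Rightarrow> 'a hs" is "uminus" by (rule HS_uminus)

lift_definition scaleR_hs :: "real \<Rightarrow> 'a hs \<Rightarrow> 'a hs" is "(*\<^sub>R)" by (rule HS_scaleR)

definition inner_hs :: "'a hs \<Rightarrow> 'a hs \<Rightarrow> real" where "inner_hs S T = Re (hs_cinner S T)"

definition norm_hs :: "'a hs \<Rightarrow> real" where "norm_hs S = sqrt (inner S S)"

definition sgn_hs :: "'a hs \<Rightarrow> 'a hs" where "sgn_hs S = scaleR (inverse (norm S)) S"

definition dist_hs :: "'a hs \<Rightarrow> 'a hs \<Rightarrow> real" where "dist_hs S T = norm (S - T)"

definition uniformity_hs :: "('a hs \<times> 'a hs) filter" where
  "uniformity_hs = (INF e\<in>{0 <..}. principal {(S, T). dist S T < e})"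

definition open_hs :: "'a hs set \<Rightarrow> bool" where
  "open_hs U = (\<forall>x\<in>U. eventually (\<lambda>(x', y). x' = x \<longrightarrow> y \<in> U) uniformity)"

instance
proof
  fix S T R :: "'a hs" and r s :: real
  show "S + T + R = S + (T + R)" by transfer (rule add.assoc)
  show "S + T = T + S" by transfer (rule add.commute)
  show "0 + S = S" by transfer simp
  show "- S + S = 0" by transfer simp
  show "S - T = S + - T" by transfer simp
  show "r *\<^sub>R (S + T) = r *\<^sub>R S + r *\<^sub>R T" by transfer (rule scaleR_add_right)
  show "(r + s) *\<^sub>R S = r *\<^sub>R S + s *\<^sub>R S" by transfer (rule scaleR_add_left)
  show "r *\<^sub>R s *\<^sub>R S = (r * s) *\<^sub>R S" by transfer simp
  show "1 *\<^sub>R S = S" by transfer simp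
  show "inner S T = inner T S"
    unfolding inner_hs_def by transfer (subst hs_inner_commute, simp_all)
  show "inner (S + T) R = inner S R + inner T R"
    unfolding inner_hs_def by transfer (simp add: hs_inner_add_left)
  show "inner (r *\<^sub>R S) T = r * inner S T"
    unfolding inner_hs_def by transfer (simp add: scaleR_op hs_inner_scaleC_left)
  show "0 \<le> inner S S"
    unfolding inner_hs_def by transfer (simp add: infsum_cinner_self infsum_nonneg)
  show "(inner S S = 0) = (S = 0)"
    unfolding inner_hs_def
  proof transfer
    fix S :: "'a op" assume S: "S \<in> HS"
    have "S = 0" if "(\<Sum>\<^sub>\<infinity>e\<in>some_onb. (norm (S e))\<^sup>2) = 0"
    proof (rule HS_eq_zero[OF S])
      fix e :: "'a l2" assume "e \<in> some_onb"
      then have "(norm (S e))\<^sup>2 = 0"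
        using S that by (intro nonneg_infsum_le_0D[of "\<lambda>e. (norm (S e))\<^sup>2" some_onb]) (auto simp: HS_iff)
      then show "S e = 0" by simp
    qed
    then show "(Re (hs_inner S S) = 0) = (S = 0)"
      using S by (auto simp: infsum_cinner_self)
  qed
qed (simp_all only: norm_hs_def sgn_hs_def dist_hs_def uniformity_hs_def open_hs_def)

end

lemma hs_norm_eq: "hs_norm (hs_op S) = norm S"
  unfolding norm_hs_def inner_hs_def hs_norm_def by transfer simp

lemma norm_hs_power2: "(norm S)\<^sup>2 = (\<Sum>\<^sub>\<infinity>e\<in>some_onb. (norm (hs_op S e))\<^sup>2)"
  unfolding power2_norm_eq_inner[of S] inner_hs_def
  by transfer (simp add: infsum_cinner_self)

text \<open>Moving \<open>T\<close> to the other side, \<open>cinner (T x) e\<close> is at most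
  \<open>norm x * norm (op_adj T e)\<close> in modulus, and the adjoint has the same Hilbert-Schmidt
  norm. Hence a Cauchy sequence in \<open>hs\<close> has a limit in operator norm, the candidate for
  its limit in \<open>hs\<close>.\<close>

lemma norm_hs_op_le: "norm (hs_op S) \<le> norm S"
proof (rule norm_blinfun_bound)
  fix x
  define T where "T = hs_op S"
  have T: "T \<in> HS" and cT: "clinear T"
    unfolding T_def by (simp_all add: hs_op_HS HS_clinear)
  have "(norm (T x))\<^sup>2 = (\<Sum>\<^sub>\<infinity>e\<in>some_onb. (cmod (cinner (T x) e))\<^sup>2)"
    by (rule infsumI[OF parseval_some_onb(2), symmetric])
  also have "\<dots> \<le> (\<Sum>\<^sub>\<infinity>e\<in>some_onb. (norm x)\<^sup>2 * (norm (op_adj T e))\<^sup>2)"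
  proof (rule infsum_mono)
    show "(\<lambda>e. (cmod (cinner (T x) e))\<^sup>2) summable_on some_onb"
      using parseval_some_onb(2) by (auto simp: summable_on_def)
    show "(\<lambda>e. (norm x)\<^sup>2 * (norm (op_adj T e))\<^sup>2) summable_on some_onb"
      using op_adj_HS[OF T] by (intro summable_on_cmult_right) (auto simp: HS_iff)
    show "(cmod (cinner (T x) e))\<^sup>2 \<le> (norm x)\<^sup>2 * (norm (op_adj T e))\<^sup>2" for e
      unfolding cinner_op_adj[OF cT] power_mult_distrib[symmetric]
      by (intro power_mono l2.ip_Cauchy_Schwarz) simp
  qed
  also have "\<dots> = (norm x)\<^sup>2 * (norm S)\<^sup>2"
    by (simp add: infsum_cmult_right' infsum_norm_op_adj[OF T, unfolded T_def] norm_hs_power2 T_def)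
  finally have "(norm (T x))\<^sup>2 \<le> (norm S * norm x)\<^sup>2"
    by (simp add: power_mult_distrib mult.commute)
  then show "norm (hs_op S x) \<le> norm S * norm x"
    unfolding T_def by (rule power2_le_imp_le) simp
qed simp

text \<open>The operator norm limit \<open>L\<close> is tested on finitely many basis vectors: the
  bounds for \<open>X n - X m\<close> survive \<open>m\<close> tending to infinity, and being
  uniform in the finite set they bound the Hilbert-Schmidt distance from \<open>X n\<close> to
  \<open>L\<close>.\<close>

instance hs :: (euclidean_space) complete_space
proof
  fix X :: "nat \<Rightarrow> 'a hs"
  assume X: "Cauchy X"
  have le: "norm (hs_op (X m) - hs_op (X n)) \<le> norm (X m - X n)" for m n
    using norm_hs_op_le[of "X m - X n"] by (simp add: minus_hs.rep_eq)
  have "Cauchy (\<lambda>n. hs_op (X n))"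
  proof (rule CauchyI)
    fix e :: real assume "0 < e"
    then show "\<exists>M. \<forall>m\<ge>M. \<forall>n\<ge>M. norm (hs_op (X m) - hs_op (X n)) < e"
      using CauchyD[OF X] le order_le_less_trans by meson
  qed
  then obtain L where L: "(\<lambda>n. hs_op (X n)) \<longlonglongrightarrow> L"
    using Cauchy_convergent convergent_def by blast
  have L': "(\<lambda>n. hs_op (X n) x) \<longlonglongrightarrow> L x" for x
    by (rule tendsto_intros L)+
  have cL: "clinear L"
    unfolding clinear_def
  proof (intro allI)
    fix c x
    have "(\<lambda>n. hs_op (X n) (c *\<^sub>C x)) \<longlonglongrightarrow> c *\<^sub>C L x"
    proof -
      have "hs_op (X n) (c *\<^sub>C x) = c *\<^sub>C hs_op (X n) x" for n
        using HS_clinear[OF hs_op_HS[of "X n"]] by (simp add: clinear_def)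
      then show ?thesis
        using bounded_linear.tendsto[OF bounded_linear_scaleC L'[of x], of c] by simp
    qed
    then show "L (c *\<^sub>C x) = c *\<^sub>C L x"
      using L' LIMSEQ_unique by blast
  qed
  have fin: "(\<Sum>e\<in>F. (norm ((hs_op (X n) - L) e))\<^sup>2) \<le> d\<^sup>2"
    if N: "\<forall>m\<ge>N. \<forall>n\<ge>N. norm (X m - X n) < d" "N \<le> n" and F: "finite F" "F \<subseteq> some_onb" for N n d F
  proof (rule tendsto_upperbound)
    show "(\<lambda>m. \<Sum>e\<in>F. (norm (hs_op (X n) e - hs_op (X m) e))\<^sup>2) \<longlonglongrightarrow> (\<Sum>e\<in>F. (norm ((hs_op (X n) - L) e))\<^sup>2)"
      unfolding blinfun.diff_left by (intro tendsto_intros L')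
    show "\<forall>\<^sub>F m in sequentially. (\<Sum>e\<in>F. (norm (hs_op (X n) e - hs_op (X m) e))\<^sup>2) \<le> d\<^sup>2"
      using eventually_ge_at_top[of N]
    proof eventually_elim
      fix m assume "N \<le> m"
      have "(\<Sum>e\<in>F. (norm (hs_op (X n) e - hs_op (X m) e))\<^sup>2) = (\<Sum>e\<in>F. (norm (hs_op (X n - X m) e))\<^sup>2)"
        by (simp add: minus_hs.rep_eq blinfun.diff_left)
      also have "\<dots> \<le> (\<Sum>\<^sub>\<infinity>e\<in>some_onb. (norm (hs_op (X n - X m) e))\<^sup>2)"
        using hs_op_HS[of "X n - X m"] F by (intro finite_sum_le_infsum) (auto simp: HS_iff)
      also have "\<dots> = (norm (X n - X m))\<^sup>2"
        by (simp add: norm_hs_power2)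
      also have "\<dots> \<le> d\<^sup>2"
        by (rule power_mono) (use N \<open>N \<le> m\<close> in \<open>auto intro: less_imp_le\<close>)
      finally show "(\<Sum>e\<in>F. (norm (hs_op (X n) e - hs_op (X m) e))\<^sup>2) \<le> d\<^sup>2" .
    qed
  qed simp
  have cd: "clinear (hs_op (X n) - L)" for n
    using cL HS_clinear[OF hs_op_HS, of "X n"] by (simp add: clinear_def blinfun.diff_left l2.sc_diff_right)
  obtain N where N: "\<forall>m\<ge>N. \<forall>n\<ge>N. norm (X m - X n) < 1"
    using CauchyD[OF X, of 1] by auto
  have "hs_op (X N) - L \<in> HS"
    unfolding HS_iff using cd nonneg_summable_bound(1)[OF _ fin[OF N order_refl]] by auto
  then have LHS: "L \<in> HS"
    using HS_minus[OF hs_op_HS[of "X N"]] by fastforce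
  then have opL: "hs_op (Abs_hs L) = L"
    by (rule Abs_hs_inverse)
  have "X \<longlonglongrightarrow> Abs_hs L"
  proof (rule LIMSEQ_I)
    fix e :: real assume "0 < e"
    then obtain N where N: "\<forall>m\<ge>N. \<forall>n\<ge>N. norm (X m - X n) < e/2"
      using CauchyD[OF X, of "e/2"] by auto
    show "\<exists>N. \<forall>n\<ge>N. norm (X n - Abs_hs L) < e"
    proof (intro exI allI impI)
      fix n assume "N \<le> n"
      have "(norm (X n - Abs_hs L))\<^sup>2 \<le> (e/2)\<^sup>2"
        unfolding norm_hs_power2 minus_hs.rep_eq opL
        by (rule nonneg_summable_bound(2)[OF _ fin[OF N \<open>N \<le> n\<close>]]) auto
      then have "norm (X n - Abs_hs L) \<le> e/2"
        by (rule power2_le_imp_le) (use \<open>0 < e\<close> in simp)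
      then show "norm (X n - Abs_hs L) < e"
        using \<open>0 < e\<close> by simp
    qed
  qed
  then show "convergent X"
    by (auto simp: convergent_def)
qed

instance hs :: (euclidean_space) banach ..

interpretation hs: complex_hilbert "hs_scaleC :: complex \<Rightarrow> 'a::euclidean_space hs \<Rightarrow> 'a hs" hs_cinner
proof
  fix S T R :: "'a hs" and c d :: complex and r :: real
  show "hs_scaleC (complex_of_real r) S = r *\<^sub>R S"
    by transfer (rule scaleR_op[symmetric])
  show "hs_scaleC c (S + T) = hs_scaleC c S + hs_scaleC c T"
    by transfer (rule blinfun_eqI, simp add: scaleC_op_apply blinfun.add_left l2.sc_add_right)
  show "hs_scaleC (c + d) S = hs_scaleC c S + hs_scaleC d S"
    by transfer (rule blinfun_eqI, simp add: scaleC_op_apply blinfun.add_left l2.sc_add_left)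
  show "hs_scaleC c (hs_scaleC d S) = hs_scaleC (c * d) S"
    by transfer (rule blinfun_eqI, simp add: scaleC_op_apply l2.sc_assoc)
  show "hs_cinner (S + T) R = hs_cinner S R + hs_cinner T R"
    by transfer (rule hs_inner_add_left)
  show "hs_cinner (hs_scaleC c S) T = c * hs_cinner S T"
    by transfer (rule hs_inner_scaleC_left)
  show "hs_cinner T S = cnj (hs_cinner S T)"
    by transfer (rule hs_inner_commute)
  show "Re (hs_cinner S T) = inner S T"
    by (simp add: inner_hs_def)
qed

subsection \<open>Translations of operators\<close>

lemma clinear_tf_shift: "clinear (tf_shift z)"
  unfolding clinear_def tf_shift_apply
  by (intro allI, transfer) (auto simp: l2_rel_def mult.left_commute
      intro!: square_integrable_cmult square_integrable_tf_shift)

lemma norm_tf_shift: "norm (tf_shift z f) = norm f"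
proof -
  have "cinner (tf_shift_l2 z f) (tf_shift_l2 z f) = cinner f f"
  proof transfer
    fix z :: "'a phase" and f :: "'a \<Rightarrow> complex"
    assume "l2_rel f f"
    then have "complex_of_real (\<integral>t. (cmod (cis (2 * pi * (snd z \<bullet> t)) * f (t - fst z)))\<^sup>2 \<partial>lborel) =
        complex_of_real (\<integral>t. (cmod (f t))\<^sup>2 \<partial>lborel)"
      by (simp only: integral_tf_shift l2_rel_def)
    then show "(\<integral>t. cis (2 * pi * (snd z \<bullet> t)) * f (t - fst z) *
          cnj (cis (2 * pi * (snd z \<bullet> t)) * f (t - fst z)) \<partial>lborel) =
        (\<integral>t. f t * cnj (f t) \<partial>lborel)"
      by (simp only: integral_complex_of_real[symmetric] complex_norm_square)
  qed
  then show ?thesis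
    by (simp add: tf_shift_apply norm_eq_sqrt_inner inner_l2_def)
qed

text \<open>Time-frequency shifts form only a projective representation: the phase arises because
  the modulation of the inner shift is evaluated at \<open>t - fst z\<close>. It cancels in the
  conjugation \<open>op_translate\<close>.\<close>

lemma tf_shift_tf_shift:
  "tf_shift z (tf_shift w f) = cis (- 2 * pi * (snd w \<bullet> fst z)) *\<^sub>C tf_shift (z + w) f"
  unfolding tf_shift_apply
proof transfer
  fix z w :: "'a phase" and f :: "'a \<Rightarrow> complex"
  assume "l2_rel f f"
  then have f: "square_integrable lborel f" by (simp add: l2_rel_def)
  have "cis (2 * pi * (snd z \<bullet> t)) * (cis (2 * pi * (snd w \<bullet> (t - fst z))) * f (t - fst z - fst w)) =
      cis (- 2 * pi * (snd w \<bullet> fst z)) * (cis (2 * pi * (snd (z + w) \<bullet> t)) * f (t - fst (z + w)))" for t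
  proof -
    have "2 * pi * (snd z \<bullet> t) + 2 * pi * (snd w \<bullet> (t - fst z)) =
        - 2 * pi * (snd w \<bullet> fst z) + 2 * pi * (snd (z + w) \<bullet> t)"
      by (simp add: inner_diff_right inner_add_left algebra_simps)
    then show ?thesis
      by (simp only: mult.assoc[symmetric] cis_mult) (simp add: diff_diff_add)
  qed
  then show "l2_rel (\<lambda>t. cis (2 * pi * (snd z \<bullet> t)) * (cis (2 * pi * (snd w \<bullet> (t - fst z))) * f (t - fst z - fst w)))
      (\<lambda>t. cis (- 2 * pi * (snd w \<bullet> fst z)) * (cis (2 * pi * (snd (z + w) \<bullet> t)) * f (t - fst (z + w))))"
    using f square_integrable_tf_shift[OF f, of "snd (z + w)" "fst (z + w)"]
    by (simp add: l2_rel_def square_integrable_cmult)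
qed

lemma tf_shift_zero: "tf_shift 0 f = f"
  unfolding tf_shift_apply by transfer (simp add: l2_rel_def)

text \<open>By polarisation the isometry preserves the real inner product, and multiplying one
  argument by the imaginary unit recovers the imaginary part of \<open>cinner\<close>.\<close>

lemma op_adj_tf_shift: "op_adj (tf_shift z) (tf_shift z f) = f"
proof (rule cinner_ext)
  fix g
  have 1: "inner (tf_shift z x) (tf_shift z y) = inner x y" for x y
    by (simp add: dot_norm norm_tf_shift flip: blinfun.add_right)
  have "cinner (tf_shift z x) (tf_shift z y) = cinner x y" for x y
  proof (rule complex_eqI)
    show "Re (cinner (tf_shift z x) (tf_shift z y)) = Re (cinner x y)"
      by (simp add: l2.Re_ip 1)
    have Im: "Im (cinner x y) = inner x (\<i> *\<^sub>C y)" for x y :: "'a l2"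
      by (simp add: l2.Re_ip[symmetric] l2.ip_sc_right)
    have "\<i> *\<^sub>C tf_shift z y = tf_shift z (\<i> *\<^sub>C y)"
      using clinear_tf_shift[of z] by (simp add: clinear_def)
    then show "Im (cinner (tf_shift z x) (tf_shift z y)) = Im (cinner x y)"
      unfolding Im by (simp add: 1)
  qed
  then show "cinner g (op_adj (tf_shift z) (tf_shift z f)) = cinner g f"
    by (simp add: cinner_op_adj[OF clinear_tf_shift, symmetric])
qed

text \<open>A left inverse of a surjection is also a right inverse; every \<open>f\<close> lies in
  the range because shifting by \<open>- z\<close> and then by \<open>z\<close> only multiplies by a
  phase.\<close>

lemma tf_shift_op_adj: "tf_shift z (op_adj (tf_shift z) f) = f"
proof -
  define c where "c = cis (- 2 * pi * (snd (- z) \<bullet> fst z))"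
  have "tf_shift z (cnj c *\<^sub>C tf_shift (- z) f) = cnj c *\<^sub>C c *\<^sub>C f"
    using clinear_tf_shift[of z] tf_shift_tf_shift[of z "- z" f]
    by (simp add: clinear_def c_def tf_shift_zero)
  also have "\<dots> = f"
    by (simp add: l2.sc_assoc c_def cis_cnj cis_mult)
  finally obtain h where "f = tf_shift z h"
    by metis
  then show ?thesis
    by (simp add: op_adj_tf_shift)
qed

lemma op_translate_apply: "op_translate z S f = tf_shift z (S (op_adj (tf_shift z) f))"
  by (simp add: op_translate_def)

lemma clinear_op_translate: "clinear S \<Longrightarrow> clinear (op_translate z S)"
  unfolding op_translate_def by (intro clinear_compose clinear_op_adj clinear_tf_shift)

text \<open>The isometry on the left does not change the norms of values. The factor on the right of
  \<open>S\<close> may change them one by one, but taking adjoints moves it to the left, and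
  adjoints keep the Hilbert-Schmidt norm.\<close>

lemma
  assumes S: "S \<in> HS"
  shows op_translate_HS: "op_translate z S \<in> HS"
    and infsum_norm_op_translate:
      "(\<Sum>\<^sub>\<infinity>e\<in>some_onb. (norm (op_translate z S e))\<^sup>2) = (\<Sum>\<^sub>\<infinity>e\<in>some_onb. (norm (S e))\<^sup>2)"
proof -
  note cS = HS_clinear[OF S]
  define R where "R = S o\<^sub>L op_adj (tf_shift z)"
  have cR: "clinear R"
    unfolding R_def by (intro clinear_compose clinear_op_adj clinear_tf_shift cS)
  have adjR: "op_adj R = tf_shift z o\<^sub>L op_adj S"
    unfolding R_def by (simp add: op_adj_compose cS clinear_op_adj clinear_tf_shift op_adj_op_adj)
  have nR: "norm (op_adj R e) = norm (op_adj S e)" for e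
    by (simp add: adjR norm_tf_shift)
  have aR: "op_adj R \<in> HS"
    using op_adj_HS[OF S] clinear_op_adj[OF cR] by (simp add: HS_iff nR)
  have RHS: "R \<in> HS"
    using op_adj_HS[OF aR] by (simp add: op_adj_op_adj[OF cR])
  have nT: "norm (op_translate z S e) = norm (R e)" for e
    by (simp add: op_translate_apply R_def norm_tf_shift)
  show "op_translate z S \<in> HS"
    using RHS clinear_op_translate[OF cS] by (simp add: HS_iff nT)
  show "(\<Sum>\<^sub>\<infinity>e\<in>some_onb. (norm (op_translate z S e))\<^sup>2) = (\<Sum>\<^sub>\<infinity>e\<in>some_onb. (norm (S e))\<^sup>2)"
    unfolding nT infsum_norm_op_adj[OF RHS, symmetric] nR by (rule infsum_norm_op_adj[OF S])
qed

text \<open>The scalars that arise on the two sides of \<open>S\<close> are conjugate and cancel by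
  complex linearity of \<open>S\<close>. Thus translations of operators are a genuine group action,
  and lattice translations permute the lattice translates of a family.\<close>

lemma op_translate_op_translate:
  assumes cS: "clinear S"
  shows "op_translate z (op_translate w S) = op_translate (z + w) S"
proof (rule blinfun_eqI)
  fix f
  define c where "c = cis (- 2 * pi * (snd w \<bullet> fst z))"
  have cc: "c * cnj c = 1"
    by (simp add: c_def cis_cnj cis_mult)
  define h where "h = op_adj (tf_shift (z + w)) f"
  have "tf_shift z (tf_shift w (cnj c *\<^sub>C h)) = (c * cnj c) *\<^sub>C tf_shift (z + w) h"
    using clinear_tf_shift[of "z + w"] by (simp add: tf_shift_tf_shift c_def clinear_def l2.sc_assoc)
  then have f: "f = tf_shift z (tf_shift w (cnj c *\<^sub>C h))"
    by (simp add: cc h_def tf_shift_op_adj)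
  have "op_translate z (op_translate w S) f = tf_shift z (tf_shift w (S (cnj c *\<^sub>C h)))"
    unfolding op_translate_apply by (subst f) (simp add: op_adj_tf_shift)
  also have "\<dots> = (c * cnj c) *\<^sub>C tf_shift (z + w) (S h)"
    using cS clinear_tf_shift[of "z + w"] by (simp add: tf_shift_tf_shift c_def clinear_def l2.sc_assoc)
  finally show "op_translate z (op_translate w S) f = op_translate (z + w) S f"
    by (simp add: cc op_translate_apply h_def)
qed

lemma op_translate_zero: "op_translate 0 S = (S :: 'a::euclidean_space op)"
proof (rule blinfun_eqI)
  fix f :: "'a l2"
  have "op_adj (tf_shift 0) f = f"
    using op_adj_tf_shift[of 0 f] by (simp add: tf_shift_zero)
  then show "op_translate 0 S f = S f"
    by (simp add: op_translate_apply tf_shift_zero)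
qed

lift_definition hs_translate :: "'a::euclidean_space phase \<Rightarrow> 'a hs \<Rightarrow> 'a hs" is op_translate
  by (rule op_translate_HS)

lemma hs_translate_add: "hs_translate z (S + T) = hs_translate z S + hs_translate z T"
  by transfer (rule blinfun_eqI, simp add: op_translate_apply blinfun.add_left blinfun.add_right)

lemma hs_translate_scaleC: "hs_translate z (hs_scaleC c S) = hs_scaleC c (hs_translate z S)"
proof transfer
  show "op_translate z (c *\<^sub>O S) = c *\<^sub>O op_translate z S" for z :: "'a phase" and c S
    using clinear_tf_shift[of z]
    by (intro blinfun_eqI) (simp add: op_translate_apply scaleC_op_apply clinear_def)
qed

lemma norm_hs_translate: "norm (hs_translate z S) = norm S"
proof -
  have "(norm (hs_translate z S))\<^sup>2 = (norm S)\<^sup>2"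
    unfolding norm_hs_power2 by transfer (rule infsum_norm_op_translate)
  then show ?thesis by simp
qed

lemma hs_translate_translate: "hs_translate z (hs_translate w S) = hs_translate (z + w) S"
  by transfer (rule op_translate_op_translate[OF HS_clinear])

lemma hs_translate_zero: "hs_translate 0 S = S"
  by transfer (rule op_translate_zero)

lemma bounded_linear_hs_translate: "bounded_linear (hs_translate z)"
  by (rule bounded_linear_intro[where K = 1])
    (simp_all add: hs_translate_add norm_hs_translate hs_translate_scaleC flip: hs.sc_of_real)

subsection \<open>Transfer of the series notions\<close>

lemma hs_op_sum: "hs_op (\<Sum>i\<in>F. g i) = (\<Sum>i\<in>F. hs_op (g i))"
  by (induction F rule: infinite_finite_induct) (simp_all add: zero_hs.rep_eq plus_hs.rep_eq)

lemma hs_has_sum_iff: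
  assumes "\<And>i. i \<in> I \<Longrightarrow> G i = hs_op (g i)"
  shows "hs_has_sum G I (hs_op x) \<longleftrightarrow> (g has_sum x) I"
proof -
  have "hs_norm (hs_op x - (\<Sum>i\<in>F. G i)) = dist (\<Sum>i\<in>F. g i) x" if "F \<subseteq> I" for F
  proof -
    have "(\<Sum>i\<in>F. G i) = hs_op (\<Sum>i\<in>F. g i)"
      using assms that unfolding hs_op_sum by (intro sum.cong) auto
    then show ?thesis
      by (simp add: dist_norm norm_minus_commute minus_hs.rep_eq[symmetric] hs_norm_eq)
  qed
  then have "((\<lambda>F. hs_norm (hs_op x - (\<Sum>i\<in>F. G i))) \<longlongrightarrow> 0) (finite_subsets_at_top I) \<longleftrightarrow>
      ((\<lambda>F. dist (\<Sum>i\<in>F. g i) x) \<longlongrightarrow> 0) (finite_subsets_at_top I)"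
    by (intro tendsto_cong eventually_finite_subsets_at_top_weakI) simp
  then show ?thesis
    using assms unfolding hs_has_sum_def has_sum_def
    by (simp add: hs_op_HS tendsto_dist_iff[of "sum g"])
qed

lemma hs_closed_span_eq:
  assumes "\<And>i. i \<in> I \<Longrightarrow> G i = hs_op (g i)"
  shows "hs_closed_span I G = hs_op ` hs.closed_span I g"
proof -
  have "hs_norm (hs_op x - (\<Sum>i\<in>F. c i *\<^sub>O G i)) = norm (x - (\<Sum>i\<in>F. hs_scaleC (c i) (g i)))"
    if "F \<subseteq> I" for F x c
  proof -
    have "(\<Sum>i\<in>F. c i *\<^sub>O G i) = hs_op (\<Sum>i\<in>F. hs_scaleC (c i) (g i))"
      using assms that unfolding hs_op_sum by (intro sum.cong) (auto simp: hs_scaleC.rep_eq)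
    then show ?thesis
      by (simp add: minus_hs.rep_eq[symmetric] hs_norm_eq)
  qed
  then have "hs_op x \<in> hs_closed_span I G \<longleftrightarrow> x \<in> hs.closed_span I g" for x
    unfolding hs_closed_span_def hs.closed_span_def by (simp add: hs_op_HS cong: conj_cong)
  moreover have "\<exists>x. T = hs_op x" if "T \<in> hs_closed_span I G" for T
    using that unfolding hs_closed_span_def by (metis (no_types, lifting) mem_Collect_eq Abs_hs_inverse)
  ultimately show ?thesis
    by (intro set_eqI) (metis image_iff)
qed

lemma hs_op_Abs_hs: "T \<in> HS \<Longrightarrow> hs_op (Abs_hs T) = T"
  by (rule Abs_hs_inverse)

lemma hs_op_eq_iff: "hs_op x = hs_op y \<longleftrightarrow> x = y"
  by (rule hs_op_inject)

text \<open>The orthonormal basis and the bijection are pulled back along \<open>hs_op\<close>, so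
  that \<open>Riesz_basis_bounds\<close> applies. The basis \<open>E\<close> is kept in the
  conclusion because dual frames are built on a space presented by an orthonormal basis.\<close>

lemma hs_riesz_sequence_bounds:
  fixes g :: "'i \<Rightarrow> 'a::euclidean_space hs"
  assumes "hs_riesz_sequence I (\<lambda>i. hs_op (g i))"
  obtains E a b where "hs.orthonormal I E" "hs.closed_span I E = hs.closed_span I g" "0 < a" "0 < b"
    "\<And>c. c \<in> ell2 I \<Longrightarrow> \<exists>x\<in>hs.closed_span I g. ((\<lambda>i. hs_scaleC (c i) (g i)) has_sum x) I"
    "\<And>c x. c \<in> ell2 I \<Longrightarrow> ((\<lambda>i. hs_scaleC (c i) (g i)) has_sum x) I \<Longrightarrow>
      a * (\<Sum>\<^sub>\<infinity>i\<in>I. (cmod (c i))\<^sup>2) \<le> (norm x)\<^sup>2 \<and> (norm x)\<^sup>2 \<le> b * (\<Sum>\<^sub>\<infinity>i\<in>I. (cmod (c i))\<^sup>2)"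
    "\<And>x. x \<in> hs.closed_span I g \<Longrightarrow> \<exists>c\<in>ell2 I. ((\<lambda>i. hs_scaleC (c i) (g i)) has_sum x) I"
proof -
  define W where "W = hs_closed_span I (\<lambda>i. hs_op (g i))"
  define V where "V = hs.closed_span I g"
  have WV: "W = hs_op ` V"
    unfolding W_def V_def by (rule hs_closed_span_eq) simp
  obtain E' U' where E': "hs_onb W I E'" and lin: "hs_bounded_linear_on W U'" and bij: "bij_betw U' W W"
      and G: "\<And>i. i \<in> I \<Longrightarrow> hs_op (g i) = U' (E' i)"
    using assms unfolding hs_riesz_sequence_def hs_riesz_basis_def W_def by blast
  define E where "E i = Abs_hs (E' i)" for i
  \<comment> \<open>\<open>Abs_hs\<close> is meaningful only on \<open>HS\<close>, so
    \<open>U\<close> is claimed to mirror \<open>U'\<close> on \<open>V\<close> alone.\<close>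
  define U where "U x = Abs_hs (U' (hs_op x))" for x
  have EE: "E' i = hs_op (E i)" if "i \<in> I" for i
    using E' that by (simp add: hs_onb_def E_def hs_op_Abs_hs)
  have UW: "U' (hs_op x) \<in> W" if "x \<in> V" for x
    using bij that by (auto simp: WV bij_betw_def)
  have UU: "hs_op (U x) = U' (hs_op x)" if "x \<in> V" for x
    using UW[OF that] by (auto simp: U_def WV hs_op_inverse)
  have on: "hs.orthonormal I E"
    using E' by (auto simp: hs_onb_def hs.orthonormal_def hs_cinner.rep_eq EE[symmetric])
  have "hs_op ` hs.closed_span I E = hs_op ` V"
    using E' hs_closed_span_eq[of I E' E] EE by (simp add: hs_onb_def WV)
  then have cs: "V = hs.closed_span I E"
    by (metis inj_image_eq_iff hs_op_eq_iff injI)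
  have csubspace_V: "hs.csubspace V"
    by (simp add: V_def hs.csubspace_closed_span)
  obtain K where K: "\<And>T. T \<in> W \<Longrightarrow> hs_norm (U' T) \<le> K * hs_norm T"
    using lin unfolding hs_bounded_linear_on_def by blast
  have add: "U (x + y) = U x + U y" if "x \<in> V" "y \<in> V" for x y
  proof -
    have "hs_op (U (x + y)) = hs_op (U x + U y)"
      using lin that hs.csubspace_add[OF csubspace_V that]
      by (simp add: UU plus_hs.rep_eq hs_bounded_linear_on_def WV)
    then show ?thesis by (simp only: hs_op_eq_iff)
  qed
  have scale: "U (hs_scaleC c x) = hs_scaleC c (U x)" if "x \<in> V" for x c
  proof -
    have "hs_op (U (hs_scaleC c x)) = hs_op (hs_scaleC c (U x))"
      using lin that hs.csubspace_sc[OF csubspace_V that]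
      by (simp add: UU hs_scaleC.rep_eq hs_bounded_linear_on_def WV)
    then show ?thesis by (simp only: hs_op_eq_iff)
  qed
  have bnd: "norm (U x) \<le> K * norm x" if "x \<in> V" for x
    using K[of "hs_op x"] that by (simp add: hs_norm_eq[symmetric] UU WV)
  have bijU: "bij_betw U V V"
    unfolding bij_betw_def
  proof
    show "inj_on U V"
      using bij UU unfolding WV by (auto simp: inj_on_def bij_betw_def hs_op_eq_iff) (metis hs_op_eq_iff)
    have "hs_op ` U ` V = U' ` hs_op ` V"
      unfolding image_image by (rule image_cong) (simp_all add: UU)
    also have "\<dots> = hs_op ` V"
      using bij by (simp add: bij_betw_def WV)
    finally show "U ` V = V"
      by (metis inj_image_eq_iff hs_op_eq_iff injI)
  qed
  have gU: "g i = U (E i)" if "i \<in> I" for i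
    using G[OF that] EE[OF that] by (simp add: U_def) (metis hs_op_inverse)
  show thesis
  proof (rule hs.Riesz_basis_bounds[OF on cs add scale bnd bijU gU])
    fix a b :: real
    assume *: "0 < a" "0 < b" "\<And>c. c \<in> ell2 I \<Longrightarrow> \<exists>x\<in>V. ((\<lambda>i. hs_scaleC (c i) (g i)) has_sum x) I"
      "\<And>c x. c \<in> ell2 I \<Longrightarrow> ((\<lambda>i. hs_scaleC (c i) (g i)) has_sum x) I \<Longrightarrow>
        a * (\<Sum>\<^sub>\<infinity>i\<in>I. (cmod (c i))\<^sup>2) \<le> (norm x)\<^sup>2 \<and> (norm x)\<^sup>2 \<le> b * (\<Sum>\<^sub>\<infinity>i\<in>I. (cmod (c i))\<^sup>2)"
      "\<And>x. x \<in> V \<Longrightarrow> \<exists>c\<in>ell2 I. ((\<lambda>i. hs_scaleC (c i) (g i)) has_sum x) I"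
    show thesis
      by (rule that[OF on cs[symmetric, unfolded V_def] *[unfolded V_def]])
  qed
qed

section \<open>Fourier series on the dual group of a lattice\<close>

lemma l2_dist_add:
  assumes "square_integrable M f" "square_integrable M f'" "square_integrable M g" "square_integrable M g'"
  shows "l2_dist M (\<lambda>x. f x + g x) (\<lambda>x. f' x + g' x) \<le> l2_dist M f f' + l2_dist M g g'"
proof -
  have "l2_dist M (\<lambda>x. f x + g x) (\<lambda>x. f' x + g' x) \<le>
      l2_dist M (\<lambda>x. f x + g x) (\<lambda>x. f' x + g x) + l2_dist M (\<lambda>x. f' x + g x) (\<lambda>x. f' x + g' x)"
    by (intro l2_dist_triangle square_integrable_add assms)
  then show ?thesis
    by (simp add: l2_dist_def)
qed

lemma l2_dist_cmult: "l2_dist M (\<lambda>x. k * f x) (\<lambda>x. k * g x) = cmod k * l2_dist M f g"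
proof -
  have "(\<integral>x. (cmod (k * f x - k * g x))\<^sup>2 \<partial>M) = (cmod k)\<^sup>2 * (\<integral>x. (cmod (f x - g x))\<^sup>2 \<partial>M)"
    by (simp add: norm_mult power_mult_distrib flip: right_diff_distrib)
  then show ?thesis
    by (simp add: l2_dist_def real_sqrt_mult)
qed

lemma sympl_add_left: "sympl (l + m) z = sympl l z + sympl m z"
  and sympl_add_right: "sympl l (z + w) = sympl l z + sympl l w"
  and sympl_scaleR_left: "sympl (r *\<^sub>R l) z = r * sympl l z"
  and sympl_scaleR_right: "sympl l (r *\<^sub>R z) = r * sympl l z"
  and sympl_swap: "sympl l z = - sympl z l"
  and sympl_zero: "sympl 0 z = 0"
  by (simp_all add: sympl_def inner_add_left inner_add_right inner_commute algebra_simps)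

section \<open>Characters and trigonometric polynomials on the dual group\<close>

text \<open>The character of the dual group attached to \<open>l\<close>, read off at the same
  chosen representative as in \<open>fourier_series_l1\<close>. For \<open>l\<close> in the lattice
  the choice is immaterial by \<open>chr_coset\<close>.\<close>

definition chr :: "'a::euclidean_space phase \<Rightarrow> 'a phase set \<Rightarrow> complex" where
  "chr l \<xi> = cis (2 * pi * sympl l (SOME z. z \<in> \<xi>))"

lemma chr_zero: "chr 0 \<xi> = 1"
  by (simp add: chr_def sympl_zero)

lemma chr_add: "chr (l + m) \<xi> = chr l \<xi> * chr m \<xi>"
  by (simp add: chr_def sympl_add_left cis_mult distrib_left)

lemma norm_chr [simp]: "cmod (chr l \<xi>) = 1"
  by (simp add: chr_def)

lemma chr_minus: "chr (- l) \<xi> = cnj (chr l \<xi>)"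
proof -
  have "sympl (- l) z = - sympl l z" for z
    by (simp add: sympl_def)
  then show ?thesis
    by (simp add: chr_def cis_cnj)
qed

lemma chr_diff: "chr (l - m) \<xi> = chr l \<xi> * cnj (chr m \<xi>)"
  using chr_add[of l "- m" \<xi>] by (simp add: chr_minus)

definition trig_poly :: "('a::euclidean_space phase \<Rightarrow> complex) \<Rightarrow> 'a phase set \<Rightarrow> 'a phase set \<Rightarrow> complex" where
  "trig_poly c X \<xi> = (\<Sum>l\<in>X. c l * chr l \<xi>)"

text \<open>The sigma-algebra of the quotient is the largest one that makes \<open>coset L\<close>
  measurable, so measurability can be tested after composition with it.\<close>

lemma borel_measurable_haarI:
  fixes f :: "_ \<Rightarrow> 'c::topological_space"
  assumes L: "full_rank_lattice L" and f: "(\<lambda>z. f (coset L z)) \<in> borel_measurable borel"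
  shows "f \<in> borel_measurable (haar L)"
proof (rule measurableI)
  fix B :: "'c set" assume B: "B \<in> sets borel"
  have sp: "space (haar L) = range (coset L)"
    using sets_eq_imp_space_eq[OF sets_haar[OF L]] by (simp add: space_quotient_borel)
  have "coset L -` (f -` B \<inter> range (coset L)) = (\<lambda>z. f (coset L z)) -` B \<inter> space borel"
    by auto
  also have "\<dots> \<in> sets borel"
    by (rule measurable_sets[OF f B])
  finally show "f -` B \<inter> space (haar L) \<in> sets (haar L)"
    unfolding sets_haar[OF L] sets_quotient_borel sp by blast
qed simp

locale lattice =
  fixes \<Lambda> :: "'a::euclidean_space phase set"
  assumes lattice: "full_rank_lattice \<Lambda>"
begin

abbreviation \<mu> :: "'a phase set measure" where "\<mu> \<equiv> dual_haar \<Lambda>"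

sublocale dual: prob_space \<mu>
  by (rule prob_space_haar[OF full_rank_lattice_adjoint[OF lattice]])

lemma space_dual: "space \<mu> = range (coset (adjoint_lattice \<Lambda>))"
  using sets_eq_imp_space_eq[OF sets_haar[OF full_rank_lattice_adjoint[OF lattice]]]
  by (simp add: space_quotient_borel)

lemma
  shows lattice_zero: "0 \<in> \<Lambda>"
    and lattice_add: "\<And>l m. l \<in> \<Lambda> \<Longrightarrow> m \<in> \<Lambda> \<Longrightarrow> l + m \<in> \<Lambda>"
    and lattice_minus: "\<And>l. l \<in> \<Lambda> \<Longrightarrow> - l \<in> \<Lambda>"
proof -
  obtain C :: "'a phase \<Rightarrow> 'a phase" where C: "linear C" "\<Lambda> = C ` int_points"
    using lattice by (auto simp: full_rank_lattice_def)
  have "0 \<in> (int_points :: 'a phase set)" and add: "\<And>a b. a \<in> int_points \<Longrightarrow> b \<in> int_points \<Longrightarrow> a + b \<in> (int_points :: 'a phase set)"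
    and minus: "\<And>a. a \<in> int_points \<Longrightarrow> - a \<in> (int_points :: 'a phase set)"
    by (auto simp: int_points_def inner_add_left)
  then show "0 \<in> \<Lambda>"
    unfolding C(2) using linear_0[OF C(1)] by force
  show "l + m \<in> \<Lambda>" if lm: "l \<in> \<Lambda>" "m \<in> \<Lambda>" for l m
  proof -
    obtain a b where "l = C a" "m = C b" "a \<in> int_points" "b \<in> int_points"
      using lm C(2) by auto
    then show ?thesis
      using add[of a b] C(2) linear_add[OF C(1), of a b] by (metis imageI)
  qed
  show "- l \<in> \<Lambda>" if l: "l \<in> \<Lambda>" for l
  proof -
    obtain a where "l = C a" "a \<in> int_points"
      using l C(2) by auto
    then show ?thesis
      using minus[of a] C(2) linear_neg[OF C(1), of a] by (metis imageI)
  qed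
qed

lemma lattice_diff: "l \<in> \<Lambda> \<Longrightarrow> m \<in> \<Lambda> \<Longrightarrow> l - m \<in> \<Lambda>"
  using lattice_add[of l "- m"] lattice_minus by simp

lemma bij_betw_lattice_shift: "k \<in> \<Lambda> \<Longrightarrow> bij_betw (\<lambda>l. l + k) \<Lambda> \<Lambda>"
  by (rule bij_betw_byWitness[where f' = "\<lambda>l. l - k"]) (auto intro: lattice_add lattice_diff)

lemma bij_betw_lattice_reflect: "k \<in> \<Lambda> \<Longrightarrow> bij_betw (\<lambda>l. k - l) \<Lambda> \<Lambda>"
  by (rule bij_betw_byWitness[where f' = "\<lambda>l. k - l"]) (auto intro: lattice_diff)

text \<open>Representatives differ by an element of the adjoint lattice, on which the character of a
  lattice point is trivial; antisymmetry of \<open>sympl\<close> accounts for the reversed order of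
  the arguments in \<open>adjoint_lattice\<close>.\<close>

lemma chr_coset:
  assumes "l \<in> \<Lambda>"
  shows "chr l (coset (adjoint_lattice \<Lambda>) z) = cis (2 * pi * sympl l z)"
proof -
  have "0 \<in> adjoint_lattice \<Lambda>"
    by (simp add: adjoint_lattice_def sympl_zero)
  then have "z \<in> coset (adjoint_lattice \<Lambda>) z"
    by (force simp: coset_def)
  then have "(SOME w. w \<in> coset (adjoint_lattice \<Lambda>) z) \<in> coset (adjoint_lattice \<Lambda>) z"
    by (rule someI)
  then obtain k where k: "k \<in> adjoint_lattice \<Lambda>" "(SOME w. w \<in> coset (adjoint_lattice \<Lambda>) z) = z + k"
    by (auto simp: coset_def)
  have "cis (2 * pi * sympl l k) = cnj (cis (2 * pi * sympl k l))"
    by (subst sympl_swap) (simp add: cis_cnj)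
  then have "cis (2 * pi * sympl l k) = 1"
    using k(1) assms by (simp add: adjoint_lattice_def)
  then show ?thesis
    by (simp add: chr_def k(2) sympl_add_right distrib_left flip: cis_mult)
qed

lemma chr_measurable [measurable]: "l \<in> \<Lambda> \<Longrightarrow> chr l \<in> borel_measurable \<mu>"
proof (rule borel_measurable_haarI[OF full_rank_lattice_adjoint[OF lattice]])
  assume l: "l \<in> \<Lambda>"
  show "(\<lambda>z. chr l (coset (adjoint_lattice \<Lambda>) z)) \<in> borel_measurable borel"
    unfolding chr_coset[OF l] sympl_def by (intro borel_measurable_continuous_onI continuous_intros)
qed

text \<open>For \<open>l \<noteq> 0\<close>, translation by half a period of the character changes
  its sign but not its Haar integral, so the integral is its own negative.\<close>

lemma integral_chr: "l \<in> \<Lambda> \<Longrightarrow> (\<integral>\<xi>. chr l \<xi> \<partial>\<mu>) = (if l = 0 then 1 else 0)"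
proof (cases "l = 0")
  case True
  then show ?thesis
    by (simp add: chr_zero dual.prob_space)
next
  case False
  assume l: "l \<in> \<Lambda>"
  \<comment> \<open>The symplectic rotation of \<open>l\<close> pairs with \<open>l\<close> to the
    squared norm of \<open>l\<close>; the scaling normalises this to 1/2.\<close>
  define w where "w = (1 / (2 * (norm l)\<^sup>2)) *\<^sub>R (snd l, - fst l)"
  have "sympl l (snd l, - fst l) = (norm l)\<^sup>2"
    by (simp add: sympl_def power2_norm_eq_inner inner_prod_def)
  then have w: "sympl l w = 1 / 2"
    using False unfolding w_def sympl_scaleR_right by simp
  have tr: "image ((+) w) \<in> \<mu> \<rightarrow>\<^sub>M \<mu>"
  proof (rule measurableI)
    let ?L = "adjoint_lattice \<Lambda>"
    note sets = sets_haar[OF full_rank_lattice_adjoint[OF lattice]]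
    show "(+) w ` \<xi> \<in> space \<mu>" if "\<xi> \<in> space \<mu>" for \<xi>
      using that unfolding space_dual by (force simp only: coset_translate)
    fix E assume "E \<in> sets \<mu>"
    then have E: "coset ?L -` E \<in> sets borel"
      unfolding sets sets_quotient_borel by blast
    have "coset ?L -` (image ((+) w) -` E \<inter> range (coset ?L)) = (\<lambda>z. w + z) -` (coset ?L -` E) \<inter> space borel"
      by (simp add: set_eq_iff coset_translate rangeI)
    also have "\<dots> \<in> sets borel"
      by (rule measurable_sets[OF _ E]) simp
    finally show "image ((+) w) -` E \<inter> space \<mu> \<in> sets \<mu>"
      unfolding sets sets_quotient_borel space_dual by blast
  qed
  have "(\<integral>\<xi>. chr l \<xi> \<partial>\<mu>) = (\<integral>\<xi>. chr l \<xi> \<partial>distr \<mu> \<mu> (image ((+) w)))"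
    by (simp add: haar_translation_invariant[OF full_rank_lattice_adjoint[OF lattice]])
  also have "\<dots> = (\<integral>\<xi>. chr l ((+) w ` \<xi>) \<partial>\<mu>)"
    by (rule integral_distr[OF tr chr_measurable[OF l]])
  also have "\<dots> = (\<integral>\<xi>. - chr l \<xi> \<partial>\<mu>)"
  proof (rule Bochner_Integration.integral_cong[OF refl])
    fix \<xi> assume "\<xi> \<in> space \<mu>"
    then obtain z where z: "\<xi> = coset (adjoint_lattice \<Lambda>) z"
      by (auto simp: space_dual)
    show "chr l ((+) w ` \<xi>) = - chr l \<xi>"
      unfolding z coset_translate chr_coset[OF l] sympl_add_right w
      by (simp add: distrib_left cis_pi flip: cis_mult)
  qed
  also have "\<dots> = - (\<integral>\<xi>. chr l \<xi> \<partial>\<mu>)"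
    by simp
  finally show ?thesis
    using False by simp
qed

lemma square_integrable_chr: "l \<in> \<Lambda> \<Longrightarrow> square_integrable \<mu> (chr l)"
  by (simp add: square_integrable_def)

lemma square_integrable_chr_mult:
  assumes "l \<in> \<Lambda>" "square_integrable \<mu> f"
  shows "square_integrable \<mu> (\<lambda>\<xi>. chr l \<xi> * f \<xi>)"
  using assms by (auto simp: square_integrable_def norm_mult)

lemma square_integrable_trig_poly: "X \<subseteq> \<Lambda> \<Longrightarrow> square_integrable \<mu> (trig_poly c X)"
  unfolding trig_poly_def
  by (intro square_integrable_sum square_integrable_cmult square_integrable_chr) auto

lemma integral_trig_poly:
  assumes X: "finite X" "X \<subseteq> \<Lambda>"
  shows "(\<integral>\<xi>. (cmod (trig_poly c X \<xi>))\<^sup>2 \<partial>\<mu>) = (\<Sum>l\<in>X. (cmod (c l))\<^sup>2)"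
proof -
  have int: "integrable \<mu> (\<lambda>\<xi>. c l * cnj (c m) * chr (l - m) \<xi>)" if "l \<in> X" "m \<in> X" for l m
  proof (rule dual.integrable_const_bound[where B = "cmod (c l * cnj (c m))"])
    show "(\<lambda>\<xi>. c l * cnj (c m) * chr (l - m) \<xi>) \<in> borel_measurable \<mu>"
      using that X lattice_diff[of l m] by (intro borel_measurable_times borel_measurable_const chr_measurable) auto
  qed (simp add: norm_mult)
  have "complex_of_real (\<integral>\<xi>. (cmod (trig_poly c X \<xi>))\<^sup>2 \<partial>\<mu>) =
      (\<integral>\<xi>. complex_of_real ((cmod (trig_poly c X \<xi>))\<^sup>2) \<partial>\<mu>)"
    by (rule integral_complex_of_real[symmetric])
  also have "\<dots> = (\<integral>\<xi>. (\<Sum>l\<in>X. \<Sum>m\<in>X. c l * cnj (c m) * chr (l - m) \<xi>) \<partial>\<mu>)"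
    unfolding complex_norm_square trig_poly_def chr_diff
    by (simp add: sum_product mult_ac)
  also have "\<dots> = (\<Sum>l\<in>X. \<Sum>m\<in>X. \<integral>\<xi>. c l * cnj (c m) * chr (l - m) \<xi> \<partial>\<mu>)"
    using int by (simp add: Bochner_Integration.integral_sum integrable_sum)
  also have "\<dots> = (\<Sum>l\<in>X. \<Sum>m\<in>X. c l * cnj (c m) * (\<integral>\<xi>. chr (l - m) \<xi> \<partial>\<mu>))"
    by simp
  also have "\<dots> = (\<Sum>l\<in>X. \<Sum>m\<in>X. if l = m then c l * cnj (c m) else 0)"
  proof (intro sum.cong refl)
    fix l m assume "l \<in> X" "m \<in> X"
    then have "l - m \<in> \<Lambda>"
      using X(2) by (intro lattice_diff) (simp_all only: subsetD)
    then show "c l * cnj (c m) * (\<integral>\<xi>. chr (l - m) \<xi> \<partial>\<mu>) = (if l = m then c l * cnj (c m) else 0)"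
      using integral_chr[of "l - m"] by simp
  qed
  also have "\<dots> = complex_of_real (\<Sum>l\<in>X. (cmod (c l))\<^sup>2)"
    using X(1) by (simp add: complex_norm_square[unfolded of_real_power])
  finally show ?thesis
    by (simp only: of_real_eq_iff)
qed

lemma l2_dist_trig_poly_zero:
  assumes "finite X" "X \<subseteq> \<Lambda>"
  shows "l2_dist \<mu> (trig_poly c X) (\<lambda>_. 0) = sqrt (\<Sum>l\<in>X. (cmod (c l))\<^sup>2)"
  using integral_trig_poly[OF assms, of c] by (simp add: l2_dist_def)

lemma l2_dist_trig_poly:
  assumes "finite X" "X \<subseteq> \<Lambda>"
  shows "l2_dist \<mu> (trig_poly c X) (trig_poly d X) = sqrt (\<Sum>l\<in>X. (cmod (c l - d l))\<^sup>2)"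
proof -
  have "trig_poly c X \<xi> - trig_poly d X \<xi> = trig_poly (\<lambda>l. c l - d l) X \<xi>" for \<xi>
    by (simp add: trig_poly_def left_diff_distrib sum_subtractf)
  then show ?thesis
    using integral_trig_poly[OF assms, of "\<lambda>l. c l - d l"] by (simp add: l2_dist_def)
qed

text \<open>The difference has its coefficients on the symmetric difference of \<open>X\<close> and
  \<open>Y\<close>, one part of which avoids \<open>X\<close> and the other
  \<open>Y\<close>.\<close>

lemma l2_dist_trig_poly_diff:
  assumes X: "finite X" "X \<subseteq> \<Lambda>" and Y: "finite Y" "Y \<subseteq> \<Lambda>" and c: "c \<in> ell2 \<Lambda>"
  shows "(l2_dist \<mu> (trig_poly c X) (trig_poly c Y))\<^sup>2 \<le>
      (\<Sum>\<^sub>\<infinity>l\<in>\<Lambda> - X. (cmod (c l))\<^sup>2) + (\<Sum>\<^sub>\<infinity>l\<in>\<Lambda> - Y. (cmod (c l))\<^sup>2)"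
proof -
  define a where "a Z l = (if l \<in> Z then c l else 0)" for Z l
  have ext: "trig_poly (a Z) (X \<union> Y) = trig_poly c Z" if "Z \<subseteq> X \<union> Y" for Z
    unfolding trig_poly_def a_def using that X Y
    by (intro ext sum.mono_neutral_cong_right) auto
  have s: "(\<lambda>l. (cmod (c l))\<^sup>2) summable_on \<Lambda> - Z" for Z
    by (rule summable_on_subset_banach[of _ \<Lambda>]) (use c in \<open>auto simp: ell2_iff\<close>)
  have "(l2_dist \<mu> (trig_poly c X) (trig_poly c Y))\<^sup>2 = (\<Sum>l\<in>X \<union> Y. (cmod (a X l - a Y l))\<^sup>2)"
    using l2_dist_trig_poly[of "X \<union> Y" "a X" "a Y"] X Y by (simp add: ext sum_nonneg)
  also have "\<dots> = (\<Sum>l\<in>(Y - X) \<union> (X - Y). (cmod (c l))\<^sup>2)"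
    unfolding a_def using X Y by (intro sum.mono_neutral_cong_right) auto
  also have "\<dots> = (\<Sum>l\<in>Y - X. (cmod (c l))\<^sup>2) + (\<Sum>l\<in>X - Y. (cmod (c l))\<^sup>2)"
    using X Y by (intro sum.union_disjoint) auto
  also have "\<dots> \<le> (\<Sum>\<^sub>\<infinity>l\<in>\<Lambda> - X. (cmod (c l))\<^sup>2) + (\<Sum>\<^sub>\<infinity>l\<in>\<Lambda> - Y. (cmod (c l))\<^sup>2)"
    using X Y s by (intro add_mono finite_sum_le_infsum) auto
  finally show ?thesis .
qed

text \<open>A relation, because the sum is determined only almost everywhere. Convergence along
  finite partial sums makes linearity and the shift rule direct computations, unlike the
  approximation property that defines \<open>fourier_series\<close>.\<close>

definition fourier_sum :: "('a phase \<Rightarrow> complex) \<Rightarrow> ('a phase set \<Rightarrow> complex) \<Rightarrow> bool" where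
  "fourier_sum c f \<longleftrightarrow> square_integrable \<mu> f \<and>
    ((\<lambda>X. l2_dist \<mu> (trig_poly c X) f) \<longlongrightarrow> 0) (finite_subsets_at_top \<Lambda>)"

text \<open>\<open>Riesz_Fischer\<close> needs a sequence, so finite sets \<open>X n\<close> with
  tails below \<open>1 / real (Suc n)\<close> are selected first. The polynomial over any finite
  \<open>Y\<close> containing \<open>X n\<close> is close to the one over \<open>X n\<close>, which
  upgrades the limit to the whole net.\<close>

lemma fourier_sum_exists:
  assumes c: "c \<in> ell2 \<Lambda>"
  shows "\<exists>f. fourier_sum c f"
proof -
  have s: "(\<lambda>l. (cmod (c l))\<^sup>2) summable_on \<Lambda>"
    using c by (simp add: ell2_iff)
  define tail where "tail X = (\<Sum>\<^sub>\<infinity>l\<in>\<Lambda> - X. (cmod (c l))\<^sup>2)" for X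
  have "\<exists>X. finite X \<and> X \<subseteq> \<Lambda> \<and> tail X < 1 / real (Suc k)" for k
    using summable_tail[OF s, of "1 / real (Suc k)"] unfolding tail_def by (metis zero_le_power2 zero_less_divide_1_iff of_nat_0_less_iff zero_less_Suc)
  then obtain X where X: "\<And>k. finite (X k)" "\<And>k. X k \<subseteq> \<Lambda>" "\<And>k. tail (X k) < 1 / real (Suc k)"
    by metis
  obtain f where f: "square_integrable \<mu> f"
      "(\<lambda>n. \<integral>\<xi>. (cmod (trig_poly c (X n) \<xi> - f \<xi>))\<^sup>2 \<partial>\<mu>) \<longlonglongrightarrow> 0"
  proof (rule Riesz_Fischer[of \<mu> "\<lambda>n. trig_poly c (X n)"])
    show "square_integrable \<mu> (trig_poly c (X n))" for n
      by (rule square_integrable_trig_poly[OF X(2)])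
    fix e :: real assume "0 < e"
    then obtain N where N: "1 / real (Suc N) < e / 2"
      using reals_Archimedean[of "e/2"] by (auto simp: inverse_eq_divide)
    have "(\<integral>\<xi>. (cmod (trig_poly c (X m) \<xi> - trig_poly c (X n) \<xi>))\<^sup>2 \<partial>\<mu>) < e" if "N \<le> m" "N \<le> n" for m n
    proof -
      have "1 / real (Suc k) < e / 2" if "N \<le> k" for k
        using N that by (meson frac_le le_less_trans of_nat_0_less_iff zero_less_Suc of_nat_le_iff Suc_le_mono order_refl zero_le_one)
      then have "tail (X m) + tail (X n) < e / 2 + e / 2"
        using X(3) that by (intro add_strict_mono) (meson less_trans)+
      then show ?thesis
        using l2_dist_trig_poly_diff[OF X(1,2) X(1,2) c, of m n] unfolding l2_dist_power2 tail_def by simp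
    qed
    then show "\<exists>N. \<forall>m\<ge>N. \<forall>n\<ge>N. (\<integral>\<xi>. (cmod (trig_poly c (X m) \<xi> - trig_poly c (X n) \<xi>))\<^sup>2 \<partial>\<mu>) < e"
      by blast
  qed
  have lim: "(\<lambda>n. l2_dist \<mu> (trig_poly c (X n)) f) \<longlonglongrightarrow> 0"
    using tendsto_real_sqrt[OF f(2)] by (simp add: l2_dist_def)
  have "((\<lambda>Y. l2_dist \<mu> (trig_poly c Y) f) \<longlongrightarrow> 0) (finite_subsets_at_top \<Lambda>)"
  proof (rule tendstoI)
    fix e :: real assume "0 < e"
    have "\<forall>\<^sub>F n in sequentially. l2_dist \<mu> (trig_poly c (X n)) f < e / 2"
      using order_tendstoD(2)[OF lim, of "e/2"] \<open>0 < e\<close> by simp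
    moreover have "\<forall>\<^sub>F n in sequentially. 2 * (1 / real (Suc n)) < (e / 2)\<^sup>2"
    proof (rule order_tendstoD(2))
      show "(\<lambda>n. 2 * (1 / real (Suc n))) \<longlonglongrightarrow> 2 * 0"
        by (intro tendsto_intros LIMSEQ_inverse_real_of_nat[unfolded inverse_eq_divide])
    qed (use \<open>0 < e\<close> in simp)
    ultimately have "\<forall>\<^sub>F n in sequentially. l2_dist \<mu> (trig_poly c (X n)) f < e / 2 \<and> 2 * (1 / real (Suc n)) < (e / 2)\<^sup>2"
      by (rule eventually_conj)
    then obtain n where n: "l2_dist \<mu> (trig_poly c (X n)) f < e / 2" "2 * (1 / real (Suc n)) < (e / 2)\<^sup>2"
      by (auto simp: eventually_sequentially)
    show "\<forall>\<^sub>F Y in finite_subsets_at_top \<Lambda>. dist (l2_dist \<mu> (trig_poly c Y) f) 0 < e"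
      unfolding eventually_finite_subsets_at_top
    proof (intro exI[of _ "X n"] conjI allI impI X)
      fix Y assume Y: "finite Y \<and> X n \<subseteq> Y \<and> Y \<subseteq> \<Lambda>"
      have "tail Y \<le> tail (X n)"
        unfolding tail_def using Y s by (intro infsum_mono_neutral summable_on_subset_banach[OF s]) auto
      then have "tail Y + tail (X n) < (e / 2)\<^sup>2"
        using X(3)[of n] n(2) by linarith
      then have "(l2_dist \<mu> (trig_poly c Y) (trig_poly c (X n)))\<^sup>2 < (e / 2)\<^sup>2"
        using l2_dist_trig_poly_diff[OF _ _ X(1,2) c, of Y n] Y unfolding tail_def by simp
      then have "l2_dist \<mu> (trig_poly c Y) (trig_poly c (X n)) < e / 2"
        using \<open>0 < e\<close> by (intro power2_less_imp_less[of _ "e/2"]) auto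
      then show "dist (l2_dist \<mu> (trig_poly c Y) f) 0 < e"
        using l2_dist_triangle[of \<mu> "trig_poly c Y" "trig_poly c (X n)" f] n(1) Y X(2)[of n] f(1)
        by (simp add: square_integrable_trig_poly l2_dist_nonneg)
    qed
  qed
  then show ?thesis
    using f(1) fourier_sum_def by blast
qed

lemma fourier_sum_norm:
  assumes c: "c \<in> ell2 \<Lambda>" and f: "fourier_sum c f"
  shows "(\<integral>\<xi>. (cmod (f \<xi>))\<^sup>2 \<partial>\<mu>) = (\<Sum>\<^sub>\<infinity>l\<in>\<Lambda>. (cmod (c l))\<^sup>2)"
proof -
  let ?F = "finite_subsets_at_top \<Lambda>"
  have sq: "square_integrable \<mu> f" and lim: "((\<lambda>X. l2_dist \<mu> (trig_poly c X) f) \<longlongrightarrow> 0) ?F"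
    using f by (auto simp: fourier_sum_def)
  have "((\<lambda>X. l2_dist \<mu> (trig_poly c X) (\<lambda>_. 0) - l2_dist \<mu> f (\<lambda>_. 0)) \<longlongrightarrow> 0) ?F"
  proof (rule Lim_null_comparison[OF _ lim], rule eventually_finite_subsets_at_top_weakI)
    fix X assume "finite X" "X \<subseteq> \<Lambda>"
    then show "norm (l2_dist \<mu> (trig_poly c X) (\<lambda>_. 0) - l2_dist \<mu> f (\<lambda>_. 0)) \<le> l2_dist \<mu> (trig_poly c X) f"
      using l2_dist_triangle[of \<mu> "trig_poly c X" f "\<lambda>_. 0"] l2_dist_triangle[of \<mu> f "trig_poly c X" "\<lambda>_. 0"]
        l2_dist_commute[of \<mu> f "trig_poly c X"] square_integrable_trig_poly[of X c] sq square_integrable_zero[of \<mu>]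
      by (simp add: abs_le_iff)
  qed
  then have "((\<lambda>X. l2_dist \<mu> (trig_poly c X) (\<lambda>_. 0)) \<longlongrightarrow> l2_dist \<mu> f (\<lambda>_. 0)) ?F"
    by (rule LIM_zero_cancel)
  moreover have "((\<lambda>X. l2_dist \<mu> (trig_poly c X) (\<lambda>_. 0)) \<longlongrightarrow> sqrt (\<Sum>\<^sub>\<infinity>l\<in>\<Lambda>. (cmod (c l))\<^sup>2)) ?F"
  proof (rule Lim_transform_eventually)
    have "((\<lambda>l. (cmod (c l))\<^sup>2) has_sum (\<Sum>\<^sub>\<infinity>l\<in>\<Lambda>. (cmod (c l))\<^sup>2)) \<Lambda>"
      using c by (simp add: ell2_iff)
    then show "((\<lambda>X. sqrt (\<Sum>l\<in>X. (cmod (c l))\<^sup>2)) \<longlongrightarrow> sqrt (\<Sum>\<^sub>\<infinity>l\<in>\<Lambda>. (cmod (c l))\<^sup>2)) ?F"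
      unfolding has_sum_def by (rule tendsto_real_sqrt)
    show "\<forall>\<^sub>F X in ?F. sqrt (\<Sum>l\<in>X. (cmod (c l))\<^sup>2) = l2_dist \<mu> (trig_poly c X) (\<lambda>_. 0)"
      by (rule eventually_finite_subsets_at_top_weakI) (simp add: l2_dist_trig_poly_zero)
  qed
  ultimately have "l2_dist \<mu> f (\<lambda>_. 0) = sqrt (\<Sum>\<^sub>\<infinity>l\<in>\<Lambda>. (cmod (c l))\<^sup>2)"
    by (rule tendsto_unique[rotated]) simp
  then show ?thesis
    by (simp add: l2_dist_def)
qed

lemma fourier_sum_add:
  assumes f: "fourier_sum c f" and g: "fourier_sum d g"
  shows "fourier_sum (\<lambda>l. c l + d l) (\<lambda>\<xi>. f \<xi> + g \<xi>)"
  unfolding fourier_sum_def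
proof
  show "square_integrable \<mu> (\<lambda>\<xi>. f \<xi> + g \<xi>)"
    using f g by (intro square_integrable_add) (auto simp: fourier_sum_def)
  have tp: "trig_poly (\<lambda>l. c l + d l) X = (\<lambda>\<xi>. trig_poly c X \<xi> + trig_poly d X \<xi>)" for X
    by (simp add: trig_poly_def distrib_right sum.distrib fun_eq_iff)
  have "((\<lambda>X. l2_dist \<mu> (trig_poly c X) f + l2_dist \<mu> (trig_poly d X) g) \<longlongrightarrow> 0 + 0) (finite_subsets_at_top \<Lambda>)"
    using f g by (intro tendsto_add) (auto simp: fourier_sum_def)
  then have lim: "((\<lambda>X. l2_dist \<mu> (trig_poly c X) f + l2_dist \<mu> (trig_poly d X) g) \<longlongrightarrow> 0) (finite_subsets_at_top \<Lambda>)"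
    by simp
  show "((\<lambda>X. l2_dist \<mu> (trig_poly (\<lambda>l. c l + d l) X) (\<lambda>\<xi>. f \<xi> + g \<xi>)) \<longlongrightarrow> 0) (finite_subsets_at_top \<Lambda>)"
  proof (rule Lim_null_comparison[OF _ lim], rule eventually_finite_subsets_at_top_weakI)
    fix X assume "X \<subseteq> \<Lambda>"
    then show "norm (l2_dist \<mu> (trig_poly (\<lambda>l. c l + d l) X) (\<lambda>\<xi>. f \<xi> + g \<xi>)) \<le> l2_dist \<mu> (trig_poly c X) f + l2_dist \<mu> (trig_poly d X) g"
      using l2_dist_add[of \<mu> "trig_poly c X" f "trig_poly d X" g] f g
      by (simp add: tp l2_dist_nonneg square_integrable_trig_poly fourier_sum_def)
  qed
qed

lemma fourier_sum_cmult:
  assumes f: "fourier_sum c f"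
  shows "fourier_sum (\<lambda>l. k * c l) (\<lambda>\<xi>. k * f \<xi>)"
proof -
  have tp: "trig_poly (\<lambda>l. k * c l) X = (\<lambda>\<xi>. k * trig_poly c X \<xi>)" for X
    by (simp add: trig_poly_def sum_distrib_left mult.assoc fun_eq_iff)
  show ?thesis
    using f unfolding fourier_sum_def tp l2_dist_cmult
    by (auto intro: square_integrable_cmult tendsto_mult_right_zero)
qed

lemma fourier_sum_zero: "fourier_sum (\<lambda>l. 0) (\<lambda>\<xi>. 0)"
  by (simp add: fourier_sum_def square_integrable_zero trig_poly_def l2_dist_def)

lemma fourier_sum_sum:
  "(\<And>i. i \<in> I \<Longrightarrow> fourier_sum (c i) (f i)) \<Longrightarrow> fourier_sum (\<lambda>l. \<Sum>i\<in>I. c i l) (\<lambda>\<xi>. \<Sum>i\<in>I. f i \<xi>)"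
  by (induction I rule: infinite_finite_induct) (auto simp: fourier_sum_zero intro: fourier_sum_add)

text \<open>The partial sum over \<open>X\<close> of the shifted sequence is \<open>chr k\<close>
  times the partial sum of \<open>c\<close> over \<open>X\<close> translated by \<open>- k\<close>,
  and \<open>chr k\<close> has modulus 1.\<close>

lemma fourier_sum_shift:
  assumes f: "fourier_sum c f" and k: "k \<in> \<Lambda>"
  shows "fourier_sum (\<lambda>l. c (l - k)) (\<lambda>\<xi>. chr k \<xi> * f \<xi>)"
  unfolding fourier_sum_def
proof
  show "square_integrable \<mu> (\<lambda>\<xi>. chr k \<xi> * f \<xi>)"
    using f k by (intro square_integrable_chr_mult) (auto simp: fourier_sum_def)
  let ?s = "\<lambda>X. (\<lambda>l. l - k) ` X"
  have "trig_poly (\<lambda>l. c (l - k)) X \<xi> = chr k \<xi> * trig_poly c (?s X) \<xi>" for X \<xi>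
  proof -
    have "trig_poly c (?s X) \<xi> = (\<Sum>l\<in>X. c (l - k) * chr (l - k) \<xi>)"
      unfolding trig_poly_def by (subst sum.reindex) (auto simp: inj_on_def)
    moreover have "c (l - k) * chr l \<xi> = chr k \<xi> * (c (l - k) * chr (l - k) \<xi>)" for l
      using chr_add[of k "l - k" \<xi>] by (simp add: mult_ac)
    then have "trig_poly (\<lambda>l. c (l - k)) X \<xi> = (\<Sum>l\<in>X. chr k \<xi> * (c (l - k) * chr (l - k) \<xi>))"
      unfolding trig_poly_def by (intro sum.cong refl)
    ultimately show ?thesis
      by (simp add: sum_distrib_left)
  qed
  then have "l2_dist \<mu> (trig_poly (\<lambda>l. c (l - k)) X) (\<lambda>\<xi>. chr k \<xi> * f \<xi>) = l2_dist \<mu> (trig_poly c (?s X)) f" for X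
    by (simp add: l2_dist_def norm_mult flip: right_diff_distrib)
  \<comment> \<open>Translation by a lattice point maps the directed set of finite subsets of the
    lattice cofinally to itself, so limits along it are unchanged.\<close>
  moreover have "filterlim ?s (finite_subsets_at_top \<Lambda>) (finite_subsets_at_top \<Lambda>)"
    unfolding filterlim_iff
  proof (intro allI impI)
    fix P assume "eventually P (finite_subsets_at_top \<Lambda>)"
    then obtain X where X: "finite X" "X \<subseteq> \<Lambda>" "\<And>Y. finite Y \<Longrightarrow> X \<subseteq> Y \<Longrightarrow> Y \<subseteq> \<Lambda> \<Longrightarrow> P Y"
      by (auto simp: eventually_finite_subsets_at_top)
    show "\<forall>\<^sub>F Y in finite_subsets_at_top \<Lambda>. P (?s Y)"
      unfolding eventually_finite_subsets_at_top
    proof (intro exI[of _ "(\<lambda>l. l + k) ` X"] conjI allI impI)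
      fix Y assume Y: "finite Y \<and> (\<lambda>l. l + k) ` X \<subseteq> Y \<and> Y \<subseteq> \<Lambda>"
      show "P (?s Y)"
      proof (rule X(3))
        show "X \<subseteq> ?s Y"
        proof
          fix l assume "l \<in> X"
          then have "l + k \<in> Y"
            using Y by blast
          then show "l \<in> ?s Y"
            by (rule rev_image_eqI) simp
        qed
        show "?s Y \<subseteq> \<Lambda>"
          using Y k lattice_diff by blast
      qed (use Y in simp)
    next
      show "finite ((\<lambda>l. l + k) ` X)" "(\<lambda>l. l + k) ` X \<subseteq> \<Lambda>"
        using X(1,2) k lattice_add by blast+
    qed
  qed
  then have "((\<lambda>X. l2_dist \<mu> (trig_poly c (?s X)) f) \<longlongrightarrow> 0) (finite_subsets_at_top \<Lambda>)"
    using f unfolding fourier_sum_def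
    by (intro filterlim_compose[of "\<lambda>X. l2_dist \<mu> (trig_poly c X) f" _ _ ?s]) auto
  ultimately show "((\<lambda>X. l2_dist \<mu> (trig_poly (\<lambda>l. c (l - k)) X) (\<lambda>\<xi>. chr k \<xi> * f \<xi>)) \<longlongrightarrow> 0) (finite_subsets_at_top \<Lambda>)"
    by simp
qed

lemma ell1_ell2: "b \<in> ell1 \<Lambda> \<Longrightarrow> b \<in> ell2 \<Lambda>"
proof -
  assume b: "b \<in> ell1 \<Lambda>"
  define C where "C = (\<Sum>\<^sub>\<infinity>l\<in>\<Lambda>. cmod (b l))"
  have "cmod (b l) \<le> C" if "l \<in> \<Lambda>" for l
    using finite_sum_le_infsum[of "\<lambda>l. cmod (b l)" \<Lambda> "{l}"] b that by (auto simp: ell1_def C_def)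
  then have "(cmod (b l))\<^sup>2 \<le> C * cmod (b l)" if "l \<in> \<Lambda>" for l
    using that by (simp add: power2_eq_square mult_right_mono)
  note le = this
  have "(\<lambda>l. C * cmod (b l)) summable_on \<Lambda>"
    using b by (intro summable_on_cmult_right) (simp add: ell1_def)
  then show ?thesis
    unfolding ell2_iff by (rule summable_on_comparison_test) (simp_all add: le)
qed

lemma fourier_series_l1_eq: "fourier_series_l1 \<Lambda> b \<xi> = (\<Sum>\<^sub>\<infinity>l\<in>\<Lambda>. b l * chr l \<xi>)"
  by (simp add: fourier_series_l1_def chr_def)

lemma fourier_series_l1_approx:
  assumes b: "b \<in> ell1 \<Lambda>" and X: "finite X" "X \<subseteq> \<Lambda>"
  shows "cmod (fourier_series_l1 \<Lambda> b \<xi> - trig_poly b X \<xi>) \<le> (\<Sum>\<^sub>\<infinity>l\<in>\<Lambda> - X. cmod (b l))"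
proof -
  have abs: "(\<lambda>l. norm (b l * chr l \<xi>)) summable_on \<Lambda>"
    using b by (simp add: ell1_def norm_mult)
  then have s: "(\<lambda>l. b l * chr l \<xi>) summable_on \<Lambda>"
    by (rule abs_summable_summable)
  have "fourier_series_l1 \<Lambda> b \<xi> - trig_poly b X \<xi> = (\<Sum>\<^sub>\<infinity>l\<in>\<Lambda> - X. b l * chr l \<xi>)"
    using X s unfolding fourier_series_l1_eq trig_poly_def by (subst infsum_Diff) auto
  also have "cmod \<dots> \<le> (\<Sum>\<^sub>\<infinity>l\<in>\<Lambda> - X. norm (b l * chr l \<xi>))"
    by (rule norm_infsum_bound, rule summable_on_subset_banach[OF abs]) auto
  finally show ?thesis
    by (simp add: norm_mult)
qed

lemma fourier_series_l1_approx_eventually: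
  assumes b: "b \<in> ell1 \<Lambda>" and "0 < e"
  shows "\<forall>\<^sub>F X in finite_subsets_at_top \<Lambda>. X \<subseteq> \<Lambda> \<and> finite X \<and> (\<forall>\<xi>. cmod (fourier_series_l1 \<Lambda> b \<xi> - trig_poly b X \<xi>) \<le> e)"
proof -
  have s: "(\<lambda>l. cmod (b l)) summable_on \<Lambda>"
    using b by (simp add: ell1_def)
  obtain X where X: "finite X" "X \<subseteq> \<Lambda>" "(\<Sum>\<^sub>\<infinity>l\<in>\<Lambda> - X. cmod (b l)) < e"
    by (rule summable_tail[OF s _ \<open>0 < e\<close>]) auto
  show ?thesis
    unfolding eventually_finite_subsets_at_top
  proof (intro exI[of _ X] conjI allI impI X)
    fix Y \<xi> assume Y: "finite Y \<and> X \<subseteq> Y \<and> Y \<subseteq> \<Lambda>"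
    then have "(\<Sum>\<^sub>\<infinity>l\<in>\<Lambda> - Y. cmod (b l)) \<le> (\<Sum>\<^sub>\<infinity>l\<in>\<Lambda> - X. cmod (b l))"
      by (intro infsum_mono_neutral summable_on_subset_banach[OF s]) auto
    then show "cmod (fourier_series_l1 \<Lambda> b \<xi> - trig_poly b Y \<xi>) \<le> e"
      using fourier_series_l1_approx[OF b, of Y \<xi>] X(3) Y by linarith
  qed auto
qed

lemma square_integrable_fourier_series_l1:
  assumes b: "b \<in> ell1 \<Lambda>"
  shows "square_integrable \<mu> (fourier_series_l1 \<Lambda> b)"
proof -
  have "\<exists>X. X \<subseteq> \<Lambda> \<and> finite X \<and> (\<forall>\<xi>. cmod (fourier_series_l1 \<Lambda> b \<xi> - trig_poly b X \<xi>) \<le> 1 / real (Suc k))" for k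
    using eventually_happens'[OF _ fourier_series_l1_approx_eventually[OF b, of "1 / real (Suc k)"]] by simp
  then obtain X where X: "\<And>k. X k \<subseteq> \<Lambda>" "\<And>k \<xi>. cmod (fourier_series_l1 \<Lambda> b \<xi> - trig_poly b (X k) \<xi>) \<le> 1 / real (Suc k)"
    by metis
  have [measurable]: "fourier_series_l1 \<Lambda> b \<in> borel_measurable \<mu>"
  proof (rule borel_measurable_LIMSEQ_metric)
    show "trig_poly b (X k) \<in> borel_measurable \<mu>" for k
      by (rule square_integrable_measurable[OF square_integrable_trig_poly[OF X(1)]])
    show "(\<lambda>k. trig_poly b (X k) \<xi>) \<longlonglongrightarrow> fourier_series_l1 \<Lambda> b \<xi>" for \<xi>
    proof (rule LIM_zero_cancel, rule Lim_null_comparison)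
      show "\<forall>\<^sub>F k in sequentially. norm (trig_poly b (X k) \<xi> - fourier_series_l1 \<Lambda> b \<xi>) \<le> 1 / real (Suc k)"
        using X(2) by (simp add: norm_minus_commute)
      show "(\<lambda>k. 1 / real (Suc k)) \<longlonglongrightarrow> 0"
        using LIMSEQ_inverse_real_of_nat by (simp add: inverse_eq_divide)
    qed
  qed
  have "cmod (fourier_series_l1 \<Lambda> b \<xi>) \<le> (\<Sum>\<^sub>\<infinity>l\<in>\<Lambda>. cmod (b l))" for \<xi>
    using fourier_series_l1_approx[OF b, of "{}" \<xi>] by (simp add: trig_poly_def)
  then have "integrable \<mu> (\<lambda>\<xi>. (cmod (fourier_series_l1 \<Lambda> b \<xi>))\<^sup>2)"
    by (intro dual.integrable_const_bound[where B = "(\<Sum>\<^sub>\<infinity>l\<in>\<Lambda>. cmod (b l))\<^sup>2"]) (auto intro!: AE_I2 power_mono)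
  then show ?thesis
    by (simp add: square_integrable_def)
qed

lemma l2_dist_uniform:
  assumes "square_integrable \<mu> f" "square_integrable \<mu> g" "\<And>\<xi>. cmod (f \<xi> - g \<xi>) \<le> e" "0 \<le> e"
  shows "l2_dist \<mu> f g \<le> e"
proof -
  have "(\<integral>\<xi>. (cmod (f \<xi> - g \<xi>))\<^sup>2 \<partial>\<mu>) \<le> (\<integral>\<xi>. e\<^sup>2 \<partial>\<mu>)"
    using assms by (intro integral_mono square_integrable_integrable square_integrable_diff power_mono) auto
  then have "(\<integral>\<xi>. (cmod (f \<xi> - g \<xi>))\<^sup>2 \<partial>\<mu>) \<le> e\<^sup>2"
    by (simp add: dual.prob_space)
  then show ?thesis
    unfolding l2_dist_def using assms(4) by (intro real_le_lsqrt) auto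
qed

text \<open>The two functions are compared through the polynomials of \<open>b\<close> and
  \<open>c\<close> over one finite set that is large enough for both, where Parseval is exact. This
  shows that a \<open>fourier_sum\<close> has the approximation property by which
  \<open>fourier_series\<close> is selected.\<close>

lemma fourier_series_l1_dist:
  assumes b: "b \<in> ell1 \<Lambda>" and c: "c \<in> ell2 \<Lambda>" and f: "fourier_sum c f"
  shows "l2_dist \<mu> (fourier_series_l1 \<Lambda> b) f \<le> ell2_dist \<Lambda> b c"
proof (rule field_le_epsilon)
  fix e :: real assume "0 < e"
  have sq: "square_integrable \<mu> f" and lim: "((\<lambda>X. l2_dist \<mu> (trig_poly c X) f) \<longlongrightarrow> 0) (finite_subsets_at_top \<Lambda>)"
    using f by (auto simp: fourier_sum_def)
  have ev: "\<forall>\<^sub>F X in finite_subsets_at_top \<Lambda>. l2_dist \<mu> (trig_poly c X) f < e / 2"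
    using order_tendstoD(2)[OF lim, of "e/2"] \<open>0 < e\<close> by simp
  have "\<forall>\<^sub>F X in finite_subsets_at_top \<Lambda>. (X \<subseteq> \<Lambda> \<and> finite X \<and> (\<forall>\<xi>. cmod (fourier_series_l1 \<Lambda> b \<xi> - trig_poly b X \<xi>) \<le> e/2)) \<and>
      l2_dist \<mu> (trig_poly c X) f < e / 2"
    by (rule eventually_conj[OF fourier_series_l1_approx_eventually[OF b] ev]) (use \<open>0 < e\<close> in simp)
  from eventually_happens'[OF _ this] obtain X where X: "X \<subseteq> \<Lambda>" "finite X"
      "\<And>\<xi>. cmod (fourier_series_l1 \<Lambda> b \<xi> - trig_poly b X \<xi>) \<le> e/2" "l2_dist \<mu> (trig_poly c X) f < e / 2"
    by auto
  have "(\<Sum>l\<in>X. (cmod (b l - c l))\<^sup>2) \<le> (\<Sum>\<^sub>\<infinity>l\<in>\<Lambda>. (cmod (b l - c l))\<^sup>2)"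
    using ell2_diff[OF ell1_ell2[OF b] c] X by (intro finite_sum_le_infsum) (auto simp: ell2_iff)
  then have 1: "l2_dist \<mu> (trig_poly b X) (trig_poly c X) \<le> ell2_dist \<Lambda> b c"
    by (simp add: l2_dist_trig_poly X ell2_dist_def)
  have 2: "l2_dist \<mu> (fourier_series_l1 \<Lambda> b) (trig_poly b X) \<le> e / 2"
    using X \<open>0 < e\<close> b by (intro l2_dist_uniform square_integrable_fourier_series_l1 square_integrable_trig_poly) auto
  note sqb = square_integrable_fourier_series_l1[OF b] and sqX = square_integrable_trig_poly[OF X(1)]
  show "l2_dist \<mu> (fourier_series_l1 \<Lambda> b) f \<le> ell2_dist \<Lambda> b c + e"
    using l2_dist_triangle[OF sqb sqX[of b] sq] l2_dist_triangle[OF sqX[of b] sqX[of c] sq] 1 2 X(4) by linarith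
qed

text \<open>A limit from \<open>fourier_sum_exists\<close> witnesses the selection, so the selected
  function has the approximation property. Conversely, truncations of \<open>c\<close> to finite
  sets are absolutely summable, tend to \<open>c\<close> and have trigonometric polynomials as
  series, so that property yields convergence of the partial sums.\<close>

lemma fourier_series:
  assumes c: "c \<in> ell2 \<Lambda>"
  shows "fourier_sum c (fourier_series \<Lambda> c)"
proof -
  define P where "P f \<longleftrightarrow> square_integrable \<mu> f \<and>
    (\<forall>\<epsilon>>0. \<exists>\<delta>>0. \<forall>b\<in>ell1 \<Lambda>. ell2_dist \<Lambda> b c < \<delta> \<longrightarrow> l2_dist \<mu> (fourier_series_l1 \<Lambda> b) f < \<epsilon>)" for f
  obtain f0 where "fourier_sum c f0"
    using fourier_sum_exists[OF c] by blast
  then have "P f0"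
    unfolding P_def using fourier_series_l1_dist[OF _ c] le_less_trans
    by (auto simp: fourier_sum_def) blast
  then have "P (fourier_series \<Lambda> c)"
    unfolding fourier_series_def P_def[symmetric] by (rule someI[of P])
  then have sq: "square_integrable \<mu> (fourier_series \<Lambda> c)"
    and P: "\<And>\<epsilon>. 0 < \<epsilon> \<Longrightarrow> \<exists>\<delta>>0. \<forall>b\<in>ell1 \<Lambda>. ell2_dist \<Lambda> b c < \<delta> \<longrightarrow> l2_dist \<mu> (fourier_series_l1 \<Lambda> b) (fourier_series \<Lambda> c) < \<epsilon>"
    by (auto simp: P_def)
  have s: "(\<lambda>l. (cmod (c l))\<^sup>2) summable_on \<Lambda>"
    using c by (simp add: ell2_iff)
  have "((\<lambda>X. l2_dist \<mu> (trig_poly c X) (fourier_series \<Lambda> c)) \<longlongrightarrow> 0) (finite_subsets_at_top \<Lambda>)"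
  proof (rule tendstoI)
    fix e :: real assume "0 < e"
    then obtain \<delta> where \<delta>: "0 < \<delta>" "\<And>b. b \<in> ell1 \<Lambda> \<Longrightarrow> ell2_dist \<Lambda> b c < \<delta> \<Longrightarrow> l2_dist \<mu> (fourier_series_l1 \<Lambda> b) (fourier_series \<Lambda> c) < e"
      using P by blast
    obtain X where X: "finite X" "X \<subseteq> \<Lambda>" "(\<Sum>\<^sub>\<infinity>l\<in>\<Lambda> - X. (cmod (c l))\<^sup>2) < \<delta>\<^sup>2"
      by (rule summable_tail[OF s, of "\<delta>\<^sup>2"]) (use \<delta>(1) in auto)
    show "\<forall>\<^sub>F Y in finite_subsets_at_top \<Lambda>. dist (l2_dist \<mu> (trig_poly c Y) (fourier_series \<Lambda> c)) 0 < e"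
      unfolding eventually_finite_subsets_at_top
    proof (intro exI[of _ X] conjI allI impI X)
      fix Y assume Y: "finite Y \<and> X \<subseteq> Y \<and> Y \<subseteq> \<Lambda>"
      define b where "b l = (if l \<in> Y then c l else 0)" for l
      have "(\<Sum>\<^sub>\<infinity>l\<in>\<Lambda>. b l * chr l \<xi>) = (\<Sum>\<^sub>\<infinity>l\<in>Y. c l * chr l \<xi>)" for \<xi>
        using Y by (intro infsum_cong_neutral) (auto simp: b_def)
      then have fs: "fourier_series_l1 \<Lambda> b = trig_poly c Y"
        using Y by (simp add: fun_eq_iff fourier_series_l1_eq trig_poly_def)
      have "(\<lambda>l. cmod (c l)) summable_on Y"
        using Y by simp
      then have b1: "b \<in> ell1 \<Lambda>"
        unfolding ell1_def mem_Collect_eq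
        by (rule summable_on_cong_neutral[THEN iffD1, rotated -1]) (use Y in \<open>auto simp: b_def\<close>)
      have "(\<Sum>\<^sub>\<infinity>l\<in>\<Lambda>. (cmod (b l - c l))\<^sup>2) = (\<Sum>\<^sub>\<infinity>l\<in>\<Lambda> - Y. (cmod (c l))\<^sup>2)"
        by (rule infsum_cong_neutral) (auto simp: b_def)
      also have "\<dots> \<le> (\<Sum>\<^sub>\<infinity>l\<in>\<Lambda> - X. (cmod (c l))\<^sup>2)"
        using Y by (intro infsum_mono_neutral summable_on_subset_banach[OF s]) auto
      also have "\<dots> < \<delta>\<^sup>2"
        by (rule X(3))
      finally have "ell2_dist \<Lambda> b c < \<delta>"
        unfolding ell2_dist_def using \<delta>(1) real_less_lsqrt by (simp add: real_sqrt_less_iff real_less_lsqrt)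
      then show "dist (l2_dist \<mu> (trig_poly c Y) (fourier_series \<Lambda> c)) 0 < e"
        using \<delta>(2)[OF b1] by (simp add: fs l2_dist_nonneg)
    qed
  qed
  then show ?thesis
    using sq by (simp add: fourier_sum_def)
qed

end

section \<open>Density of trigonometric polynomials\<close>

lemma Arg2pi_cis: "Arg2pi (cis (2 * pi * t)) = 2 * pi * frac t"
proof (rule Arg2pi_unique)
  have "cis (2 * pi * t) = cis (2 * pi * frac t + 2 * pi * of_int \<lfloor>t\<rfloor>)"
    by (simp add: frac_def algebra_simps)
  also have "\<dots> = cis (2 * pi * frac t)"
    by (simp add: cis_multiple_2pi flip: cis_mult)
  finally show "of_real 1 * exp (\<i> * of_real (2 * pi * frac t)) = cis (2 * pi * t)"
    by (simp add: cis_conv_exp)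
qed (simp_all add: frac_lt_1)

text \<open>\<open>Arg2pi\<close> is continuous off the nonnegative reals and vanishes on them, so
  it equals its own product with an indicator.\<close>

lemma borel_measurable_Arg2pi [measurable]: "Arg2pi \<in> borel_measurable borel"
proof -
  have "continuous_on (- \<real>\<^sub>\<ge>\<^sub>0) Arg2pi"
    by (intro continuous_at_imp_continuous_on ballI continuous_at_Arg2pi) simp
  then have "(\<lambda>z. indicator (- \<real>\<^sub>\<ge>\<^sub>0) z *\<^sub>R Arg2pi z) \<in> borel_measurable borel"
    by (intro borel_measurable_continuous_on_indicator) (simp_all add: closed_nonneg_Reals_complex borel_comp)
  also have "(\<lambda>z. indicator (- \<real>\<^sub>\<ge>\<^sub>0) z *\<^sub>R Arg2pi z) = Arg2pi"
    by (auto simp: fun_eq_iff indicator_def complex_nonneg_Reals_iff Arg2pi_eq_0 complex_is_Real_iff)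
  finally show ?thesis .
qed

context lattice
begin

text \<open>Trigonometric polynomials without bookkeeping of supports: closure under products
  becomes a double induction based on \<open>chr_add\<close>, and \<open>TP_trig_poly\<close>
  recovers explicit coefficients.\<close>

inductive TP :: "('a phase set \<Rightarrow> complex) \<Rightarrow> bool" where
  chr: "l \<in> \<Lambda> \<Longrightarrow> TP (\<lambda>\<xi>. c * chr l \<xi>)"
| add: "TP f \<Longrightarrow> TP g \<Longrightarrow> TP (\<lambda>\<xi>. f \<xi> + g \<xi>)"

lemma TP_const: "TP (\<lambda>\<xi>. c)"
  using TP.chr[OF lattice_zero, of c] by (simp add: chr_zero)

lemma TP_sum: "(\<And>i. i \<in> I \<Longrightarrow> TP (f i)) \<Longrightarrow> TP (\<lambda>\<xi>. \<Sum>i\<in>I. f i \<xi>)"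
  by (induction I rule: infinite_finite_induct) (auto intro: TP_const TP.add)

lemma TP_mult:
  assumes "TP f" "TP g"
  shows "TP (\<lambda>\<xi>. f \<xi> * g \<xi>)"
  using assms(1)
proof induction
  case (chr l c)
  show ?case
    using assms(2)
  proof induction
    case (chr m d)
    then show ?case
      using TP.chr[OF lattice_add[OF \<open>l \<in> \<Lambda>\<close> chr], of "c * d"] by (simp add: chr_add mult_ac)
  next
    case (add f g)
    then show ?case
      using TP.add by (simp add: distrib_left)
  qed
next
  case (add f g)
  then show ?case
    using TP.add by (simp add: distrib_right)
qed

lemma TP_Re_chr: "l \<in> \<Lambda> \<Longrightarrow> TP (\<lambda>\<xi>. complex_of_real (Re (chr l \<xi>)))"
  and TP_Im_chr: "l \<in> \<Lambda> \<Longrightarrow> TP (\<lambda>\<xi>. complex_of_real (Im (chr l \<xi>)))"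
proof -
  assume l: "l \<in> \<Lambda>"
  have "(\<lambda>\<xi>. complex_of_real (Re (chr l \<xi>))) = (\<lambda>\<xi>. (1/2) * chr l \<xi> + (1/2) * chr (- l) \<xi>)"
    by (simp add: fun_eq_iff chr_minus complex_eq_iff)
  then show "TP (\<lambda>\<xi>. complex_of_real (Re (chr l \<xi>)))"
    using l by (simp only:) (intro TP.add TP.chr lattice_minus)
  have "(\<lambda>\<xi>. complex_of_real (Im (chr l \<xi>))) = (\<lambda>\<xi>. (- \<i>/2) * chr l \<xi> + (\<i>/2) * chr (- l) \<xi>)"
    by (simp add: fun_eq_iff chr_minus complex_eq_iff)
  then show "TP (\<lambda>\<xi>. complex_of_real (Im (chr l \<xi>)))"
    using l by (simp only:) (intro TP.add TP.chr lattice_minus)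
qed

lemma TP_trig_poly: "TP f \<Longrightarrow> \<exists>X a. finite X \<and> X \<subseteq> \<Lambda> \<and> f = trig_poly a X"
proof (induction rule: TP.induct)
  case (chr l c)
  then show ?case
    by (intro exI[of _ "{l}"] exI[of _ "\<lambda>_. c"]) (simp add: trig_poly_def fun_eq_iff)
next
  case (add f g)
  then obtain X a Z d where X: "finite X" "X \<subseteq> \<Lambda>" "f = trig_poly a X"
      and Z: "finite Z" "Z \<subseteq> \<Lambda>" "g = trig_poly d Z"
    by blast
  have ext: "trig_poly (\<lambda>l. if l \<in> W then a l else 0) (X \<union> Z) \<xi> = trig_poly a W \<xi>" if "W \<subseteq> X \<union> Z" for W a \<xi>
    unfolding trig_poly_def using that X Z by (intro sum.mono_neutral_cong_right) auto
  have "trig_poly (\<lambda>l. (if l \<in> X then a l else 0) + (if l \<in> Z then d l else 0)) (X \<union> Z) \<xi> =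
      trig_poly (\<lambda>l. if l \<in> X then a l else 0) (X \<union> Z) \<xi> + trig_poly (\<lambda>l. if l \<in> Z then d l else 0) (X \<union> Z) \<xi>" for \<xi>
    by (simp only: trig_poly_def distrib_right sum.distrib)
  then have "(\<lambda>\<xi>. f \<xi> + g \<xi>) = trig_poly (\<lambda>l. (if l \<in> X then a l else 0) + (if l \<in> Z then d l else 0)) (X \<union> Z)"
    by (simp add: fun_eq_iff ext X(3) Z(3))
  then show ?case
    using X Z by blast
qed

lemma square_integrable_TP: "TP f \<Longrightarrow> square_integrable \<mu> f"
  using TP_trig_poly square_integrable_trig_poly by blast

definition approximable :: "('a phase set \<Rightarrow> complex) \<Rightarrow> bool" where
  "approximable f \<longleftrightarrow> square_integrable \<mu> f \<and> (\<forall>e>0. \<exists>p. TP p \<and> l2_dist \<mu> p f < e)"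

lemma approximable_TP: "TP f \<Longrightarrow> approximable f"
  unfolding approximable_def by (auto simp: square_integrable_TP l2_dist_def intro!: exI[of _ f])

lemma approximable_add:
  assumes "approximable f" "approximable g"
  shows "approximable (\<lambda>\<xi>. f \<xi> + g \<xi>)"
  unfolding approximable_def
proof (intro conjI allI impI)
  show "square_integrable \<mu> (\<lambda>\<xi>. f \<xi> + g \<xi>)"
    using assms by (intro square_integrable_add) (auto simp: approximable_def)
  fix e :: real assume "0 < e"
  then obtain p q where "TP p" "l2_dist \<mu> p f < e/2" "TP q" "l2_dist \<mu> q g < e/2"
    using assms unfolding approximable_def by (meson half_gt_zero)
  then show "\<exists>p. TP p \<and> l2_dist \<mu> p (\<lambda>\<xi>. f \<xi> + g \<xi>) < e"
    using l2_dist_add[of \<mu> p f q g] assms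
    by (intro exI[of _ "\<lambda>\<xi>. p \<xi> + q \<xi>"]) (auto simp: approximable_def square_integrable_TP intro: TP.add)
qed

lemma approximable_minus:
  assumes "approximable f"
  shows "approximable (\<lambda>\<xi>. - f \<xi>)"
  unfolding approximable_def
proof (intro conjI allI impI)
  show "square_integrable \<mu> (\<lambda>\<xi>. - f \<xi>)"
    using assms square_integrable_cmult[of \<mu> f "- 1"] by (simp add: approximable_def)
  fix e :: real assume "0 < e"
  then obtain p where "TP p" "l2_dist \<mu> p f < e"
    using assms unfolding approximable_def by blast
  then show "\<exists>p. TP p \<and> l2_dist \<mu> p (\<lambda>\<xi>. - f \<xi>) < e"
    using l2_dist_cmult[of \<mu> "-1" p f] TP_mult[OF TP_const[of "-1"], of p]
    by (intro exI[of _ "\<lambda>\<xi>. - p \<xi>"]) simp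
qed

text \<open>On a probability space a constant bound is integrable, so dominated convergence turns
  bounded pointwise limits into L2 limits.\<close>

lemma approximable_LIMSEQ:
  assumes g: "\<And>n. approximable (g n)" and f: "f \<in> borel_measurable \<mu>"
    and lim: "\<And>\<xi>. \<xi> \<in> space \<mu> \<Longrightarrow> (\<lambda>n. g n \<xi>) \<longlonglongrightarrow> f \<xi>" and bound: "\<And>n \<xi>. \<xi> \<in> space \<mu> \<Longrightarrow> cmod (g n \<xi>) \<le> C"
  shows "approximable f"
proof -
  have [measurable]: "f \<in> borel_measurable \<mu>" "g n \<in> borel_measurable \<mu>" for n
    using f g by (auto simp: approximable_def square_integrable_def)
  have fC: "cmod (f \<xi>) \<le> C" if "\<xi> \<in> space \<mu>" for \<xi>
    using Lim_bounded[OF tendsto_norm[OF lim[OF that]], of 0 C] bound[OF that] by simp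
  have "integrable \<mu> (\<lambda>\<xi>. (cmod (f \<xi>))\<^sup>2)"
    by (intro dual.integrable_const_bound[where B = "C\<^sup>2"]) (auto intro!: AE_I2 power_mono fC)
  then have sqf: "square_integrable \<mu> f"
    by (simp add: square_integrable_def)
  have "(\<lambda>n. \<integral>\<xi>. (cmod (g n \<xi> - f \<xi>))\<^sup>2 \<partial>\<mu>) \<longlonglongrightarrow> (\<integral>\<xi>. 0 \<partial>\<mu>)"
  proof (rule integral_dominated_convergence[where w = "\<lambda>_. (2 * C)\<^sup>2"])
    show "AE \<xi> in \<mu>. (\<lambda>n. (cmod (g n \<xi> - f \<xi>))\<^sup>2) \<longlonglongrightarrow> 0"
    proof (rule AE_I2)
      fix \<xi> assume "\<xi> \<in> space \<mu>"
      then have "(\<lambda>n. (cmod (g n \<xi> - f \<xi>))\<^sup>2) \<longlonglongrightarrow> (cmod (f \<xi> - f \<xi>))\<^sup>2"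
        by (intro tendsto_intros lim)
      then show "(\<lambda>n. (cmod (g n \<xi> - f \<xi>))\<^sup>2) \<longlonglongrightarrow> 0" by simp
    qed
    show "AE \<xi> in \<mu>. norm ((cmod (g n \<xi> - f \<xi>))\<^sup>2) \<le> (2 * C)\<^sup>2" for n
    proof (rule AE_I2)
      fix \<xi> assume "\<xi> \<in> space \<mu>"
      then have "cmod (g n \<xi> - f \<xi>) \<le> 2 * C"
        using norm_triangle_ineq4[of "g n \<xi>" "f \<xi>"] bound[of \<xi> n] fC[of \<xi>] by linarith
      then show "norm ((cmod (g n \<xi> - f \<xi>))\<^sup>2) \<le> (2 * C)\<^sup>2"
        using power_mono[OF _ norm_ge_zero, of _ "2 * C" 2] by simp
    qed
  qed auto
  then have "(\<lambda>n. sqrt (\<integral>\<xi>. (cmod (g n \<xi> - f \<xi>))\<^sup>2 \<partial>\<mu>)) \<longlonglongrightarrow> sqrt 0"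
    by (intro tendsto_real_sqrt) simp
  then have d: "(\<lambda>n. l2_dist \<mu> (g n) f) \<longlonglongrightarrow> 0"
    by (simp add: l2_dist_def)
  show ?thesis
    unfolding approximable_def
  proof (intro conjI allI impI sqf)
    fix e :: real assume "0 < e"
    then have "\<forall>\<^sub>F n in sequentially. l2_dist \<mu> (g n) f < e/2"
      using order_tendstoD(2)[OF d, of "e/2"] by simp
    then obtain n where n: "l2_dist \<mu> (g n) f < e/2"
      by (auto simp: eventually_sequentially)
    obtain p where p: "TP p" "l2_dist \<mu> p (g n) < e/2"
      using g[of n] \<open>0 < e\<close> unfolding approximable_def by (meson half_gt_zero)
    have "l2_dist \<mu> p f \<le> l2_dist \<mu> p (g n) + l2_dist \<mu> (g n) f"
      using g[of n] sqf p by (intro l2_dist_triangle) (auto simp: approximable_def square_integrable_TP)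
    then show "\<exists>p. TP p \<and> l2_dist \<mu> p f < e"
      using n p by (intro exI[of _ p]) auto
  qed
qed

text \<open>A basis of the lattice embeds the dual group into the torus in \<open>\<real>\<^sup>n \<times> \<real>\<^sup>n\<close>. Indicators of closed
  sets of the torus are limits of continuous functions, which are uniform limits of polynomials by
  Stone-Weierstrass; the remaining Borel sets are reached by a Dynkin argument.\<close>

definition torus :: "('a phase \<Rightarrow> 'a phase) \<Rightarrow> 'a phase set \<Rightarrow> 'a phase \<times> 'a phase" where
  "torus C \<xi> = ((\<Sum>b\<in>Basis. Re (chr (C b) \<xi>) *\<^sub>R b), (\<Sum>b\<in>Basis. Im (chr (C b) \<xi>) *\<^sub>R b))"

lemma approximable_indicator_torus:
  assumes C: "\<And>b. b \<in> Basis \<Longrightarrow> C b \<in> \<Lambda>" and X: "X \<in> sets borel"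
  shows "approximable (\<lambda>\<xi>. indicator X (torus C \<xi>))"
proof -
  have [measurable]: "torus C \<in> borel_measurable \<mu>"
    unfolding torus_def using C by (intro borel_measurable_Pair borel_measurable_sum borel_measurable_scaleR borel_measurable_const
      measurable_compose[OF chr_measurable]) auto
  \<comment> \<open>Stone-Weierstrass needs a compact set; each of the two components of
    \<open>torus\<close> has norm at most the number of basis vectors.\<close>
  define R where "R = 2 * real (card (Basis :: 'a phase set))"
  have R: "torus C \<xi> \<in> cball 0 R" for \<xi>
  proof -
    have "norm (\<Sum>b\<in>Basis. Re (chr (C b) \<xi>) *\<^sub>R b) \<le> real (card (Basis :: 'a phase set))"
      using sum_norm_bound[of Basis "\<lambda>b. Re (chr (C b) \<xi>) *\<^sub>R b" 1] abs_Re_le_cmod[of "chr _ \<xi>"] by simp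
    moreover have "norm (\<Sum>b\<in>Basis. Im (chr (C b) \<xi>) *\<^sub>R b) \<le> real (card (Basis :: 'a phase set))"
      using sum_norm_bound[of Basis "\<lambda>b. Im (chr (C b) \<xi>) *\<^sub>R b" 1] abs_Im_le_cmod[of "chr _ \<xi>"] by simp
    ultimately show ?thesis
      using norm_Pair_le[of "\<Sum>b\<in>Basis. Re (chr (C b) \<xi>) *\<^sub>R b" "\<Sum>b\<in>Basis. Im (chr (C b) \<xi>) *\<^sub>R b"]
      unfolding torus_def R_def by simp
  qed
  \<comment> \<open>Real and imaginary parts of characters are combinations of \<open>chr l\<close>
    and \<open>chr (- l)\<close>, and products of characters are characters, so polynomials in the
    coordinates remain trigonometric.\<close>
  have poly: "TP (\<lambda>\<xi>. complex_of_real (p (torus C \<xi>)))" if "real_polynomial_function p" for p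
    using that
  proof induction
    case (linear f)
    then interpret bounded_linear f .
    have "f (torus C \<xi>) = (\<Sum>b\<in>Basis. Re (chr (C b) \<xi>) * f (b, 0) + Im (chr (C b) \<xi>) * f (0, b))" for \<xi>
    proof -
      have "torus C \<xi> = (\<Sum>b\<in>Basis. Re (chr (C b) \<xi>) *\<^sub>R (b, 0) + Im (chr (C b) \<xi>) *\<^sub>R (0, b))"
        by (simp add: torus_def prod_eq_iff fst_sum snd_sum)
      then show ?thesis
        by (simp only: sum add scaleR real_scaleR_def)
    qed
    then show ?case
      by (simp only: of_real_sum of_real_add of_real_mult)
        (intro TP_sum TP.add TP_mult TP_Re_chr TP_Im_chr TP_const C)
  next
    case (const c)
    then show ?case by (rule TP_const)
  next
    case (add f g)
    then show ?case using TP.add by simp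
  next
    case (mult f g)
    then show ?case using TP_mult by simp
  qed
  have closed: "approximable (\<lambda>\<xi>. indicator K (torus C \<xi>))" if K: "closed K" for K
  proof (cases "K = {}")
    case True
    then show ?thesis
      using approximable_TP[OF TP_const[of 0]] by simp
  next
    case False
    \<comment> \<open>These continuous functions equal 1 on \<open>K\<close> and, for
      \<open>n > 0\<close>, vanish at distance at least \<open>1 / n\<close> from it. Empty
      \<open>K\<close> is treated separately because \<open>infdist\<close> to the empty set is 0 by
      convention.\<close>
    define h where "h n s = max 0 (1 - real n * infdist s K)" for n s
    have "\<exists>g. real_polynomial_function g \<and> (\<forall>s\<in>cball 0 R. \<bar>h n s - g s\<bar> < 1 / real (Suc n))" for n
    proof -
      have cont: "continuous_on (cball 0 R) (h n)"
        unfolding h_def by (intro continuous_intros continuous_on_infdist)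
      have "0 < 1 / real (Suc n)" by simp
      then obtain p where "real_polynomial_function p" "\<And>s. s \<in> cball 0 R \<Longrightarrow> \<bar>h n s - p s\<bar> < 1 / real (Suc n)"
        by (rule Stone_Weierstrass_real_polynomial_function[OF compact_cball cont]) (rule that)
      then show ?thesis
        by blast
    qed
    then obtain g where g: "\<And>n. real_polynomial_function (g n)" "\<And>n s. s \<in> cball 0 R \<Longrightarrow> \<bar>h n s - g n s\<bar> < 1 / real (Suc n)"
      by metis
    show ?thesis
    proof (rule approximable_LIMSEQ)
      show "approximable (\<lambda>\<xi>. complex_of_real (g n (torus C \<xi>)))" for n
        by (rule approximable_TP[OF poly[OF g(1)]])
      have [measurable]: "K \<in> sets borel" using K by simp
      show "(\<lambda>\<xi>. indicator K (torus C \<xi>) :: complex) \<in> borel_measurable \<mu>"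
        by measurable
      show "cmod (complex_of_real (g n (torus C \<xi>))) \<le> 2" for n \<xi>
      proof -
        have "\<bar>h n (torus C \<xi>)\<bar> \<le> 1"
          unfolding h_def using infdist_nonneg[of "torus C \<xi>" K] by (simp add: mult_nonneg_nonneg)
        moreover have "1 / real (Suc n) \<le> 1" by simp
        ultimately show ?thesis
          using g(2)[OF R[of \<xi>], of n] unfolding norm_of_real by linarith
      qed
      show "(\<lambda>n. complex_of_real (g n (torus C \<xi>))) \<longlonglongrightarrow> indicator K (torus C \<xi>)" for \<xi>
      proof -
        let ?s = "torus C \<xi>"
        have "(\<lambda>n. h n ?s) \<longlonglongrightarrow> indicator K ?s"
        proof (cases "?s \<in> K")
          case True
          then show ?thesis
            by (simp add: h_def)
        next
          case ns: False
          then have pos: "0 < infdist ?s K"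
            using K False by (metis in_closed_iff_infdist_zero infdist_nonneg less_eq_real_def)
          obtain N :: nat where N: "1 / infdist ?s K \<le> real N"
            using real_arch_simple by blast
          have "\<forall>\<^sub>F n in sequentially. h n ?s = 0"
            using eventually_ge_at_top[of N]
          proof eventually_elim
            fix n assume "N \<le> n"
            then have "1 / infdist ?s K \<le> real n"
              using N by linarith
            then have "1 \<le> real n * infdist ?s K"
              using pos by (simp add: field_simps)
            then show "h n ?s = 0"
              by (simp add: h_def)
          qed
          then show ?thesis
            using ns by (simp add: tendsto_eventually)
        qed
        moreover have "(\<lambda>n. h n ?s - g n ?s) \<longlonglongrightarrow> 0"
        proof (rule Lim_null_comparison)
          show "\<forall>\<^sub>F n in sequentially. norm (h n ?s - g n ?s) \<le> 1 / real (Suc n)"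
            using g(2)[OF R[of \<xi>]] by (simp add: less_imp_le)
          show "(\<lambda>n. 1 / real (Suc n)) \<longlonglongrightarrow> 0"
            using LIMSEQ_inverse_real_of_nat by (simp add: inverse_eq_divide)
        qed
        ultimately have "(\<lambda>n. h n ?s - (h n ?s - g n ?s)) \<longlonglongrightarrow> indicator K ?s - 0"
          by (rule tendsto_diff)
        then have "(\<lambda>n. complex_of_real (g n ?s)) \<longlonglongrightarrow> complex_of_real (indicator K ?s)"
          by (intro tendsto_of_real) simp
        then show ?thesis
          by (cases "?s \<in> K") simp_all
      qed
    qed
  qed
  have X': "X \<in> sigma_sets UNIV (Collect closed)"
    using X by (subst (asm) borel_eq_closed) simp
  have "Int_stable (Collect (closed :: ('a phase \<times> 'a phase) set \<Rightarrow> bool))"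
    by (simp add: Int_stable_def closed_Int)
  moreover have "Collect closed \<subseteq> Pow (UNIV :: ('a phase \<times> 'a phase) set)"
    by simp
  ultimately show ?thesis using X'
  proof (induction X rule: sigma_sets_induct_disjoint)
    case (basic K)
    then show ?case by (simp add: closed)
  next
    case empty
    then show ?case by (simp add: approximable_TP TP_const)
  next
    case (compl K)
    have "approximable (\<lambda>\<xi>. 1 + - indicator K (torus C \<xi>))"
      by (intro approximable_add approximable_minus compl approximable_TP TP_const)
    then show ?case
      by (simp add: indicator_compl Compl_eq_Diff_UNIV[symmetric])
  next
    case (union K)
    have sums: "(\<Sum>i<n. indicator (K i) s) = (indicator (\<Union>i<n. K i) s :: complex)" for n s
      using union(1) by (subst indicator_UN_disjoint) (auto simp: disjoint_family_on_def)
    show ?case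
    proof (rule approximable_LIMSEQ)
      show "approximable (\<lambda>\<xi>. \<Sum>i<n. indicator (K i) (torus C \<xi>))" for n
      proof (induction n)
        case 0
        then show ?case using approximable_TP[OF TP_const[of 0]] by simp
      next
        case (Suc n)
        then show ?case using approximable_add[OF Suc union(3)[of n]] by (simp add: add.commute)
      qed
      have "\<And>i. K i \<in> sets borel"
        using union(2) by (subst borel_eq_closed) auto
      then have [measurable]: "(\<Union>i. K i) \<in> sets borel"
        by blast
      show "(\<lambda>\<xi>. indicator (\<Union>i. K i) (torus C \<xi>) :: complex) \<in> borel_measurable \<mu>"
        by measurable
      show "cmod (\<Sum>i<n. indicator (K i) (torus C \<xi>)) \<le> 1" for n \<xi>
        unfolding sums by (simp add: indicator_def)
      show "(\<lambda>n. \<Sum>i<n. indicator (K i) (torus C \<xi>) :: complex) \<longlonglongrightarrow> indicator (\<Union>i. K i) (torus C \<xi>)" for \<xi>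
        unfolding sums by (rule LIMSEQ_indicator_UN)
    qed
  qed
qed

text \<open>The embedding has a Borel left inverse modulo the adjoint lattice: the arguments of the
  characters of the \<open>C b\<close> determine the symplectic coordinates of a representative up
  to integers. Hence every measurable set of the dual group is cut out by a Borel set of the ambient
  space.\<close>

lemma torus_preimage:
  assumes lin: "linear C" and bij: "bij C" and \<Lambda>: "\<Lambda> = C ` int_points" and E: "E \<in> sets \<mu>"
  shows "\<exists>X\<in>sets borel. \<forall>\<xi>\<in>space \<mu>. torus C \<xi> \<in> X \<longleftrightarrow> \<xi> \<in> E"
proof -
  let ?L = "adjoint_lattice \<Lambda>"
  have "b \<in> int_points" if "b \<in> Basis" for b :: "'a phase"
    using that by (auto simp: int_points_def inner_Basis)
  then have CB: "C b \<in> \<Lambda>" if "b \<in> Basis" for b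
    using that \<Lambda> by blast
  \<comment> \<open>Symplectic coordinates with respect to the lattice basis \<open>C b\<close>;
    points with integral coordinates lie in the adjoint lattice.\<close>
  define D where "D z = (\<Sum>b\<in>Basis. sympl (C b) z *\<^sub>R b)" for z
  have Db: "D z \<bullet> b = sympl (C b) z" if "b \<in> Basis" for z b
    unfolding D_def using that by (simp add: inner_sum_left_Basis)
  have expand: "sympl (C k) z = (\<Sum>b\<in>Basis. (k \<bullet> b) * sympl (C b) z)" for k z
  proof -
    have sum: "sympl (\<Sum>b\<in>A. v b) z = (\<Sum>b\<in>A. sympl (v b) z)" for v :: "'a phase \<Rightarrow> 'a phase" and A
      by (induction A rule: infinite_finite_induct) (simp_all add: sympl_zero sympl_add_left)
    have "C k = (\<Sum>b\<in>Basis. (k \<bullet> b) *\<^sub>R C b)"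
      using linear_sum[OF lin, of "\<lambda>b. (k \<bullet> b) *\<^sub>R b" Basis] linear_scale[OF lin] by (simp add: euclidean_representation)
    then show ?thesis
      by (simp add: sum sympl_scaleR_left)
  qed
  have linD: "linear D"
    by (rule linearI) (simp_all add: D_def sympl_add_right sympl_scaleR_right scaleR_add_left sum.distrib scaleR_sum_right)
  have "inj D"
    unfolding linear_injective_0[OF linD]
  proof (intro allI impI)
    fix z assume "D z = 0"
    then have z: "sympl (C b) z = 0" if "b \<in> Basis" for b
      using Db[OF that, of z] by simp
    have "sympl (C k) z = 0" for k
      unfolding expand[of k z] by (intro sum.neutral) (simp add: z)
    \<comment> \<open>Nondegeneracy of the symplectic form: since \<open>C\<close> is onto, its
      range contains the rotation of \<open>z\<close>, whose pairing with \<open>z\<close> is minus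
      the squared norm of \<open>z\<close>.\<close>
    moreover obtain k where "(snd z, - fst z) = C k"
      using surjD[OF bij_is_surj[OF bij]] by blast
    ultimately have "sympl (snd z, - fst z) z = 0"
      by simp
    then have "- (fst z \<bullet> fst z) - snd z \<bullet> snd z = 0"
      by (simp add: sympl_def)
    then show "z = 0"
      by (simp add: prod_eq_iff) (smt (verit) inner_ge_zero inner_eq_zero_iff)
  qed
  then obtain D' where D': "linear D'" "D' \<circ> D = id"
    using linear_injective_left_inverse[OF linD] by blast
  then have DD': "D (D' x) = x" for x
    using linear_inverse_left[OF D'(1) linD] by (metis comp_apply id_apply)
  have dual: "w \<in> ?L" if "D w \<in> int_points" for w
    unfolding adjoint_lattice_def
  proof (intro CollectI ballI)
    fix l assume "l \<in> \<Lambda>"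
    then obtain k where k: "l = C k" "k \<in> int_points"
      using \<Lambda> by blast
    have "sympl (C k) w \<in> \<int>"
      unfolding expand[of k w] using k(2) that
      by (intro Ints_sum Ints_mult) (auto simp: int_points_def Db[symmetric])
    then have "sympl w l \<in> \<int>"
      by (subst sympl_swap) (simp add: k(1))
    then show "cis (2 * pi * sympl w l) = 1"
      by (auto elim!: Ints_cases simp: cis_multiple_2pi)
  qed
  \<comment> \<open>By \<open>Arg2pi_cis\<close> each argument divided by \<open>2 * pi\<close> is
    the fractional part of a coordinate of \<open>D z\<close>; the lost integer parts move the
    recovered point only within its coset.\<close>
  define \<psi> where "\<psi> s = (\<Sum>b\<in>Basis. (Arg2pi (Complex (fst s \<bullet> b) (snd s \<bullet> b)) / (2 * pi)) *\<^sub>R b)" for s :: "'a phase \<times> 'a phase"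
  have \<psi>: "D' (\<psi> (torus C (coset ?L z))) - z \<in> ?L" for z
  proof (rule dual)
    have "\<psi> (torus C (coset ?L z)) \<bullet> b = frac (sympl (C b) z)" if b: "b \<in> Basis" for b
    proof -
      have "Complex (fst (torus C (coset ?L z)) \<bullet> b) (snd (torus C (coset ?L z)) \<bullet> b) = chr (C b) (coset ?L z)"
        using b by (simp add: torus_def inner_sum_left_Basis)
      then show ?thesis
        using b by (simp add: \<psi>_def inner_sum_left_Basis chr_coset CB Arg2pi_cis)
    qed
    then have "D (D' (\<psi> (torus C (coset ?L z))) - z) \<bullet> b = - of_int \<lfloor>sympl (C b) z\<rfloor>" if "b \<in> Basis" for b
      using that by (simp add: linear_diff[OF linD] DD' inner_diff_left Db frac_def)
    then show "D (D' (\<psi> (torus C (coset ?L z))) - z) \<in> int_points"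
      by (auto simp: int_points_def)
  qed
  have "Complex x y = of_real x + \<i> * of_real y" for x y
    by (simp add: complex_eq_iff)
  then have \<psi>': "\<psi> = (\<lambda>s. \<Sum>b\<in>Basis. (Arg2pi (of_real (fst s \<bullet> b) + \<i> * of_real (snd s \<bullet> b)) / (2 * pi)) *\<^sub>R b)"
    by (simp add: \<psi>_def fun_eq_iff)
  have \<psi>_measurable [measurable]: "\<psi> \<in> borel_measurable borel"
    unfolding \<psi>'
    by (intro borel_measurable_sum borel_measurable_scaleR borel_measurable_const borel_measurable_divide
        measurable_compose[OF _ borel_measurable_Arg2pi] borel_measurable_continuous_onI continuous_intros)
  have [measurable]: "D' \<in> borel_measurable borel"
    using D'(1) by (intro borel_measurable_continuous_onI linear_continuous_on) (simp add: linear_conv_bounded_linear)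
  have E': "coset ?L -` E \<in> sets borel"
    using E unfolding sets_haar[OF full_rank_lattice_adjoint[OF lattice]] sets_quotient_borel by blast
  show ?thesis
  proof (intro bexI ballI)
    show "(\<lambda>s. D' (\<psi> s)) -` (coset ?L -` E) \<in> sets borel"
      using measurable_sets[of "\<lambda>s. D' (\<psi> s)" borel borel, OF _ E'] by simp
    fix \<xi> assume "\<xi> \<in> space \<mu>"
    then obtain z where z: "\<xi> = coset ?L z"
      by (auto simp: space_dual)
    have "coset ?L (D' (\<psi> (torus C \<xi>))) = \<xi>"
      using coset_eq[OF full_rank_lattice_adjoint[OF lattice] \<psi>[of z], of z] z by simp
    then show "torus C \<xi> \<in> (\<lambda>s. D' (\<psi> s)) -` (coset ?L -` E) \<longleftrightarrow> \<xi> \<in> E"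
      by simp
  qed
qed

lemma trig_poly_dense_indicator:
  assumes E: "E \<in> sets \<mu>" and "0 < e"
  obtains X a where "finite X" "X \<subseteq> \<Lambda>" "l2_dist \<mu> (trig_poly a X) (indicator E) < e"
proof -
  obtain C :: "'a phase \<Rightarrow> 'a phase" where C: "linear C" "bij C" "\<Lambda> = C ` int_points"
    using lattice by (auto simp: full_rank_lattice_def)
  have "C b \<in> \<Lambda>" if "b \<in> Basis" for b
    unfolding C(3) by (rule imageI) (use that in \<open>auto simp: int_points_def inner_Basis\<close>)
  moreover obtain X where X: "X \<in> sets borel" "\<And>\<xi>. \<xi> \<in> space \<mu> \<Longrightarrow> torus C \<xi> \<in> X \<longleftrightarrow> \<xi> \<in> E"
    using torus_preimage[OF C E] by blast
  ultimately obtain p where p: "TP p" "l2_dist \<mu> p (\<lambda>\<xi>. indicator X (torus C \<xi>)) < e"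
    using approximable_indicator_torus[of C X] \<open>0 < e\<close> unfolding approximable_def by blast
  have "l2_dist \<mu> p (\<lambda>\<xi>. indicator X (torus C \<xi>)) = l2_dist \<mu> p (indicator E)"
    unfolding l2_dist_def
    by (intro arg_cong[where f = sqrt] Bochner_Integration.integral_cong) (auto simp: X(2) indicator_def)
  then show thesis
    using that TP_trig_poly[OF p(1)] p(2) by metis
qed

end

section \<open>Extremal eigenvalues of \<open>X\<^sup>* X\<close>\<close>

text \<open>The real inner product on \<open>complex^'n\<close> is the real part of the Hermitian
  one, so \<open>conj_transpose X\<close> is the adjoint in the real sense too and the eigenvalue
  arguments below may be carried out over the reals.\<close>

lemma inner_conj_transpose:
  fixes X :: "complex^'n^'m"
  shows "inner (X *v v) w = inner v (conj_transpose X *v w)"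
proof -
  have c: "inner (a * x) y = inner x (cnj a * y)" for a x y :: complex
    by (simp add: inner_complex_def algebra_simps)
  have "inner (X *v v) w = (\<Sum>i\<in>UNIV. \<Sum>j\<in>UNIV. inner (v $ j) (cnj (X $ i $ j) * w $ i))"
    by (simp add: inner_vec_def matrix_vector_mult_def inner_sum_left c)
  also have "\<dots> = (\<Sum>j\<in>UNIV. \<Sum>i\<in>UNIV. inner (v $ j) (cnj (X $ i $ j) * w $ i))"
    by (rule sum.swap)
  also have "\<dots> = inner v (conj_transpose X *v w)"
    by (simp add: inner_vec_def matrix_vector_mult_def inner_sum_right conj_transpose_def)
  finally show ?thesis .
qed

lemma of_real_scalar_mult: "complex_of_real r *s v = r *\<^sub>R (v :: complex^'n)"
  by (simp add: vec_eq_iff complex_eq_iff)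

lemma linear_complex_matrix: "linear (\<lambda>v. (X :: complex^'n^'m) *v v)"
proof (rule linearI)
  show "X *v (r *\<^sub>R v) = r *\<^sub>R (X *v v)" for r v
    by (simp add: vector_scalar_commute flip: of_real_scalar_mult)
qed (rule matrix_vector_right_distrib)

lemma zero_if_quadratic_nonneg:
  fixes b q :: real
  assumes "\<And>t. 0 \<le> 2 * t * b + t\<^sup>2 * q"
  shows "b = 0"
proof (rule ccontr)
  assume "b \<noteq> 0"
  \<comment> \<open>At \<open>t = - b / d\<close> the quadratic equals
    \<open>b\<^sup>2 * (q - 2 * d) / d\<^sup>2\<close>, and this \<open>d\<close> makes it
    negative.\<close>
  define d where "d = \<bar>q\<bar> + 1"
  have d: "0 < d" "q < 2 * d" by (auto simp: d_def)
  have "0 \<le> 2 * (- b / d) * b + (- b / d)\<^sup>2 * q"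
    by (rule assms)
  also have "\<dots> = b\<^sup>2 * (q - 2 * d) / d\<^sup>2"
    using d by (simp add: field_simps power2_eq_square)
  also have "\<dots> < 0"
    using d \<open>b \<noteq> 0\<close> by (intro divide_neg_pos mult_pos_neg) auto
  finally show False by simp
qed

context
  fixes X :: "complex^'n^'m"
begin

private abbreviation (input) Y :: "complex^'n^'n" where "Y \<equiv> conj_transpose X ** X"

private lemma inner_Y: "inner (X *v v) (X *v w) = inner v (Y *v w)"
  by (simp add: inner_conj_transpose matrix_vector_mul_assoc)

private lemma inner_Y_sym: "inner (Y *v v) w = inner v (Y *v w)"
  using inner_Y[of w v] inner_Y[of v w] by (simp add: inner_commute)

private lemma eigenvalue_iff: "r \<in> real_eigenvalues Y \<longleftrightarrow> (\<exists>v. v \<noteq> 0 \<and> Y *v v = r *\<^sub>R v)"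
  by (simp add: real_eigenvalues_def of_real_scalar_mult)

private lemma eigenvalue_norm:
  assumes "Y *v v = r *\<^sub>R v"
  shows "(norm (X *v v))\<^sup>2 = r * (norm v)\<^sup>2"
  using inner_Y[of v v] assms by (simp add: power2_norm_eq_inner)

text \<open>Eigenvectors of a symmetric matrix for different eigenvalues are orthogonal, hence
  independent. Finiteness is what gives \<open>Min\<close> and \<open>Max\<close> in
  \<open>lambda_min\<close> and \<open>lambda_max\<close> their meaning.\<close>

private lemma finite_eigenvalues: "finite (real_eigenvalues Y)"
proof -
  obtain e where e: "\<And>r. r \<in> real_eigenvalues Y \<Longrightarrow> e r \<noteq> 0 \<and> Y *v e r = r *\<^sub>R e r"
    using eigenvalue_iff by metis
  have orth: "inner (e r) (e s) = 0" if "r \<in> real_eigenvalues Y" "s \<in> real_eigenvalues Y" "r \<noteq> s" for r s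
  proof -
    have "r * inner (e r) (e s) = s * inner (e r) (e s)"
      using inner_Y_sym[of "e r" "e s"] e[OF that(1)] e[OF that(2)] by simp
    then show ?thesis using that(3) by simp
  qed
  have inj: "inj_on e (real_eigenvalues Y)"
    by (rule inj_onI) (metis e orth inner_eq_zero_iff)
  have "independent (e ` real_eigenvalues Y)"
  proof (rule pairwise_orthogonal_independent)
    show "pairwise orthogonal (e ` real_eigenvalues Y)"
      unfolding pairwise_def orthogonal_def by (auto intro: orth)
    show "0 \<notin> e ` real_eigenvalues Y"
      using e by auto
  qed
  then have "finite (e ` real_eigenvalues Y)"
    by (rule independent_imp_finite)
  then show ?thesis
    using inj by (rule finite_imageD)
qed

private lemma unit_sphere: "compact {v::complex^'n. norm v = 1}" "{v::complex^'n. norm v = 1} \<noteq> {}"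
proof -
  show "compact {v::complex^'n. norm v = 1}"
    using compact_sphere[of "0::complex^'n" 1] by (simp add: sphere_def)
  show "{v::complex^'n. norm v = 1} \<noteq> {}"
    using vector_choose_size[of 1, where 'a = "complex^'n"] by auto
qed

private lemma continuous_norm_power2: "continuous_on S (\<lambda>v. (norm (X *v v))\<^sup>2)"
  by (intro continuous_intros)

private lemma norm_power2_scale:
  assumes "v \<noteq> 0"
  shows "(norm (X *v v))\<^sup>2 = (norm v)\<^sup>2 * (norm (X *v ((1 / norm v) *\<^sub>R v)))\<^sup>2" "norm ((1 / norm v) *\<^sub>R v) = 1"
  using assms by (simp_all add: linear_scale[OF linear_complex_matrix] power_mult_distrib power_divide)

private lemma norm_power2_add_scaleR:
  "(norm (X *v (u + t *\<^sub>R w)))\<^sup>2 = (norm (X *v u))\<^sup>2 + 2 * t * inner (Y *v u) w + t\<^sup>2 * (norm (X *v w))\<^sup>2"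
proof -
  have "(norm (X *v (u + t *\<^sub>R w)))\<^sup>2 = inner (X *v u) (X *v u) + 2 * t * inner (X *v u) (X *v w) + t\<^sup>2 * inner (X *v w) (X *v w)"
    unfolding power2_norm_eq_inner linear_add[OF linear_complex_matrix] linear_scale[OF linear_complex_matrix]
    by (simp add: inner_add_left inner_add_right inner_commute power2_eq_square algebra_simps)
  moreover have "inner (X *v u) (X *v w) = inner (Y *v u) w"
    by (simp add: inner_Y inner_Y_sym)
  ultimately show ?thesis
    by (simp add: power2_norm_eq_inner)
qed

private lemma norm_power2_add:
  "(norm ((u::complex^'n) + t *\<^sub>R w))\<^sup>2 = (norm u)\<^sup>2 + 2 * t * inner u w + t\<^sup>2 * (norm w)\<^sup>2"
  unfolding power2_norm_eq_inner
  by (simp add: inner_add_left inner_add_right inner_commute power2_eq_square algebra_simps)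

text \<open>At an extremum of the Rayleigh quotient the first variation vanishes.\<close>

private lemma extremal_eigenvector:
  assumes ext: "s = 1 \<or> s = - 1" "\<And>v. s * (r * (norm v)\<^sup>2) \<le> s * (norm (X *v v))\<^sup>2"
    and u: "(norm (X *v u))\<^sup>2 = r * (norm u)\<^sup>2"
  shows "Y *v u = r *\<^sub>R u"
proof -
  \<comment> \<open>The variation is taken in the direction of the residual itself, so the vanishing
    first-order term is the squared norm of the residual. The sign \<open>s\<close> treats minimum
    and maximum together.\<close>
  define z where "z = Y *v u - r *\<^sub>R u"
  have "0 \<le> 2 * t * (s * inner z z) + t\<^sup>2 * (s * ((norm (X *v z))\<^sup>2 - r * (norm z)\<^sup>2))" for t
    using ext(2)[of "u + t *\<^sub>R z"] u unfolding norm_power2_add_scaleR norm_power2_add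
    by (simp add: z_def inner_diff_left algebra_simps)
  then have "s * inner z z = 0"
    by (rule zero_if_quadratic_nonneg)
  then show ?thesis
    using ext(1) by (auto simp: z_def)
qed

text \<open>The Rayleigh quotient attains its minimum on the compact unit sphere; the minimiser is
  an eigenvector, and evaluating the quotient at eigenvectors shows that no eigenvalue is smaller.
  This trades the eigenvalue for norm inequalities about \<open>X\<close>.\<close>

lemma lambda_min:
  shows lambda_min_le: "lambda_min (conj_transpose X ** X) * (norm v)\<^sup>2 \<le> (norm (X *v v))\<^sup>2"
    and lambda_min_attained: "\<exists>u. u \<noteq> 0 \<and> (norm (X *v u))\<^sup>2 = lambda_min (conj_transpose X ** X) * (norm u)\<^sup>2"
proof -
  obtain u where u: "norm u = 1" "\<And>v. norm v = 1 \<Longrightarrow> (norm (X *v u))\<^sup>2 \<le> (norm (X *v v))\<^sup>2"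
    using continuous_attains_inf[OF unit_sphere continuous_norm_power2] by auto
  define r where "r = (norm (X *v u))\<^sup>2"
  have r: "r * (norm v)\<^sup>2 \<le> (norm (X *v v))\<^sup>2" for v
  proof (cases "v = 0")
    case False
    show ?thesis
      unfolding norm_power2_scale(1)[OF False] r_def mult.commute[of _ "(norm v)\<^sup>2"]
      by (intro mult_left_mono u norm_power2_scale(2)[OF False]) simp
  qed simp
  have "Y *v u = r *\<^sub>R u"
    by (rule extremal_eigenvector[of 1]) (use r u in \<open>auto simp: r_def\<close>)
  then have eig: "r \<in> real_eigenvalues Y"
    using u(1) by (auto simp: eigenvalue_iff intro!: exI[of _ u])
  have "r \<le> s" if "s \<in> real_eigenvalues Y" for s
  proof -
    from that obtain v where v: "v \<noteq> 0 \<and> Y *v v = s *\<^sub>R v"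
      unfolding eigenvalue_iff ..
    have "r * (norm v)\<^sup>2 \<le> s * (norm v)\<^sup>2"
      using r[of v] unfolding eigenvalue_norm[OF conjunct2[OF v]] .
    then show ?thesis
      using v by simp
  qed
  then have "lambda_min Y = r"
    unfolding lambda_min_def by (rule Min_eqI[OF finite_eigenvalues _ eig])
  then show "lambda_min Y * (norm v)\<^sup>2 \<le> (norm (X *v v))\<^sup>2" "\<exists>u. u \<noteq> 0 \<and> (norm (X *v u))\<^sup>2 = lambda_min Y * (norm u)\<^sup>2"
    using r[of v] u(1) by (auto simp: r_def intro!: exI[of _ u])
qed

lemma le_lambda_max: "(norm (X *v v))\<^sup>2 \<le> lambda_max (conj_transpose X ** X) * (norm v)\<^sup>2"
proof -
  obtain u where u: "norm u = 1" "\<And>v. norm v = 1 \<Longrightarrow> (norm (X *v v))\<^sup>2 \<le> (norm (X *v u))\<^sup>2"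
    using continuous_attains_sup[OF unit_sphere continuous_norm_power2] by auto
  define r where "r = (norm (X *v u))\<^sup>2"
  have r: "(norm (X *v v))\<^sup>2 \<le> r * (norm v)\<^sup>2" for v
  proof (cases "v = 0")
    case True
    then show ?thesis
      using linear_0[OF linear_complex_matrix, of X] by simp
  next
    case False
    show ?thesis
      unfolding norm_power2_scale(1)[OF False] r_def mult.commute[of _ "(norm v)\<^sup>2"]
      by (intro mult_left_mono u norm_power2_scale(2)[OF False]) simp
  qed
  have "Y *v u = r *\<^sub>R u"
    by (rule extremal_eigenvector[of "-1"]) (use r u in \<open>auto simp: r_def\<close>)
  then have "r \<in> real_eigenvalues Y"
    using u(1) by (auto simp: eigenvalue_iff intro!: exI[of _ u])
  then have "r \<le> lambda_max Y"
    unfolding lambda_max_def by (intro Max_ge finite_eigenvalues)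
  then have "r * (norm v)\<^sup>2 \<le> lambda_max Y * (norm v)\<^sup>2"
    by (intro mult_right_mono) auto
  with r[of v] show ?thesis
    by linarith
qed

end

lemma lambda_min_ge:
  fixes X :: "complex^'n^'m"
  assumes "\<And>v. r * (norm v)\<^sup>2 \<le> (norm (X *v v))\<^sup>2"
  shows "r \<le> lambda_min (conj_transpose X ** X)"
proof -
  obtain u :: "complex^'n" where "u \<noteq> 0" "(norm (X *v u))\<^sup>2 = lambda_min (conj_transpose X ** X) * (norm u)\<^sup>2"
    using lambda_min_attained by blast
  then show ?thesis
    using assms[of u] by simp
qed

text \<open>A positive smallest eigenvalue makes \<open>X\<close> injective; the real dimensions
  compared are twice the numbers of columns and rows.\<close>

lemma card_le_if_lambda_min_pos:
  fixes X :: "complex^'n^'m"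
  assumes "0 < lambda_min (conj_transpose X ** X)"
  shows "CARD('n) \<le> CARD('m)"
proof -
  have "v = 0" if "X *v v = 0" for v
    using lambda_min_le[of X v] that assms by (simp add: mult_le_0_iff)
  then have "inj (\<lambda>v. X *v v)"
    by (simp add: linear_injective_0[OF linear_complex_matrix])
  then have "dim (range (\<lambda>v. X *v v)) = DIM(complex^'n)"
    using dim_image_eq[OF linear_complex_matrix, of X UNIV] by simp
  then have "DIM(complex^'n) \<le> DIM(complex^'m)"
    using dim_subset_UNIV[of "range (\<lambda>v. X *v v)"] by simp
  then show ?thesis
    by simp
qed

lemma measurable_norm_matrix_vector:
  fixes X :: "'x \<Rightarrow> complex^'n^'m"
  assumes [measurable]: "\<And>m n. (\<lambda>\<xi>. X \<xi> $ m $ n) \<in> borel_measurable M"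
  shows "(\<lambda>\<xi>. (norm (X \<xi> *v v))\<^sup>2) \<in> borel_measurable M"
  unfolding norm_vec_def L2_set_def matrix_vector_mult_def by simp

text \<open>\<open>lambda_min\<close> is below \<open>a\<close> exactly if the Rayleigh quotient is
  below \<open>a\<close> somewhere. This is an open condition on the vector, so a countable dense
  set of vectors detects it. Measurability is demanded by \<open>esssup_I\<close>.\<close>

lemma measurable_lambda_min:
  fixes X :: "'x \<Rightarrow> complex^'n^'m"
  assumes X: "\<And>m n. (\<lambda>\<xi>. X \<xi> $ m $ n) \<in> borel_measurable M"
  shows "(\<lambda>\<xi>. lambda_min (conj_transpose (X \<xi>) ** X \<xi>)) \<in> borel_measurable M"
proof (rule borel_measurableI_less)
  fix a :: real
  have [measurable]: "(\<lambda>\<xi>. (norm (X \<xi> *v v))\<^sup>2) \<in> borel_measurable M" for v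
    by (rule measurable_norm_matrix_vector[OF X])
  obtain D :: "(complex^'n) set" where D: "countable D" "\<And>U. open U \<Longrightarrow> U \<noteq> {} \<Longrightarrow> \<exists>d\<in>D. d \<in> U"
    using countable_dense_exists by blast
  have "lambda_min (conj_transpose (X \<xi>) ** X \<xi>) < a \<longleftrightarrow> (\<exists>v\<in>D. (norm (X \<xi> *v v))\<^sup>2 < a * (norm v)\<^sup>2)" for \<xi>
  proof
    assume less: "lambda_min (conj_transpose (X \<xi>) ** X \<xi>) < a"
    obtain u :: "complex^'n" where u: "u \<noteq> 0" "(norm (X \<xi> *v u))\<^sup>2 = lambda_min (conj_transpose (X \<xi>) ** X \<xi>) * (norm u)\<^sup>2"
      using lambda_min_attained by blast
    have "open {v. (norm (X \<xi> *v v))\<^sup>2 < a * (norm v)\<^sup>2}"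
      by (intro open_Collect_less continuous_intros)
    moreover have "u \<in> {v. (norm (X \<xi> *v v))\<^sup>2 < a * (norm v)\<^sup>2}"
      using less u by simp
    ultimately show "\<exists>v\<in>D. (norm (X \<xi> *v v))\<^sup>2 < a * (norm v)\<^sup>2"
      using D(2) by blast
  next
    assume "\<exists>v\<in>D. (norm (X \<xi> *v v))\<^sup>2 < a * (norm v)\<^sup>2"
    then obtain v where "(norm (X \<xi> *v v))\<^sup>2 < a * (norm v)\<^sup>2"
      by blast
    then have "lambda_min (conj_transpose (X \<xi>) ** X \<xi>) * (norm v)\<^sup>2 < a * (norm v)\<^sup>2"
      using lambda_min_le[of "X \<xi>" v] by linarith
    then show "lambda_min (conj_transpose (X \<xi>) ** X \<xi>) < a"
      by (metis mult_right_mono not_less zero_le_power2)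
  qed
  then have "{\<xi>\<in>space M. lambda_min (conj_transpose (X \<xi>) ** X \<xi>) < a} =
      (\<Union>v\<in>D. {\<xi>\<in>space M. (norm (X \<xi> *v v))\<^sup>2 < a * (norm v)\<^sup>2})"
    by auto
  also have "\<dots> \<in> sets M"
    using D(1) by (intro sets.countable_UN'') measurable
  finally show "{\<xi>\<in>space M. lambda_min (conj_transpose (X \<xi>) ** X \<xi>) < a} \<in> sets M" .
qed

section \<open>Convolution operators\<close>

lemma (in lattice) ell2_shift:
  assumes c: "c \<in> ell2 \<Lambda>" and k: "k \<in> \<Lambda>"
  shows "(\<lambda>l. c (l - k)) \<in> ell2 \<Lambda>"
proof -
  have "bij_betw (\<lambda>l. l - k) \<Lambda> \<Lambda>"
    using bij_betw_lattice_shift[OF lattice_minus[OF k]] by simp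
  from summable_on_reindex_bij_betw[OF this, of "\<lambda>l. (cmod (c l))\<^sup>2"] show ?thesis
    using c by (simp add: ell2_iff)
qed

lemma (in lattice) ell2_reflect:
  assumes c: "c \<in> ell2 \<Lambda>" and k: "k \<in> \<Lambda>"
  shows "(\<lambda>l. c (k - l)) \<in> ell2 \<Lambda>"
  using summable_on_reindex_bij_betw[OF bij_betw_lattice_reflect[OF k], of "\<lambda>l. (cmod (c l))\<^sup>2"] c
  by (simp add: ell2_iff)

lemma ell2_cong: "(\<And>l. l \<in> I \<Longrightarrow> c l = d l) \<Longrightarrow> c \<in> ell2 I \<longleftrightarrow> d \<in> ell2 I"
  unfolding ell2_iff by (rule summable_on_cong) simp

lemma (in lattice) fourier_sum_cong:
  assumes "fourier_sum c f" "\<And>l. l \<in> \<Lambda> \<Longrightarrow> c l = d l"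
  shows "fourier_sum d f"
proof -
  have "\<forall>\<^sub>F X in finite_subsets_at_top \<Lambda>. l2_dist \<mu> (trig_poly c X) f = l2_dist \<mu> (trig_poly d X) f"
  proof (rule eventually_finite_subsets_at_top_weakI)
    fix X assume "X \<subseteq> \<Lambda>"
    then have "trig_poly c X = trig_poly d X"
      using assms(2) by (auto simp: trig_poly_def fun_eq_iff intro!: sum.cong)
    then show "l2_dist \<mu> (trig_poly c X) f = l2_dist \<mu> (trig_poly d X) f"
      by simp
  qed
  then show ?thesis
    using assms(1) unfolding fourier_sum_def by (auto elim: Lim_transform_eventually)
qed

text \<open>Reflecting \<open>k\<close> to \<open>l - k\<close> moves the summation variable into
  \<open>c\<close>, so that truncating \<open>c\<close> to a finite set turns the convolution into a
  finite sum of shifts of \<open>a\<close>.\<close>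

lemma (in lattice) conv_has_sum:
  assumes a: "a \<in> ell2 \<Lambda>" and c: "c \<in> ell2 \<Lambda>" and l: "l \<in> \<Lambda>"
  shows "((\<lambda>k. c k * a (l - k)) has_sum conv \<Lambda> a c l) \<Lambda>"
proof -
  have "conv \<Lambda> a c l = (\<Sum>\<^sub>\<infinity>k\<in>\<Lambda>. a (l - k) * c (l - (l - k)))"
    unfolding conv_def by (rule infsum_reindex_bij_betw[OF bij_betw_lattice_reflect[OF l], symmetric])
  also have "\<dots> = (\<Sum>\<^sub>\<infinity>k\<in>\<Lambda>. c k * a (l - k))"
    by (simp add: mult.commute)
  finally show ?thesis
    using abs_summable_summable[OF Cauchy_Schwarz_ell2(1)[OF c ell2_reflect[OF a l]]] by simp
qed

lemma norm_vec_power2: "(norm (v :: complex^'n))\<^sup>2 = (\<Sum>i\<in>UNIV. (cmod (v $ i))\<^sup>2)"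
  by (simp add: norm_vec_def L2_set_def sum_nonneg)

definition ell2_sqnorm :: "'b set \<Rightarrow> ('k::finite \<Rightarrow> 'b \<Rightarrow> complex) \<Rightarrow> real" where
  "ell2_sqnorm I c = (\<Sum>k\<in>UNIV. \<Sum>\<^sub>\<infinity>l\<in>I. (cmod (c k l))\<^sup>2)"

lemma ell2_sqnorm_add:
  assumes "\<And>k. u k \<in> ell2 I" "\<And>k. w k \<in> ell2 I" "0 < t"
  shows "ell2_sqnorm I (\<lambda>k l. u k l + w k l) \<le> (1 + t) * ell2_sqnorm I u + (1 + 1 / t) * ell2_sqnorm I w"
proof -
  have "(\<Sum>\<^sub>\<infinity>l\<in>I. (cmod (u k l + w k l))\<^sup>2) \<le>
      (1 + t) * (\<Sum>\<^sub>\<infinity>l\<in>I. (cmod (u k l))\<^sup>2) + (1 + 1 / t) * (\<Sum>\<^sub>\<infinity>l\<in>I. (cmod (w k l))\<^sup>2)" for k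
  proof -
    have s: "(\<lambda>l. (1 + t) * (cmod (u k l))\<^sup>2) summable_on I" "(\<lambda>l. (1 + 1 / t) * (cmod (w k l))\<^sup>2) summable_on I"
      using assms(1,2)[of k] by (auto simp: ell2_iff intro!: summable_on_cmult_right)
    have "(\<Sum>\<^sub>\<infinity>l\<in>I. (cmod (u k l + w k l))\<^sup>2) \<le> (\<Sum>\<^sub>\<infinity>l\<in>I. (1 + t) * (cmod (u k l))\<^sup>2 + (1 + 1 / t) * (cmod (w k l))\<^sup>2)"
      using ell2_add[OF assms(1,2)[of k]] power2_norm_add_weighted[OF assms(3)]
      by (intro infsum_mono summable_on_add s) (auto simp: ell2_iff)
    also have "\<dots> = (1 + t) * (\<Sum>\<^sub>\<infinity>l\<in>I. (cmod (u k l))\<^sup>2) + (1 + 1 / t) * (\<Sum>\<^sub>\<infinity>l\<in>I. (cmod (w k l))\<^sup>2)"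
      by (subst infsum_add[OF s]) (simp only: infsum_cmult_right')
    finally show ?thesis .
  qed
  then have "ell2_sqnorm I (\<lambda>k l. u k l + w k l) \<le>
      (\<Sum>k\<in>UNIV. (1 + t) * (\<Sum>\<^sub>\<infinity>l\<in>I. (cmod (u k l))\<^sup>2) + (1 + 1 / t) * (\<Sum>\<^sub>\<infinity>l\<in>I. (cmod (w k l))\<^sup>2))"
    unfolding ell2_sqnorm_def by (intro sum_mono)
  then show ?thesis
    by (simp add: ell2_sqnorm_def sum.distrib sum_distrib_left)
qed

text \<open>Translates and their series are indexed by pairs, whereas convolution and Fourier series
  act on each component; the sum over pairs splits into one slice per component.\<close>

lemma
  fixes c :: "'k::finite \<Rightarrow> 'b \<Rightarrow> complex"
  shows ell2_pairs_iff: "(\<lambda>(l, k). c k l) \<in> ell2 (I \<times> UNIV) \<longleftrightarrow> (\<forall>k. c k \<in> ell2 I)"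
    and infsum_pairs: "(\<forall>k. c k \<in> ell2 I) \<Longrightarrow>
      (\<Sum>\<^sub>\<infinity>i\<in>I \<times> UNIV. (cmod ((\<lambda>(l, k). c k l) i))\<^sup>2) = ell2_sqnorm I c"
proof -
  let ?F = "\<lambda>i. (cmod ((\<lambda>(l, k). c k l) i))\<^sup>2"
  have bij: "bij_betw (\<lambda>l. (l, k)) I (I \<times> {k})" for k :: 'k
    by (auto simp: bij_betw_def inj_on_def)
  have slice: "(?F has_sum s) (I \<times> {k}) \<longleftrightarrow> ((\<lambda>l. (cmod (c k l))\<^sup>2) has_sum s) I" for k s
    using has_sum_reindex_bij_betw[OF bij[of k], of ?F s] by simp
  have U: "I \<times> UNIV = (\<Union>k\<in>UNIV. I \<times> {k :: 'k})"
    by auto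
  have hs: "(?F has_sum ell2_sqnorm I c) (I \<times> UNIV)" if "\<forall>k. c k \<in> ell2 I"
    unfolding U ell2_sqnorm_def
    by (rule sum_has_sum) (use that in \<open>auto simp: slice ell2_iff\<close>)
  show "(\<Sum>\<^sub>\<infinity>i\<in>I \<times> UNIV. (cmod ((\<lambda>(l, k). c k l) i))\<^sup>2) = ell2_sqnorm I c" if "\<forall>k. c k \<in> ell2 I"
    by (rule infsumI[OF hs[OF that]])
  show "(\<lambda>(l, k). c k l) \<in> ell2 (I \<times> UNIV) \<longleftrightarrow> (\<forall>k. c k \<in> ell2 I)"
  proof
    assume "(\<lambda>(l, k). c k l) \<in> ell2 (I \<times> UNIV)"
    then have "?F summable_on I \<times> {k}" for k
      unfolding ell2_iff by (rule summable_on_subset_banach) auto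
    then show "\<forall>k. c k \<in> ell2 I"
      unfolding ell2_iff summable_on_def slice by blast
  next
    assume "\<forall>k. c k \<in> ell2 I"
    then have "?F summable_on I \<times> UNIV"
      using hs by (blast intro: has_sum_imp_summable)
    then show "(\<lambda>(l, k). c k l) \<in> ell2 (I \<times> UNIV)"
      unfolding ell2_iff .
  qed
qed

lemma has_sum_finite_sum:
  fixes f :: "'k \<Rightarrow> 'i \<Rightarrow> 'v::topological_comm_monoid_add"
  shows "(\<And>k. k \<in> K \<Longrightarrow> (f k has_sum s k) I) \<Longrightarrow> ((\<lambda>i. \<Sum>k\<in>K. f k i) has_sum (\<Sum>k\<in>K. s k)) I"
  by (induction K rule: infinite_finite_induct) (auto intro: has_sum_add)

locale convolution = lattice \<Lambda> for \<Lambda> :: "'a::euclidean_space phase set" +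
  fixes A :: "'m::finite \<Rightarrow> 'n::finite \<Rightarrow> 'a phase \<Rightarrow> complex"
  assumes A: "\<And>m n. A m n \<in> ell2 \<Lambda>"
begin

definition restrict_to :: "'a phase set \<Rightarrow> ('n \<Rightarrow> 'a phase \<Rightarrow> complex) \<Rightarrow> 'n \<Rightarrow> 'a phase \<Rightarrow> complex" where
  "restrict_to X c n l = (if l \<in> X then c n l else 0)"

lemma restrict_to_ell2: "finite X \<Longrightarrow> restrict_to X c n \<in> ell2 \<Lambda>"
  by (rule ell2_finite_support[of X]) (auto simp: restrict_to_def)

lemma mat_conv_has_sum:
  assumes c: "\<And>n. c n \<in> ell2 \<Lambda>" and l: "l \<in> \<Lambda>"
  shows "((\<lambda>k. \<Sum>n\<in>UNIV. c n k * A m n (l - k)) has_sum mat_conv \<Lambda> A c m l) \<Lambda>"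
  unfolding mat_conv_def by (intro has_sum_finite_sum conv_has_sum A c l)

lemma mat_conv_restrict_to:
  assumes X: "finite X" "X \<subseteq> \<Lambda>" and l: "l \<in> \<Lambda>"
  shows "mat_conv \<Lambda> A (restrict_to X c) m l = (\<Sum>k\<in>X. \<Sum>n\<in>UNIV. c n k * A m n (l - k))"
proof -
  have "((\<lambda>k. \<Sum>n\<in>UNIV. restrict_to X c n k * A m n (l - k)) has_sum mat_conv \<Lambda> A (restrict_to X c) m l) \<Lambda>"
    by (rule mat_conv_has_sum[OF restrict_to_ell2[OF X(1)] l])
  moreover have "((\<lambda>k. \<Sum>n\<in>UNIV. restrict_to X c n k * A m n (l - k)) has_sum (\<Sum>k\<in>X. \<Sum>n\<in>UNIV. c n k * A m n (l - k))) \<Lambda>"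
    by (rule has_sum_finite_neutralI[OF X]) (auto simp: restrict_to_def intro!: sum.cong)
  ultimately show ?thesis
    by (rule has_sum_unique)
qed

lemma mat_conv_cong:
  assumes "\<And>n l. l \<in> \<Lambda> \<Longrightarrow> c n l = d n l" "l \<in> \<Lambda>"
  shows "mat_conv \<Lambda> A c m l = mat_conv \<Lambda> A d m l"
  unfolding mat_conv_def conv_def
  by (intro sum.cong refl infsum_cong) (simp add: assms lattice_diff)

lemma mat_conv_shift:
  assumes "\<And>n l. l \<in> \<Lambda> \<Longrightarrow> d n l = c n (l - k)" "l \<in> \<Lambda>" "k \<in> \<Lambda>"
  shows "mat_conv \<Lambda> A d m (l + k) = mat_conv \<Lambda> A c m l"
  unfolding mat_conv_def conv_def
proof (intro sum.cong refl infsum_cong)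
  fix n l' assume "l' \<in> \<Lambda>"
  then have "l + k - l' \<in> \<Lambda>"
    using assms by (intro lattice_diff lattice_add)
  then show "A m n l' * d n (l + k - l') = A m n l' * c n (l - l')"
    by (simp add: assms(1) algebra_simps)
qed

lemma mat_conv_add:
  assumes c: "\<And>n. c n \<in> ell2 \<Lambda>" and d: "\<And>n. d n \<in> ell2 \<Lambda>" and l: "l \<in> \<Lambda>"
  shows "mat_conv \<Lambda> A (\<lambda>n l. c n l + d n l) m l = mat_conv \<Lambda> A c m l + mat_conv \<Lambda> A d m l"
proof -
  have "((\<lambda>k. \<Sum>n\<in>UNIV. (c n k + d n k) * A m n (l - k)) has_sum mat_conv \<Lambda> A c m l + mat_conv \<Lambda> A d m l) \<Lambda>"
    unfolding distrib_right sum.distrib by (intro has_sum_add mat_conv_has_sum c d l)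
  moreover have "((\<lambda>k. \<Sum>n\<in>UNIV. (c n k + d n k) * A m n (l - k)) has_sum mat_conv \<Lambda> A (\<lambda>n l. c n l + d n l) m l) \<Lambda>"
    by (intro mat_conv_has_sum ell2_add c d l)
  ultimately show ?thesis
    by (rule has_sum_unique[rotated])
qed

lemma mat_conv_cmult:
  assumes c: "\<And>n. c n \<in> ell2 \<Lambda>" and l: "l \<in> \<Lambda>"
  shows "mat_conv \<Lambda> A (\<lambda>n l. z * c n l) m l = z * mat_conv \<Lambda> A c m l"
proof -
  have "((\<lambda>k. z * (\<Sum>n\<in>UNIV. c n k * A m n (l - k))) has_sum z * mat_conv \<Lambda> A c m l) \<Lambda>"
    by (intro has_sum_cmult_right mat_conv_has_sum c l)
  then have "((\<lambda>k. \<Sum>n\<in>UNIV. z * c n k * A m n (l - k)) has_sum z * mat_conv \<Lambda> A c m l) \<Lambda>"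
    by (simp add: sum_distrib_left mult.assoc)
  moreover have "((\<lambda>k. \<Sum>n\<in>UNIV. z * c n k * A m n (l - k)) has_sum mat_conv \<Lambda> A (\<lambda>n l. z * c n l) m l) \<Lambda>"
    by (intro mat_conv_has_sum ell2_cmult c l)
  ultimately show ?thesis
    by (rule has_sum_unique[rotated])
qed

section \<open>The transfer matrix on finitely supported sequences\<close>

abbreviation hat :: "'a phase set \<Rightarrow> complex^'n^'m" where
  "hat \<xi> \<equiv> transfer_matrix \<Lambda> A \<xi>"

definition poly_vec :: "'a phase set \<Rightarrow> ('n \<Rightarrow> 'a phase \<Rightarrow> complex) \<Rightarrow> 'a phase set \<Rightarrow> complex^'n" where
  "poly_vec X c \<xi> = (\<chi> n. trig_poly (c n) X \<xi>)"

lemma hat_measurable: "(\<lambda>\<xi>. hat \<xi> $ m $ n) \<in> borel_measurable \<mu>"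
  using fourier_series[OF A] by (simp add: transfer_matrix_def fourier_sum_def square_integrable_def)

text \<open>For finite support the convolution is a finite combination of shifts of the entries of
  \<open>A\<close>, so linearity and \<open>fourier_sum_shift\<close> give both square-summability
  and the product formula. For general \<open>c\<close>, square-summability has to wait for a bound
  on the transfer matrix.\<close>

lemma
  assumes X: "finite X" "X \<subseteq> \<Lambda>"
  shows mat_conv_restrict_to_ell2: "mat_conv \<Lambda> A (restrict_to X c) m \<in> ell2 \<Lambda>"
    and fourier_sum_mat_conv:
      "fourier_sum (mat_conv \<Lambda> A (restrict_to X c) m) (\<lambda>\<xi>. (hat \<xi> *v poly_vec X c \<xi>) $ m)"
proof -
  have "(\<lambda>l. \<Sum>k\<in>X. \<Sum>n\<in>UNIV. c n k * A m n (l - k)) \<in> ell2 \<Lambda>"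
    using X by (intro ell2_sum ell2_cmult ell2_shift A) auto
  then show "mat_conv \<Lambda> A (restrict_to X c) m \<in> ell2 \<Lambda>"
    by (rule ell2_cong[THEN iffD2, rotated]) (rule mat_conv_restrict_to[OF X])
  have "fourier_sum (\<lambda>l. \<Sum>k\<in>X. \<Sum>n\<in>UNIV. c n k * A m n (l - k))
      (\<lambda>\<xi>. \<Sum>k\<in>X. \<Sum>n\<in>UNIV. c n k * (chr k \<xi> * fourier_series \<Lambda> (A m n) \<xi>))"
    using X by (intro fourier_sum_sum fourier_sum_cmult fourier_sum_shift fourier_series A) auto
  moreover have "(\<lambda>\<xi>. \<Sum>k\<in>X. \<Sum>n\<in>UNIV. c n k * (chr k \<xi> * fourier_series \<Lambda> (A m n) \<xi>)) =
      (\<lambda>\<xi>. (hat \<xi> *v poly_vec X c \<xi>) $ m)"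
    unfolding matrix_vector_mult_def poly_vec_def trig_poly_def transfer_matrix_def
    by (subst sum.swap) (simp add: sum_distrib_left mult_ac)
  ultimately have "fourier_sum (\<lambda>l. \<Sum>k\<in>X. \<Sum>n\<in>UNIV. c n k * A m n (l - k)) (\<lambda>\<xi>. (hat \<xi> *v poly_vec X c \<xi>) $ m)"
    by simp
  then show "fourier_sum (mat_conv \<Lambda> A (restrict_to X c) m) (\<lambda>\<xi>. (hat \<xi> *v poly_vec X c \<xi>) $ m)"
    by (rule fourier_sum_cong) (simp add: mat_conv_restrict_to[OF X])
qed

lemma
  assumes X: "finite X" "X \<subseteq> \<Lambda>"
  shows integrable_hat_poly_vec: "integrable \<mu> (\<lambda>\<xi>. (norm (hat \<xi> *v poly_vec X c \<xi>))\<^sup>2)"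
    and ell2_sqnorm_mat_conv:
      "ell2_sqnorm \<Lambda> (mat_conv \<Lambda> A (restrict_to X c)) = (\<integral>\<xi>. (norm (hat \<xi> *v poly_vec X c \<xi>))\<^sup>2 \<partial>\<mu>)"
proof -
  have int: "integrable \<mu> (\<lambda>\<xi>. (cmod ((hat \<xi> *v poly_vec X c \<xi>) $ m))\<^sup>2)" for m
    using fourier_sum_mat_conv[OF X, of c m] by (auto simp: fourier_sum_def intro: square_integrable_integrable)
  then show "integrable \<mu> (\<lambda>\<xi>. (norm (hat \<xi> *v poly_vec X c \<xi>))\<^sup>2)"
    unfolding norm_vec_power2 by (intro Bochner_Integration.integrable_sum)
  show "ell2_sqnorm \<Lambda> (mat_conv \<Lambda> A (restrict_to X c)) = (\<integral>\<xi>. (norm (hat \<xi> *v poly_vec X c \<xi>))\<^sup>2 \<partial>\<mu>)"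
    unfolding norm_vec_power2 ell2_sqnorm_def
      fourier_sum_norm[OF mat_conv_restrict_to_ell2[OF X] fourier_sum_mat_conv[OF X], symmetric]
    by (rule Bochner_Integration.integral_sum[symmetric]) (rule int)
qed

lemma
  assumes X: "finite X" "X \<subseteq> \<Lambda>"
  shows integrable_poly_vec: "integrable \<mu> (\<lambda>\<xi>. (norm (poly_vec X c \<xi>))\<^sup>2)"
    and integral_poly_vec: "(\<integral>\<xi>. (norm (poly_vec X c \<xi>))\<^sup>2 \<partial>\<mu>) = ell2_sqnorm \<Lambda> (restrict_to X c)"
proof -
  have int: "integrable \<mu> (\<lambda>\<xi>. (cmod (trig_poly (c n) X \<xi>))\<^sup>2)" for n
    by (rule square_integrable_integrable[OF square_integrable_trig_poly[OF X(2)]])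
  then show "integrable \<mu> (\<lambda>\<xi>. (norm (poly_vec X c \<xi>))\<^sup>2)"
    unfolding norm_vec_power2 poly_vec_def by (intro Bochner_Integration.integrable_sum) simp
  have "(\<Sum>\<^sub>\<infinity>l\<in>\<Lambda>. (cmod (restrict_to X c n l))\<^sup>2) = (\<Sum>\<^sub>\<infinity>l\<in>X. (cmod (c n l))\<^sup>2)" for n
    using X by (intro infsum_cong_neutral) (auto simp: restrict_to_def)
  then show "(\<integral>\<xi>. (norm (poly_vec X c \<xi>))\<^sup>2 \<partial>\<mu>) = ell2_sqnorm \<Lambda> (restrict_to X c)"
    using X int by (simp add: norm_vec_power2 poly_vec_def ell2_sqnorm_def Bochner_Integration.integral_sum integral_trig_poly)
qed

lemma restrict_to_lower:
  assumes X: "finite X" "X \<subseteq> \<Lambda>" and a: "AE \<xi> in \<mu>. \<forall>v. a * (norm v)\<^sup>2 \<le> (norm (hat \<xi> *v v))\<^sup>2"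
  shows "a * ell2_sqnorm \<Lambda> (restrict_to X c) \<le> ell2_sqnorm \<Lambda> (mat_conv \<Lambda> A (restrict_to X c))"
proof -
  have "(\<integral>\<xi>. a * (norm (poly_vec X c \<xi>))\<^sup>2 \<partial>\<mu>) \<le> (\<integral>\<xi>. (norm (hat \<xi> *v poly_vec X c \<xi>))\<^sup>2 \<partial>\<mu>)"
    using a by (intro integral_mono_AE integrable_hat_poly_vec[OF X] integrable_mult_right integrable_poly_vec[OF X])
      (auto elim: eventually_mono)
  then show ?thesis
    by (simp add: ell2_sqnorm_mat_conv[OF X] integral_poly_vec[OF X])
qed

lemma restrict_to_upper:
  assumes X: "finite X" "X \<subseteq> \<Lambda>" and b: "AE \<xi> in \<mu>. \<forall>v. (norm (hat \<xi> *v v))\<^sup>2 \<le> b * (norm v)\<^sup>2"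
  shows "ell2_sqnorm \<Lambda> (mat_conv \<Lambda> A (restrict_to X c)) \<le> b * ell2_sqnorm \<Lambda> (restrict_to X c)"
proof -
  have "(\<integral>\<xi>. (norm (hat \<xi> *v poly_vec X c \<xi>))\<^sup>2 \<partial>\<mu>) \<le> (\<integral>\<xi>. b * (norm (poly_vec X c \<xi>))\<^sup>2 \<partial>\<mu>)"
    using b by (intro integral_mono_AE integrable_hat_poly_vec[OF X] integrable_mult_right integrable_poly_vec[OF X])
      (auto elim: eventually_mono)
  then show ?thesis
    by (simp add: ell2_sqnorm_mat_conv[OF X] integral_poly_vec[OF X])
qed

lemma ell2_sqnorm_restrict_to_tendsto:
  assumes c: "\<And>n. c n \<in> ell2 \<Lambda>"
  shows "((\<lambda>X. ell2_sqnorm \<Lambda> (restrict_to X c)) \<longlongrightarrow> ell2_sqnorm \<Lambda> c) (finite_subsets_at_top \<Lambda>)"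
    and "((\<lambda>X. ell2_sqnorm \<Lambda> (\<lambda>n l. c n l - restrict_to X c n l)) \<longlongrightarrow> 0) (finite_subsets_at_top \<Lambda>)"
proof -
  let ?F = "finite_subsets_at_top \<Lambda>"
  have s: "(\<lambda>l. (cmod (c n l))\<^sup>2) summable_on \<Lambda>" for n
    using c by (simp add: ell2_iff)
  have lim: "((\<lambda>X. \<Sum>n\<in>UNIV. \<Sum>l\<in>X. (cmod (c n l))\<^sup>2) \<longlongrightarrow> ell2_sqnorm \<Lambda> c) ?F"
    unfolding ell2_sqnorm_def using has_sum_infsum[OF s] by (intro tendsto_sum) (simp add: has_sum_def)
  have 1: "ell2_sqnorm \<Lambda> (restrict_to X c) = (\<Sum>n\<in>UNIV. \<Sum>l\<in>X. (cmod (c n l))\<^sup>2)" if "finite X" "X \<subseteq> \<Lambda>" for X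
  proof -
    have "(\<Sum>\<^sub>\<infinity>l\<in>\<Lambda>. (cmod (restrict_to X c n l))\<^sup>2) = (\<Sum>\<^sub>\<infinity>l\<in>X. (cmod (c n l))\<^sup>2)" for n
      using that by (intro infsum_cong_neutral) (auto simp: restrict_to_def)
    then show ?thesis
      using that by (simp add: ell2_sqnorm_def)
  qed
  have 2: "ell2_sqnorm \<Lambda> (\<lambda>n l. c n l - restrict_to X c n l) = ell2_sqnorm \<Lambda> c - (\<Sum>n\<in>UNIV. \<Sum>l\<in>X. (cmod (c n l))\<^sup>2)"
    if X: "finite X" "X \<subseteq> \<Lambda>" for X
  proof -
    have "(\<Sum>\<^sub>\<infinity>l\<in>\<Lambda>. (cmod (c n l - restrict_to X c n l))\<^sup>2) = (\<Sum>\<^sub>\<infinity>l\<in>\<Lambda>. (cmod (c n l))\<^sup>2) - (\<Sum>l\<in>X. (cmod (c n l))\<^sup>2)" for n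
    proof -
      have "(\<Sum>\<^sub>\<infinity>l\<in>\<Lambda>. (cmod (c n l - restrict_to X c n l))\<^sup>2) = (\<Sum>\<^sub>\<infinity>l\<in>\<Lambda> - X. (cmod (c n l))\<^sup>2)"
        by (intro infsum_cong_neutral) (auto simp: restrict_to_def)
      then show ?thesis
        using X s[of n] by (simp add: infsum_Diff)
    qed
    then show ?thesis
      by (simp add: ell2_sqnorm_def sum_subtractf)
  qed
  show "((\<lambda>X. ell2_sqnorm \<Lambda> (restrict_to X c)) \<longlongrightarrow> ell2_sqnorm \<Lambda> c) ?F"
    by (rule Lim_transform_eventually[OF lim])
      (rule eventually_finite_subsets_at_top_weakI, simp add: 1)
  have "((\<lambda>X. ell2_sqnorm \<Lambda> c - (\<Sum>n\<in>UNIV. \<Sum>l\<in>X. (cmod (c n l))\<^sup>2)) \<longlongrightarrow> ell2_sqnorm \<Lambda> c - ell2_sqnorm \<Lambda> c) ?F"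
    by (intro tendsto_diff tendsto_const lim)
  then have lim': "((\<lambda>X. ell2_sqnorm \<Lambda> c - (\<Sum>n\<in>UNIV. \<Sum>l\<in>X. (cmod (c n l))\<^sup>2)) \<longlongrightarrow> 0) ?F"
    by simp
  show "((\<lambda>X. ell2_sqnorm \<Lambda> (\<lambda>n l. c n l - restrict_to X c n l)) \<longlongrightarrow> 0) ?F"
    by (rule Lim_transform_eventually[OF lim'])
      (rule eventually_finite_subsets_at_top_weakI, simp add: 2)
qed

lemma ell2_sqnorm_restrict_to_le:
  assumes c: "\<And>n. c n \<in> ell2 \<Lambda>" and "finite X"
  shows "ell2_sqnorm \<Lambda> (restrict_to X c) \<le> ell2_sqnorm \<Lambda> c"
  unfolding ell2_sqnorm_def
  using c restrict_to_ell2[OF assms(2)]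
  by (intro sum_mono infsum_mono) (auto simp: ell2_iff restrict_to_def)

text \<open>Fatou's lemma for sums: at each lattice point the convolution with truncations of
  \<open>c\<close> converges, so over a finite set \<open>Y\<close> of indices the uniform bound for
  truncations passes to the limit, and \<open>Y\<close> is arbitrary.\<close>

lemma
  assumes b: "AE \<xi> in \<mu>. \<forall>v. (norm (hat \<xi> *v v))\<^sup>2 \<le> b * (norm v)\<^sup>2" and "0 \<le> b"
    and c: "\<And>n. c n \<in> ell2 \<Lambda>"
  shows mat_conv_ell2: "mat_conv \<Lambda> A c m \<in> ell2 \<Lambda>"
    and mat_conv_upper: "ell2_sqnorm \<Lambda> (mat_conv \<Lambda> A c) \<le> b * ell2_sqnorm \<Lambda> c"
proof -
  have fin: "(\<Sum>i\<in>Y. (cmod ((\<lambda>(l, m). mat_conv \<Lambda> A c m l) i))\<^sup>2) \<le> b * ell2_sqnorm \<Lambda> c"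
    if Y: "finite Y" "Y \<subseteq> \<Lambda> \<times> UNIV" for Y
  proof (rule tendsto_upperbound)
    show "((\<lambda>X. \<Sum>i\<in>Y. (cmod ((\<lambda>(l, m). mat_conv \<Lambda> A (restrict_to X c) m l) i))\<^sup>2) \<longlongrightarrow>
        (\<Sum>i\<in>Y. (cmod ((\<lambda>(l, m). mat_conv \<Lambda> A c m l) i))\<^sup>2)) (finite_subsets_at_top \<Lambda>)"
    proof (intro tendsto_sum tendsto_power tendsto_norm)
      fix i assume "i \<in> Y"
      then obtain l m where i: "i = (l, m)" "l \<in> \<Lambda>"
        using Y by auto
      have "((\<lambda>X. \<Sum>k\<in>X. \<Sum>n\<in>UNIV. c n k * A m n (l - k)) \<longlongrightarrow> mat_conv \<Lambda> A c m l) (finite_subsets_at_top \<Lambda>)"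
        using mat_conv_has_sum[OF c i(2), where m = m] by (simp add: has_sum_def)
      then have "((\<lambda>X. mat_conv \<Lambda> A (restrict_to X c) m l) \<longlongrightarrow> mat_conv \<Lambda> A c m l) (finite_subsets_at_top \<Lambda>)"
        by (rule Lim_transform_eventually)
          (rule eventually_finite_subsets_at_top_weakI, simp add: mat_conv_restrict_to i(2))
      then show "((\<lambda>X. (\<lambda>(l, m). mat_conv \<Lambda> A (restrict_to X c) m l) i) \<longlongrightarrow> (\<lambda>(l, m). mat_conv \<Lambda> A c m l) i) (finite_subsets_at_top \<Lambda>)"
        by (simp add: i(1))
    qed
    show "\<forall>\<^sub>F X in finite_subsets_at_top \<Lambda>.
        (\<Sum>i\<in>Y. (cmod ((\<lambda>(l, m). mat_conv \<Lambda> A (restrict_to X c) m l) i))\<^sup>2) \<le> b * ell2_sqnorm \<Lambda> c"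
    proof (rule eventually_finite_subsets_at_top_weakI)
      fix X assume X: "finite X" "X \<subseteq> \<Lambda>"
      have e: "\<forall>m. mat_conv \<Lambda> A (restrict_to X c) m \<in> ell2 \<Lambda>"
        using mat_conv_restrict_to_ell2[OF X] by blast
      have "(\<Sum>i\<in>Y. (cmod ((\<lambda>(l, m). mat_conv \<Lambda> A (restrict_to X c) m l) i))\<^sup>2) \<le>
          (\<Sum>\<^sub>\<infinity>i\<in>\<Lambda> \<times> UNIV. (cmod ((\<lambda>(l, m). mat_conv \<Lambda> A (restrict_to X c) m l) i))\<^sup>2)"
        using ell2_pairs_iff[THEN iffD2, OF e] Y unfolding ell2_iff by (intro finite_sum_le_infsum) auto
      also have "\<dots> = ell2_sqnorm \<Lambda> (mat_conv \<Lambda> A (restrict_to X c))"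
        by (rule infsum_pairs[OF e])
      also have "\<dots> \<le> b * ell2_sqnorm \<Lambda> (restrict_to X c)"
        by (rule restrict_to_upper[OF X b])
      also have "\<dots> \<le> b * ell2_sqnorm \<Lambda> c"
        using \<open>0 \<le> b\<close> by (intro mult_left_mono ell2_sqnorm_restrict_to_le c X)
      finally show "(\<Sum>i\<in>Y. (cmod ((\<lambda>(l, m). mat_conv \<Lambda> A (restrict_to X c) m l) i))\<^sup>2) \<le> b * ell2_sqnorm \<Lambda> c" .
    qed
  qed simp
  have "(\<lambda>(l, m). mat_conv \<Lambda> A c m l) \<in> ell2 (\<Lambda> \<times> UNIV)"
    unfolding ell2_iff by (rule nonneg_summable_bound(1)[OF _ fin]) auto
  then have e: "\<forall>m. mat_conv \<Lambda> A c m \<in> ell2 \<Lambda>"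
    by (simp add: ell2_pairs_iff)
  then show "mat_conv \<Lambda> A c m \<in> ell2 \<Lambda>" by simp
  show "ell2_sqnorm \<Lambda> (mat_conv \<Lambda> A c) \<le> b * ell2_sqnorm \<Lambda> c"
    unfolding infsum_pairs[OF e, symmetric] by (rule nonneg_summable_bound(2)[OF _ fin]) auto
qed

text \<open>The truncation of \<open>c\<close> is \<open>c\<close> minus a remainder, whose
  convolution is small by \<open>mat_conv_upper\<close>. The remainder carries the factor
  \<open>1 + 1 / t\<close>, which is harmless because \<open>t\<close> stays fixed while the
  remainder vanishes; only afterwards does \<open>t\<close> tend to 0.\<close>

lemma mat_conv_lower:
  assumes a: "AE \<xi> in \<mu>. \<forall>v. a * (norm v)\<^sup>2 \<le> (norm (hat \<xi> *v v))\<^sup>2"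
    and b: "AE \<xi> in \<mu>. \<forall>v. (norm (hat \<xi> *v v))\<^sup>2 \<le> b * (norm v)\<^sup>2" and "0 \<le> b"
    and c: "\<And>n. c n \<in> ell2 \<Lambda>"
  shows "a * ell2_sqnorm \<Lambda> c \<le> ell2_sqnorm \<Lambda> (mat_conv \<Lambda> A c)"
proof -
  let ?F = "finite_subsets_at_top \<Lambda>"
  let ?N = "ell2_sqnorm \<Lambda>"
  have *: "a * ?N c \<le> (1 + t) * ?N (mat_conv \<Lambda> A c)" if "0 < t" for t
  proof (rule tendsto_le[OF finite_subsets_at_top_neq_bot])
    show "((\<lambda>X. a * ?N (restrict_to X c)) \<longlongrightarrow> a * ?N c) ?F"
      by (intro tendsto_mult_left ell2_sqnorm_restrict_to_tendsto(1) c)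
    have "((\<lambda>X. (1 + t) * ?N (mat_conv \<Lambda> A c) + (1 + 1 / t) * (b * ?N (\<lambda>n l. c n l - restrict_to X c n l))) \<longlongrightarrow>
        (1 + t) * ?N (mat_conv \<Lambda> A c) + (1 + 1 / t) * (b * 0)) ?F"
      by (intro tendsto_add tendsto_mult_left tendsto_const ell2_sqnorm_restrict_to_tendsto(2) c)
    then show "((\<lambda>X. (1 + t) * ?N (mat_conv \<Lambda> A c) + (1 + 1 / t) * (b * ?N (\<lambda>n l. c n l - restrict_to X c n l))) \<longlongrightarrow>
        (1 + t) * ?N (mat_conv \<Lambda> A c)) ?F"
      by simp
    show "\<forall>\<^sub>F X in ?F. a * ?N (restrict_to X c) \<le>
        (1 + t) * ?N (mat_conv \<Lambda> A c) + (1 + 1 / t) * (b * ?N (\<lambda>n l. c n l - restrict_to X c n l))"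
    proof (rule eventually_finite_subsets_at_top_weakI)
      fix X assume X: "finite X" "X \<subseteq> \<Lambda>"
      define d where "d n l = c n l - restrict_to X c n l" for n l
      have d: "d n \<in> ell2 \<Lambda>" for n
        unfolding d_def by (intro ell2_diff c restrict_to_ell2 X)
      have d': "(\<lambda>l. - 1 * d n l) \<in> ell2 \<Lambda>" for n
        by (rule ell2_cmult[OF d])
      have split: "mat_conv \<Lambda> A (restrict_to X c) m l = mat_conv \<Lambda> A c m l + mat_conv \<Lambda> A (\<lambda>n l. - 1 * d n l) m l"
        if "l \<in> \<Lambda>" for m l
      proof -
        have "mat_conv \<Lambda> A (restrict_to X c) m l = mat_conv \<Lambda> A (\<lambda>n l. c n l + - 1 * d n l) m l"
          by (rule mat_conv_cong) (simp_all add: d_def that)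
        then show ?thesis
          using mat_conv_add[OF c d' that, where m = m] by simp
      qed
      have "a * ?N (restrict_to X c) \<le> ?N (mat_conv \<Lambda> A (restrict_to X c))"
        by (rule restrict_to_lower[OF X a])
      also have "\<dots> = ?N (\<lambda>m l. mat_conv \<Lambda> A c m l + mat_conv \<Lambda> A (\<lambda>n l. - 1 * d n l) m l)"
        unfolding ell2_sqnorm_def by (intro sum.cong refl infsum_cong) (simp add: split)
      also have "\<dots> \<le> (1 + t) * ?N (mat_conv \<Lambda> A c) + (1 + 1 / t) * ?N (mat_conv \<Lambda> A (\<lambda>n l. - 1 * d n l))"
        by (intro ell2_sqnorm_add mat_conv_ell2[OF b \<open>0 \<le> b\<close>] c d' that)
      also have "\<dots> \<le> (1 + t) * ?N (mat_conv \<Lambda> A c) + (1 + 1 / t) * (b * ?N (\<lambda>n l. - 1 * d n l))"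
        using that by (intro add_left_mono mult_left_mono mat_conv_upper[OF b \<open>0 \<le> b\<close>] d') auto
      also have "?N (\<lambda>n l. - 1 * d n l) = ?N d"
        by (simp add: ell2_sqnorm_def)
      finally show "a * ?N (restrict_to X c) \<le>
          (1 + t) * ?N (mat_conv \<Lambda> A c) + (1 + 1 / t) * (b * ?N (\<lambda>n l. c n l - restrict_to X c n l))"
        by (simp add: d_def[abs_def])
    qed
  qed
  have "((\<lambda>t. (1 + t) * ?N (mat_conv \<Lambda> A c)) \<longlongrightarrow> (1 + 0) * ?N (mat_conv \<Lambda> A c)) (at_right 0)"
    by (intro tendsto_intros)
  moreover have "\<forall>\<^sub>F t in at_right 0. a * ?N c \<le> (1 + t) * ?N (mat_conv \<Lambda> A c)"
    using * by (auto simp: eventually_at_right_field intro: exI[of _ 1])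
  ultimately show ?thesis
    by (simp add: tendsto_lowerbound)
qed

subsection \<open>Essential bounds of the transfer matrix\<close>

lemma AE_upper_if_beta:
  assumes "beta \<Lambda> A < \<infinity>"
  obtains b where "0 < b" "AE \<xi> in \<mu>. \<forall>v. (norm (hat \<xi> *v v))\<^sup>2 \<le> b * (norm v)\<^sup>2"
proof -
  obtain b0 :: real where b0: "beta \<Lambda> A \<le> ereal b0"
    using assms by (cases "beta \<Lambda> A") auto
  \<comment> \<open>The maximum with 1 gives a positive constant even if the transfer matrix
    vanishes almost everywhere.\<close>
  define b where "b = max b0 1"
  have "AE \<xi> in \<mu>. ereal (lambda_max (conj_transpose (hat \<xi>) ** hat \<xi>)) \<le> beta \<Lambda> A"
    unfolding beta_def by (rule esssup_AE)
  then have "AE \<xi> in \<mu>. \<forall>v. (norm (hat \<xi> *v v))\<^sup>2 \<le> b * (norm v)\<^sup>2"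
  proof eventually_elim
    fix \<xi> assume "ereal (lambda_max (conj_transpose (hat \<xi>) ** hat \<xi>)) \<le> beta \<Lambda> A"
    then have "ereal (lambda_max (conj_transpose (hat \<xi>) ** hat \<xi>)) \<le> ereal b0"
      using b0 by (rule order_trans)
    then have "lambda_max (conj_transpose (hat \<xi>) ** hat \<xi>) \<le> b"
      by (simp add: b_def)
    then show "\<forall>v. (norm (hat \<xi> *v v))\<^sup>2 \<le> b * (norm v)\<^sup>2"
      using le_lambda_max[of "hat \<xi>"] by (meson mult_right_mono order_trans zero_le_power2)
  qed
  then show thesis
    using that[of b] by (simp add: b_def)
qed

lemma AE_lambda_min_if_alpha:
  assumes "0 < alpha \<Lambda> A"
  obtains a where "0 < a" "AE \<xi> in \<mu>. a \<le> lambda_min (conj_transpose (hat \<xi>) ** hat \<xi>)"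
proof -
  \<comment> \<open>\<open>alpha\<close> is an extended real that might be infinite, so a real
    number strictly below it is chosen.\<close>
  obtain a where a: "0 < ereal a" "ereal a < alpha \<Lambda> A"
    using ereal_dense2[OF assms] by (auto simp: zero_ereal_def)
  have "AE \<xi> in \<mu>. - ereal (lambda_min (conj_transpose (hat \<xi>) ** hat \<xi>)) \<le> - alpha \<Lambda> A"
    using esssup_AE[where M = \<mu> and f = "\<lambda>\<xi>. - ereal (lambda_min (conj_transpose (hat \<xi>) ** hat \<xi>))"]
    unfolding alpha_def essinf_def by simp
  then have "AE \<xi> in \<mu>. a \<le> lambda_min (conj_transpose (hat \<xi>) ** hat \<xi>)"
  proof eventually_elim
    fix \<xi> assume "- ereal (lambda_min (conj_transpose (hat \<xi>) ** hat \<xi>)) \<le> - alpha \<Lambda> A"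
    then have "ereal a \<le> ereal (lambda_min (conj_transpose (hat \<xi>) ** hat \<xi>))"
      using a(2) by (simp only: ereal_minus_le_minus)
    then show "a \<le> lambda_min (conj_transpose (hat \<xi>) ** hat \<xi>)"
      by simp
  qed
  then show thesis
    using that a(1) by simp
qed

lemma le_alpha:
  assumes "AE \<xi> in \<mu>. \<forall>v. r * (norm v)\<^sup>2 \<le> (norm (hat \<xi> *v v))\<^sup>2"
  shows "ereal r \<le> alpha \<Lambda> A"
proof -
  have "esssup \<mu> (\<lambda>\<xi>. - ereal (lambda_min (conj_transpose (hat \<xi>) ** hat \<xi>))) \<le> - ereal r"
  proof (rule esssup_I)
    show "(\<lambda>\<xi>. - ereal (lambda_min (conj_transpose (hat \<xi>) ** hat \<xi>))) \<in> borel_measurable \<mu>"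
      using measurable_lambda_min[OF hat_measurable] by (simp add: borel_measurable_ereal)
    show "AE \<xi> in \<mu>. - ereal (lambda_min (conj_transpose (hat \<xi>) ** hat \<xi>)) \<le> - ereal r"
      using assms by eventually_elim (simp add: lambda_min_ge)
  qed
  then have "- (- ereal r) \<le> - esssup \<mu> (\<lambda>\<xi>. - ereal (lambda_min (conj_transpose (hat \<xi>) ** hat \<xi>)))"
    by (simp only: ereal_minus_le_minus)
  then show ?thesis
    by (simp add: alpha_def essinf_def)
qed

text \<open>Multiples \<open>p v\<close> of a constant vector by a trigonometric polynomial, with \<open>p\<close> close to the
  indicator of \<open>E\<close> in \<open>L\<^sup>2\<close>, turn the lower bound on finite sequences into a bound on the integral
  over \<open>E\<close>.\<close>

lemma AE_lower_if_restrict_to: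
  assumes r: "0 \<le> r" "\<And>X c. finite X \<Longrightarrow> X \<subseteq> \<Lambda> \<Longrightarrow>
      r * ell2_sqnorm \<Lambda> (restrict_to X c) \<le> ell2_sqnorm \<Lambda> (mat_conv \<Lambda> A (restrict_to X c))"
    and b: "AE \<xi> in \<mu>. \<forall>v. (norm (hat \<xi> *v v))\<^sup>2 \<le> b * (norm v)\<^sup>2" "0 < b"
  shows "AE \<xi> in \<mu>. \<forall>v. r * (norm v)\<^sup>2 \<le> (norm (hat \<xi> *v v))\<^sup>2"
proof -
  have [measurable]: "(\<lambda>\<xi>. (norm (hat \<xi> *v v))\<^sup>2) \<in> borel_measurable \<mu>" for v
    by (rule measurable_norm_matrix_vector[OF hat_measurable])
  have single: "AE \<xi> in \<mu>. r * (norm v)\<^sup>2 \<le> (norm (hat \<xi> *v v))\<^sup>2" for v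
  proof -
    \<comment> \<open>For multiples of the fixed vector \<open>v\<close> both sides depend only on
      the moduli of \<open>hat \<xi> *v v\<close> and \<open>v\<close>. The scalars \<open>w\<close>
      and \<open>k\<close> carry these moduli, so the claim becomes a comparison of the L2 norms of
      \<open>p * k\<close> and \<open>p * w\<close>.\<close>
    define w where "w \<xi> = complex_of_real (norm (hat \<xi> *v v))" for \<xi>
    define k where "k = complex_of_real (sqrt r * norm v)"
    have w2: "(cmod (w \<xi>))\<^sup>2 = (norm (hat \<xi> *v v))\<^sup>2" and k2: "(cmod k)\<^sup>2 = r * (norm v)\<^sup>2" for \<xi>
      using r(1) by (simp_all add: w_def k_def norm_mult power_mult_distrib)
    have [measurable]: "w \<in> borel_measurable \<mu>"
    proof -
      have "(\<lambda>\<xi>. complex_of_real (sqrt ((norm (hat \<xi> *v v))\<^sup>2))) \<in> borel_measurable \<mu>"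
        by measurable
      then show ?thesis by (simp add: w_def[abs_def])
    qed
    have wb: "AE \<xi> in \<mu>. (cmod (w \<xi>))\<^sup>2 \<le> b * (norm v)\<^sup>2"
      using b(1) by eventually_elim (simp add: w2)
    \<comment> \<open>The upper bound on the transfer matrix makes \<open>w\<close> essentially
      bounded, so multiplication by it is continuous on L2; this is what allows a polynomial to be
      replaced by an indicator.\<close>
    have sqw: "square_integrable \<mu> (\<lambda>\<xi>. f \<xi> * w \<xi>)"
      and intw: "(\<integral>\<xi>. (cmod (f \<xi> * w \<xi>))\<^sup>2 \<partial>\<mu>) \<le> b * (norm v)\<^sup>2 * (\<integral>\<xi>. (cmod (f \<xi>))\<^sup>2 \<partial>\<mu>)"
      if f: "square_integrable \<mu> f" for f
    proof -
      have [measurable]: "f \<in> borel_measurable \<mu>" and fi: "integrable \<mu> (\<lambda>\<xi>. (cmod (f \<xi>))\<^sup>2)"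
        using f by (auto simp: square_integrable_def)
      have le: "AE \<xi> in \<mu>. (cmod (f \<xi> * w \<xi>))\<^sup>2 \<le> b * (norm v)\<^sup>2 * (cmod (f \<xi>))\<^sup>2"
        using wb
      proof eventually_elim
        fix \<xi> assume "(cmod (w \<xi>))\<^sup>2 \<le> b * (norm v)\<^sup>2"
        then have "(cmod (w \<xi>))\<^sup>2 * (cmod (f \<xi>))\<^sup>2 \<le> b * (norm v)\<^sup>2 * (cmod (f \<xi>))\<^sup>2"
          by (rule mult_right_mono) simp
        then show "(cmod (f \<xi> * w \<xi>))\<^sup>2 \<le> b * (norm v)\<^sup>2 * (cmod (f \<xi>))\<^sup>2"
          by (simp add: norm_mult power_mult_distrib mult.commute)
      qed
      have i: "integrable \<mu> (\<lambda>\<xi>. (cmod (f \<xi> * w \<xi>))\<^sup>2)"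
        by (rule Bochner_Integration.integrable_bound[OF integrable_mult_right[OF fi, of "b * (norm v)\<^sup>2"]])
          (use le in \<open>auto elim!: eventually_mono\<close>)
      then show "square_integrable \<mu> (\<lambda>\<xi>. f \<xi> * w \<xi>)"
        by (simp add: square_integrable_def)
      have "(\<integral>\<xi>. (cmod (f \<xi> * w \<xi>))\<^sup>2 \<partial>\<mu>) \<le> (\<integral>\<xi>. b * (norm v)\<^sup>2 * (cmod (f \<xi>))\<^sup>2 \<partial>\<mu>)"
        by (rule integral_mono_AE[OF i integrable_mult_right[OF fi] le])
      then show "(\<integral>\<xi>. (cmod (f \<xi> * w \<xi>))\<^sup>2 \<partial>\<mu>) \<le> b * (norm v)\<^sup>2 * (\<integral>\<xi>. (cmod (f \<xi>))\<^sup>2 \<partial>\<mu>)"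
        by simp
    qed
    have poly: "(\<integral>\<xi>. (cmod (trig_poly a X \<xi> * k))\<^sup>2 \<partial>\<mu>) \<le> (\<integral>\<xi>. (cmod (trig_poly a X \<xi> * w \<xi>))\<^sup>2 \<partial>\<mu>)"
      if X: "finite X" "X \<subseteq> \<Lambda>" for a X
    proof -
      \<comment> \<open>With these coefficients \<open>poly_vec\<close> is the scalar polynomial
        times \<open>v\<close>, so the hypothesis on finite sequences applies.\<close>
      define c where "c n l = a l * v $ n" for n l
      have pv: "poly_vec X c \<xi> = trig_poly a X \<xi> *s v" for \<xi>
        by (simp add: poly_vec_def c_def trig_poly_def vec_eq_iff sum_distrib_left mult_ac)
      have ns: "norm (z *s u) = cmod z * norm u" for z and u :: "complex^'k"
        by (simp add: norm_vec_def L2_set_def norm_mult power_mult_distrib sum_distrib_left[symmetric] real_sqrt_mult)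
      have "r * (\<integral>\<xi>. (norm (poly_vec X c \<xi>))\<^sup>2 \<partial>\<mu>) \<le> (\<integral>\<xi>. (norm (hat \<xi> *v poly_vec X c \<xi>))\<^sup>2 \<partial>\<mu>)"
        using r(2)[OF X, of c] by (simp only: ell2_sqnorm_mat_conv[OF X] integral_poly_vec[OF X])
      moreover have "(\<integral>\<xi>. (cmod (trig_poly a X \<xi> * k))\<^sup>2 \<partial>\<mu>) = r * (\<integral>\<xi>. (norm (poly_vec X c \<xi>))\<^sup>2 \<partial>\<mu>)"
        by (simp add: norm_mult power_mult_distrib k2 pv ns mult_ac flip: integral_mult_right_zero)
      moreover have "(cmod (trig_poly a X \<xi> * w \<xi>))\<^sup>2 = (norm (hat \<xi> *v poly_vec X c \<xi>))\<^sup>2" for \<xi>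
        by (simp add: norm_mult power_mult_distrib w2 pv vector_scalar_commute ns)
      ultimately show ?thesis
        by simp
    qed
    have int: "(\<integral>\<xi>. (cmod (indicator E \<xi> * k))\<^sup>2 \<partial>\<mu>) \<le> (\<integral>\<xi>. (cmod (indicator E \<xi> * w \<xi>))\<^sup>2 \<partial>\<mu>)"
      if E: "E \<in> sets \<mu>" for E
    proof -
      let ?Z = "\<lambda>_. 0 :: complex"
      have sqE: "square_integrable \<mu> (indicator E :: _ \<Rightarrow> complex)"
      proof -
        have "(\<lambda>\<xi>. (cmod (indicator E \<xi> :: complex))\<^sup>2) = (indicator E :: _ \<Rightarrow> real)"
          by (auto simp: fun_eq_iff indicator_def)
        then show ?thesis
          using E by (simp add: square_integrable_def dual.emeasure_finite less_top[symmetric])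
      qed
      have sqk: "square_integrable \<mu> (\<lambda>\<xi>. f \<xi> * k)" if "square_integrable \<mu> f" for f
        using square_integrable_cmult[OF that, of k] by (simp add: mult.commute)
      have "l2_dist \<mu> (\<lambda>\<xi>. indicator E \<xi> * k) ?Z \<le> l2_dist \<mu> (\<lambda>\<xi>. indicator E \<xi> * w \<xi>) ?Z"
      proof (rule field_le_epsilon)
        fix e :: real assume "0 < e"
        \<comment> \<open>Replacing the indicator by \<open>p\<close> costs a factor
          \<open>cmod k\<close> on one side and the essential bound of \<open>w\<close> on the
          other; the added 1 keeps \<open>K\<close> positive.\<close>
        define K where "K = cmod k + sqrt (b * (norm v)\<^sup>2) + 1"
        have "0 < K" using b(2) by (simp add: K_def add_nonneg_pos)
        then have "0 < e / K" using \<open>0 < e\<close> by simp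
        then obtain X a where X: "finite X" "X \<subseteq> \<Lambda>" "l2_dist \<mu> (trig_poly a X) (indicator E) < e / K"
          by (rule trig_poly_dense_indicator[OF E])
        define p where "p = trig_poly a X"
        have sqp: "square_integrable \<mu> p"
          unfolding p_def by (rule square_integrable_trig_poly[OF X(2)])
        have 1: "l2_dist \<mu> (\<lambda>\<xi>. indicator E \<xi> * k) (\<lambda>\<xi>. p \<xi> * k) = cmod k * l2_dist \<mu> p (indicator E)"
          using l2_dist_cmult[of \<mu> k "indicator E" p] by (simp add: mult.commute l2_dist_commute)
        have "(\<integral>\<xi>. (cmod (p \<xi> * w \<xi> - indicator E \<xi> * w \<xi>))\<^sup>2 \<partial>\<mu>) = (\<integral>\<xi>. (cmod ((p \<xi> - indicator E \<xi>) * w \<xi>))\<^sup>2 \<partial>\<mu>)"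
          by (simp add: left_diff_distrib)
        also have "\<dots> \<le> b * (norm v)\<^sup>2 * (\<integral>\<xi>. (cmod (p \<xi> - indicator E \<xi>))\<^sup>2 \<partial>\<mu>)"
          by (rule intw[OF square_integrable_diff[OF sqp sqE]])
        finally have 2: "l2_dist \<mu> (\<lambda>\<xi>. p \<xi> * w \<xi>) (\<lambda>\<xi>. indicator E \<xi> * w \<xi>) \<le> sqrt (b * (norm v)\<^sup>2) * l2_dist \<mu> p (indicator E)"
          unfolding l2_dist_def real_sqrt_mult[symmetric] by (rule real_sqrt_le_mono)
        have 3: "l2_dist \<mu> (\<lambda>\<xi>. p \<xi> * k) ?Z \<le> l2_dist \<mu> (\<lambda>\<xi>. p \<xi> * w \<xi>) ?Z"
          using poly[OF X(1,2), of a] by (simp add: l2_dist_def p_def)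
        have "l2_dist \<mu> (\<lambda>\<xi>. indicator E \<xi> * k) ?Z \<le>
            l2_dist \<mu> (\<lambda>\<xi>. indicator E \<xi> * k) (\<lambda>\<xi>. p \<xi> * k) + l2_dist \<mu> (\<lambda>\<xi>. p \<xi> * k) ?Z"
          by (intro l2_dist_triangle sqk sqE sqp square_integrable_zero)
        also have "\<dots> \<le> cmod k * l2_dist \<mu> p (indicator E) + l2_dist \<mu> (\<lambda>\<xi>. p \<xi> * w \<xi>) ?Z"
          using 1 3 by simp
        also have "l2_dist \<mu> (\<lambda>\<xi>. p \<xi> * w \<xi>) ?Z \<le>
            l2_dist \<mu> (\<lambda>\<xi>. p \<xi> * w \<xi>) (\<lambda>\<xi>. indicator E \<xi> * w \<xi>) + l2_dist \<mu> (\<lambda>\<xi>. indicator E \<xi> * w \<xi>) ?Z"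
          by (intro l2_dist_triangle sqw sqE sqp square_integrable_zero)
        finally have "l2_dist \<mu> (\<lambda>\<xi>. indicator E \<xi> * k) ?Z \<le>
            (cmod k + sqrt (b * (norm v)\<^sup>2)) * l2_dist \<mu> p (indicator E) + l2_dist \<mu> (\<lambda>\<xi>. indicator E \<xi> * w \<xi>) ?Z"
          using 2 by (simp only: distrib_right) linarith
        moreover have "(cmod k + sqrt (b * (norm v)\<^sup>2)) * l2_dist \<mu> p (indicator E) \<le> K * (e / K)"
          using X(3) b(2) unfolding K_def p_def by (intro mult_mono) (auto simp: l2_dist_nonneg)
        ultimately show "l2_dist \<mu> (\<lambda>\<xi>. indicator E \<xi> * k) ?Z \<le> l2_dist \<mu> (\<lambda>\<xi>. indicator E \<xi> * w \<xi>) ?Z + e"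
          using \<open>0 < K\<close> by simp
      qed
      then show ?thesis
        by (simp add: l2_dist_def)
    qed
    \<comment> \<open>The set where the claim fails for \<open>v\<close>. On it the integrands
      compare strictly in one direction while the integrals compare in the other, so it is a null
      set.\<close>
    define E where "E = {\<xi>\<in>space \<mu>. (norm (hat \<xi> *v v))\<^sup>2 < r * (norm v)\<^sup>2}"
    have E [measurable]: "E \<in> sets \<mu>"
      unfolding E_def by measurable
    have iw: "integrable \<mu> (\<lambda>\<xi>. indicator E \<xi> * (norm (hat \<xi> *v v))\<^sup>2)"
    proof (rule dual.integrable_const_bound[where B = "b * (norm v)\<^sup>2"])
      show "AE \<xi> in \<mu>. norm (indicator E \<xi> * (norm (hat \<xi> *v v))\<^sup>2) \<le> b * (norm v)\<^sup>2"
        using b(1) by eventually_elim (use b(2) in \<open>auto simp: indicator_def\<close>)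
    qed measurable
    have ik: "integrable \<mu> (\<lambda>\<xi>. indicator E \<xi> * (r * (norm v)\<^sup>2))"
      by (rule dual.integrable_const_bound[where B = "r * (norm v)\<^sup>2"]) (use r(1) in \<open>auto simp: indicator_def intro!: AE_I2\<close>)
    have "(cmod (indicator E \<xi> * k))\<^sup>2 = indicator E \<xi> * (r * (norm v)\<^sup>2)"
      "(cmod (indicator E \<xi> * w \<xi>))\<^sup>2 = indicator E \<xi> * (norm (hat \<xi> *v v))\<^sup>2" for \<xi>
      by (auto simp: indicator_def k2 w2)
    then have le: "(\<integral>\<xi>. indicator E \<xi> * (r * (norm v)\<^sup>2) \<partial>\<mu>) \<le> (\<integral>\<xi>. indicator E \<xi> * (norm (hat \<xi> *v v))\<^sup>2 \<partial>\<mu>)"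
      using int[OF E] by simp
    let ?g = "\<lambda>\<xi>. indicator E \<xi> * (r * (norm v)\<^sup>2) - indicator E \<xi> * (norm (hat \<xi> *v v))\<^sup>2"
    have nn: "0 \<le> ?g \<xi>" for \<xi>
      by (auto simp: indicator_def E_def)
    have "(\<integral>\<xi>. ?g \<xi> \<partial>\<mu>) \<le> 0"
      using le by (simp add: Bochner_Integration.integral_diff[OF ik iw])
    moreover have "0 \<le> (\<integral>\<xi>. ?g \<xi> \<partial>\<mu>)"
      by (rule Bochner_Integration.integral_nonneg) (rule nn)
    ultimately have "(\<integral>\<xi>. ?g \<xi> \<partial>\<mu>) = 0"
      by simp
    then have "AE \<xi> in \<mu>. ?g \<xi> = 0"
      using integral_nonneg_eq_0_iff_AE[OF Bochner_Integration.integrable_diff[OF ik iw] AE_I2[OF nn]] by simp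
    then show ?thesis
    proof (rule AE_mp, intro AE_I2 impI)
      fix \<xi> assume "\<xi> \<in> space \<mu>" "?g \<xi> = 0"
      then show "r * (norm v)\<^sup>2 \<le> (norm (hat \<xi> *v v))\<^sup>2"
        by (cases "\<xi> \<in> E") (auto simp: E_def)
    qed
  qed
  \<comment> \<open>The exceptional null set depends on \<open>v\<close>. A countable dense set of
    vectors yields a common one, and this suffices because for a fixed matrix the set of vectors
    violating the inequality is open.\<close>
  obtain D :: "(complex^'n) set" where D: "countable D" "\<And>U. open U \<Longrightarrow> U \<noteq> {} \<Longrightarrow> \<exists>d\<in>D. d \<in> U"
    using countable_dense_exists by blast
  have "AE \<xi> in \<mu>. \<forall>v\<in>D. r * (norm v)\<^sup>2 \<le> (norm (hat \<xi> *v v))\<^sup>2"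
    using single by (simp add: AE_ball_countable[OF D(1)])
  then show ?thesis
  proof eventually_elim
    fix \<xi> assume d: "\<forall>v\<in>D. r * (norm v)\<^sup>2 \<le> (norm (hat \<xi> *v v))\<^sup>2"
    show "\<forall>v. r * (norm v)\<^sup>2 \<le> (norm (hat \<xi> *v v))\<^sup>2"
    proof (rule ccontr)
      assume "\<not> ?thesis"
      then have "{v. (norm (hat \<xi> *v v))\<^sup>2 < r * (norm v)\<^sup>2} \<noteq> {}"
        by (auto simp: not_le)
      moreover have "open {v. (norm (hat \<xi> *v v))\<^sup>2 < r * (norm v)\<^sup>2}"
        by (intro open_Collect_less continuous_intros)
      ultimately obtain v where "v \<in> D" "(norm (hat \<xi> *v v))\<^sup>2 < r * (norm v)\<^sup>2"
        using D(2) by blast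
      then show False
        using d by force
    qed
  qed
qed

end

section \<open>Sampling in the shift-invariant space\<close>

definition shifts :: "('k \<Rightarrow> 'a::euclidean_space hs) \<Rightarrow> 'a phase \<times> 'k \<Rightarrow> 'a hs" where
  "shifts h = (\<lambda>(l, k). hs_translate l (h k))"

lemma translates_hs_op: "translates (\<lambda>k. hs_op (h k)) = (\<lambda>i. hs_op (shifts h i))"
  by (auto simp: translates_def shifts_def fun_eq_iff hs_translate.rep_eq)

lemma expands_hs_op:
  "expands \<Lambda> (\<lambda>k. hs_op (h k)) c (hs_op x) \<longleftrightarrow>
    ((\<lambda>(l, k). hs_scaleC (c k l) (shifts h (l, k))) has_sum x) (\<Lambda> \<times> UNIV)"
  unfolding expands_def translates_hs_op
  by (rule hs_has_sum_iff) (auto simp: hs_scaleC.rep_eq)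

lemma hs_op_image_iff: "hs_op x \<in> hs_op ` V \<longleftrightarrow> x \<in> V"
  by (auto simp: hs_op_eq_iff)

lemma hs_frame_hs_op:
  "hs_frame (hs_op ` V) J (\<lambda>j. hs_op (g j)) \<longleftrightarrow> (\<forall>j\<in>J. g j \<in> V) \<and>
    (\<exists>a>0. \<exists>b>0. \<forall>x\<in>V. (\<lambda>j. hs_cinner x (g j)) \<in> ell2 J \<and>
      a * (norm x)\<^sup>2 \<le> (\<Sum>\<^sub>\<infinity>j\<in>J. (cmod (hs_cinner x (g j)))\<^sup>2) \<and>
      (\<Sum>\<^sub>\<infinity>j\<in>J. (cmod (hs_cinner x (g j)))\<^sup>2) \<le> b * (norm x)\<^sup>2)"
  by (simp add: hs_frame_def hs_op_image_iff hs_cinner.rep_eq hs_norm_eq ell2_iff)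

text \<open>Collects what \<open>hs_riesz_sequence_bounds\<close> provides: \<open>p\<close> and
  \<open>q\<close> are Riesz bounds of the translates, and \<open>E\<close> is some orthonormal
  basis of their closed span, for which no compatibility with translations is assumed.\<close>

locale shift_invariant = convolution \<Lambda> A
  for \<Lambda> :: "'a::euclidean_space phase set" and A :: "'m::finite \<Rightarrow> 'n::finite \<Rightarrow> 'a phase \<Rightarrow> complex" +
  fixes s :: "'n \<Rightarrow> 'a hs" and E :: "'a phase \<times> 'n \<Rightarrow> 'a hs" and p q :: real
  assumes onb: "hs.orthonormal (\<Lambda> \<times> UNIV) E"
    and span: "hs.closed_span (\<Lambda> \<times> UNIV) E = hs.closed_span (\<Lambda> \<times> UNIV) (shifts s)"
    and p: "0 < p" and q: "0 < q"
    and synthesis: "\<And>c. c \<in> ell2 (\<Lambda> \<times> UNIV) \<Longrightarrow>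
      \<exists>x\<in>hs.closed_span (\<Lambda> \<times> UNIV) (shifts s). ((\<lambda>i. hs_scaleC (c i) (shifts s i)) has_sum x) (\<Lambda> \<times> UNIV)"
    and bounds: "\<And>c x. c \<in> ell2 (\<Lambda> \<times> UNIV) \<Longrightarrow> ((\<lambda>i. hs_scaleC (c i) (shifts s i)) has_sum x) (\<Lambda> \<times> UNIV) \<Longrightarrow>
      p * (\<Sum>\<^sub>\<infinity>i\<in>\<Lambda> \<times> UNIV. (cmod (c i))\<^sup>2) \<le> (norm x)\<^sup>2 \<and> (norm x)\<^sup>2 \<le> q * (\<Sum>\<^sub>\<infinity>i\<in>\<Lambda> \<times> UNIV. (cmod (c i))\<^sup>2)"
    and expansion: "\<And>x. x \<in> hs.closed_span (\<Lambda> \<times> UNIV) (shifts s) \<Longrightarrow>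
      \<exists>c\<in>ell2 (\<Lambda> \<times> UNIV). ((\<lambda>i. hs_scaleC (c i) (shifts s i)) has_sum x) (\<Lambda> \<times> UNIV)"
begin

definition V :: "'a hs set" where
  "V = hs.closed_span (\<Lambda> \<times> UNIV) (shifts s)"

lemma V_onb: "V = hs.closed_span (\<Lambda> \<times> UNIV) E"
  by (simp add: V_def span)

lemma csubspace_V: "hs.csubspace V"
  by (simp add: V_def hs.csubspace_closed_span)

lemma shifts_in_V: "i \<in> \<Lambda> \<times> UNIV \<Longrightarrow> shifts s i \<in> V"
  unfolding V_def by (rule hs.closed_span_base)

lemma in_V_if_has_sum:
  "((\<lambda>i. hs_scaleC (c i) (shifts s i)) has_sum x) (\<Lambda> \<times> UNIV) \<Longrightarrow> x \<in> V"
  by (rule hs.csubspace_has_sum[OF csubspace_V]) (auto intro: hs.csubspace_sc[OF csubspace_V] shifts_in_V)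

definition coef :: "'a hs \<Rightarrow> 'a phase \<times> 'n \<Rightarrow> complex" where
  "coef x = (SOME c. c \<in> ell2 (\<Lambda> \<times> UNIV) \<and> ((\<lambda>i. hs_scaleC (c i) (shifts s i)) has_sum x) (\<Lambda> \<times> UNIV))"

lemma
  assumes "x \<in> V"
  shows coef_ell2: "coef x \<in> ell2 (\<Lambda> \<times> UNIV)"
    and coef_has_sum: "((\<lambda>i. hs_scaleC (coef x i) (shifts s i)) has_sum x) (\<Lambda> \<times> UNIV)"
proof -
  have "\<exists>c. c \<in> ell2 (\<Lambda> \<times> UNIV) \<and> ((\<lambda>i. hs_scaleC (c i) (shifts s i)) has_sum x) (\<Lambda> \<times> UNIV)"
    using expansion[of x] assms unfolding V_def by blast
  from someI_ex[OF this]
  show "coef x \<in> ell2 (\<Lambda> \<times> UNIV)" "((\<lambda>i. hs_scaleC (coef x i) (shifts s i)) has_sum x) (\<Lambda> \<times> UNIV)"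
    unfolding coef_def by blast+
qed

text \<open>The difference of two expansions is an expansion of 0, whose coefficients the lower
  Riesz bound forces to vanish. Only the values on the index set are determined.\<close>

lemma coef_unique:
  assumes c: "c \<in> ell2 (\<Lambda> \<times> UNIV)" and hs: "((\<lambda>i. hs_scaleC (c i) (shifts s i)) has_sum x) (\<Lambda> \<times> UNIV)"
    and i: "i \<in> \<Lambda> \<times> UNIV"
  shows "coef x i = c i"
proof -
  have x: "x \<in> V"
    by (rule in_V_if_has_sum[OF hs])
  define d where "d i = coef x i - c i" for i
  have d: "d \<in> ell2 (\<Lambda> \<times> UNIV)"
    unfolding d_def by (rule ell2_diff[OF coef_ell2[OF x] c])
  have sc: "hs_scaleC (d i) y = hs_scaleC (coef x i) y + - hs_scaleC (c i) y" for i y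
    using hs.sc_add_left[of "d i" "c i" y] by (simp add: d_def)
  have "((\<lambda>i. - hs_scaleC (c i) (shifts s i)) has_sum - x) (\<Lambda> \<times> UNIV)"
    using hs by (simp add: has_sum_uminus)
  then have "((\<lambda>i. hs_scaleC (d i) (shifts s i)) has_sum x + - x) (\<Lambda> \<times> UNIV)"
    unfolding sc by (intro has_sum_add coef_has_sum x)
  then have "p * (\<Sum>\<^sub>\<infinity>i\<in>\<Lambda> \<times> UNIV. (cmod (d i))\<^sup>2) \<le> 0"
    using bounds[OF d, of 0] by simp
  then have "(\<Sum>\<^sub>\<infinity>i\<in>\<Lambda> \<times> UNIV. (cmod (d i))\<^sup>2) \<le> 0"
    using p by (simp add: mult_le_0_iff)
  then have "(cmod (d i))\<^sup>2 = 0"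
    using d i by (intro nonneg_infsum_le_0D[where A = "\<Lambda> \<times> UNIV" and f = "\<lambda>i. (cmod (d i))\<^sup>2"]) (auto simp: ell2_iff)
  then show ?thesis
    by (simp add: d_def)
qed

lemma coef_add:
  assumes "x \<in> V" "y \<in> V" "i \<in> \<Lambda> \<times> UNIV"
  shows "coef (x + y) i = coef x i + coef y i"
proof (rule coef_unique[where c = "\<lambda>i. coef x i + coef y i"])
  show "(\<lambda>i. coef x i + coef y i) \<in> ell2 (\<Lambda> \<times> UNIV)"
    by (intro ell2_add coef_ell2 assms)
  show "((\<lambda>i. hs_scaleC (coef x i + coef y i) (shifts s i)) has_sum x + y) (\<Lambda> \<times> UNIV)"
    unfolding hs.sc_add_left by (intro has_sum_add coef_has_sum assms)
qed (rule assms)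

lemma coef_sc:
  assumes "x \<in> V" "i \<in> \<Lambda> \<times> UNIV"
  shows "coef (hs_scaleC z x) i = z * coef x i"
proof (rule coef_unique[where c = "\<lambda>i. z * coef x i"])
  show "(\<lambda>i. z * coef x i) \<in> ell2 (\<Lambda> \<times> UNIV)"
    by (intro ell2_cmult coef_ell2 assms)
  show "((\<lambda>i. hs_scaleC (z * coef x i) (shifts s i)) has_sum hs_scaleC z x) (\<Lambda> \<times> UNIV)"
    using hs.has_sum_sc[OF coef_has_sum[OF assms(1)], of z] by (simp add: hs.sc_assoc)
qed (rule assms)

text \<open>Translation by a lattice point permutes the generators, so translating a series merely
  reindexes its coefficients.\<close>

lemma coef_translate:
  assumes x: "x \<in> V" and k: "k \<in> \<Lambda>"
  shows "hs_translate k x \<in> V"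
    and "\<And>l n. l \<in> \<Lambda> \<Longrightarrow> coef (hs_translate k x) (l, n) = coef x (l - k, n)"
proof -
  define c where "c i = coef x (fst i - k, snd i)" for i
  define sh where "sh i = (fst i + k, snd i)" for i :: "'a phase \<times> 'n"
  have bij: "bij_betw sh (\<Lambda> \<times> UNIV) (\<Lambda> \<times> UNIV)"
    by (rule bij_betw_byWitness[where f' = "\<lambda>i. (fst i - k, snd i)"])
      (use k in \<open>auto simp: sh_def intro: lattice_add lattice_diff\<close>)
  have csh: "c (sh i) = coef x i" for i
    by (simp add: c_def sh_def)
  have c: "c \<in> ell2 (\<Lambda> \<times> UNIV)"
    using summable_on_reindex_bij_betw[OF bij, of "\<lambda>i. (cmod (c i))\<^sup>2"] coef_ell2[OF x]
    by (simp add: ell2_iff csh)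
  have "hs_translate k (shifts s i) = shifts s (sh i)" for i
    by (cases i) (simp add: shifts_def sh_def hs_translate_translate add.commute)
  then have "((\<lambda>i. hs_scaleC (c (sh i)) (shifts s (sh i))) has_sum hs_translate k x) (\<Lambda> \<times> UNIV)"
    using has_sum_bounded_linear[OF bounded_linear_hs_translate coef_has_sum[OF x], of k]
    by (simp add: csh hs_translate_scaleC)
  then have hs: "((\<lambda>i. hs_scaleC (c i) (shifts s i)) has_sum hs_translate k x) (\<Lambda> \<times> UNIV)"
    using has_sum_reindex_bij_betw[OF bij, of "\<lambda>i. hs_scaleC (c i) (shifts s i)"] by simp
  show "hs_translate k x \<in> V"
    by (rule in_V_if_has_sum[OF hs])
  show "coef (hs_translate k x) (l, n) = coef x (l - k, n)" if "l \<in> \<Lambda>" for l n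
    using coef_unique[OF c hs, of "(l, n)"] that by (simp add: c_def)
qed

definition cf :: "'a hs \<Rightarrow> 'n \<Rightarrow> 'a phase \<Rightarrow> complex" where
  "cf x n l = coef x (l, n)"

lemma cf_ell2: "x \<in> V \<Longrightarrow> cf x n \<in> ell2 \<Lambda>"
  using coef_ell2[of x] ell2_pairs_iff[of "cf x" \<Lambda>] by (simp add: cf_def)

lemma ell2_sqnorm_cf: "x \<in> V \<Longrightarrow> ell2_sqnorm \<Lambda> (cf x) = (\<Sum>\<^sub>\<infinity>i\<in>\<Lambda> \<times> UNIV. (cmod (coef x i))\<^sup>2)"
  using infsum_pairs[of "cf x" \<Lambda>] cf_ell2[of x] by (simp add: cf_def)

definition sample :: "'a phase \<times> 'm \<Rightarrow> 'a hs \<Rightarrow> complex" where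
  "sample = (\<lambda>(l, m) x. mat_conv \<Lambda> A (cf x) m l)"

lemma sample_pair: "sample (l, m) x = mat_conv \<Lambda> A (cf x) m l"
  by (simp add: sample_def)

text \<open>Samples are defined through the chosen coefficients; uniqueness on the lattice makes
  every other expansion yield the same samples there.\<close>

lemma sample_has_sum:
  assumes c: "\<And>n. c n \<in> ell2 \<Lambda>"
    and x: "((\<lambda>(l, n). hs_scaleC (c n l) (shifts s (l, n))) has_sum x) (\<Lambda> \<times> UNIV)" and l: "l \<in> \<Lambda>"
  shows "sample (l, m) x = mat_conv \<Lambda> A c m l"
  unfolding sample_pair
proof (rule mat_conv_cong[OF _ l])
  have "(\<lambda>(l, n). c n l) \<in> ell2 (\<Lambda> \<times> UNIV)"
    using c by (simp add: ell2_pairs_iff)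
  moreover have "((\<lambda>i. hs_scaleC ((\<lambda>(l, n). c n l) i) (shifts s i)) has_sum x) (\<Lambda> \<times> UNIV)"
    using x by (simp add: case_prod_unfold)
  ultimately show "cf x n l = c n l" if "l \<in> \<Lambda>" for n l
    using coef_unique[of "\<lambda>(l, n). c n l" x "(l, n)"] that by (simp add: cf_def)
qed

lemma sample_translate:
  assumes "x \<in> V" "k \<in> \<Lambda>" "l \<in> \<Lambda>"
  shows "sample (l + k, m) (hs_translate k x) = sample (l, m) x"
  unfolding sample_pair by (rule mat_conv_shift) (simp_all add: assms cf_def coef_translate(2))

text \<open>\<open>a\<close> and \<open>b\<close> bound the convolution in terms of the
  coefficients, while \<open>p\<close> and \<open>q\<close> compare the coefficients with the
  vector; hence the quotients \<open>a / q\<close> and \<open>b / p\<close>.\<close>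

lemma frame_functionals_sample:
  assumes a: "0 < a" "AE \<xi> in \<mu>. \<forall>v. a * (norm v)\<^sup>2 \<le> (norm (hat \<xi> *v v))\<^sup>2"
    and b: "0 < b" "AE \<xi> in \<mu>. \<forall>v. (norm (hat \<xi> *v v))\<^sup>2 \<le> b * (norm v)\<^sup>2"
  shows "frame_functionals hs_scaleC hs_cinner (\<Lambda> \<times> UNIV) E V (\<Lambda> \<times> UNIV) sample (a / q) (b / p)"
proof
  have b0: "0 \<le> b" using b(1) by simp
  show "hs.orthonormal (\<Lambda> \<times> UNIV) E" by (rule onb)
  show "V = hs.closed_span (\<Lambda> \<times> UNIV) E" by (rule V_onb)
  show "0 < a / q" "0 < b / p" using a(1) b(1) p q by simp_all
  show "sample j (x + y) = sample j x + sample j y" if j: "j \<in> \<Lambda> \<times> UNIV" and xy: "x \<in> V" "y \<in> V" for j x y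
  proof -
    obtain l m where lm: "j = (l, m)" "l \<in> \<Lambda>" using j by auto
    have "mat_conv \<Lambda> A (cf (x + y)) m l = mat_conv \<Lambda> A (\<lambda>n l. cf x n l + cf y n l) m l"
      by (rule mat_conv_cong[OF _ lm(2)]) (simp add: cf_def coef_add xy)
    then show ?thesis
      using mat_conv_add[where c = "cf x" and d = "cf y" and m = m, OF cf_ell2[OF xy(1)] cf_ell2[OF xy(2)] lm(2)]
      by (simp add: lm(1) sample_pair)
  qed
  show "sample j (hs_scaleC z x) = z * sample j x" if j: "j \<in> \<Lambda> \<times> UNIV" and x: "x \<in> V" for j x z
  proof -
    obtain l m where lm: "j = (l, m)" "l \<in> \<Lambda>" using j by auto
    have "mat_conv \<Lambda> A (cf (hs_scaleC z x)) m l = mat_conv \<Lambda> A (\<lambda>n l. z * cf x n l) m l"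
      by (rule mat_conv_cong[OF _ lm(2)]) (simp add: cf_def coef_sc x)
    then show ?thesis
      using mat_conv_cmult[where c = "cf x" and m = m and z = z, OF cf_ell2[OF x] lm(2)] by (simp add: lm(1) sample_pair)
  qed
  fix x assume x: "x \<in> V"
  have e: "\<forall>m. mat_conv \<Lambda> A (cf x) m \<in> ell2 \<Lambda>"
    using mat_conv_ell2[where c = "cf x", OF b(2) b0 cf_ell2[OF x]] by blast
  have eq: "(\<lambda>j. sample j x) = (\<lambda>(l, m). mat_conv \<Lambda> A (cf x) m l)"
    by (auto simp: sample_def)
  show "(\<lambda>j. sample j x) \<in> ell2 (\<Lambda> \<times> UNIV)"
    unfolding eq using e by (simp add: ell2_pairs_iff)
  have sum: "(\<Sum>\<^sub>\<infinity>j\<in>\<Lambda> \<times> UNIV. (cmod (sample j x))\<^sup>2) = ell2_sqnorm \<Lambda> (mat_conv \<Lambda> A (cf x))"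
    using infsum_pairs[OF e] by (simp add: fun_cong[OF eq])
  have B: "p * ell2_sqnorm \<Lambda> (cf x) \<le> (norm x)\<^sup>2" "(norm x)\<^sup>2 \<le> q * ell2_sqnorm \<Lambda> (cf x)"
    using bounds[OF coef_ell2 coef_has_sum, OF x x] by (simp_all add: ell2_sqnorm_cf[OF x])
  have "a / q * (norm x)\<^sup>2 \<le> a / q * (q * ell2_sqnorm \<Lambda> (cf x))"
    using a(1) q by (intro mult_left_mono B) simp
  also have "\<dots> \<le> ell2_sqnorm \<Lambda> (mat_conv \<Lambda> A (cf x))"
    using mat_conv_lower[where c = "cf x", OF a(2) b(2) b0 cf_ell2[OF x]] q by simp
  finally show "a / q * (norm x)\<^sup>2 \<le> (\<Sum>\<^sub>\<infinity>j\<in>\<Lambda> \<times> UNIV. (cmod (sample j x))\<^sup>2)"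
    by (simp add: sum)
  have "ell2_sqnorm \<Lambda> (mat_conv \<Lambda> A (cf x)) \<le> b / p * (p * ell2_sqnorm \<Lambda> (cf x))"
    using mat_conv_upper[where c = "cf x", OF b(2) b0 cf_ell2[OF x]] p by simp
  also have "\<dots> \<le> b / p * (norm x)\<^sup>2"
    using b(1) p by (intro mult_left_mono B) simp
  finally show "(\<Sum>\<^sub>\<infinity>j\<in>\<Lambda> \<times> UNIV. (cmod (sample j x))\<^sup>2) \<le> b / p * (norm x)\<^sup>2"
    by (simp add: sum)
qed

text \<open>Translating a vector shifts its samples, so by \<open>dual_equivariant\<close>
  translation by \<open>l\<close> carries the dual vector at \<open>(0, m)\<close> to the one at
  \<open>(l, m)\<close>. The whole dual frame is thus generated by its members at the lattice point
  0, one for each \<open>m\<close>.\<close>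

lemma exists_sampling_frame:
  assumes a: "0 < a" "AE \<xi> in \<mu>. \<forall>v. a * (norm v)\<^sup>2 \<le> (norm (hat \<xi> *v v))\<^sup>2"
    and b: "0 < b" "AE \<xi> in \<mu>. \<forall>v. (norm (hat \<xi> *v v))\<^sup>2 \<le> b * (norm v)\<^sup>2"
  obtains h :: "'m \<Rightarrow> 'a hs" where "\<And>m. h m \<in> V"
    "hs_frame (hs_op ` V) (\<Lambda> \<times> UNIV) (\<lambda>j. hs_op (shifts h j))"
    "\<And>x. x \<in> V \<Longrightarrow> ((\<lambda>j. hs_scaleC (sample j x) (shifts h j)) has_sum x) (\<Lambda> \<times> UNIV)"
proof -
  interpret F: frame_functionals hs_scaleC hs_cinner "\<Lambda> \<times> UNIV" E V "\<Lambda> \<times> UNIV" sample "a / q" "b / p"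
    by (rule frame_functionals_sample[OF assms])
  define h where "h m = F.dual (0, m)" for m
  have shifts_h: "shifts h j = F.dual j" if "j \<in> \<Lambda> \<times> UNIV" for j
  proof -
    obtain l m where lm: "j = (l, m)" "l \<in> \<Lambda>" using \<open>j \<in> \<Lambda> \<times> UNIV\<close> by auto
    define sh :: "'a phase \<times> 'm \<Rightarrow> 'a phase \<times> 'm" where "sh j = (fst j + l, snd j)" for j
    have "hs_translate l (F.dual (0, m)) = F.dual (sh (0, m))"
    proof (rule F.dual_equivariant[where \<tau> = "hs_translate l" and \<tau>' = "hs_translate (- l)"])
      show "hs_translate l x \<in> V" if "x \<in> V" for x
        by (rule coef_translate(1)[OF that lm(2)])
      show "hs_translate (- l) x \<in> V \<and> hs_translate l (hs_translate (- l) x) = x" if "x \<in> V" for x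
        using coef_translate(1)[OF that lattice_minus[OF lm(2)]]
        by (simp add: hs_translate_translate hs_translate_zero)
      show "bij_betw sh (\<Lambda> \<times> UNIV) (\<Lambda> \<times> UNIV)"
        by (rule bij_betw_byWitness[where f' = "\<lambda>j. (fst j - l, snd j)"])
          (use lm(2) in \<open>auto simp: sh_def intro: lattice_add lattice_diff\<close>)
      show "sample (sh j) (hs_translate l x) = sample j x" if "j \<in> \<Lambda> \<times> UNIV" "x \<in> V" for j x
        using sample_translate[OF that(2) lm(2), of "fst j" "snd j"] that(1) by (auto simp: sh_def)
      show "(0, m) \<in> \<Lambda> \<times> UNIV"
        using lattice_zero by simp
    qed
    then show ?thesis
      by (simp add: shifts_def h_def lm(1) sh_def)
  qed
  show thesis
  proof (rule that[of h])
    show "h m \<in> V" for m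
      unfolding h_def by (rule F.dual(1)) (simp add: lattice_zero)
    have "(\<lambda>j. hs_cinner x (shifts h j)) \<in> ell2 (\<Lambda> \<times> UNIV)"
      "(\<Sum>\<^sub>\<infinity>j\<in>\<Lambda> \<times> UNIV. (cmod (hs_cinner x (shifts h j)))\<^sup>2) = (\<Sum>\<^sub>\<infinity>j\<in>\<Lambda> \<times> UNIV. (cmod (hs_cinner x (F.dual j)))\<^sup>2)"
      if "x \<in> V" for x
      using F.dual_frame(1)[OF that] ell2_cong[of "\<Lambda> \<times> UNIV" "\<lambda>j. hs_cinner x (shifts h j)" "\<lambda>j. hs_cinner x (F.dual j)"]
      by (auto simp: shifts_h intro!: infsum_cong)
    then have "\<forall>x\<in>V. (\<lambda>j. hs_cinner x (shifts h j)) \<in> ell2 (\<Lambda> \<times> UNIV) \<and>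
        1 / (b / p) * (norm x)\<^sup>2 \<le> (\<Sum>\<^sub>\<infinity>j\<in>\<Lambda> \<times> UNIV. (cmod (hs_cinner x (shifts h j)))\<^sup>2) \<and>
        (\<Sum>\<^sub>\<infinity>j\<in>\<Lambda> \<times> UNIV. (cmod (hs_cinner x (shifts h j)))\<^sup>2) \<le> 1 / (a / q) * (norm x)\<^sup>2"
      using F.dual_frame(2,3) by simp
    moreover have "0 < 1 / (b / p)" "0 < 1 / (a / q)"
      using F.a F.b by (simp_all only: zero_less_divide_1_iff)
    moreover have "\<forall>j\<in>\<Lambda> \<times> UNIV. shifts h j \<in> V"
      using shifts_h F.dual(1) by metis
    ultimately show "hs_frame (hs_op ` V) (\<Lambda> \<times> UNIV) (\<lambda>j. hs_op (shifts h j))"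
      unfolding hs_frame_hs_op by blast
    show "((\<lambda>j. hs_scaleC (sample j x) (shifts h j)) has_sum x) (\<Lambda> \<times> UNIV)" if "x \<in> V" for x
      using F.reconstruction[OF that] by (rule has_sum_cong[THEN iffD1, rotated]) (simp add: shifts_h)
  qed
qed

text \<open>The lower Riesz bound \<open>p\<close> passes from coefficients to \<open>x\<close>, and
  the upper frame bound \<open>B\<close>, read as a bound on synthesis, from \<open>x\<close> to its
  samples; hence \<open>r = p / B\<close>. For finite support the samples are square-summable by
  \<open>mat_conv_restrict_to_ell2\<close>.\<close>

lemma restrict_to_lower_if_sampling:
  fixes h :: "'m \<Rightarrow> 'a hs"
  assumes frame: "hs_frame (hs_op ` V) (\<Lambda> \<times> UNIV) (\<lambda>j. hs_op (shifts h j))"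
    and sampling: "\<And>x. x \<in> V \<Longrightarrow> ((\<lambda>j. hs_scaleC (sample j x) (shifts h j)) has_sum x) (\<Lambda> \<times> UNIV)"
  obtains r where "0 < r" "\<And>X c. finite X \<Longrightarrow> X \<subseteq> \<Lambda> \<Longrightarrow>
      r * ell2_sqnorm \<Lambda> (restrict_to X c) \<le> ell2_sqnorm \<Lambda> (mat_conv \<Lambda> A (restrict_to X c))"
proof -
  obtain B where hV: "\<And>j. j \<in> \<Lambda> \<times> UNIV \<Longrightarrow> shifts h j \<in> V" and B: "0 < B"
    "\<And>x. x \<in> V \<Longrightarrow> (\<lambda>j. hs_cinner x (shifts h j)) \<in> ell2 (\<Lambda> \<times> UNIV)"
    "\<And>x. x \<in> V \<Longrightarrow> (\<Sum>\<^sub>\<infinity>j\<in>\<Lambda> \<times> UNIV. (cmod (hs_cinner x (shifts h j)))\<^sup>2) \<le> B * (norm x)\<^sup>2"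
    using frame unfolding hs_frame_hs_op by blast
  have syn: "(norm (\<Sum>j\<in>F. hs_scaleC (d j) (shifts h j)))\<^sup>2 \<le> B * (\<Sum>j\<in>F. (cmod (d j))\<^sup>2)"
    if F: "finite F" "F \<subseteq> \<Lambda> \<times> UNIV" for F d
  proof (rule hs.synthesis_le_if_sum_ip[OF F(1) _ csubspace_V])
    show "shifts h j \<in> V" if "j \<in> F" for j
      using that F(2) hV by blast
    show "(\<Sum>j\<in>F. (cmod (hs_cinner x (shifts h j)))\<^sup>2) \<le> B * (norm x)\<^sup>2" if "x \<in> V" for x
    proof (rule order_trans[OF finite_sum_le_infsum B(3)[OF that]])
      show "(\<lambda>j. (cmod (hs_cinner x (shifts h j)))\<^sup>2) summable_on \<Lambda> \<times> UNIV"
        using B(2)[OF that] by (simp add: ell2_iff)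
    qed (use F in auto)
  qed (use B(1) in simp)
  have "p * ell2_sqnorm \<Lambda> (restrict_to X c) \<le> B * ell2_sqnorm \<Lambda> (mat_conv \<Lambda> A (restrict_to X c))"
    if X: "finite X" "X \<subseteq> \<Lambda>" for X c
  proof -
    let ?c = "\<lambda>(l, n). restrict_to X c n l"
    have rc: "restrict_to X c n \<in> ell2 \<Lambda>" for n
      by (rule restrict_to_ell2[OF X(1)])
    have c: "?c \<in> ell2 (\<Lambda> \<times> UNIV)"
      using rc by (simp add: ell2_pairs_iff)
    obtain x where x: "((\<lambda>i. hs_scaleC (?c i) (shifts s i)) has_sum x) (\<Lambda> \<times> UNIV)"
      using synthesis[OF c] by blast
    then have x': "((\<lambda>(l, n). hs_scaleC (restrict_to X c n l) (shifts s (l, n))) has_sum x) (\<Lambda> \<times> UNIV)"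
      by (simp add: case_prod_unfold)
    have e: "\<forall>m. mat_conv \<Lambda> A (restrict_to X c) m \<in> ell2 \<Lambda>"
      using mat_conv_restrict_to_ell2[OF X] by blast
    have sx: "sample j x = (\<lambda>(l, m). mat_conv \<Lambda> A (restrict_to X c) m l) j" if "j \<in> \<Lambda> \<times> UNIV" for j
      using sample_has_sum[where c = "restrict_to X c", OF rc x'] that by auto
    have sell: "(\<lambda>j. sample j x) \<in> ell2 (\<Lambda> \<times> UNIV)"
      using e ell2_cong[of "\<Lambda> \<times> UNIV" "\<lambda>j. sample j x" "\<lambda>(l, m). mat_conv \<Lambda> A (restrict_to X c) m l"]
      by (simp add: sx ell2_pairs_iff)
    have "p * ell2_sqnorm \<Lambda> (restrict_to X c) \<le> (norm x)\<^sup>2"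
      using bounds[OF c x] infsum_pairs[of "restrict_to X c" \<Lambda>] rc by simp
    also have "\<dots> \<le> B * (\<Sum>\<^sub>\<infinity>j\<in>\<Lambda> \<times> UNIV. (cmod (sample j x))\<^sup>2)"
      by (rule hs.bessel_has_sum(2)[OF syn _ sell sampling[OF in_V_if_has_sum[OF x]]]) (use B(1) in simp_all)
    also have "(\<Sum>\<^sub>\<infinity>j\<in>\<Lambda> \<times> UNIV. (cmod (sample j x))\<^sup>2) = ell2_sqnorm \<Lambda> (mat_conv \<Lambda> A (restrict_to X c))"
      unfolding infsum_pairs[OF e, symmetric] by (rule infsum_cong) (simp add: sx)
    finally show ?thesis .
  qed
  then show thesis
    using that[of "p / B"] B(1) p by (simp add: field_simps)
qed

lemma V2_eq: "V2 \<Lambda> (\<lambda>n. hs_op (s n)) = hs_op ` V"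
proof (intro set_eqI iffI)
  fix T assume "T \<in> V2 \<Lambda> (\<lambda>n. hs_op (s n))"
  then obtain c where c: "\<forall>n. c n \<in> ell2 \<Lambda>" "expands \<Lambda> (\<lambda>n. hs_op (s n)) c T"
    by (auto simp: V2_def)
  then have "T \<in> HS"
    by (simp add: expands_def hs_has_sum_def)
  then obtain x where T: "T = hs_op x"
    using hs_op_Abs_hs by metis
  have "((\<lambda>i. hs_scaleC (c (snd i) (fst i)) (shifts s i)) has_sum x) (\<Lambda> \<times> UNIV)"
    using c(2) unfolding T expands_hs_op by (simp add: case_prod_unfold)
  then have "x \<in> V"
    by (rule in_V_if_has_sum)
  then show "T \<in> hs_op ` V"
    by (simp add: T)
next
  fix T assume "T \<in> hs_op ` V"
  then obtain x where x: "x \<in> V" "T = hs_op x" by blast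
  have "expands \<Lambda> (\<lambda>n. hs_op (s n)) (cf x) T"
    unfolding x(2) expands_hs_op using coef_has_sum[OF x(1)] by (simp add: cf_def case_prod_unfold)
  then show "T \<in> V2 \<Lambda> (\<lambda>n. hs_op (s n))"
    unfolding V2_def using cf_ell2[OF x(1)] by blast
qed

text \<open>The formula quantifies over all coefficient sequences that expand an operator. As these
  agree on the lattice, the samples depend on the vector alone, and the formula becomes a property
  of each element of \<open>V\<close>.\<close>

lemma sampling_formula_iff:
  "sampling_formula \<Lambda> (\<lambda>n. hs_op (s n)) A (\<lambda>m. hs_op (h m)) \<longleftrightarrow>
    (\<forall>x\<in>V. ((\<lambda>j. hs_scaleC (sample j x) (shifts h j)) has_sum x) (\<Lambda> \<times> UNIV))"
proof -
  have iff: "((\<lambda>(l, m). hs_scaleC (mat_conv \<Lambda> A c m l) (shifts h (l, m))) has_sum x) (\<Lambda> \<times> UNIV) \<longleftrightarrow>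
      ((\<lambda>j. hs_scaleC (sample j x) (shifts h j)) has_sum x) (\<Lambda> \<times> UNIV)"
    if "\<And>n. c n \<in> ell2 \<Lambda>" "((\<lambda>(l, n). hs_scaleC (c n l) (shifts s (l, n))) has_sum x) (\<Lambda> \<times> UNIV)" for c x
    by (rule has_sum_cong) (use sample_has_sum[where c = c, OF that] in auto)
  show ?thesis
  proof
    assume *: "sampling_formula \<Lambda> (\<lambda>n. hs_op (s n)) A (\<lambda>m. hs_op (h m))"
    show "\<forall>x\<in>V. ((\<lambda>j. hs_scaleC (sample j x) (shifts h j)) has_sum x) (\<Lambda> \<times> UNIV)"
    proof
      fix x assume x: "x \<in> V"
      have cx: "((\<lambda>(l, n). hs_scaleC (cf x n l) (shifts s (l, n))) has_sum x) (\<Lambda> \<times> UNIV)"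
        using coef_has_sum[OF x] by (simp add: cf_def case_prod_unfold)
      then have "((\<lambda>(l, m). hs_scaleC (mat_conv \<Lambda> A (cf x) m l) (shifts h (l, m))) has_sum x) (\<Lambda> \<times> UNIV)"
        using * cf_ell2[OF x] unfolding sampling_formula_def expands_hs_op[symmetric] by simp
      then show "((\<lambda>j. hs_scaleC (sample j x) (shifts h j)) has_sum x) (\<Lambda> \<times> UNIV)"
        using iff[of "cf x" x] cf_ell2[OF x] cx by simp
    qed
  next
    assume *: "\<forall>x\<in>V. ((\<lambda>j. hs_scaleC (sample j x) (shifts h j)) has_sum x) (\<Lambda> \<times> UNIV)"
    show "sampling_formula \<Lambda> (\<lambda>n. hs_op (s n)) A (\<lambda>m. hs_op (h m))"
      unfolding sampling_formula_def
    proof (intro allI impI)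
      fix T c assume c: "\<forall>n. c n \<in> ell2 \<Lambda>" "expands \<Lambda> (\<lambda>n. hs_op (s n)) c T"
      then have "T \<in> hs_op ` V"
        using V2_eq unfolding V2_def by blast
      then obtain x where x: "x \<in> V" "T = hs_op x" by blast
      have "((\<lambda>(l, n). hs_scaleC (c n l) (shifts s (l, n))) has_sum x) (\<Lambda> \<times> UNIV)"
        using c(2) by (simp only: x(2) expands_hs_op)
      then show "expands \<Lambda> (\<lambda>m. hs_op (h m)) (mat_conv \<Lambda> A c) T"
        unfolding x(2) expands_hs_op using iff[of c x] c(1) * x(1) by simp
    qed
  qed
qed

end

theorem theorem2:
  fixes \<Lambda> :: "(real^'d) phase set"
    and S :: "'n::finite \<Rightarrow> (real^'d) op"
    and A :: "'m::finite \<Rightarrow> 'n \<Rightarrow> (real^'d) phase \<Rightarrow> complex"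
  assumes "full_rank_lattice \<Lambda>"
    and "\<forall>n. S n \<in> HS"
    and "hs_riesz_sequence (\<Lambda> \<times> UNIV) (translates S)"
    and "\<forall>m n. A m n \<in> ell2 \<Lambda>"
  shows
    "(0 < alpha \<Lambda> A \<and> alpha \<Lambda> A \<le> beta \<Lambda> A \<and> beta \<Lambda> A < \<infinity> \<longrightarrow>
        (\<forall>c. (\<forall>n. c n \<in> ell2 \<Lambda>) \<longrightarrow> (\<forall>m. mat_conv \<Lambda> A c m \<in> ell2 \<Lambda>)) \<and>
        CARD('n) \<le> CARD('m) \<and>
        (\<exists>H :: 'm \<Rightarrow> (real^'d) op. (\<forall>m. H m \<in> V2 \<Lambda> S) \<and>
          hs_frame (V2 \<Lambda> S) (\<Lambda> \<times> UNIV) (translates H) \<and> sampling_formula \<Lambda> S A H)) \<and>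
     (beta \<Lambda> A < \<infinity> \<and>
        (\<exists>H :: 'm \<Rightarrow> (real^'d) op. (\<forall>m. H m \<in> V2 \<Lambda> S) \<and>
          hs_frame (V2 \<Lambda> S) (\<Lambda> \<times> UNIV) (translates H) \<and> sampling_formula \<Lambda> S A H) \<longrightarrow>
      0 < alpha \<Lambda> A)"
proof -
  define s where "s n = Abs_hs (S n)" for n
  have S: "S = (\<lambda>n. hs_op (s n))"
    using assms(2) by (simp add: s_def fun_eq_iff hs_op_Abs_hs)
  have riesz: "hs_riesz_sequence (\<Lambda> \<times> UNIV) (\<lambda>i. hs_op (shifts s i))"
    using assms(3) by (simp only: S translates_hs_op)
  obtain E :: "(real^'d) phase \<times> 'n \<Rightarrow> (real^'d) hs" and p q where "shift_invariant \<Lambda> A s E p q"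
  proof (rule hs_riesz_sequence_bounds[OF riesz])
    fix E :: "(real^'d) phase \<times> 'n \<Rightarrow> (real^'d) hs" and p q :: real
    assume "hs.orthonormal (\<Lambda> \<times> UNIV) E"
      "hs.closed_span (\<Lambda> \<times> UNIV) E = hs.closed_span (\<Lambda> \<times> UNIV) (shifts s)" "0 < p" "0 < q"
      "\<And>c. c \<in> ell2 (\<Lambda> \<times> UNIV) \<Longrightarrow>
        \<exists>x\<in>hs.closed_span (\<Lambda> \<times> UNIV) (shifts s). ((\<lambda>i. hs_scaleC (c i) (shifts s i)) has_sum x) (\<Lambda> \<times> UNIV)"
      "\<And>c x. c \<in> ell2 (\<Lambda> \<times> UNIV) \<Longrightarrow> ((\<lambda>i. hs_scaleC (c i) (shifts s i)) has_sum x) (\<Lambda> \<times> UNIV) \<Longrightarrow>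
        p * (\<Sum>\<^sub>\<infinity>i\<in>\<Lambda> \<times> UNIV. (cmod (c i))\<^sup>2) \<le> (norm x)\<^sup>2 \<and> (norm x)\<^sup>2 \<le> q * (\<Sum>\<^sub>\<infinity>i\<in>\<Lambda> \<times> UNIV. (cmod (c i))\<^sup>2)"
      "\<And>x. x \<in> hs.closed_span (\<Lambda> \<times> UNIV) (shifts s) \<Longrightarrow>
        \<exists>c\<in>ell2 (\<Lambda> \<times> UNIV). ((\<lambda>i. hs_scaleC (c i) (shifts s i)) has_sum x) (\<Lambda> \<times> UNIV)"
    moreover have "lattice \<Lambda>" "convolution_axioms \<Lambda> A"
      using assms(1,4) by (simp_all add: lattice_def convolution_axioms_def)
    ultimately have "shift_invariant \<Lambda> A s E p q"
      by (intro shift_invariant.intro convolution.intro shift_invariant_axioms.intro) assumption+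
    then show thesis by (rule that)
  qed
  then interpret shift_invariant \<Lambda> A s E p q .
  show ?thesis
  proof (intro conjI impI; (elim conjE exE)?)
    assume alpha: "0 < alpha \<Lambda> A" and beta: "beta \<Lambda> A < \<infinity>"
    obtain b where b: "0 < b" "AE \<xi> in \<mu>. \<forall>v. (norm (hat \<xi> *v v))\<^sup>2 \<le> b * (norm v)\<^sup>2"
      using AE_upper_if_beta[OF beta] by blast
    obtain a where a: "0 < a" "AE \<xi> in \<mu>. a \<le> lambda_min (conj_transpose (hat \<xi>) ** hat \<xi>)"
      using AE_lambda_min_if_alpha[OF alpha] by blast
    show "\<forall>c. (\<forall>n. c n \<in> ell2 \<Lambda>) \<longrightarrow> (\<forall>m. mat_conv \<Lambda> A c m \<in> ell2 \<Lambda>)"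
      using mat_conv_ell2[OF b(2)] b(1) by simp
    \<comment> \<open>A property that holds almost everywhere on a probability space holds
      somewhere, and a single point of the dual group decides the dimension count.\<close>
    have "\<exists>\<xi>. a \<le> lambda_min (conj_transpose (hat \<xi>) ** hat \<xi>)"
      using eventually_happens[OF a(2)] by (simp add: dual.ae_filter_bot)
    then show "CARD('n) \<le> CARD('m)"
      using card_le_if_lambda_min_pos a(1) by (meson less_le_trans)
    have "AE \<xi> in \<mu>. \<forall>v. a * (norm v)\<^sup>2 \<le> (norm (hat \<xi> *v v))\<^sup>2"
      using a(2)
    proof eventually_elim
      fix \<xi> assume "a \<le> lambda_min (conj_transpose (hat \<xi>) ** hat \<xi>)"
      then show "\<forall>v. a * (norm v)\<^sup>2 \<le> (norm (hat \<xi> *v v))\<^sup>2"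
        using lambda_min_le[of "hat \<xi>"] by (meson mult_right_mono order_trans zero_le_power2)
    qed
    then obtain h where h: "\<And>m. h m \<in> V" "hs_frame (hs_op ` V) (\<Lambda> \<times> UNIV) (\<lambda>j. hs_op (shifts h j))"
      "\<And>x. x \<in> V \<Longrightarrow> ((\<lambda>j. hs_scaleC (sample j x) (shifts h j)) has_sum x) (\<Lambda> \<times> UNIV)"
      using exists_sampling_frame[OF a(1) _ b] by blast
    show "\<exists>H :: 'm \<Rightarrow> (real^'d) op. (\<forall>m. H m \<in> V2 \<Lambda> S) \<and>
        hs_frame (V2 \<Lambda> S) (\<Lambda> \<times> UNIV) (translates H) \<and> sampling_formula \<Lambda> S A H"
      unfolding S V2_eq using h
      by (intro exI[of _ "\<lambda>m. hs_op (h m)"]) (simp add: translates_hs_op sampling_formula_iff)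
  next
    fix H :: "'m \<Rightarrow> (real^'d) op"
    assume beta: "beta \<Lambda> A < \<infinity>" and H: "\<forall>m. H m \<in> V2 \<Lambda> S"
      "hs_frame (V2 \<Lambda> S) (\<Lambda> \<times> UNIV) (translates H)" "sampling_formula \<Lambda> S A H"
    obtain b where b: "0 < b" "AE \<xi> in \<mu>. \<forall>v. (norm (hat \<xi> *v v))\<^sup>2 \<le> b * (norm v)\<^sup>2"
      using AE_upper_if_beta[OF beta] by blast
    have "\<forall>m. \<exists>x. H m = hs_op x"
      using H(1) unfolding S V2_eq by blast
    then obtain h where h: "H = (\<lambda>m. hs_op (h m))"
      by metis
    have frame: "hs_frame (hs_op ` V) (\<Lambda> \<times> UNIV) (\<lambda>j. hs_op (shifts h j))"
      using H(2) by (simp only: h S V2_eq translates_hs_op)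
    have sampling: "((\<lambda>j. hs_scaleC (sample j x) (shifts h j)) has_sum x) (\<Lambda> \<times> UNIV)" if "x \<in> V" for x
      using H(3) that by (simp add: h S sampling_formula_iff)
    obtain r where r: "0 < r" "\<And>X c. finite X \<Longrightarrow> X \<subseteq> \<Lambda> \<Longrightarrow>
      r * ell2_sqnorm \<Lambda> (restrict_to X c) \<le> ell2_sqnorm \<Lambda> (mat_conv \<Lambda> A (restrict_to X c))"
    proof (rule restrict_to_lower_if_sampling[OF frame sampling])
      fix r assume "0 < r" "\<And>X c. finite X \<Longrightarrow> X \<subseteq> \<Lambda> \<Longrightarrow>
        r * ell2_sqnorm \<Lambda> (restrict_to X c) \<le> ell2_sqnorm \<Lambda> (mat_conv \<Lambda> A (restrict_to X c))"
      then show thesis by (rule that)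
    qed
    have "AE \<xi> in \<mu>. \<forall>v. r * (norm v)\<^sup>2 \<le> (norm (hat \<xi> *v v))\<^sup>2"
      using AE_lower_if_restrict_to[OF _ r(2) b(2,1)] r(1) by simp
    then have "ereal r \<le> alpha \<Lambda> A"
      by (rule le_alpha)
    then show "0 < alpha \<Lambda> A"
      using r(1) by (meson ereal_less(2) less_le_trans)
  qed
qed

end
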